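(* Suppose the phase I bootstrap weights satisfy $W_{Ni}^{(1)}\le M<\infty$ for every $i$ for some constant $M$. Let $\mathcal M=\{m_\theta:\theta\in\Theta\}$ be the set of criterion functions and define $\mathcal M_\delta=\{m_\theta-m_{\theta_0}:d(\theta,\theta_0)<\delta\}$ for some fixed $\delta>0$, where $d$ is a semimetric on the parameter space $\Theta$. (1) Suppose that for every $\theta$ in a neighborhood of $\theta_0$, $P_0(m_\theta-m_{\theta_0})\lesssim -d^2(\theta,\theta_0)$. Assume that there exists a function $\phi_N$ such that $\delta\mapsto\phi_N(\delta)/\delta^{\alpha}$ is decreasing for some $\alpha<2$ (not depending on $N$) and, for every $N$, $E^*\|\mathbb G_N\|_{\mathcal M_\delta}\lesssim\phi_N(\delta)$. If the estimator $\hat{\hat\theta}_N$ satisfies $\hat{\mathbb P}_N^\pi m_{\hat{\hat\theta}_N}\ge\hat{\mathbb P}_N^\pi m_{\theta_0}-O_{P_W^*}(r_N^{-2})$ and $\hat{\hat\theta}_N=\theta_0+o_{P_W^*}(1)$ (that is, $d(\hat{\hat\theta}_N,\theta_0)=o_{P_W^*}(1)$) in $P^*$-probability, then $r_Nd(\hat{\hat\theta}_N,\theta_0)=O_{P_W^*}(1)$ in $P^*$-probability for every sequence $r_N$ such that $r_N^2\phi_N(1/r_N)\le\sqrt N$ for every $N$. (2) Suppose the calibration conditions (C1)-(C5) and (B) of the context hold, and let $*\in\{b,bs\}$ and $\#\in\{c,cc\}$ be fixed. Suppose also that for every $\theta\in\Theta$ in a neighborhood of $\theta_0$, $P_0\{G_\#(V;\alpha)(m_\theta-m_{\theta_0})\}\lesssim-d^2(\theta,\theta_0)+|\alpha-\alpha_0|^2$.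 Assume that $E^*\|\mathbb G_N\|_{G^\#\mathcal M_\delta}\lesssim\phi_N(\delta)$ with $\phi_N$ having the same properties as in (1), where $G^\#\mathcal M_\delta=\{G_\#(\cdot;\alpha)f:|\alpha|\le\delta,\alpha\in\mathcal A_N,f\in\mathcal M_\delta\}$ for some $\mathcal A_N\subset\mathcal A$. If the estimator $\hat{\hat\theta}_{N,*\#}$ satisfies $\hat{\mathbb P}_N^{\pi,*\#}m_{\hat{\hat\theta}_{N,*\#}}\ge\hat{\mathbb P}_N^{\pi,*\#}m_{\theta_0}-O_{P_W^*}(r_N^{-2})$ and $\hat{\hat\theta}_{N,*\#}=\theta_0+o_{P_W^*}(1)$ in $P^*$-probability, then $r_Nd(\hat{\hat\theta}_{N,*\#},\theta_0)=O_{P_W^*}(1)$ in $P^*$-probability for every sequence $r_N$ such that $r_N^2\phi_N(1/r_N)\le\sqrt N$ for every $N$.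
   Context: **Sampling.** $W=(X,U)$ is a random element of $\mathcal W=\mathcal X\times\mathcal U$ with law $\tilde P_0$; $X$ has law $P_0$; $V=(\tilde X,U)\in\mathcal V$ where $\tilde X=\tilde X(X)$ is a function of $X$. $\mathcal V$ is partitioned into strata $\mathcal V_1,\dots,\mathcal V_J$; $\nu_j=\tilde P_0(V\in\mathcal V_j)$. $W_1,W_2,\dots$ are i.i.d. copies of $W$ (giving $X_i,V_i$), $N_j=\#\{i\le N:V_i\in\mathcal V_j\}$. In each stratum $j$, $n_j$ of the $N_j$ units are drawn by simple random sampling without replacement, independently across strata; $\xi_i\in\{0,1\}$ is the sampling indicator and $\pi_0(V_i)=n_j/N_j$ if $V_i\in\mathcal V_j$. Observed data: $(V_i,X_i\xi_i,\xi_i)$, $i\le N$. Double subscripts $j,i$ denote the $i$th unit in stratum $j$. Standing assumptions: $0<\sigma\le\pi_0(v)\le1$ for a constant $\sigma$, and $n_j/N_j\to p_j>0$ as $N\to\infty$; $\pi_{0,\infty}(v)=\sum_jp_j1_{\mathcal V_j}(v)$. Notation: $a\lesssim b$ means $a\le Kb$ for some constant $K\in(0,\infty)$; $Qf=\int f\,dQ$, $\|Q\|_{\mathcal F}=\sup_{f\in\mathcal F}|Qf|$, $x^{\otimes2}=xx^T$, $\tilde V=V-P_0V$, $E^*$ outer expectation; $\theta_0\in\Theta$ is the true parameter. If an index function is defined on $\mathcal W$ rather than $\mathcal X$, read $\delta_{W_i},\tilde P_0$ for $\delta_{X_i},P_0$. $\mathbb P_N=N^{-1}\sum_i\delta_{X_i}$,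 $\mathbb G_N=\sqrt N(\mathbb P_N-P_0)$, $\mathbb P_N^\pi=N^{-1}\sum_{i=1}^N\frac{\xi_i}{\pi_0(V_i)}\delta_{X_i}$. **Bootstrap weights.** Phase I weights $W^{(1)}_{N_j,j,i}$, $i\le N_j$, are i.i.d. copies of $W_j^{(1)}$ with $P(W_j^{(1)}>0)=1$, $EW_j^{(1)}=1$, $\mathrm{Var}(W_j^{(1)})=c_j^2=p_j/(2-p_j)$, $\|W_j^{(1)}\|_{2,1}=\int_0^\infty\{P(W_j^{(1)}>x)\}^{1/2}dx<\infty$. Phase II weights: write $N_j=n_jk_j+r_j$, $0\le r_j<n_j$; $(\tilde W^{(2)}_{j,1},\dots,\tilde W^{(2)}_{j,n_j})$ follows the multivariate hypergeometric law $MH_{n_j}(n_jk_j,n_j,(k_j,\dots,k_j))$ with probability $s_j=(1-\frac{r_j}{n_j})(1-\frac{r_j}{N_j-1})$ and $MH_{n_j}(n_j(k_j+1),n_j,(k_j+1,\dots,k_j+1))$ with probability $1-s_j$, where $MH_d(M,n,(m_1,\dots,m_d))$ is the law of the counts when $n$ balls are drawn without replacement from $M=\sum m_i$ balls in $d$ groups of sizes $m_i$. $W^{(2)}_{n_j,j,i}=0$ if $\xi_{j,i}=0$, and $W^{(2)}_{n_j,j,i}=\tilde W^{(2)}_{j,k}$ if unit $i$ is the $k$th sampled unit of stratum $j$. Phase I and II weights are independent, independent across strata, and independent of the data given stratum memberships and sampling indicators. Write $W^{(1)}_{Ni},W^{(2)}_{Ni}$ for the phase I and II weights of unit $i$ when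 its stratum is not specified. The weight of unit $i$ is $W_{Ni}=W^{(1)}_{Ni}W^{(2)}_{Ni}$, and $\hat{\mathbb P}_N^\pi=N^{-1}\sum_iW_{Ni}\frac{\xi_i}{\pi_0(V_i)}\delta_{X_i}$. **Calibration.** $G_c(V;\alpha)=G(V^T\alpha)$, $G_{cc}(V;\alpha)=G((\pi_0(V)^{-1}-1)(V-\mathbb P_NV)^T\alpha)$, $\alpha\in\mathcal A\subset\mathbb R^k$. $\hat\alpha_N^c$ solves $\mathbb P_N^\pi G_c(V;\alpha)V=\mathbb P_NV$; $\hat\alpha_N^{cc}$ solves $\mathbb P_N^\pi G_{cc}(V;\alpha)(V-\mathbb P_NV)=0$. Bootstrap calibration: with $\mathbb P_N^\pi W_N^{(2)}g=N^{-1}\sum_iW_{Ni}^{(2)}\frac{\xi_i}{\pi_0(V_i)}g_i$, $\hat{\hat\alpha}_N^{bc}$ solves $\mathbb P_N^\pi W_N^{(2)}G_c(V;\alpha)V=\mathbb P_NV$; $\hat{\hat\alpha}_N^{bcc}$ solves $\mathbb P_N^\pi W_N^{(2)}G_{cc}(V;\alpha)(V-\mathbb P_NV)=0$; $\hat{\hat\alpha}_N^{bsc}$ solves $\mathbb P_N^\pi W_N^{(2)}G_c(V;\alpha)V=\mathbb P_N^\pi V$; $\hat{\hat\alpha}_N^{bscc}$ solves $\mathbb P_N^\pi W_N^{(2)}G_{cc}(V;\alpha)(V-\mathbb P_N^\pi V)=0$. $\hat{\mathbb P}_N^{\pi,*\#}=N^{-1}\sum_iW_{Ni}\frac{\xi_iG_\#(V_i;\hat{\hat\alpha}_N^{*\#})}{\pi_0(V_i)}\delta_{X_i}$.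 Calibration conditions: (C1) $\hat\alpha_N^c,\hat\alpha_N^{cc}$ solve their calibration equations. (C2) $V\in\mathbb R^k$ is not concentrated at $0$ and has bounded support. (C3) $G$ is strictly increasing, bounded, continuously differentiable on $\mathbb R$ with $G(0)=1$, bounded derivative $\dot G$, $\dot G(0)>0$. (C4) $P_0V^{\otimes2}$ and $P_0\{(\pi_{0,\infty}(V)^{-1}-1)\tilde V^{\otimes2}\}$ are finite and positive definite. (C5) The "true" parameter is $\alpha_0=0$. (B) $\hat{\hat\alpha}_N^{bc},\hat{\hat\alpha}_N^{bcc},\hat{\hat\alpha}_N^{bsc},\hat{\hat\alpha}_N^{bscc}$ solve their equations above. **Bootstrap order symbols.** $P_W$ is the law of the weights, $P^\infty$ that of the data, stars denote outer probability. In $P^*$-probability: $\Delta_N=o_{P_W^*}(1)$ if $P^*\{P_W^*(|\Delta_N|>\epsilon)>\eta\}\to0$ for all $\epsilon,\eta>0$; $\Delta_N=O_{P_W^*}(1)$ if $P^*\{P_W^*(|\Delta_N|>M_N)>\eta\}\to0$ for all $\eta>0$ and all $M_N\to\infty$; $O_{P_W^*}(a_N)$ means $a_N\cdot O_{P_W^*}(1)$.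
   Formalization: In (2) the sets A_N are assumed to contain alpha_0 (for empty A_N the claim fails); each m_theta is assumed P_0-integrable, which loses nothing after replacing m_theta by m_theta - m_{theta_0} and localizing Theta near theta_0. *)

theory Defs
  imports "HOL-Probability.Probability"
begin

section \<open>Outer expectation, suprema over function classes\<close>

text \<open>The library integral of a nonmeasurable function is a lower integral, so the
  outer expectation of a nonnegative map is defined through measurable majorants.\<close>

definition outer_expectation :: "'a measure \<Rightarrow> ('a \<Rightarrow> ennreal) \<Rightarrow> ennreal" where
  "outer_expectation M T =
     (INF U \<in> {U \<in> borel_measurable M. \<forall>x\<in>space M. T x \<le> U x}. \<integral>\<^sup>+ x. U x \<partial>M)"

definition sup_over :: "(('a \<Rightarrow> real) \<Rightarrow> real) \<Rightarrow> ('a \<Rightarrow> real) set \<Rightarrow> ennreal" where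
  "sup_over Q F = (SUP f\<in>F. ennreal \<bar>Q f\<bar>)"

definition semimetric_on :: "'t set \<Rightarrow> ('t \<Rightarrow> 't \<Rightarrow> real) \<Rightarrow> bool" where
  "semimetric_on T d \<longleftrightarrow>
     (\<forall>x\<in>T. d x x = 0) \<and> (\<forall>x\<in>T. \<forall>y\<in>T. 0 \<le> d x y \<and> d x y = d y x) \<and>
     (\<forall>x\<in>T. \<forall>y\<in>T. \<forall>z\<in>T. d x z \<le> d x y + d y z)"

definition empirical :: "nat \<Rightarrow> (nat \<Rightarrow> 'a) \<Rightarrow> ('a \<Rightarrow> 'b::real_vector) \<Rightarrow> 'b" where
  "empirical N z g = (1 / real N) *\<^sub>R (\<Sum>i<N. g (z i))"

definition empirical_process :: "'a measure \<Rightarrow> nat \<Rightarrow> (nat \<Rightarrow> 'a) \<Rightarrow> ('a \<Rightarrow> real) \<Rightarrow> real" where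
  "empirical_process Q N z f = sqrt (real N) * (empirical N z f - (\<integral>x. f x \<partial>Q))"

section \<open>Two-phase stratified sampling\<close>

text \<open>
  \<open>law0\<close> is the law of $W=(X,U)$ and \<open>xtilde\<close> the map $X \mapsto \tilde X$.
  The finite type \<open>'j\<close> indexes the strata.
  \<open>nsel c j\<close> is the phase II sample size $n_j$ when the vector of stratum sizes
  $(N_1,\dots,N_J)$ is \<open>c\<close>.
  \<open>rand_space\<close> carries the randomness of the phase II selection; \<open>xi N i\<close> is the
  sampling indicator of unit \<open>i < N\<close> (units are numbered from 0) when there are \<open>N\<close> units.
  \<open>plim j\<close> is $p_j$ and \<open>w1_law j\<close> the law of $W_j^{(1)}$.
\<close>

record ('x, 'u, 'y, 'j, 's) two_phase =
  x_space :: "'x measure"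
  u_space :: "'u measure"
  xt_space :: "'y measure"
  law0 :: "('x \<times> 'u) measure"
  xtilde :: "'x \<Rightarrow> 'y"
  stratum :: "'j \<Rightarrow> ('y \<times> 'u) set"
  nsel :: "('j \<Rightarrow> nat) \<Rightarrow> 'j \<Rightarrow> nat"
  rand_space :: "'s measure"
  xi :: "nat \<Rightarrow> nat \<Rightarrow> (nat \<Rightarrow> 'x \<times> 'u) \<times> 's \<Rightarrow> bool"
  plim :: "'j \<Rightarrow> real"
  w1_law :: "'j \<Rightarrow> real measure"

definition P0 :: "('x, 'u, 'y, 'j, 's) two_phase \<Rightarrow> 'x measure" where
  "P0 D = distr (law0 D) (x_space D) fst"

definition V_space :: "('x, 'u, 'y, 'j, 's) two_phase \<Rightarrow> ('y \<times> 'u) measure" where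
  "V_space D = xt_space D \<Otimes>\<^sub>M u_space D"

definition Vof :: "('x, 'u, 'y, 'j, 's) two_phase \<Rightarrow> 'x \<times> 'u \<Rightarrow> 'y \<times> 'u" where
  "Vof D z = (xtilde D (fst z), snd z)"

definition stratum_of :: "('x, 'u, 'y, 'j, 's) two_phase \<Rightarrow> 'y \<times> 'u \<Rightarrow> 'j" where
  "stratum_of D v = (THE j. v \<in> stratum D j)"

text \<open>Units are coordinate projections on a product space, the usual convention for
  outer expectations of empirical processes.\<close>

definition iid :: "('x, 'u, 'y, 'j, 's) two_phase \<Rightarrow> (nat \<Rightarrow> 'x \<times> 'u) measure" where
  "iid D = (\<Pi>\<^sub>M i\<in>(UNIV :: nat set). law0 D)"

definition data :: "('x, 'u, 'y, 'j, 's) two_phase \<Rightarrow> ((nat \<Rightarrow> 'x \<times> 'u) \<times> 's) measure" where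
  "data D = iid D \<Otimes>\<^sub>M rand_space D"

definition members :: "('x, 'u, 'y, 'j, 's) two_phase \<Rightarrow> nat \<Rightarrow> (nat \<Rightarrow> 'x \<times> 'u) \<Rightarrow> 'j \<Rightarrow> nat set" where
  "members D N w j = {i. i < N \<and> Vof D (w i) \<in> stratum D j}"

definition Ncount :: "('x, 'u, 'y, 'j, 's) two_phase \<Rightarrow> nat \<Rightarrow> (nat \<Rightarrow> 'x \<times> 'u) \<Rightarrow> 'j \<Rightarrow> nat" where
  "Ncount D N w j = card (members D N w j)"

definition ncount :: "('x, 'u, 'y, 'j, 's) two_phase \<Rightarrow> nat \<Rightarrow> (nat \<Rightarrow> 'x \<times> 'u) \<Rightarrow> 'j \<Rightarrow> nat" where
  "ncount D N w j = nsel D (Ncount D N w) j"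

definition sampled ::
  "('x, 'u, 'y, 'j, 's) two_phase \<Rightarrow> nat \<Rightarrow> (nat \<Rightarrow> 'x \<times> 'u) \<times> 's \<Rightarrow> nat set" where
  "sampled D N \<omega> = {i. i < N \<and> xi D N i \<omega>}"

text \<open>On a stratum that contains none of the \<open>N\<close> units the ratio $n_j/N_j$ is undefined;
  the value 1 keeps the standing bound $\sigma\le\pi_0\le 1$.\<close>

definition pi0 ::
  "('x, 'u, 'y, 'j, 's) two_phase \<Rightarrow> nat \<Rightarrow> (nat \<Rightarrow> 'x \<times> 'u) \<Rightarrow> 'y \<times> 'u \<Rightarrow> real" where
  "pi0 D N w v = (let j = stratum_of D v in
     if Ncount D N w j = 0 then 1 else real (ncount D N w j) / real (Ncount D N w j))"

definition pi_inf :: "('x, 'u, 'y, 'j::finite, 's) two_phase \<Rightarrow> 'y \<times> 'u \<Rightarrow> real" where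
  "pi_inf D v = (\<Sum>j\<in>UNIV. plim D j * indicator (stratum D j) v)"

definition two_phase_design :: "('x, 'u, 'y, 'j::finite, 's) two_phase \<Rightarrow> bool" where
  "two_phase_design D \<longleftrightarrow>
     prob_space (law0 D) \<and> sets (law0 D) = sets (x_space D \<Otimes>\<^sub>M u_space D) \<and>
     xtilde D \<in> measurable (x_space D) (xt_space D) \<and>
     (\<forall>j. stratum D j \<in> sets (V_space D)) \<and> disjoint_family (stratum D) \<and>
     (\<Union>j. stratum D j) = space (V_space D) \<and>
     prob_space (rand_space D) \<and>
     (\<forall>N i. {\<omega> \<in> space (data D). xi D N i \<omega>} \<in> sets (data D)) \<and>
     \<comment> \<open>given the units: simple random sampling without replacement, independent across strata\<close>
     (AE w in iid D. \<forall>N\<ge>1. \<forall>A\<subseteq>{..<N}.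
        (\<forall>j. card (A \<inter> members D N w j) = ncount D N w j) \<longrightarrow>
        measure (rand_space D) {s \<in> space (rand_space D). sampled D N (w, s) = A} =
          (\<Prod>j\<in>UNIV. 1 / real (Ncount D N w j choose ncount D N w j))) \<and>
     (\<forall>N\<ge>1. \<forall>w\<in>space (iid D). \<forall>j. ncount D N w j \<le> Ncount D N w j) \<and>
     (\<exists>\<sigma>>0. \<forall>N\<ge>1. \<forall>w\<in>space (iid D). \<forall>v\<in>space (V_space D).
        \<sigma> \<le> pi0 D N w v \<and> pi0 D N w v \<le> 1) \<and>
     (\<forall>j. 0 < plim D j) \<and>
     (AE w in iid D. \<forall>j.
        (\<lambda>N. real (ncount D N w j) / real (Ncount D N w j)) \<longlonglongrightarrow> plim D j)"

section \<open>Bootstrap weights\<close>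

definition phase1_weight_conditions :: "('x, 'u, 'y, 'j, 's) two_phase \<Rightarrow> bool" where
  "phase1_weight_conditions D \<longleftrightarrow> (\<forall>j.
     prob_space (w1_law D j) \<and> sets (w1_law D j) = sets borel \<and>
     (AE x in w1_law D j. 0 < x) \<and>
     integrable (w1_law D j) (\<lambda>x. x) \<and> integrable (w1_law D j) (\<lambda>x. x\<^sup>2) \<and>
     prob_space.expectation (w1_law D j) (\<lambda>x. x) = 1 \<and>
     prob_space.variance (w1_law D j) (\<lambda>x. x) = plim D j / (2 - plim D j) \<and>
     (\<integral>\<^sup>+ x. ennreal (sqrt (measure (w1_law D j) {x<..})) * indicator {0..} x \<partial>lborel) < \<infinity>)"

text \<open>Law of the counts when \<open>n\<close> balls are drawn without replacement from groups
  indexed by \<open>I\<close>, group \<open>i\<close> holding \<open>m i\<close> balls.\<close>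

definition multi_hypergeometric :: "'a set \<Rightarrow> ('a \<Rightarrow> nat) \<Rightarrow> nat \<Rightarrow> ('a \<Rightarrow> nat) pmf" where
  "multi_hypergeometric I m n =
     map_pmf (\<lambda>B i. card {b \<in> B. fst b = i})
       (pmf_of_set {B. B \<subseteq> (SIGMA i:I. {..<m i}) \<and> card B = n})"

text \<open>Phase II weights in one stratum of size \<open>Nj\<close> with set \<open>A\<close> of sampled units.
  The groups are labelled by the sampled units themselves, not by their rank; all
  groups have the same size, so the two labellings give the same law.\<close>

definition stratum_weights :: "nat \<Rightarrow> nat set \<Rightarrow> (nat \<Rightarrow> nat) pmf" where
  "stratum_weights Nj A =
     (let n = card A; k = Nj div n; r = Nj mod n;
          s = (1 - real r / real n) * (1 - real r / (real Nj - 1))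
      in bernoulli_pmf s \<bind> (\<lambda>b.
           if b then multi_hypergeometric A (\<lambda>_. k) n
           else multi_hypergeometric A (\<lambda>_. k + 1) n))"

definition phase2_law ::
  "('x, 'u, 'y, 'j::finite, 's) two_phase \<Rightarrow> nat \<Rightarrow> (nat \<Rightarrow> 'x \<times> 'u) \<times> 's \<Rightarrow> (nat \<Rightarrow> nat) pmf" where
  "phase2_law D N \<omega> =
     map_pmf (\<lambda>g i. if i \<in> sampled D N \<omega> then g (stratum_of D (Vof D (fst \<omega> i))) i else 0)
       (Pi_pmf UNIV (\<lambda>_. 0) (\<lambda>j.
          stratum_weights (Ncount D N (fst \<omega>) j) (sampled D N \<omega> \<inter> members D N (fst \<omega>) j)))"

type_synonym weights = "(nat \<Rightarrow> real) \<times> (nat \<Rightarrow> nat)"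

text \<open>The law $P_W$ of the phase I and II weights of the \<open>N\<close> units given the data \<open>\<omega>\<close>; it
  depends on \<open>\<omega>\<close> only through stratum memberships and sampling indicators.\<close>

definition PW ::
  "('x, 'u, 'y, 'j::finite, 's) two_phase \<Rightarrow> nat \<Rightarrow> (nat \<Rightarrow> 'x \<times> 'u) \<times> 's \<Rightarrow> weights measure" where
  "PW D N \<omega> =
     (\<Pi>\<^sub>M i\<in>{..<N}. w1_law D (stratum_of D (Vof D (fst \<omega> i)))) \<Otimes>\<^sub>M measure_pmf (phase2_law D N \<omega>)"

section \<open>Weighted empirical measures\<close>

definition ipw ::
  "('x, 'u, 'y, 'j, 's) two_phase \<Rightarrow> nat \<Rightarrow> (nat \<Rightarrow> 'x \<times> 'u) \<times> 's \<Rightarrow> nat \<Rightarrow> real" where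
  "ipw D N \<omega> i = of_bool (xi D N i \<omega>) / pi0 D N (fst \<omega>) (Vof D (fst \<omega> i))"

text \<open>$\mathbb P_N^\pi g$, $\mathbb P_N^\pi W_N^{(2)} g$ and $\hat{\mathbb P}_N^\pi g$,
  for index functions on the space of $W=(X,U)$.\<close>

definition emp_pi ::
  "('x, 'u, 'y, 'j, 's) two_phase \<Rightarrow> nat \<Rightarrow> (nat \<Rightarrow> 'x \<times> 'u) \<times> 's
    \<Rightarrow> ('x \<times> 'u \<Rightarrow> 'b::real_vector) \<Rightarrow> 'b" where
  "emp_pi D N \<omega> g = (1 / real N) *\<^sub>R (\<Sum>i<N. ipw D N \<omega> i *\<^sub>R g (fst \<omega> i))"

definition emp_pi_W2 ::
  "('x, 'u, 'y, 'j, 's) two_phase \<Rightarrow> nat \<Rightarrow> (nat \<Rightarrow> 'x \<times> 'u) \<times> 's \<Rightarrow> weights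
    \<Rightarrow> ('x \<times> 'u \<Rightarrow> 'b::real_vector) \<Rightarrow> 'b" where
  "emp_pi_W2 D N \<omega> b g =
     (1 / real N) *\<^sub>R (\<Sum>i<N. (real (snd b i) * ipw D N \<omega> i) *\<^sub>R g (fst \<omega> i))"

definition boot_emp ::
  "('x, 'u, 'y, 'j, 's) two_phase \<Rightarrow> nat \<Rightarrow> (nat \<Rightarrow> 'x \<times> 'u) \<times> 's \<Rightarrow> weights
    \<Rightarrow> ('x \<times> 'u \<Rightarrow> 'b::real_vector) \<Rightarrow> 'b" where
  "boot_emp D N \<omega> b g =
     (1 / real N) *\<^sub>R (\<Sum>i<N. (fst b i * real (snd b i) * ipw D N \<omega> i) *\<^sub>R g (fst \<omega> i))"

section \<open>Bootstrap order symbols\<close>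

definition boot_oP ::
  "('x, 'u, 'y, 'j::finite, 's) two_phase \<Rightarrow>
    (nat \<Rightarrow> (nat \<Rightarrow> 'x \<times> 'u) \<times> 's \<Rightarrow> weights \<Rightarrow> real) \<Rightarrow> bool" where
  "boot_oP D \<Delta> \<longleftrightarrow> (\<forall>\<epsilon>>0. \<forall>\<eta>::real. 0 < \<eta> \<longrightarrow>
     (\<lambda>N. outer_measure_of (data D) {\<omega> \<in> space (data D).
        outer_measure_of (PW D N \<omega>) {b \<in> space (PW D N \<omega>). \<bar>\<Delta> N \<omega> b\<bar> > \<epsilon>} > ennreal \<eta>})
     \<longlonglongrightarrow> 0)"

definition boot_OP ::
  "('x, 'u, 'y, 'j::finite, 's) two_phase \<Rightarrow>
    (nat \<Rightarrow> (nat \<Rightarrow> 'x \<times> 'u) \<times> 's \<Rightarrow> weights \<Rightarrow> real) \<Rightarrow> bool" where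
  "boot_OP D \<Delta> \<longleftrightarrow> (\<forall>\<eta>::real. 0 < \<eta> \<longrightarrow> (\<forall>L::nat \<Rightarrow> real. filterlim L at_top sequentially \<longrightarrow>
     (\<lambda>N. outer_measure_of (data D) {\<omega> \<in> space (data D).
        outer_measure_of (PW D N \<omega>) {b \<in> space (PW D N \<omega>). \<bar>\<Delta> N \<omega> b\<bar> > L N} > ennreal \<eta>})
     \<longlonglongrightarrow> 0))"

section \<open>Calibration\<close>

text \<open>The superscripts $\# \in \{c, cc\}$ and $* \in \{b, bs\}$.\<close>

datatype sharp = Cal_c | Cal_cc
datatype star = Boot_b | Boot_bs

text \<open>\<open>Vv\<close> reads the auxiliary variable $V=(\tilde X,U)$ as a vector in $\mathbb R^k$.\<close>

fun Gcal ::
  "('x, 'u, 'y, 'j, 's) two_phase \<Rightarrow> ('y \<times> 'u \<Rightarrow> real ^ 'k) \<Rightarrow> (real \<Rightarrow> real) \<Rightarrow> sharp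
    \<Rightarrow> nat \<Rightarrow> (nat \<Rightarrow> 'x \<times> 'u) \<Rightarrow> 'y \<times> 'u \<Rightarrow> real ^ 'k \<Rightarrow> real" where
  "Gcal D Vv G Cal_c N w v \<alpha> = G (Vv v \<bullet> \<alpha>)"
| "Gcal D Vv G Cal_cc N w v \<alpha> =
     G ((1 / pi0 D N w v - 1) * ((Vv v - empirical N w (\<lambda>z. Vv (Vof D z))) \<bullet> \<alpha>))"

fun calibration_eq ::
  "('x, 'u, 'y, 'j, 's) two_phase \<Rightarrow> ('y \<times> 'u \<Rightarrow> real ^ 'k) \<Rightarrow> (real \<Rightarrow> real) \<Rightarrow> sharp
    \<Rightarrow> nat \<Rightarrow> (nat \<Rightarrow> 'x \<times> 'u) \<times> 's \<Rightarrow> real ^ 'k \<Rightarrow> bool" where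
  "calibration_eq D Vv G Cal_c N \<omega> \<alpha> \<longleftrightarrow>
     emp_pi D N \<omega> (\<lambda>z. Gcal D Vv G Cal_c N (fst \<omega>) (Vof D z) \<alpha> *\<^sub>R Vv (Vof D z))
       = empirical N (fst \<omega>) (\<lambda>z. Vv (Vof D z))"
| "calibration_eq D Vv G Cal_cc N \<omega> \<alpha> \<longleftrightarrow>
     emp_pi D N \<omega> (\<lambda>z. Gcal D Vv G Cal_cc N (fst \<omega>) (Vof D z) \<alpha> *\<^sub>R
         (Vv (Vof D z) - empirical N (fst \<omega>) (\<lambda>z. Vv (Vof D z)))) = 0"

fun boot_calibration_eq ::
  "('x, 'u, 'y, 'j, 's) two_phase \<Rightarrow> ('y \<times> 'u \<Rightarrow> real ^ 'k) \<Rightarrow> (real \<Rightarrow> real) \<Rightarrow> star \<Rightarrow> sharp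
    \<Rightarrow> nat \<Rightarrow> (nat \<Rightarrow> 'x \<times> 'u) \<times> 's \<Rightarrow> weights \<Rightarrow> real ^ 'k \<Rightarrow> bool" where
  "boot_calibration_eq D Vv G Boot_b Cal_c N \<omega> b \<alpha> \<longleftrightarrow>
     emp_pi_W2 D N \<omega> b (\<lambda>z. Gcal D Vv G Cal_c N (fst \<omega>) (Vof D z) \<alpha> *\<^sub>R Vv (Vof D z))
       = empirical N (fst \<omega>) (\<lambda>z. Vv (Vof D z))"
| "boot_calibration_eq D Vv G Boot_b Cal_cc N \<omega> b \<alpha> \<longleftrightarrow>
     emp_pi_W2 D N \<omega> b (\<lambda>z. Gcal D Vv G Cal_cc N (fst \<omega>) (Vof D z) \<alpha> *\<^sub>R
         (Vv (Vof D z) - empirical N (fst \<omega>) (\<lambda>z. Vv (Vof D z)))) = 0"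
| "boot_calibration_eq D Vv G Boot_bs Cal_c N \<omega> b \<alpha> \<longleftrightarrow>
     emp_pi_W2 D N \<omega> b (\<lambda>z. Gcal D Vv G Cal_c N (fst \<omega>) (Vof D z) \<alpha> *\<^sub>R Vv (Vof D z))
       = emp_pi D N \<omega> (\<lambda>z. Vv (Vof D z))"
| "boot_calibration_eq D Vv G Boot_bs Cal_cc N \<omega> b \<alpha> \<longleftrightarrow>
     emp_pi_W2 D N \<omega> b (\<lambda>z. Gcal D Vv G Cal_cc N (fst \<omega>) (Vof D z) \<alpha> *\<^sub>R
         (Vv (Vof D z) - emp_pi D N \<omega> (\<lambda>z. Vv (Vof D z)))) = 0"

definition outer_square :: "real ^ 'k \<Rightarrow> real ^ 'k ^ 'k" where
  "outer_square x = (\<chi> i j. x $ i * x $ j)"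

definition positive_definite :: "real ^ 'k ^ 'k \<Rightarrow> bool" where
  "positive_definite A \<longleftrightarrow> transpose A = A \<and> (\<forall>x. x \<noteq> 0 \<longrightarrow> 0 < x \<bullet> (A *v x))"

text \<open>The calibration equations need not be solvable for every realization of the data and
  the weights, so the estimators solve them with (outer) probability of failure tending to
  zero.  \<open>\<alpha>h\<close> and \<open>\<alpha>hh\<close> are the calibration estimators $\hat\alpha_N^{\#}$ and
  $\hat{\hat\alpha}_N^{*\#}$.\<close>

definition calibration_conditions ::
  "('x, 'u, 'y, 'j::finite, 's) two_phase \<Rightarrow> ('y \<times> 'u \<Rightarrow> real ^ 'k) \<Rightarrow> (real \<Rightarrow> real)
    \<Rightarrow> (real ^ 'k) set \<Rightarrow> real ^ 'k
    \<Rightarrow> (sharp \<Rightarrow> nat \<Rightarrow> (nat \<Rightarrow> 'x \<times> 'u) \<times> 's \<Rightarrow> real ^ 'k)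
    \<Rightarrow> (star \<Rightarrow> sharp \<Rightarrow> nat \<Rightarrow> (nat \<Rightarrow> 'x \<times> 'u) \<times> 's \<Rightarrow> weights \<Rightarrow> real ^ 'k) \<Rightarrow> bool" where
  "calibration_conditions D Vv G \<A> \<alpha>0 \<alpha>h \<alpha>hh \<longleftrightarrow>
     Vv \<in> borel_measurable (V_space D) \<and>
     \<alpha>0 \<in> \<A> \<and>
     (\<forall>sh. (\<lambda>N. outer_measure_of (data D) {\<omega> \<in> space (data D).
        \<not> (\<alpha>h sh N \<omega> \<in> \<A> \<and> calibration_eq D Vv G sh N \<omega> (\<alpha>h sh N \<omega>))}) \<longlonglongrightarrow> 0) \<and>
     (\<not> (AE z in law0 D. Vv (Vof D z) = 0) \<and> (\<exists>B. AE z in law0 D. norm (Vv (Vof D z)) \<le> B)) \<and>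
     (strict_mono G \<and> bounded (range G) \<and> G 0 = 1 \<and>
       (\<exists>G'. (\<forall>x. (G has_real_derivative G' x) (at x)) \<and> continuous_on UNIV G' \<and>
             bounded (range G') \<and> 0 < G' 0)) \<and>
     (integrable (law0 D) (\<lambda>z. outer_square (Vv (Vof D z))) \<and>
      positive_definite (\<integral>z. outer_square (Vv (Vof D z)) \<partial>law0 D) \<and>
      (let \<mu> = (\<integral>z. Vv (Vof D z) \<partial>law0 D);
           S = (\<lambda>z. (1 / pi_inf D (Vof D z) - 1) *\<^sub>R outer_square (Vv (Vof D z) - \<mu>))
       in integrable (law0 D) S \<and> positive_definite (\<integral>z. S z \<partial>law0 D))) \<and>
     \<alpha>0 = 0 \<and>
     (\<forall>st sh. \<forall>\<eta>::real. 0 < \<eta> \<longrightarrow>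
        (\<lambda>N. outer_measure_of (data D) {\<omega> \<in> space (data D).
           outer_measure_of (PW D N \<omega>) {b \<in> space (PW D N \<omega>).
             \<not> (\<alpha>hh st sh N \<omega> b \<in> \<A> \<and>
                boot_calibration_eq D Vv G st sh N \<omega> b (\<alpha>hh st sh N \<omega> b))} > ennreal \<eta>})
        \<longlonglongrightarrow> 0)"

text \<open>$\hat{\mathbb P}_N^{\pi,*\#} g$ with calibration parameter \<open>\<alpha>\<close>.\<close>

definition boot_emp_cal ::
  "('x, 'u, 'y, 'j, 's) two_phase \<Rightarrow> ('y \<times> 'u \<Rightarrow> real ^ 'k) \<Rightarrow> (real \<Rightarrow> real) \<Rightarrow> sharp
    \<Rightarrow> nat \<Rightarrow> (nat \<Rightarrow> 'x \<times> 'u) \<times> 's \<Rightarrow> weights \<Rightarrow> real ^ 'k \<Rightarrow> ('x \<times> 'u \<Rightarrow> real) \<Rightarrow> real" where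
  "boot_emp_cal D Vv G sh N \<omega> b \<alpha> g =
     boot_emp D N \<omega> b (\<lambda>z. Gcal D Vv G sh N (fst \<omega>) (Vof D z) \<alpha> * g z)"

section \<open>Criterion functions\<close>

definition M_local ::
  "'t set \<Rightarrow> ('t \<Rightarrow> 't \<Rightarrow> real) \<Rightarrow> ('t \<Rightarrow> 'x \<Rightarrow> real) \<Rightarrow> 't \<Rightarrow> real \<Rightarrow> ('x \<Rightarrow> real) set" where
  "M_local \<Theta> d m \<theta>0 \<delta> = {\<lambda>x. m \<theta> x - m \<theta>0 x | \<theta>. \<theta> \<in> \<Theta> \<and> d \<theta> \<theta>0 < \<delta>}"

text \<open>For \<open>Cal_cc\<close> the calibration function depends on the data through $\pi_0$ and
  $\mathbb P_N V$, hence so does this class.\<close>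

definition GM_local ::
  "('x, 'u, 'y, 'j, 's) two_phase \<Rightarrow> ('y \<times> 'u \<Rightarrow> real ^ 'k) \<Rightarrow> (real \<Rightarrow> real) \<Rightarrow> sharp
    \<Rightarrow> nat \<Rightarrow> (nat \<Rightarrow> 'x \<times> 'u) \<Rightarrow> (real ^ 'k) set \<Rightarrow> ('x \<Rightarrow> real) set \<Rightarrow> real
    \<Rightarrow> ('x \<times> 'u \<Rightarrow> real) set" where
  "GM_local D Vv G sh N w \<A>N F \<delta> =
     {\<lambda>z. Gcal D Vv G sh N w (Vof D z) \<alpha> * f (fst z) | \<alpha> f. \<alpha> \<in> \<A>N \<and> norm \<alpha> \<le> \<delta> \<and> f \<in> F}"

definition rate_function :: "(nat \<Rightarrow> real \<Rightarrow> real) \<Rightarrow> bool" where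
  "rate_function \<phi> \<longleftrightarrow>
     (\<exists>a<2. \<forall>N\<ge>1. antimono_on {0<..} (\<lambda>\<delta>. \<phi> N \<delta> / \<delta> powr a))"

end

theory Submission
  imports Defs
begin

text \<open>
  The bootstrap weights are bounded: a unit receives at most \<open>N\<^sub>j div n\<^sub>j + 1\<close> phase II
  draws, and these draws total exactly \<open>n\<^sub>j\<close> in stratum \<open>j\<close>.  Given the stratum
  memberships the weights are independent of the units, so a weight vector is a mixture of
  vertices of a cube, each vertex selects a subset of the units, and resampling the
  unselected units within their strata (Jensen) bounds the bootstrap empirical process by the
  original one, up to the deviations of the stratum means from the overall mean.  These
  deviations are controlled by the modulus itself: Khintchine's inequality gives
  \<open>E\<^sup>* sup\<^sub>f \<bbbP>\<^sub>N \<bar>f - P f\<bar> \<lesssim> E\<^sup>* \<parallel>\<bbbG>\<^sub>N\<parallel>\<close>.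

  The same consequence of Khintchine's inequality makes calibration harmless: the calibration
  parameter is \<open>O(N\<^sup>-\<^sup>1\<^sup>/\<^sup>2)\<close>, so the factors \<open>G\<close> differ from 1 by
  \<open>O(N\<^sup>-\<^sup>1\<^sup>/\<^sup>2)\<close> uniformly, and such a perturbation of the weights changes the process
  by no more than the modulus.  Hence only the member \<open>\<alpha> = \<alpha>\<^sub>0\<close> of the calibrated
  class is needed, and one peeling argument proves both parts.
\<close>

section \<open>Subset sums and Khintchine's inequality\<close>

text \<open>Three obstacles shape the proof. Suprema over the function class need not be measurable,
  so no supremum is integrated: a measurable majorant \<open>U\<close> of the centred sums on
  \<open>N\<close> units is transformed, by resampling and by averages over finitely many subsets,
  into measurable majorants of the bootstrap sums, valid for all functions of the class at once. The
  law of the weights varies with the data, but only through stratum labels and the sampled set;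
  these take finitely many values, which makes conditional means measurable in the data. The weights
  depend on the labels, hence on the units, so a multiplier inequality is available only
  conditionally on the labels, where the natural centring of \<open>f\<close> is at its stratum
  means. Recentring leaves stratum totals of the weights, accurate up to order
  \<open>sqrt N\<close>, times deviations of stratum means. No envelope or moment bound for the
  class is assumed, so the smallness of these deviations has to be extracted from signed sums; hence
  the inequality below, which bounds absolute sums by signed ones.\<close>

lemma subset_sum_moments:
  fixes a :: "'i \<Rightarrow> real"
  assumes "finite I"
  defines "S \<equiv> \<lambda>I A. sum a A - sum a (I - A)"
  shows "(\<Sum>A\<in>Pow I. (S I A)\<^sup>2) = 2 ^ card I * (\<Sum>i\<in>I. (a i)\<^sup>2)
    \<and> (\<Sum>A\<in>Pow I. (S I A) ^ 4) \<le> 3 * 2 ^ card I * (\<Sum>i\<in>I. (a i)\<^sup>2)\<^sup>2"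
  using assms(1)
proof (induction I rule: finite_induct)
  case empty
  then show ?case by (simp add: S_def)
next
  case (insert x I)
  have fin: "finite (Pow I)" "finite (insert x ` Pow I)" using insert by auto
  have disj: "Pow I \<inter> insert x ` Pow I = {}" using insert by auto
  have inj: "inj_on (insert x) (Pow I)" using insert by (auto simp: inj_on_def)
  have S1: "S (insert x I) A = S I A - a x" if "A \<in> Pow I" for A
  proof -
    have "insert x I - A = insert x (I - A)" using that insert by auto
    then show ?thesis using insert that by (simp add: S_def)
  qed
  have S2: "S (insert x I) (insert x A) = S I A + a x" if "A \<in> Pow I" for A
  proof -
    have "insert x I - insert x A = I - A" using that insert by auto
    moreover have "finite A" "x \<notin> A" using that insert finite_subset by auto
    ultimately show ?thesis by (simp add: S_def)
  qed
  \<comment> \<open>\<open>S I A\<close> is a Rademacher sum with sign plus on \<open>A\<close> and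
    minus off \<open>A\<close>, and a sum over \<open>Pow I\<close> is \<open>2 ^ card I\<close>
    times an expectation. The two extensions of a subset by \<open>x\<close> shift the sum by
    \<open>- a x\<close> and by \<open>a x\<close>, so odd powers of \<open>a x\<close>
    cancel.\<close>
  have split: "(\<Sum>A\<in>Pow (insert x I). F (S (insert x I) A))
      = (\<Sum>A\<in>Pow I. F (S I A - a x) + F (S I A + a x))" for F :: "real \<Rightarrow> real"
    unfolding Pow_insert sum.union_disjoint[OF fin disj] sum.reindex[OF inj]
    by (simp add: S1 S2 sum.distrib)
  define m2 m4 where "m2 = (\<Sum>A\<in>Pow I. (S I A)\<^sup>2)" and "m4 = (\<Sum>A\<in>Pow I. (S I A)^4)"
  define q where "q = (\<Sum>i\<in>I. (a i)\<^sup>2)"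
  have card: "(\<Sum>A\<in>Pow I. c) = 2 ^ card I * c" for c :: real
    using insert by (simp add: card_Pow)
  have e2: "(\<Sum>A\<in>Pow (insert x I). (S (insert x I) A)\<^sup>2) = 2 * m2 + 2 * 2 ^ card I * (a x)\<^sup>2"
  proof -
    have "(\<Sum>A\<in>Pow (insert x I). (S (insert x I) A)\<^sup>2) = (\<Sum>A\<in>Pow I. 2 * (S I A)\<^sup>2 + 2 * (a x)\<^sup>2)"
      unfolding split[of "\<lambda>s. s\<^sup>2"] by (intro sum.cong refl) (simp add: power2_eq_square algebra_simps)
    then show ?thesis by (simp only: sum.distrib card m2_def sum_distrib_left mult.assoc)
  qed
  have e4: "(\<Sum>A\<in>Pow (insert x I). (S (insert x I) A)^4)
      = 2 * m4 + 12 * (a x)\<^sup>2 * m2 + 2 * 2 ^ card I * (a x)^4"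
  proof -
    have "(\<Sum>A\<in>Pow (insert x I). (S (insert x I) A)^4)
        = (\<Sum>A\<in>Pow I. 2 * (S I A)^4 + 12 * (a x)\<^sup>2 * (S I A)\<^sup>2 + 2 * (a x)^4)"
      unfolding split[of "\<lambda>s. s ^ 4"] by (intro sum.cong refl) (simp add: power2_eq_square power4_eq_xxxx algebra_simps)
    then show ?thesis by (simp only: sum.distrib card m2_def m4_def sum_distrib_left)
  qed
  have IH: "m2 = 2 ^ card I * q" "m4 \<le> 3 * 2 ^ card I * q\<^sup>2"
    using insert.IH by (simp_all add: m2_def m4_def q_def)
  have q': "(\<Sum>i\<in>insert x I. (a i)\<^sup>2) = (a x)\<^sup>2 + q" using insert by (simp add: q_def)
  have c': "card (insert x I) = Suc (card I)" using insert by simp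
  have "2 * m4 + 12 * (a x)\<^sup>2 * m2 + 2 * 2 ^ card I * (a x)^4
    \<le> 2 ^ card I * (6 * q\<^sup>2 + 12 * (a x)\<^sup>2 * q + 2 * (a x)^4)"
    using IH by (simp add: algebra_simps)
  \<comment> \<open>The right side reproduces the \<open>q^2\<close> term and the mixed term exactly
    and has 6 instead of 2 at the fourth power of \<open>a x\<close>. The constant 3 of the claim is
    the fourth moment of a standard Gaussian.\<close>
  also have "\<dots> \<le> 2 ^ card I * (6 * ((a x)\<^sup>2 + q)\<^sup>2)"
  proof (intro mult_left_mono)
    define s where "s = (a x)\<^sup>2"
    have "(a x) ^ 4 = s\<^sup>2" by (simp add: s_def flip: power_mult)
    then show "6 * q\<^sup>2 + 12 * (a x)\<^sup>2 * q + 2 * (a x)^4 \<le> 6 * ((a x)\<^sup>2 + q)\<^sup>2"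
      unfolding s_def[symmetric] by (simp add: power2_eq_square algebra_simps)
  qed simp
  finally show ?case unfolding e2 e4 q' c' using IH by (simp add: algebra_simps)
qed

text \<open>Khintchine's inequality with exponent one: second moment 1 and fourth moment at most 3
  force the first absolute moment to stay away from 0. A quartic minorant of the absolute value
  combines the two moments, in place of Hoelder interpolation.\<close>

lemma sum_sq_root_le_subset_average:
  fixes a :: "'i \<Rightarrow> real"
  assumes "finite I"
  shows "sqrt (\<Sum>i\<in>I. (a i)\<^sup>2) \<le> 2 / 2 ^ card I * (\<Sum>A\<in>Pow I. \<bar>sum a A - sum a (I - A)\<bar>)"
proof -
  define S where "S A = sum a A - sum a (I - A)" for A
  define q where "q = (\<Sum>i\<in>I. (a i)\<^sup>2)"
  have q0: "q \<ge> 0" by (simp add: q_def sum_nonneg)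
  note m = subset_sum_moments[OF assms, of a, folded S_def q_def]
  show ?thesis
  proof (cases "q = 0")
    case True
    then show ?thesis by (simp add: q_def[symmetric] sum_nonneg)
  next
    case False
    define t where "t = 1 / sqrt q"
    have t: "t > 0" "t\<^sup>2 * q = 1" "t * q = sqrt q"
      using False q0 by (auto simp: t_def power_divide real_div_sqrt)
    \<comment> \<open>The quartic touches the identity at \<open>x = 3/2\<close>, whence the
      constant 4/27: the difference factors as
      \<open>4/27 * x * (x - 3/2)^2 * (x + 3)\<close>.\<close>
    have pw: "t\<^sup>2 * s\<^sup>2 - 4 / 27 * t ^ 4 * s ^ 4 \<le> t * \<bar>s\<bar>" for s
    proof -
      define x where "x = t * \<bar>s\<bar>"
      have x: "x \<ge> 0" using t by (simp add: x_def)
      have "x - x\<^sup>2 + 4 / 27 * x ^ 4 = 4 / 27 * x * ((x - 3 / 2)\<^sup>2 * (x + 3))"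
        by (simp add: power2_eq_square power4_eq_xxxx field_simps)
      also have "\<dots> \<ge> 0" using x by simp
      finally have "x\<^sup>2 - 4 / 27 * x ^ 4 \<le> x" by simp
      then show ?thesis by (simp add: x_def power_mult_distrib mult.assoc)
    qed
    have "2 ^ card I * 1 - 4 / 27 * (3 * 2 ^ card I * 1)
       \<le> t\<^sup>2 * (\<Sum>A\<in>Pow I. (S A)\<^sup>2) - 4 / 27 * (t ^ 4 * (\<Sum>A\<in>Pow I. S A ^ 4))"
    proof -
      have "t ^ 4 * (\<Sum>A\<in>Pow I. S A ^ 4) \<le> t ^ 4 * (3 * 2 ^ card I * q\<^sup>2)"
        using m t by (intro mult_left_mono) auto
      also have "\<dots> = 3 * 2 ^ card I * (t\<^sup>2 * q)\<^sup>2" by (simp add: power_mult_distrib flip: power_mult)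
      finally have "t ^ 4 * (\<Sum>A\<in>Pow I. S A ^ 4) \<le> 3 * 2 ^ card I" using t by simp
      moreover have "t\<^sup>2 * (\<Sum>A\<in>Pow I. (S A)\<^sup>2) = 2 ^ card I * (t\<^sup>2 * q)" using m by simp
      ultimately show ?thesis using t by simp
    qed
    also have "\<dots> = (\<Sum>A\<in>Pow I. t\<^sup>2 * (S A)\<^sup>2 - 4 / 27 * t ^ 4 * S A ^ 4)"
      by (simp add: sum_subtractf sum_distrib_left mult.assoc)
    also have "\<dots> \<le> (\<Sum>A\<in>Pow I. t * \<bar>S A\<bar>)" by (intro sum_mono pw)
    finally have "5 / 9 * 2 ^ card I \<le> t * (\<Sum>A\<in>Pow I. \<bar>S A\<bar>)" by (simp add: sum_distrib_left)
    then have "sqrt q * (5 / 9 * 2 ^ card I) \<le> sqrt q * (t * (\<Sum>A\<in>Pow I. \<bar>S A\<bar>))"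
      using q0 by (intro mult_left_mono) auto
    also have "sqrt q * (t * (\<Sum>A\<in>Pow I. \<bar>S A\<bar>)) = (\<Sum>A\<in>Pow I. \<bar>S A\<bar>)"
      using False q0 by (simp add: t_def)
    finally have *: "sqrt q * (5 / 9 * 2 ^ card I) \<le> (\<Sum>A\<in>Pow I. \<bar>S A\<bar>)" .
    \<comment> \<open>Averaging the minorant leaves \<open>1 - 3 * 4/27 = 5/9\<close>; rounding down
      to 1/2 produces the factor 2 of the claim.\<close>
    have "sqrt q * 2 ^ card I * (1 / 2) \<le> sqrt q * 2 ^ card I * (5 / 9)"
      using q0 by (intro mult_left_mono) auto
    with * have "sqrt q * 2 ^ card I \<le> 2 * (\<Sum>A\<in>Pow I. \<bar>S A\<bar>)" by (simp add: algebra_simps)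
    then show ?thesis by (simp add: field_simps S_def q_def)
  qed
qed

text \<open>Cauchy-Schwarz passes from the l1 norm to the l2 norm at the price
  \<open>sqrt (card I)\<close>. A Rademacher sum is a subset sum minus the complementary one, and
  complementation permutes the subsets, which turns the constant 2 into 4. Subset sums are the right
  target because resampling the remaining units yields majorants for them.\<close>

lemma sum_abs_le_subset_average:
  fixes a :: "'i \<Rightarrow> real"
  assumes I: "finite I"
  shows "(\<Sum>i\<in>I. \<bar>a i\<bar>) \<le> 4 * sqrt (real (card I)) / 2 ^ card I * (\<Sum>A\<in>Pow I. \<bar>sum a A\<bar>)"
proof -
  have "(\<Sum>i\<in>I. \<bar>a i\<bar>) \<le> sqrt (real (card I)) * sqrt (\<Sum>i\<in>I. (a i)\<^sup>2)"
    using L2_set_mult_ineq[of "\<lambda>_. 1" a I] by (simp add: L2_set_def)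
  also have "\<dots> \<le> sqrt (real (card I)) *
      (2 / 2 ^ card I * (\<Sum>A\<in>Pow I. \<bar>sum a A\<bar> + \<bar>sum a (I - A)\<bar>))"
    by (intro mult_left_mono order_trans[OF sum_sq_root_le_subset_average[OF I]] sum_mono) auto
  also have "(\<Sum>A\<in>Pow I. \<bar>sum a A\<bar> + \<bar>sum a (I - A)\<bar>) = 2 * (\<Sum>A\<in>Pow I. \<bar>sum a A\<bar>)"
  proof -
    have "(\<Sum>A\<in>Pow I. \<bar>sum a (I - A)\<bar>) = (\<Sum>A\<in>Pow I. \<bar>sum a A\<bar>)"
      by (rule sum.reindex_bij_witness[where i="\<lambda>A. I - A" and j="\<lambda>A. I - A"]) (auto simp: double_diff)
    then show ?thesis by (simp add: sum.distrib)
  qed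
  finally show ?thesis by (simp add: mult_ac)
qed

text \<open>The probability that independent trials with success probabilities \<open>c i\<close>
  succeed exactly on \<open>A\<close>; these are weights that represent the cube point
  \<open>c\<close> as a mixture of vertices.\<close>

definition vertex_weight :: "'i set \<Rightarrow> ('i \<Rightarrow> real) \<Rightarrow> 'i set \<Rightarrow> real" where
  "vertex_weight I c A = (\<Prod>i\<in>A. c i) * (\<Prod>i\<in>I - A. 1 - c i)"

lemma vertex_weight_nonneg:
  "(\<And>i. i \<in> I \<Longrightarrow> 0 \<le> c i \<and> c i \<le> 1) \<Longrightarrow> A \<subseteq> I \<Longrightarrow> 0 \<le> vertex_weight I c A"
  by (auto simp: vertex_weight_def intro!: mult_nonneg_nonneg prod_nonneg)

lemma sum_vertex_weight: "finite I \<Longrightarrow> (\<Sum>A\<in>Pow I. vertex_weight I c A) = 1"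
  using prod_add[of I c "\<lambda>i. 1 - c i"] by (simp add: vertex_weight_def)

text \<open>Each index \<open>i\<close> is selected with total weight \<open>c i\<close>, so
  \<open>c\<close> is the barycentre of the vertices. Linear functionals of a fractional weight
  vector thus become averages of subset sums.\<close>

lemma sum_vertex_weight_sum:
  assumes I: "finite I"
  shows "(\<Sum>A\<in>Pow I. vertex_weight I c A * sum a A) = (\<Sum>i\<in>I. c i * a i)"
proof -
  have *: "(\<Sum>A\<in>Pow I. vertex_weight I c A * of_bool (i \<in> A)) = c i" if i: "i \<in> I" for i
  proof -
    \<comment> \<open>Giving \<open>i\<close> the weight 0 for being left out deletes from the
      expanded product exactly the subsets without \<open>i\<close>.\<close>
    have "(\<Prod>k\<in>I. c k + (if k = i then 0 else 1 - c k))
      = (\<Sum>A\<in>Pow I. (\<Prod>k\<in>A. c k) * (\<Prod>k\<in>I - A. if k = i then 0 else 1 - c k))"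
      by (rule prod_add[OF I])
    also have "\<dots> = (\<Sum>A\<in>Pow I. vertex_weight I c A * of_bool (i \<in> A))"
    proof (intro sum.cong refl)
      fix A assume "A \<in> Pow I"
      show "(\<Prod>k\<in>A. c k) * (\<Prod>k\<in>I - A. if k = i then 0 else 1 - c k)
          = vertex_weight I c A * of_bool (i \<in> A)"
      proof (cases "i \<in> A")
        case True
        then have "(\<Prod>k\<in>I - A. if k = i then 0 else 1 - c k) = (\<Prod>k\<in>I - A. 1 - c k)"
          by (intro prod.cong) auto
        with True show ?thesis by (simp add: vertex_weight_def)
      next
        case False
        then have "(\<Prod>k\<in>I - A. if k = i then 0 else 1 - c k) = 0"
          using i I by (intro prod_zero) auto
        with False show ?thesis by simp
      qed
    qed
    also have "(\<Prod>k\<in>I. c k + (if k = i then 0 else 1 - c k)) = (\<Prod>k\<in>I. if k = i then c k else 1)"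
      by (intro prod.cong) auto
    also have "\<dots> = c i" using I i by (simp add: prod.delta)
    finally show ?thesis by simp
  qed
  have "(\<Sum>A\<in>Pow I. vertex_weight I c A * sum a A)
      = (\<Sum>A\<in>Pow I. \<Sum>i\<in>I. vertex_weight I c A * of_bool (i \<in> A) * a i)"
  proof (intro sum.cong refl)
    fix A assume A: "A \<in> Pow I"
    have "sum a A = (\<Sum>i\<in>I. of_bool (i \<in> A) * a i)"
      using I A by (intro sum.mono_neutral_cong_left) auto
    then show "vertex_weight I c A * sum a A = (\<Sum>i\<in>I. vertex_weight I c A * of_bool (i \<in> A) * a i)"
      by (simp add: sum_distrib_left mult.assoc)
  qed
  also have "\<dots> = (\<Sum>i\<in>I. (\<Sum>A\<in>Pow I. vertex_weight I c A * of_bool (i \<in> A)) * a i)"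
    by (subst sum.swap) (simp add: sum_distrib_right)
  also have "\<dots> = (\<Sum>i\<in>I. c i * a i)" using * by simp
  finally show ?thesis .
qed

section \<open>Resampling within strata\<close>

text \<open>Two instances occur: labels that are strata, and the constant label, for which
  resampling is plain averaging over fresh independent units.\<close>

locale labelled_sample = prob_space P for P :: "'z measure" +
  fixes lab :: "'z \<Rightarrow> 'j::finite" and I :: "'i set"
  assumes lab[measurable]: "lab \<in> measurable P (count_space UNIV)" and finite_I: "finite I"
begin

definition nu :: "'j \<Rightarrow> real" where "nu j = measure P {z \<in> space P. lab z = j}"

text \<open>The conditional mean of \<open>f\<close> given the label; on a null stratum division by
  zero makes it 0.\<close>

definition smean :: "('z \<Rightarrow> real) \<Rightarrow> 'j \<Rightarrow> real" where
  "smean f j = (\<integral>z. f z * of_bool (lab z = j) \<partial>P) / nu j"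

definition kern :: "'i set \<Rightarrow> ('i \<Rightarrow> 'z) \<Rightarrow> ('i \<Rightarrow> 'z) \<Rightarrow> real" where
  "kern A x y = (\<Prod>i\<in>I - A. of_bool (lab (y i) = lab (x i)) / nu (lab (x i)))"

text \<open>Replacing the units outside \<open>A\<close> by fresh ones from the same strata: the
  indicator kernel turns independent draws from \<open>P\<close> into draws from the conditional law.\<close>

definition resample :: "(('i \<Rightarrow> 'z) \<Rightarrow> ennreal) \<Rightarrow> 'i set \<Rightarrow> ('i \<Rightarrow> 'z) \<Rightarrow> ennreal" where
  "resample U A x =
     (\<integral>\<^sup>+y. U (merge A (I - A) (x, y)) * ennreal (kern A x y) \<partial>PiM (I - A) (\<lambda>_. P))"

lemma nu_nonneg: "0 \<le> nu j" by (simp add: nu_def)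

lemma kern_nonneg: "0 \<le> kern A x y"
  by (auto simp: kern_def nu_nonneg intro!: prod_nonneg)

sublocale PF: product_sigma_finite "\<lambda>_. P" ..

lemma measurable_merge_sub:
  assumes "A \<subseteq> I"
  shows "(\<lambda>(x, y). merge A (I - A) (x, y)) \<in>
    measurable (PiM I (\<lambda>_. P) \<Otimes>\<^sub>M PiM (I - A) (\<lambda>_. P)) (PiM I (\<lambda>_. P))"
proof (rule measurable_PiM_single')
  fix i assume i: "i \<in> I"
  show "(\<lambda>\<omega>. (case \<omega> of (x, y) \<Rightarrow> merge A (I - A) (x, y)) i) \<in>
      measurable (PiM I (\<lambda>_. P) \<Otimes>\<^sub>M PiM (I - A) (\<lambda>_. P)) P"
  proof (cases "i \<in> A")
    case True
    then show ?thesis using i by (simp add: merge_def split_beta')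
  next
    case False
    then show ?thesis using i by (simp add: merge_def split_beta')
  qed
qed (use assms in \<open>auto simp: space_pair_measure space_PiM merge_def PiE_iff extensional_def\<close>)

lemma measurable_kern:
  assumes "A \<subseteq> I"
  shows "(\<lambda>(x, y). kern A x y) \<in>
    borel_measurable (PiM I (\<lambda>_. P) \<Otimes>\<^sub>M PiM (I - A) (\<lambda>_. P))"
  unfolding kern_def split_beta'
proof (rule borel_measurable_prod)
  fix i assume i: "i \<in> I - A"
  then have [measurable]: "(\<lambda>p. fst p i) \<in> measurable (PiM I (\<lambda>_. P) \<Otimes>\<^sub>M PiM (I - A) (\<lambda>_. P)) P"
      "(\<lambda>p. snd p i) \<in> measurable (PiM I (\<lambda>_. P) \<Otimes>\<^sub>M PiM (I - A) (\<lambda>_. P)) P"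
    by simp_all
  show "(\<lambda>p. of_bool (lab (snd p i) = lab (fst p i)) / nu (lab (fst p i))) \<in>
      borel_measurable (PiM I (\<lambda>_. P) \<Otimes>\<^sub>M PiM (I - A) (\<lambda>_. P))"
    by measurable
qed

lemma measurable_resample:
  assumes A: "A \<subseteq> I" and U: "U \<in> borel_measurable (PiM I (\<lambda>_. P))"
  shows "resample U A \<in> borel_measurable (PiM I (\<lambda>_. P))"
proof -
  interpret B: finite_product_sigma_finite "\<lambda>_. P" "I - A" by standard (simp add: finite_I)
  have "(\<lambda>p. U ((\<lambda>(x, y). merge A (I - A) (x, y)) p) * ennreal ((\<lambda>(x, y). kern A x y) p)) \<in>
      borel_measurable (PiM I (\<lambda>_. P) \<Otimes>\<^sub>M PiM (I - A) (\<lambda>_. P))"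
    using measurable_compose[OF measurable_merge_sub[OF A] U]
      measurable_compose[OF measurable_kern[OF A] measurable_ennreal]
    by (intro borel_measurable_times_ennreal)
  from B.borel_measurable_nn_integral_fst[OF this]
  show ?thesis by (simp add: resample_def[abs_def])
qed

lemma integral_of_bool_lab: "(\<integral>z. of_bool (lab z = j) \<partial>P) = nu j"
proof -
  have "(\<integral>z. of_bool (lab z = j) \<partial>P) = (\<integral>z. indicator {z \<in> space P. lab z = j} z \<partial>P)"
    by (intro Bochner_Integration.integral_cong) (auto simp: indicator_def)
  also have "\<dots> = measure P ({z \<in> space P. lab z = j} \<inter> space P)" by simp
  also have "{z \<in> space P. lab z = j} \<inter> space P = {z \<in> space P. lab z = j}" by auto
  finally show ?thesis by (simp add: nu_def)
qed

text \<open>Jensen's inequality: \<open>resample U A x\<close> averages \<open>U\<close> over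
  vectors that agree with \<open>x\<close> on \<open>A\<close>, and under the same average each unit
  outside \<open>A\<close> contributes its stratum mean to the centred sum. Positivity of
  \<open>nu\<close> makes the kernel a probability density.\<close>

lemma resample_ge:
  assumes A: "A \<subseteq> I" and f[measurable]: "integrable P f"
    and U: "\<And>z. z \<in> space (PiM I (\<lambda>_. P)) \<Longrightarrow> ennreal \<bar>\<Sum>i\<in>I. f (z i) - expectation f\<bar> \<le> U z"
    and x: "x \<in> space (PiM I (\<lambda>_. P))" and pos: "\<And>i. i \<in> I \<Longrightarrow> nu (lab (x i)) > 0"
  shows "ennreal \<bar>(\<Sum>i\<in>A. f (x i) - expectation f)
      + (\<Sum>i\<in>I - A. smean f (lab (x i)) - expectation f)\<bar> \<le> resample U A x"
proof -
  let ?B = "I - A"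
  let ?PB = "PiM ?B (\<lambda>_. P)"
  define k where "k l z = of_bool (lab z = lab (x l)) / nu (lab (x l))" for l z
  define g where "g z = f z - expectation f" for z
  have finB: "finite ?B" and finA: "finite A" using finite_I A finite_subset by auto
  have kern: "kern A x y = (\<Prod>l\<in>?B. k l (y l))" for y by (simp add: kern_def k_def)
  have k_int: "integrable P (k l)" for l
    unfolding k_def by (intro integrable_divide integrable_const_bound[where B=1]) auto
  have g_int: "integrable P g" unfolding g_def using f by simp
  have kg_int: "integrable P (\<lambda>z. k l z * g z)" for l
  proof -
    have "integrable P (\<lambda>z. of_bool (lab z = lab (x l)) * g z)"
      by (rule Bochner_Integration.integrable_bound[OF g_int]) (use g_int in \<open>auto\<close>)
    then show ?thesis unfolding k_def by (simp add: field_simps)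
  qed
  have k1: "expectation (k l) = 1" if "l \<in> I" for l
    using pos[OF that] by (simp add: k_def[abs_def] integral_of_bool_lab)
  have kg1: "expectation (\<lambda>z. k l z * g z) = smean f (lab (x l)) - expectation f" if "l \<in> I" for l
  proof -
    have fi: "integrable P (\<lambda>z. f z * of_bool (lab z = lab (x l)))"
      by (rule Bochner_Integration.integrable_bound[OF f]) (use f in \<open>auto\<close>)
    have "expectation (\<lambda>z. k l z * g z) =
       expectation (\<lambda>z. f z * of_bool (lab z = lab (x l)) / nu (lab (x l)) - expectation f * k l z)"
      by (intro Bochner_Integration.integral_cong) (auto simp: k_def g_def diff_divide_distrib)
    also have "\<dots> = smean f (lab (x l)) - expectation f * expectation (k l)"
      using fi k_int by (subst Bochner_Integration.integral_diff) (auto simp: smean_def)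
    finally show ?thesis using k1[OF that] by simp
  qed
  \<comment> \<open>The kernel times one centred value still factorizes over the units: unit
    \<open>i\<close> receives the factor \<open>k i z * g z\<close>, and every other factor
    integrates to 1.\<close>
  define h where "h i l z = (if l = i then k l z * g z else k l z)" for i l z
  have h_int: "integrable P (h i l)" for i l
    unfolding h_def using k_int kg_int by (cases "l = i") auto
  have h_prod: "kern A x y * g (y i) = (\<Prod>l\<in>?B. h i l (y l))" if "i \<in> ?B" for i y
  proof -
    have "(\<Prod>l\<in>?B. h i l (y l)) = (\<Prod>l\<in>?B. k l (y l)) * (\<Prod>l\<in>?B. if l = i then g (y l) else 1)"
      unfolding prod.distrib[symmetric] by (intro prod.cong) (auto simp: h_def)
    also have "(\<Prod>l\<in>?B. if l = i then g (y l) else 1) = g (y i)"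
      using finB that by (simp add: prod.delta)
    finally show ?thesis by (simp add: kern)
  qed
  have i1: "integrable ?PB (\<lambda>y. kern A x y)"
    unfolding kern by (rule PF.product_integrable_prod[OF finB k_int])
  have e1: "(\<integral>y. kern A x y \<partial>?PB) = 1"
    unfolding kern by (subst PF.product_integral_prod[OF finB k_int]) (simp add: k1)
  have i2: "integrable ?PB (\<lambda>y. kern A x y * g (y i))" if "i \<in> ?B" for i
    unfolding h_prod[OF that] by (rule PF.product_integrable_prod[OF finB h_int])
  have e2: "(\<integral>y. kern A x y * g (y i) \<partial>?PB) = smean f (lab (x i)) - expectation f" if "i \<in> ?B" for i
  proof -
    have "(\<integral>y. kern A x y * g (y i) \<partial>?PB) = (\<Prod>l\<in>?B. expectation (h i l))"
      unfolding h_prod[OF that] by (rule PF.product_integral_prod[OF finB h_int])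
    also have "\<dots> = (\<Prod>l\<in>?B. if l = i then smean f (lab (x l)) - expectation f else 1)"
      by (intro prod.cong refl) (auto simp: h_def[abs_def] k1 kg1)
    also have "\<dots> = smean f (lab (x i)) - expectation f" using finB that by (simp add: prod.delta)
    finally show ?thesis .
  qed
  define S where "S y = (\<Sum>i\<in>I. g (merge A ?B (x, y) i))" for y
  have S: "S y = (\<Sum>i\<in>A. g (x i)) + (\<Sum>i\<in>?B. g (y i))" for y
  proof -
    have "S y = (\<Sum>i\<in>A. g (merge A ?B (x, y) i)) + (\<Sum>i\<in>?B. g (merge A ?B (x, y) i))"
      unfolding S_def using A finA finB
      by (subst sum.union_disjoint[symmetric]) (auto intro!: sum.cong)
    moreover have "(\<Sum>i\<in>A. g (merge A ?B (x, y) i)) = (\<Sum>i\<in>A. g (x i))" by (simp add: merge_def)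
    moreover have "(\<Sum>i\<in>?B. g (merge A ?B (x, y) i)) = (\<Sum>i\<in>?B. g (y i))"
      by (intro sum.cong refl) (auto simp: merge_def)
    ultimately show ?thesis by simp
  qed
  have eq: "kern A x y * S y = kern A x y * (\<Sum>i\<in>A. g (x i)) + (\<Sum>i\<in>?B. kern A x y * g (y i))" for y
    by (simp add: S distrib_left sum_distrib_left)
  have "(\<Sum>i\<in>A. g (x i)) + (\<Sum>i\<in>?B. smean f (lab (x i)) - expectation f)
      = (\<integral>y. kern A x y * S y \<partial>?PB)"
    unfolding eq using i1 i2 e1 e2
    by (subst Bochner_Integration.integral_add) (auto simp: Bochner_Integration.integral_sum)
  moreover have "integrable ?PB (\<lambda>y. kern A x y * S y)"
    unfolding eq
    by (intro Bochner_Integration.integrable_add integrable_mult_left Bochner_Integration.integrable_sum)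
       (use i1 i2 in auto)
  ultimately have "ennreal \<bar>(\<Sum>i\<in>A. g (x i)) + (\<Sum>i\<in>?B. smean f (lab (x i)) - expectation f)\<bar>
      \<le> (\<integral>\<^sup>+y. ennreal \<bar>kern A x y * S y\<bar> \<partial>?PB)"
    using integral_norm_bound_ennreal[of ?PB "\<lambda>y. kern A x y * S y"] by simp
  also have "\<dots> \<le> resample U A x"
    unfolding resample_def
  proof (intro nn_integral_mono)
    fix y assume y: "y \<in> space ?PB"
    have m: "merge A ?B (x, y) \<in> space (PiM I (\<lambda>_. P))"
      using x y A by (auto simp: space_PiM merge_def PiE_iff extensional_def)
    have "ennreal \<bar>S y\<bar> \<le> U (merge A ?B (x, y))" using U[OF m] by (simp add: S_def g_def)
    then show "ennreal \<bar>kern A x y * S y\<bar> \<le> U (merge A ?B (x, y)) * ennreal (kern A x y)"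
      by (simp add: abs_mult kern_nonneg ennreal_mult mult.commute[of "ennreal (kern A x y)"] mult_right_mono)
  qed
  finally show ?thesis by (simp add: g_def)
qed

text \<open>Integration runs over the original units here, not over the fresh ones as in
  \<open>resample\<close>. Every factor integrates to \<open>nu / nu\<close>, which is 1 or, for a
  null stratum, 0; this is why resampling cannot increase expectations.\<close>

lemma nn_integral_kern_le_1:
  assumes "y' \<in> space (PiM (I - A) (\<lambda>_. P))"
  shows "(\<integral>\<^sup>+y. ennreal (kern A y y') \<partial>PiM (I - A) (\<lambda>_. P)) \<le> 1"
proof -
  have "(\<integral>\<^sup>+y. ennreal (kern A y y') \<partial>PiM (I - A) (\<lambda>_. P))
     = (\<integral>\<^sup>+y. (\<Prod>i\<in>I - A. ennreal (of_bool (lab (y i) = lab (y' i)) / nu (lab (y' i))))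
          \<partial>PiM (I - A) (\<lambda>_. P))"
    unfolding kern_def
    by (intro nn_integral_cong, subst prod_ennreal[symmetric])
       (auto simp: nu_nonneg intro!: arg_cong[of _ _ ennreal] prod.cong)
  also have "\<dots> = (\<Prod>i\<in>I - A. \<integral>\<^sup>+z. ennreal (of_bool (lab z = lab (y' i)) / nu (lab (y' i))) \<partial>P)"
    by (rule PF.product_nn_integral_prod) (auto simp: finite_I)
  also have "\<dots> = (\<Prod>i\<in>I - A. ennreal (nu (lab (y' i)) / nu (lab (y' i))))"
  proof (intro prod.cong refl)
    fix i
    have "(\<integral>\<^sup>+z. ennreal (of_bool (lab z = lab (y' i)) / nu (lab (y' i))) \<partial>P)
       = ennreal (\<integral>z. of_bool (lab z = lab (y' i)) / nu (lab (y' i)) \<partial>P)"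
      by (intro nn_integral_eq_integral integrable_divide integrable_const_bound[where B=1])
         (auto simp: nu_nonneg)
    then show "(\<integral>\<^sup>+z. ennreal (of_bool (lab z = lab (y' i)) / nu (lab (y' i))) \<partial>P)
       = ennreal (nu (lab (y' i)) / nu (lab (y' i)))" by (simp add: integral_of_bool_lab)
  qed
  also have "\<dots> = ennreal (\<Prod>i\<in>I - A. nu (lab (y' i)) / nu (lab (y' i)))"
    by (rule prod_ennreal) (simp add: nu_nonneg)
  also have "\<dots> \<le> ennreal 1"
    by (intro ennreal_leI prod_le_1) (auto simp: nu_nonneg divide_le_eq_1 less_le)
  finally show ?thesis by simp
qed

text \<open>Replacing units by independent ones of the same strata preserves their joint law, and a
  factor that sees only the labels is unaffected. By Fubini the original and the fresh units outside
  \<open>A\<close> exchange roles, after which the original ones integrate out.\<close>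

lemma nn_integral_resample_le:
  assumes A: "A \<subseteq> I" and U[measurable]: "U \<in> borel_measurable (PiM I (\<lambda>_. P))"
    and g[measurable]: "\<gamma> \<in> borel_measurable (PiM I (\<lambda>_. P))"
    and g_lab: "\<And>x x'. x \<in> space (PiM I (\<lambda>_. P)) \<Longrightarrow> x' \<in> space (PiM I (\<lambda>_. P)) \<Longrightarrow>
        (\<And>i. i \<in> I \<Longrightarrow> lab (x i) = lab (x' i)) \<Longrightarrow> \<gamma> x = \<gamma> x'"
  shows "(\<integral>\<^sup>+x. \<gamma> x * resample U A x \<partial>PiM I (\<lambda>_. P)) \<le> (\<integral>\<^sup>+x. \<gamma> x * U x \<partial>PiM I (\<lambda>_. P))"
proof -
  let ?B = "I - A"
  let ?PA = "PiM A (\<lambda>_. P)" and ?PB = "PiM ?B (\<lambda>_. P)" and ?PI = "PiM I (\<lambda>_. P)"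
  have finB: "finite ?B" and finA: "finite A" using finite_I A finite_subset by auto
  have AB: "A \<union> ?B = I" "A \<inter> ?B = {}" using A by auto
  interpret FB: finite_product_sigma_finite "\<lambda>_. P" ?B by standard (rule finB)
  interpret FBB: pair_sigma_finite ?PB ?PB ..
  have [measurable]: "resample U A \<in> borel_measurable ?PI" by (rule measurable_resample[OF A U])
  have mm[measurable]: "(\<lambda>p. merge A ?B p) \<in> measurable (?PA \<Otimes>\<^sub>M ?PB) ?PI"
    using measurable_merge[of A ?B "\<lambda>_. P"] by (simp only: AB)
  have sp: "merge A ?B (x, y) \<in> space ?PI" if "x \<in> space ?PA" "y \<in> space ?PB" for x y
    using measurable_space[OF mm] that by (simp add: space_pair_measure)
  have kk: "kern A (merge A ?B (x, y)) y' = kern A y y'" for x y y'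
    unfolding kern_def by (intro prod.cong refl) (auto simp: merge_def)
  have um: "merge A ?B (merge A ?B (x, y), y') = merge A ?B (x, y')" for x y y'
    by (auto simp: merge_def fun_eq_iff)
  have kmeas[measurable]: "(\<lambda>(y, y'). ennreal (kern A y y')) \<in> borel_measurable (?PB \<Otimes>\<^sub>M ?PB)"
    unfolding kern_def split_beta'
  proof (intro measurable_compose[OF borel_measurable_prod measurable_ennreal])
    fix i assume i: "i \<in> ?B"
    then have [measurable]: "(\<lambda>p. fst p i) \<in> measurable (?PB \<Otimes>\<^sub>M ?PB) P"
      "(\<lambda>p. snd p i) \<in> measurable (?PB \<Otimes>\<^sub>M ?PB) P" by simp_all
    show "(\<lambda>p. of_bool (lab (snd p i) = lab (fst p i)) / nu (lab (fst p i))) \<in>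
       borel_measurable (?PB \<Otimes>\<^sub>M ?PB)" by measurable
  qed
  have "(\<integral>\<^sup>+x. \<gamma> x * resample U A x \<partial>?PI) =
     (\<integral>\<^sup>+x. \<integral>\<^sup>+y. \<gamma> (merge A ?B (x, y)) * resample U A (merge A ?B (x, y)) \<partial>?PB \<partial>?PA)"
    using PF.product_nn_integral_fold[of A ?B "\<lambda>x. \<gamma> x * resample U A x"] finA finB
    by (simp only: AB) simp
  also have "\<dots> = (\<integral>\<^sup>+x. \<integral>\<^sup>+y. \<integral>\<^sup>+y'. \<gamma> (merge A ?B (x, y)) *
       (U (merge A ?B (x, y')) * ennreal (kern A y y')) \<partial>?PB \<partial>?PB \<partial>?PA)"
  proof (intro nn_integral_cong)
    fix x y assume xy[measurable]: "x \<in> space ?PA" "y \<in> space ?PB"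
    have [measurable]: "(\<lambda>y'. U (merge A ?B (x, y'))) \<in> borel_measurable ?PB"
      by (rule measurable_compose[OF measurable_compose[OF measurable_Pair1'[OF xy(1)] mm] U])
    have [measurable]: "(\<lambda>y'. ennreal (kern A y y')) \<in> borel_measurable ?PB"
      using measurable_compose[OF measurable_Pair1'[OF xy(2)] kmeas] by simp
    show "\<gamma> (merge A ?B (x, y)) * resample U A (merge A ?B (x, y)) =
      (\<integral>\<^sup>+y'. \<gamma> (merge A ?B (x, y)) * (U (merge A ?B (x, y')) * ennreal (kern A y y')) \<partial>?PB)"
      unfolding resample_def um kk by (subst nn_integral_cmult) auto
  qed
  \<comment> \<open>Where the kernel is nonzero, the fresh units carry the labels of the original
    ones, so \<open>\<gamma>\<close> may be evaluated at the resampled vector.\<close>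
  also have "\<dots> = (\<integral>\<^sup>+x. \<integral>\<^sup>+y. \<integral>\<^sup>+y'. \<gamma> (merge A ?B (x, y')) * U (merge A ?B (x, y')) *
       ennreal (kern A y y') \<partial>?PB \<partial>?PB \<partial>?PA)"
  proof (intro nn_integral_cong)
    fix x y y' assume xy: "x \<in> space ?PA" "y \<in> space ?PB" "y' \<in> space ?PB"
    show "\<gamma> (merge A ?B (x, y)) * (U (merge A ?B (x, y')) * ennreal (kern A y y')) =
        \<gamma> (merge A ?B (x, y')) * U (merge A ?B (x, y')) * ennreal (kern A y y')"
    proof (cases "kern A y y' = 0")
      case False
      then have "lab (y' i) = lab (y i)" if "i \<in> ?B" for i
        using finB that unfolding kern_def by (auto simp: prod_zero_iff split: if_splits)
      then have "\<gamma> (merge A ?B (x, y)) = \<gamma> (merge A ?B (x, y'))"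
        using xy by (intro g_lab sp) (auto simp: merge_def)
      then show ?thesis by (simp add: mult.assoc)
    qed simp
  qed
  also have "\<dots> = (\<integral>\<^sup>+x. \<integral>\<^sup>+y'. \<integral>\<^sup>+y. \<gamma> (merge A ?B (x, y')) * U (merge A ?B (x, y')) *
       ennreal (kern A y y') \<partial>?PB \<partial>?PB \<partial>?PA)"
  proof (rule nn_integral_cong)
    fix x assume x: "x \<in> space ?PA"
    have m1: "(\<lambda>y'. \<gamma> (merge A ?B (x, y')) * U (merge A ?B (x, y'))) \<in> borel_measurable ?PB"
      by (intro borel_measurable_times_ennreal
         measurable_compose[OF measurable_compose[OF measurable_Pair1'[OF x] mm] U]
         measurable_compose[OF measurable_compose[OF measurable_Pair1'[OF x] mm] g])
    have "(\<lambda>p. (\<gamma> (merge A ?B (x, snd p)) * U (merge A ?B (x, snd p))) *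
        (\<lambda>(y, y'). ennreal (kern A y y')) p) \<in> borel_measurable (?PB \<Otimes>\<^sub>M ?PB)"
      by (intro borel_measurable_times_ennreal[OF measurable_compose[OF measurable_snd m1] kmeas])
    from FBB.Fubini'[of "\<lambda>y y'. \<gamma> (merge A ?B (x, y')) * U (merge A ?B (x, y')) * ennreal (kern A y y')"] this
    show "(\<integral>\<^sup>+y. \<integral>\<^sup>+y'. \<gamma> (merge A ?B (x, y')) * U (merge A ?B (x, y')) *
       ennreal (kern A y y') \<partial>?PB \<partial>?PB) = (\<integral>\<^sup>+y'. \<integral>\<^sup>+y. \<gamma> (merge A ?B (x, y')) * U (merge A ?B (x, y')) *
       ennreal (kern A y y') \<partial>?PB \<partial>?PB)"
      by (simp add: split_beta')
  qed
  \<comment> \<open>Only the kernel still depends on the original units \<open>y\<close>, and its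
    integral over them is at most 1.\<close>
  also have "\<dots> \<le> (\<integral>\<^sup>+x. \<integral>\<^sup>+y'. \<gamma> (merge A ?B (x, y')) * U (merge A ?B (x, y')) \<partial>?PB \<partial>?PA)"
  proof (intro nn_integral_mono)
    fix x y' assume xy: "x \<in> space ?PA" "y' \<in> space ?PB"
    have "(\<lambda>y. ennreal (kern A y y')) \<in> borel_measurable ?PB"
      using measurable_compose[OF measurable_Pair2'[OF xy(2)] kmeas] by simp
    then have "(\<integral>\<^sup>+y. \<gamma> (merge A ?B (x, y')) * U (merge A ?B (x, y')) * ennreal (kern A y y') \<partial>?PB)
       = \<gamma> (merge A ?B (x, y')) * U (merge A ?B (x, y')) * (\<integral>\<^sup>+y. ennreal (kern A y y') \<partial>?PB)"
      by (rule nn_integral_cmult)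
    also have "\<dots> \<le> \<gamma> (merge A ?B (x, y')) * U (merge A ?B (x, y')) * 1"
      by (intro mult_left_mono nn_integral_kern_le_1 xy) auto
    finally show "(\<integral>\<^sup>+y. \<gamma> (merge A ?B (x, y')) * U (merge A ?B (x, y')) * ennreal (kern A y y') \<partial>?PB)
       \<le> \<gamma> (merge A ?B (x, y')) * U (merge A ?B (x, y'))" by simp
  qed
  also have "\<dots> = (\<integral>\<^sup>+x. \<gamma> x * U x \<partial>?PI)"
    using PF.product_nn_integral_fold[of A ?B "\<lambda>x. \<gamma> x * U x"] finA finB by (simp only: AB) simp
  finally show ?thesis .
qed

end

section \<open>Centring at stratum means\<close>

context labelled_sample
begin

text \<open>The sum over \<open>A\<close> centred at stratum means is a difference of two resampled
  centred sums: the one that keeps \<open>A\<close> and replaces the other units by their stratum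
  means, minus the one that replaces all units. The latter is resampling with the empty set
  kept.\<close>

lemma resample_centered_ge:
  assumes A: "A \<subseteq> I" and f: "integrable P f"
    and U: "\<And>z. z \<in> space (PiM I (\<lambda>_. P)) \<Longrightarrow> ennreal \<bar>\<Sum>i\<in>I. f (z i) - expectation f\<bar> \<le> U z"
    and x: "x \<in> space (PiM I (\<lambda>_. P))" and pos: "\<And>i. i \<in> I \<Longrightarrow> nu (lab (x i)) > 0"
  shows "ennreal \<bar>\<Sum>i\<in>A. f (x i) - smean f (lab (x i))\<bar> \<le> resample U A x + resample U {} x"
proof -
  define s where "s i = smean f (lab (x i)) - expectation f" for i
  have finA: "finite A" using A finite_I finite_subset by auto
  have "(\<Sum>i\<in>A. f (x i) - smean f (lab (x i))) = (\<Sum>i\<in>A. (f (x i) - expectation f) - s i)"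
    by (simp add: s_def)
  also have "\<dots> = (\<Sum>i\<in>A. f (x i) - expectation f) - (sum s I - sum s (I - A))"
    using sum.subset_diff[OF A finite_I, of s] by (simp add: sum_subtractf)
  finally have "\<bar>\<Sum>i\<in>A. f (x i) - smean f (lab (x i))\<bar>
      \<le> \<bar>(\<Sum>i\<in>A. f (x i) - expectation f) + sum s (I - A)\<bar> + \<bar>(\<Sum>i\<in>{}. f (x i) - expectation f) + sum s (I - {})\<bar>"
    by simp
  then have "ennreal \<bar>\<Sum>i\<in>A. f (x i) - smean f (lab (x i))\<bar>
      \<le> ennreal \<bar>(\<Sum>i\<in>A. f (x i) - expectation f) + sum s (I - A)\<bar>
        + ennreal \<bar>(\<Sum>i\<in>{}. f (x i) - expectation f) + sum s (I - {})\<bar>"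
    by (simp add: ennreal_plus[symmetric] ennreal_leI del: ennreal_plus)
  also have "\<dots> \<le> resample U A x + resample U {} x"
    unfolding s_def by (intro add_mono resample_ge A f U x pos) auto
  finally show ?thesis .
qed

text \<open>The deviation is the integral of \<open>f - expectation f\<close> over one stratum,
  divided by the stratum probability; extending the absolute integral to the whole space gives the
  bound.\<close>

lemma smean_deviation:
  assumes f: "integrable P f" and pos: "nu j > 0"
  shows "\<bar>smean f j - expectation f\<bar> \<le> expectation (\<lambda>z. \<bar>f z - expectation f\<bar>) / nu j"
proof -
  let ?b = "\<lambda>z. of_bool (lab z = j) :: real"
  have fi: "integrable P (\<lambda>z. f z * ?b z)"
    by (rule Bochner_Integration.integrable_bound[OF f]) (use f in auto)
  have bi: "integrable P ?b" by (rule integrable_const_bound[where B=1]) auto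
  have "smean f j - expectation f = (expectation (\<lambda>z. f z * ?b z) - expectation f * nu j) / nu j"
    using pos by (simp add: smean_def diff_divide_distrib)
  also have "expectation (\<lambda>z. f z * ?b z) - expectation f * nu j
      = expectation (\<lambda>z. f z * ?b z - expectation f * ?b z)"
    using fi bi by (subst Bochner_Integration.integral_diff) (auto simp: integral_of_bool_lab)
  finally have *: "smean f j - expectation f
      = expectation (\<lambda>z. f z * ?b z - expectation f * ?b z) / nu j" .
  have "\<bar>expectation (\<lambda>z. f z * ?b z - expectation f * ?b z)\<bar>
      \<le> expectation (\<lambda>z. \<bar>f z * ?b z - expectation f * ?b z\<bar>)" by (rule integral_abs_bound)
  also have "\<dots> \<le> expectation (\<lambda>z. \<bar>f z - expectation f\<bar>)"
    using fi bi f by (intro integral_mono) auto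
  finally show ?thesis using pos unfolding * by (simp add: divide_right_mono)
qed

lemma sum_nu: "(\<Sum>j\<in>UNIV. nu j) = 1"
proof -
  have "(\<Sum>j\<in>UNIV. nu j) = measure P (\<Union>j\<in>UNIV. {z \<in> space P. lab z = j})"
    unfolding nu_def by (subst finite_measure_finite_Union) (auto simp: disjoint_family_on_def)
  also have "(\<Union>j\<in>UNIV. {z \<in> space P. lab z = j}) = space P" by auto
  finally show ?thesis by (simp add: prob_space)
qed

lemma sum_nu_smean:
  assumes f: "integrable P f" and pos: "\<And>j. nu j > 0"
  shows "(\<Sum>j\<in>UNIV. nu j * smean f j) = expectation f"
proof -
  have fi: "integrable P (\<lambda>z. f z * of_bool (lab z = j))" for j
    by (rule Bochner_Integration.integrable_bound[OF f]) (use f in auto)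
  have "(\<Sum>j\<in>UNIV. nu j * smean f j) = (\<Sum>j\<in>UNIV. expectation (\<lambda>z. f z * of_bool (lab z = j)))"
    using pos by (intro sum.cong refl) (simp add: smean_def less_imp_neq[THEN not_sym])
  also have "\<dots> = expectation (\<lambda>z. \<Sum>j\<in>UNIV. f z * of_bool (lab z = j))"
    using fi by (intro Bochner_Integration.integral_sum[symmetric]) auto
  also have "\<dots> = expectation f"
    by (intro Bochner_Integration.integral_cong refl) (simp add: if_distrib cong: if_cong)
  finally show ?thesis .
qed

end

section \<open>Mean absolute deviations and majorants on finitely many units\<close>

context prob_space
begin

text \<open>The label is constant, so each summand averages \<open>U\<close> over all units outside
  \<open>A\<close>; the prefactor is the constant of
  \<open>sum_abs_le_subset_average\<close>.\<close>

definition abs_majorant :: "'i set \<Rightarrow> (('i \<Rightarrow> 'a) \<Rightarrow> ennreal) \<Rightarrow> ('i \<Rightarrow> 'a) \<Rightarrow> ennreal" where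
  "abs_majorant I U x = ennreal (4 * sqrt (real (card I)) / 2 ^ card I) *
     (\<Sum>A\<in>Pow I. labelled_sample.resample M (\<lambda>_. ()) I U A x)"

context
  fixes I :: "'i set" assumes I: "finite I"
begin

interpretation T: labelled_sample M "\<lambda>_. ()" I
  by standard (auto simp: I)

lemma measurable_abs_majorant:
  "U \<in> borel_measurable (PiM I (\<lambda>_. M)) \<Longrightarrow> abs_majorant I U \<in> borel_measurable (PiM I (\<lambda>_. M))"
  unfolding abs_majorant_def[abs_def]
  by (intro borel_measurable_times_ennreal borel_measurable_const borel_measurable_sum T.measurable_resample) auto

text \<open>By Khintchine's inequality \<open>\<Sum>\<bar>a\<^sub>i\<bar>\<close> is at most \<open>O(\<surd>n)\<close> times the average
  of \<open>\<bar>\<Sum>\<^sub>i\<^sub>\<in>\<^sub>A a\<^sub>i\<bar>\<close> over all subsets \<open>A\<close>, and each subset sum has the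
  majorant obtained by averaging \<open>U\<close> over the units outside \<open>A\<close>.\<close>

lemma abs_majorant_ge:
  assumes f: "integrable M f"
    and U: "\<And>z. z \<in> space (PiM I (\<lambda>_. M)) \<Longrightarrow> ennreal \<bar>\<Sum>i\<in>I. f (z i) - expectation f\<bar> \<le> U z"
    and x: "x \<in> space (PiM I (\<lambda>_. M))"
  shows "ennreal (\<Sum>i\<in>I. \<bar>f (x i) - expectation f\<bar>) \<le> abs_majorant I U x"
proof -
  have nu: "T.nu j = 1" for j by (simp add: T.nu_def prob_space)
  have sm: "T.smean f j = expectation f" for j by (simp add: T.smean_def nu)
  let ?S = "\<lambda>A. \<Sum>i\<in>A. f (x i) - expectation f"
  have "(\<Sum>i\<in>I. \<bar>f (x i) - expectation f\<bar>)
      \<le> 4 * sqrt (real (card I)) / 2 ^ card I * (\<Sum>A\<in>Pow I. \<bar>?S A\<bar>)"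
    by (rule sum_abs_le_subset_average[OF I])
  then have "ennreal (\<Sum>i\<in>I. \<bar>f (x i) - expectation f\<bar>)
      \<le> ennreal (4 * sqrt (real (card I)) / 2 ^ card I) * (\<Sum>A\<in>Pow I. ennreal \<bar>?S A\<bar>)"
    by (subst sum_ennreal) (auto simp: ennreal_mult[symmetric] sum_nonneg ennreal_leI)
  also have "\<dots> \<le> abs_majorant I U x"
    unfolding abs_majorant_def
  proof (intro mult_left_mono sum_mono)
    fix A assume "A \<in> Pow I"
    then show "ennreal \<bar>?S A\<bar> \<le> T.resample U A x"
      using T.resample_ge[OF _ f U x, of A] by (simp add: nu sm)
  qed simp
  finally show ?thesis .
qed

text \<open>Each of the \<open>2 ^ card I\<close> resampled majorants has integral at most that of
  \<open>U\<close>, which cancels the normalisation.\<close>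

lemma nn_integral_abs_majorant_le:
  assumes U: "U \<in> borel_measurable (PiM I (\<lambda>_. M))"
  shows "(\<integral>\<^sup>+x. abs_majorant I U x \<partial>PiM I (\<lambda>_. M))
     \<le> ennreal (4 * sqrt (real (card I))) * (\<integral>\<^sup>+x. U x \<partial>PiM I (\<lambda>_. M))"
proof -
  let ?c = "ennreal (4 * sqrt (real (card I)) / 2 ^ card I)"
  have "(\<integral>\<^sup>+x. abs_majorant I U x \<partial>PiM I (\<lambda>_. M))
     = ?c * (\<Sum>A\<in>Pow I. \<integral>\<^sup>+x. T.resample U A x \<partial>PiM I (\<lambda>_. M))"
    unfolding abs_majorant_def
    by (subst nn_integral_cmult, use U in \<open>auto intro!: borel_measurable_sum T.measurable_resample\<close>)
       (subst nn_integral_sum, use U in \<open>auto intro!: T.measurable_resample\<close>)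
  also have "\<dots> \<le> ?c * (\<Sum>A\<in>Pow I. \<integral>\<^sup>+x. U x \<partial>PiM I (\<lambda>_. M))"
    using T.nn_integral_resample_le[OF _ U, of _ "\<lambda>_. 1"] by (intro mult_left_mono sum_mono) auto
  also have "\<dots> = ?c * ennreal (2 ^ card I) * (\<integral>\<^sup>+x. U x \<partial>PiM I (\<lambda>_. M))"
    using I by (simp add: card_Pow mult.assoc ennreal_power[symmetric])
  also have "?c * ennreal (2 ^ card I) = ennreal (4 * sqrt (real (card I)))"
    by (subst ennreal_mult[symmetric]) auto
  finally show ?thesis .
qed

text \<open>Integrating the sum of absolute deviations gives \<open>card I\<close> copies of the
  population mean absolute deviation, which is therefore at most
  \<open>4 * \<tau> / sqrt (card I)\<close>. A bound on signed centred sums thus controls the size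
  of every member of the class.\<close>

lemma expectation_abs_deviation_le:
  assumes f: "integrable M f" and U: "U \<in> borel_measurable (PiM I (\<lambda>_. M))"
    and Uf: "\<And>z. z \<in> space (PiM I (\<lambda>_. M)) \<Longrightarrow> ennreal \<bar>\<Sum>i\<in>I. f (z i) - expectation f\<bar> \<le> U z"
    and le: "(\<integral>\<^sup>+x. U x \<partial>PiM I (\<lambda>_. M)) \<le> ennreal \<tau>" and "0 \<le> \<tau>"
  shows "real (card I) * expectation (\<lambda>z. \<bar>f z - expectation f\<bar>) \<le> 4 * sqrt (real (card I)) * \<tau>"
proof -
  let ?g = "\<lambda>z. \<bar>f z - expectation f\<bar>"
  have g: "integrable M ?g" using f by auto
  have comp: "(\<integral>\<^sup>+x. ennreal (?g (x i)) \<partial>PiM I (\<lambda>_. M)) = ennreal (expectation ?g)" if i: "i \<in> I" for i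
  proof -
    have "distr (PiM I (\<lambda>_. M)) M (\<lambda>x. x i) = M"
      by (rule distr_PiM_component) (auto intro: prob_space_axioms i)
    then have "(\<integral>\<^sup>+z. ennreal (?g z) \<partial>M) = (\<integral>\<^sup>+z. ennreal (?g z) \<partial>distr (PiM I (\<lambda>_. M)) M (\<lambda>x. x i))"
      by simp
    also have "\<dots> = (\<integral>\<^sup>+x. ennreal (?g (x i)) \<partial>PiM I (\<lambda>_. M))"
      using g i by (intro nn_integral_distr) auto
    finally show ?thesis using nn_integral_eq_integral[OF g] by simp
  qed
  have "ennreal (real (card I) * expectation ?g) = (\<Sum>i\<in>I. ennreal (expectation ?g))"
    by (subst sum_ennreal) (auto intro!: Bochner_Integration.integral_nonneg)
  also have "\<dots> = (\<integral>\<^sup>+x. (\<Sum>i\<in>I. ennreal (?g (x i))) \<partial>PiM I (\<lambda>_. M))"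
    using comp f by (subst nn_integral_sum) auto
  also have "\<dots> \<le> (\<integral>\<^sup>+x. abs_majorant I U x \<partial>PiM I (\<lambda>_. M))"
    using abs_majorant_ge[OF f Uf] by (intro nn_integral_mono) (subst sum_ennreal, auto)
  also have "\<dots> \<le> ennreal (4 * sqrt (real (card I))) * ennreal \<tau>"
    using nn_integral_abs_majorant_le[OF U] le by (meson mult_left_mono order_trans zero_le)
  also have "\<dots> = ennreal (4 * sqrt (real (card I)) * \<tau>)"
    using \<open>0 \<le> \<tau>\<close> by (simp add: ennreal_mult)
  finally show ?thesis using \<open>0 \<le> \<tau>\<close> by (subst (asm) ennreal_le_iff) auto
qed

end

text \<open>\<open>U'\<close> integrates out the coordinates from \<open>N\<close> on. This keeps
  the integral and also the majorant property for quantities determined by the first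
  \<open>N\<close> coordinates. Outer expectations live on the sequence space, whereas resampling
  takes place on a finite product.\<close>

lemma finite_dim_majorant:
  fixes U :: "(nat \<Rightarrow> 'a) \<Rightarrow> ennreal"
  assumes U: "U \<in> borel_measurable (PiM UNIV (\<lambda>_. M))"
  obtains U' where "U' \<in> borel_measurable (PiM {..<N} (\<lambda>_. M))"
    "(\<integral>\<^sup>+x. U' x \<partial>PiM {..<N} (\<lambda>_. M)) = (\<integral>\<^sup>+x. U x \<partial>PiM UNIV (\<lambda>_. M))"
    "\<And>z t. z \<in> space (PiM {..<N} (\<lambda>_. M)) \<Longrightarrow>
       (\<And>w. w \<in> space (PiM UNIV (\<lambda>_. M)) \<Longrightarrow> (\<And>i. i < N \<Longrightarrow> w i = z i) \<Longrightarrow> t \<le> U w) \<Longrightarrow> t \<le> U' z"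
proof -
  let ?S = "PiM (UNIV::nat set) (\<lambda>_. M)" and ?F = "PiM {..<N} (\<lambda>_. M)"
  interpret S: sequence_space M ..
  interpret SS: pair_sigma_finite ?S ?S ..
  interpret pp: product_prob_space "\<lambda>_. M" UNIV by standard
  have mc: "(\<lambda>p. comb_seq N (fst p) (snd p)) \<in> measurable (?F \<Otimes>\<^sub>M ?S) ?S"
  proof (rule measurable_PiM_single')
    fix i :: nat
    show "(\<lambda>p. comb_seq N (fst p) (snd p) i) \<in> measurable (?F \<Otimes>\<^sub>M ?S) M"
      by (cases "i < N") (simp_all add: comb_seq_def)
  qed (auto simp: space_pair_measure space_PiM comb_seq_def PiE_iff)
  define U' where "U' z = (\<integral>\<^sup>+w. U (comb_seq N z w) \<partial>?S)" for z
  have m: "U' \<in> borel_measurable ?F"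
    unfolding U'_def[abs_def]
    using S.P.borel_measurable_nn_integral_fst[OF measurable_compose[OF mc U]] by simp
  have r: "distr ?S ?F (\<lambda>w. restrict w {..<N}) = ?F"
    by (rule pp.distr_PiM_restrict_finite) auto
  have "(\<integral>\<^sup>+x. U' x \<partial>?F) = (\<integral>\<^sup>+x. U' x \<partial>distr ?S ?F (\<lambda>w. restrict w {..<N}))" unfolding r ..
  also have "\<dots> = (\<integral>\<^sup>+x. U' (restrict x {..<N}) \<partial>?S)"
    using m by (subst nn_integral_distr) (auto intro!: measurable_restrict_subset)
  also have "\<dots> = (\<integral>\<^sup>+x. \<integral>\<^sup>+w. U (comb_seq N x w) \<partial>?S \<partial>?S)"
    unfolding U'_def by (intro nn_integral_cong arg_cong[of _ _ U]) (auto simp: comb_seq_def)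
  also have "\<dots> = (\<integral>\<^sup>+p. U ((\<lambda>(x, w). comb_seq N x w) p) \<partial>(?S \<Otimes>\<^sub>M ?S))"
    using U measurable_comb_seq[of N M]
    by (subst S.P.nn_integral_fst[symmetric]) auto
  also have "\<dots> = (\<integral>\<^sup>+x. U x \<partial>distr (?S \<Otimes>\<^sub>M ?S) ?S (\<lambda>(x, w). comb_seq N x w))"
    using U measurable_comb_seq[of N M] by (subst nn_integral_distr) auto
  also have "\<dots> = (\<integral>\<^sup>+x. U x \<partial>?S)" by (simp add: S.PiM_comb_seq)
  finally have i: "(\<integral>\<^sup>+x. U' x \<partial>?F) = (\<integral>\<^sup>+x. U x \<partial>?S)" .
  show ?thesis
  proof (rule that[OF m i])
    fix z t assume z: "z \<in> space ?F"
      and t: "\<And>w. w \<in> space ?S \<Longrightarrow> (\<And>i. i < N \<Longrightarrow> w i = z i) \<Longrightarrow> t \<le> U w"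
    have "t = (\<integral>\<^sup>+w. t \<partial>?S)" by (simp add: S.P.emeasure_space_1)
    also have "\<dots> \<le> U' z"
      unfolding U'_def
    proof (intro nn_integral_mono t)
      fix w assume "w \<in> space ?S"
      then show "comb_seq N z w \<in> space ?S"
        using z by (auto simp: space_PiM comb_seq_def PiE_iff)
    qed (simp add: comb_seq_def)
    finally show "t \<le> U' z" .
  qed
qed

end

section \<open>Outer probability calculus\<close>

text \<open>The common core of both bootstrap order symbols: the conditional outer probability of
  the event given the data tends to 0 in outer probability. Working with events replaces an algebra
  of random variables by finite unions and almost sure implications.\<close>

definition negl ::
  "('x, 'u, 'y, 'j::finite, 's) two_phase \<Rightarrow>
    (nat \<Rightarrow> (nat \<Rightarrow> 'x \<times> 'u) \<times> 's \<Rightarrow> weights \<Rightarrow> bool) \<Rightarrow> bool" where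
  "negl D E \<longleftrightarrow> (\<forall>\<eta>::real. 0 < \<eta> \<longrightarrow>
     (\<lambda>N. outer_measure_of (data D) {\<omega> \<in> space (data D).
        outer_measure_of (PW D N \<omega>) {b \<in> space (PW D N \<omega>). E N \<omega> b} > ennreal \<eta>})
     \<longlonglongrightarrow> 0)"

lemma outer_measure_of_Un_le:
  assumes "A \<subseteq> space M" "B \<subseteq> space M"
  shows "outer_measure_of M (A \<union> B) \<le> outer_measure_of M A + outer_measure_of M B"
proof -
  obtain E where E: "E \<in> sets M" "A \<subseteq> E" "outer_measure_of M A = emeasure M E"
    using outer_measure_of_attain[OF assms(1)] by auto
  obtain F where F: "F \<in> sets M" "B \<subseteq> F" "outer_measure_of M B = emeasure M F"
    using outer_measure_of_attain[OF assms(2)] by auto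
  have "outer_measure_of M (A \<union> B) \<le> outer_measure_of M (E \<union> F)"
    using E F by (intro outer_measure_of_mono) auto
  also have "\<dots> = emeasure M (E \<union> F)" using E F by simp
  also have "\<dots> \<le> emeasure M E + emeasure M F" using E F by (intro emeasure_subadditive)
  finally show ?thesis using E F by simp
qed

lemma outer_measure_of_AE_mono:
  assumes "AE x in M. x \<in> A \<longrightarrow> x \<in> B" "A \<subseteq> space M" "B \<subseteq> space M"
  shows "outer_measure_of M A \<le> outer_measure_of M B"
proof -
  obtain C where C: "C \<in> sets M" "emeasure M C = 0" "{x \<in> space M. \<not> (x \<in> A \<longrightarrow> x \<in> B)} \<subseteq> C"
    using assms(1) by (auto elim: AE_E)
  have "outer_measure_of M A \<le> outer_measure_of M (B \<union> C)"
    using C assms by (intro outer_measure_of_mono) auto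
  also have "\<dots> \<le> outer_measure_of M B + outer_measure_of M C"
    using assms sets.sets_into_space[OF C(1)] by (intro outer_measure_of_Un_le) auto
  finally show ?thesis using C by simp
qed

lemma negl_mono:
  assumes "negl D E'"
    and "eventually (\<lambda>N. AE \<omega> in data D. AE b in PW D N \<omega>. E N \<omega> b \<longrightarrow> E' N \<omega> b) sequentially"
  shows "negl D E"
  unfolding negl_def
proof (intro allI impI)
  fix \<eta> :: real assume \<eta>: "\<eta> > 0"
  show "(\<lambda>N. outer_measure_of (data D) {\<omega> \<in> space (data D).
        outer_measure_of (PW D N \<omega>) {b \<in> space (PW D N \<omega>). E N \<omega> b} > ennreal \<eta>}) \<longlonglongrightarrow> 0"
  proof (rule tendsto_sandwich[OF _ _ tendsto_const])
    show "(\<lambda>N. outer_measure_of (data D) {\<omega> \<in> space (data D).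
        outer_measure_of (PW D N \<omega>) {b \<in> space (PW D N \<omega>). E' N \<omega> b} > ennreal \<eta>}) \<longlonglongrightarrow> 0"
      using assms(1) \<eta> by (auto simp: negl_def)
    show "eventually (\<lambda>N. outer_measure_of (data D) {\<omega> \<in> space (data D).
        outer_measure_of (PW D N \<omega>) {b \<in> space (PW D N \<omega>). E N \<omega> b} > ennreal \<eta>}
      \<le> outer_measure_of (data D) {\<omega> \<in> space (data D).
        outer_measure_of (PW D N \<omega>) {b \<in> space (PW D N \<omega>). E' N \<omega> b} > ennreal \<eta>}) sequentially"
      using assms(2)
    proof eventually_elim
      case (elim N)
      show ?case
      proof (rule outer_measure_of_AE_mono)
        show "AE \<omega> in data D. \<omega> \<in> {\<omega> \<in> space (data D).
            outer_measure_of (PW D N \<omega>) {b \<in> space (PW D N \<omega>). E N \<omega> b} > ennreal \<eta>} \<longrightarrow>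
           \<omega> \<in> {\<omega> \<in> space (data D).
            outer_measure_of (PW D N \<omega>) {b \<in> space (PW D N \<omega>). E' N \<omega> b} > ennreal \<eta>}"
          using elim
        proof eventually_elim
          case (elim \<omega>)
          have "outer_measure_of (PW D N \<omega>) {b \<in> space (PW D N \<omega>). E N \<omega> b}
            \<le> outer_measure_of (PW D N \<omega>) {b \<in> space (PW D N \<omega>). E' N \<omega> b}"
            using elim by (intro outer_measure_of_AE_mono) auto
          then show ?case by (auto intro: less_le_trans)
        qed
      qed auto
    qed
  qed auto
qed

lemma negl_mono_pointwise:
  assumes "negl D E'"
    and "eventually (\<lambda>N. \<forall>\<omega>\<in>space (data D). \<forall>b\<in>space (PW D N \<omega>). E N \<omega> b \<longrightarrow> E' N \<omega> b) sequentially"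
  shows "negl D E"
  using assms(1)
proof (rule negl_mono)
  show "eventually (\<lambda>N. AE \<omega> in data D. AE b in PW D N \<omega>. E N \<omega> b \<longrightarrow> E' N \<omega> b) sequentially"
    using assms(2)
    by eventually_elim (auto intro!: AE_I2)
qed

lemma negl_False: "negl D (\<lambda>N \<omega> b. False)"
proof -
  have "{\<omega> \<in> space (data D). outer_measure_of (PW D N \<omega>) {b \<in> space (PW D N \<omega>). False} > ennreal \<eta>} = {}"
    for N \<eta> by simp
  then show ?thesis unfolding negl_def by simp
qed

lemma negl_AE:
  assumes "eventually (\<lambda>N. AE \<omega> in data D. AE b in PW D N \<omega>. \<not> E N \<omega> b) sequentially"
  shows "negl D E"
  by (rule negl_mono[OF negl_False]) (use assms in simp)

lemma negl_disj:
  assumes "negl D E" "negl D F"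
  shows "negl D (\<lambda>N \<omega> b. E N \<omega> b \<or> F N \<omega> b)"
  unfolding negl_def
proof (intro allI impI)
  fix \<eta> :: real assume \<eta>: "\<eta> > 0"
  let ?S = "\<lambda>E N \<eta>. {\<omega> \<in> space (data D).
        outer_measure_of (PW D N \<omega>) {b \<in> space (PW D N \<omega>). E N \<omega> b} > ennreal \<eta>}"
  let ?G = "\<lambda>N \<omega> b. E N \<omega> b \<or> F N \<omega> b"
  have sub: "?S ?G N \<eta> \<subseteq> ?S E N (\<eta> / 2) \<union> ?S F N (\<eta> / 2)" for N
  proof
    fix \<omega> assume w: "\<omega> \<in> ?S ?G N \<eta>"
    show "\<omega> \<in> ?S E N (\<eta> / 2) \<union> ?S F N (\<eta> / 2)"
    proof (rule ccontr)
      assume "\<not> ?thesis"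
      with w have le: "outer_measure_of (PW D N \<omega>) {b \<in> space (PW D N \<omega>). E N \<omega> b} \<le> ennreal (\<eta> / 2)"
        "outer_measure_of (PW D N \<omega>) {b \<in> space (PW D N \<omega>). F N \<omega> b} \<le> ennreal (\<eta> / 2)" by auto
      have "outer_measure_of (PW D N \<omega>) {b \<in> space (PW D N \<omega>). ?G N \<omega> b}
         = outer_measure_of (PW D N \<omega>) ({b \<in> space (PW D N \<omega>). E N \<omega> b} \<union> {b \<in> space (PW D N \<omega>). F N \<omega> b})"
        by (intro arg_cong[of _ _ "outer_measure_of (PW D N \<omega>)"]) auto
      also have "\<dots> \<le> ennreal (\<eta> / 2) + ennreal (\<eta> / 2)"
        by (rule order_trans[OF outer_measure_of_Un_le add_mono[OF le]]) auto
      also have "\<dots> = ennreal \<eta>" using \<eta> by (simp add: ennreal_plus[symmetric] del: ennreal_plus)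
      finally show False using w by (auto simp: not_less[symmetric])
    qed
  qed
  have lim: "(\<lambda>N. outer_measure_of (data D) (?S E N (\<eta> / 2)) + outer_measure_of (data D) (?S F N (\<eta> / 2)))
      \<longlonglongrightarrow> 0 + 0"
    using assms[unfolded negl_def, rule_format, of "\<eta> / 2"] \<eta> by (intro tendsto_add) auto
  show "(\<lambda>N. outer_measure_of (data D) (?S ?G N \<eta>)) \<longlonglongrightarrow> 0"
  proof (rule tendsto_sandwich[OF _ _ tendsto_const])
    show "(\<lambda>N. outer_measure_of (data D) (?S E N (\<eta> / 2)) + outer_measure_of (data D) (?S F N (\<eta> / 2)))
      \<longlonglongrightarrow> 0" using lim by simp
    show "eventually (\<lambda>N. outer_measure_of (data D) (?S ?G N \<eta>) \<le>
       outer_measure_of (data D) (?S E N (\<eta> / 2)) + outer_measure_of (data D) (?S F N (\<eta> / 2))) sequentially"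
    proof (intro always_eventually allI)
      fix N
      have "outer_measure_of (data D) (?S ?G N \<eta>) \<le> outer_measure_of (data D) (?S E N (\<eta> / 2) \<union> ?S F N (\<eta> / 2))"
        by (rule outer_measure_of_mono[OF sub])
      also have "\<dots> \<le> outer_measure_of (data D) (?S E N (\<eta> / 2)) + outer_measure_of (data D) (?S F N (\<eta> / 2))"
        by (rule outer_measure_of_Un_le) blast+
      finally show "outer_measure_of (data D) (?S ?G N \<eta>) \<le>
        outer_measure_of (data D) (?S E N (\<eta> / 2)) + outer_measure_of (data D) (?S F N (\<eta> / 2))" .
    qed
  qed auto
qed

text \<open>A bound on the double expectation over weights and data. The conditional mean given the
  data only has to lie below a measurable \<open>h\<close>, because nothing establishes that this
  mean is itself measurable in the data.\<close>

definition mean_le ::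
  "('x, 'u, 'y, 'j::finite, 's) two_phase \<Rightarrow> nat \<Rightarrow>
    ((nat \<Rightarrow> 'x \<times> 'u) \<times> 's \<Rightarrow> weights \<Rightarrow> ennreal) \<Rightarrow> ennreal \<Rightarrow> bool" where
  "mean_le D N \<Xi> e \<longleftrightarrow> (\<exists>h\<in>borel_measurable (data D).
     (AE \<omega> in data D. \<Xi> \<omega> \<in> borel_measurable (PW D N \<omega>) \<and> (\<integral>\<^sup>+b. \<Xi> \<omega> b \<partial>PW D N \<omega>) \<le> h \<omega>) \<and>
     (\<integral>\<^sup>+\<omega>. h \<omega> \<partial>data D) \<le> e)"

lemma mean_leI:
  assumes "h \<in> borel_measurable (data D)"
    "AE \<omega> in data D. \<Xi> \<omega> \<in> borel_measurable (PW D N \<omega>) \<and> (\<integral>\<^sup>+b. \<Xi> \<omega> b \<partial>PW D N \<omega>) \<le> h \<omega>"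
    "(\<integral>\<^sup>+\<omega>. h \<omega> \<partial>data D) \<le> e"
  shows "mean_le D N \<Xi> e"
  using assms unfolding mean_le_def by blast

lemma mean_le_zero: "mean_le D N (\<lambda>\<omega> b. 0) e"
  by (rule mean_leI[of "\<lambda>_. 0"]) auto

lemma mean_le_add:
  assumes "mean_le D N X e" "mean_le D N Y e'"
  shows "mean_le D N (\<lambda>\<omega> b. X \<omega> b + Y \<omega> b) (e + e')"
proof -
  obtain h where h[measurable]: "h \<in> borel_measurable (data D)"
    and h1: "AE \<omega> in data D. X \<omega> \<in> borel_measurable (PW D N \<omega>) \<and> (\<integral>\<^sup>+b. X \<omega> b \<partial>PW D N \<omega>) \<le> h \<omega>"
    and h2: "(\<integral>\<^sup>+\<omega>. h \<omega> \<partial>data D) \<le> e" using assms(1) unfolding mean_le_def by auto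
  obtain k where k[measurable]: "k \<in> borel_measurable (data D)"
    and k1: "AE \<omega> in data D. Y \<omega> \<in> borel_measurable (PW D N \<omega>) \<and> (\<integral>\<^sup>+b. Y \<omega> b \<partial>PW D N \<omega>) \<le> k \<omega>"
    and k2: "(\<integral>\<^sup>+\<omega>. k \<omega> \<partial>data D) \<le> e'" using assms(2) unfolding mean_le_def by auto
  show ?thesis
  proof (rule mean_leI[of "\<lambda>\<omega>. h \<omega> + k \<omega>"])
    show "AE \<omega> in data D. (\<lambda>b. X \<omega> b + Y \<omega> b) \<in> borel_measurable (PW D N \<omega>) \<and>
        (\<integral>\<^sup>+b. X \<omega> b + Y \<omega> b \<partial>PW D N \<omega>) \<le> h \<omega> + k \<omega>"
      using h1 k1
      by eventually_elim (auto simp: nn_integral_add intro!: add_mono)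
    show "(\<integral>\<^sup>+\<omega>. h \<omega> + k \<omega> \<partial>data D) \<le> e + e'"
      using h2 k2 by (subst nn_integral_add) (auto intro!: add_mono)
  qed auto
qed

lemma mean_le_cmult:
  assumes "mean_le D N X e"
  shows "mean_le D N (\<lambda>\<omega> b. c * X \<omega> b) (c * e)"
proof -
  obtain h where h[measurable]: "h \<in> borel_measurable (data D)"
    and h1: "AE \<omega> in data D. X \<omega> \<in> borel_measurable (PW D N \<omega>) \<and> (\<integral>\<^sup>+b. X \<omega> b \<partial>PW D N \<omega>) \<le> h \<omega>"
    and h2: "(\<integral>\<^sup>+\<omega>. h \<omega> \<partial>data D) \<le> e" using assms unfolding mean_le_def by auto
  show ?thesis
  proof (rule mean_leI[of "\<lambda>\<omega>. c * h \<omega>"])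
    show "AE \<omega> in data D. (\<lambda>b. c * X \<omega> b) \<in> borel_measurable (PW D N \<omega>) \<and>
        (\<integral>\<^sup>+b. c * X \<omega> b \<partial>PW D N \<omega>) \<le> c * h \<omega>"
      using h1
      by eventually_elim (auto simp: nn_integral_cmult intro!: mult_left_mono)
    show "(\<integral>\<^sup>+\<omega>. c * h \<omega> \<partial>data D) \<le> c * e"
      using h2 by (subst nn_integral_cmult) (auto intro!: mult_left_mono)
  qed auto
qed

text \<open>Monotone convergence at both levels; this sums the bounds over the countably many shells
  of the peeling argument.\<close>

lemma mean_le_suminf:
  assumes "\<And>n::nat. mean_le D N (X n) (e n)"
  shows "mean_le D N (\<lambda>\<omega> b. \<Sum>n. X n \<omega> b) (\<Sum>n. e n)"
proof -
  have "\<forall>n. \<exists>h. h \<in> borel_measurable (data D) \<and>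
    (AE \<omega> in data D. X n \<omega> \<in> borel_measurable (PW D N \<omega>) \<and> (\<integral>\<^sup>+b. X n \<omega> b \<partial>PW D N \<omega>) \<le> h \<omega>) \<and>
    (\<integral>\<^sup>+\<omega>. h \<omega> \<partial>data D) \<le> e n"
    using assms[unfolded mean_le_def Bex_def] by (intro allI)
  from choice[OF this] obtain h where h_all: "\<forall>n. h n \<in> borel_measurable (data D) \<and>
    (AE \<omega> in data D. X n \<omega> \<in> borel_measurable (PW D N \<omega>) \<and> (\<integral>\<^sup>+b. X n \<omega> b \<partial>PW D N \<omega>) \<le> h n \<omega>) \<and>
    (\<integral>\<^sup>+\<omega>. h n \<omega> \<partial>data D) \<le> e n" ..
  note h[measurable] = h_all[THEN spec, THEN conjunct1]
  note h1 = h_all[THEN spec, THEN conjunct2, THEN conjunct1]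
    and h2 = h_all[THEN spec, THEN conjunct2, THEN conjunct2]
  show ?thesis
  proof (rule mean_leI[of "\<lambda>\<omega>. \<Sum>n. h n \<omega>"])
    have "AE \<omega> in data D. \<forall>n. X n \<omega> \<in> borel_measurable (PW D N \<omega>) \<and> (\<integral>\<^sup>+b. X n \<omega> b \<partial>PW D N \<omega>) \<le> h n \<omega>"
      unfolding AE_all_countable by (intro allI h1)
    then show "AE \<omega> in data D. (\<lambda>b. \<Sum>n. X n \<omega> b) \<in> borel_measurable (PW D N \<omega>) \<and>
        (\<integral>\<^sup>+b. (\<Sum>n. X n \<omega> b) \<partial>PW D N \<omega>) \<le> (\<Sum>n. h n \<omega>)"
    proof eventually_elim
      case (elim \<omega>)
      have m: "X n \<omega> \<in> borel_measurable (PW D N \<omega>)" for n using elim by simp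
      have "(\<integral>\<^sup>+b. (\<Sum>n. X n \<omega> b) \<partial>PW D N \<omega>) = (\<Sum>n. \<integral>\<^sup>+b. X n \<omega> b \<partial>PW D N \<omega>)"
        by (rule nn_integral_suminf[OF m])
      also have "\<dots> \<le> (\<Sum>n. h n \<omega>)" using elim by (intro suminf_le) auto
      finally show ?case using m by (intro conjI borel_measurable_suminf_order) auto
    qed
    show "(\<integral>\<^sup>+\<omega>. (\<Sum>n. h n \<omega>) \<partial>data D) \<le> (\<Sum>n. e n)"
      by (subst nn_integral_suminf[OF h], intro suminf_le h2) auto
  qed auto
qed

text \<open>Markov's inequality twice: over the weights it bounds the conditional probability of the
  event by \<open>h\<close>, and over the data it bounds the probability that \<open>h\<close>
  reaches \<open>\<eta>\<close>.\<close>

lemma negl_markov: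
  assumes "eventually (\<lambda>N. mean_le D N (X N) (ennreal (\<epsilon> N))) sequentially" and "\<epsilon> \<longlonglongrightarrow> 0"
  shows "negl D (\<lambda>N \<omega> b. 1 \<le> X N \<omega> b)"
  unfolding negl_def
proof (intro allI impI)
  fix \<eta> :: real assume \<eta>: "\<eta> > 0"
  let ?S = "\<lambda>N. {\<omega> \<in> space (data D).
        outer_measure_of (PW D N \<omega>) {b \<in> space (PW D N \<omega>). 1 \<le> X N \<omega> b} > ennreal \<eta>}"
  show "(\<lambda>N. outer_measure_of (data D) (?S N)) \<longlonglongrightarrow> 0"
  proof (rule tendsto_sandwich[OF _ _ tendsto_const])
    show "eventually (\<lambda>N. outer_measure_of (data D) (?S N) \<le> ennreal (\<epsilon> N / \<eta>)) sequentially"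
      using assms(1)
    proof eventually_elim
      case (elim N)
      obtain h where h[measurable]: "h \<in> borel_measurable (data D)"
        and h1: "AE \<omega> in data D. X N \<omega> \<in> borel_measurable (PW D N \<omega>) \<and> (\<integral>\<^sup>+b. X N \<omega> b \<partial>PW D N \<omega>) \<le> h \<omega>"
        and h2: "(\<integral>\<^sup>+\<omega>. h \<omega> \<partial>data D) \<le> ennreal (\<epsilon> N)" using elim unfolding mean_le_def by auto
      let ?H = "{\<omega> \<in> space (data D). 1 \<le> ennreal (1 / \<eta>) * h \<omega>}"
      have "outer_measure_of (data D) (?S N) \<le> outer_measure_of (data D) ?H"
      proof (rule outer_measure_of_AE_mono)
        show "AE \<omega> in data D. \<omega> \<in> ?S N \<longrightarrow> \<omega> \<in> ?H"
          using h1
        proof eventually_elim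
          case (elim \<omega>)
          then have [measurable]: "X N \<omega> \<in> borel_measurable (PW D N \<omega>)" by simp
          have "outer_measure_of (PW D N \<omega>) {b \<in> space (PW D N \<omega>). 1 \<le> X N \<omega> b}
              = emeasure (PW D N \<omega>) {b \<in> space (PW D N \<omega>). 1 \<le> X N \<omega> b}"
            by (intro outer_measure_of_eq) measurable
          also have "\<dots> \<le> 1 * (\<integral>\<^sup>+b. X N \<omega> b * indicator (space (PW D N \<omega>)) b \<partial>PW D N \<omega>)"
            using nn_integral_Markov_inequality[of "X N \<omega>" "space (PW D N \<omega>)" "PW D N \<omega>" 1] by simp
          also have "\<dots> = (\<integral>\<^sup>+b. X N \<omega> b \<partial>PW D N \<omega>)"
            by (subst mult_1, intro nn_integral_cong) auto
          finally have le: "outer_measure_of (PW D N \<omega>) {b \<in> space (PW D N \<omega>). 1 \<le> X N \<omega> b} \<le> h \<omega>"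
            using elim by simp
          show ?case
          proof (intro impI)
            assume w: "\<omega> \<in> ?S N"
            then have "ennreal \<eta> \<le> h \<omega>" using le by (auto intro: order_trans less_imp_le)
            then have "ennreal (1 / \<eta>) * ennreal \<eta> \<le> ennreal (1 / \<eta>) * h \<omega>" by (rule mult_left_mono) simp
            moreover have "ennreal (1 / \<eta>) * ennreal \<eta> = 1"
              using \<eta> by (simp add: ennreal_mult[symmetric])
            ultimately show "\<omega> \<in> ?H" using w by simp
          qed
        qed
      qed auto
      also have "\<dots> = emeasure (data D) ?H" by (intro outer_measure_of_eq) measurable
      also have "\<dots> \<le> ennreal (1 / \<eta>) * (\<integral>\<^sup>+\<omega>. h \<omega> * indicator (space (data D)) \<omega> \<partial>data D)"
        using nn_integral_Markov_inequality[of h "space (data D)" "data D" "ennreal (1 / \<eta>)"] by simp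
      also have "(\<integral>\<^sup>+\<omega>. h \<omega> * indicator (space (data D)) \<omega> \<partial>data D) = (\<integral>\<^sup>+\<omega>. h \<omega> \<partial>data D)"
        by (intro nn_integral_cong) auto
      also have "ennreal (1 / \<eta>) * (\<integral>\<^sup>+\<omega>. h \<omega> \<partial>data D) \<le> ennreal (1 / \<eta>) * ennreal (\<epsilon> N)"
        by (intro mult_left_mono h2) simp
      also have "\<dots> = ennreal (\<epsilon> N / \<eta>)" using \<eta> by (simp add: ennreal_mult'[symmetric])
      finally show ?case .
    qed
    have "(\<lambda>N. ennreal (\<epsilon> N / \<eta>)) \<longlonglongrightarrow> ennreal (0 / \<eta>)"
      using assms(2) \<eta> by (intro tendsto_intros) auto
    then show "(\<lambda>N. ennreal (\<epsilon> N / \<eta>)) \<longlonglongrightarrow> 0" by simp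
  qed auto
qed

lemma negl_data:
  assumes "(\<lambda>N. outer_measure_of (data D) {\<omega> \<in> space (data D). F N \<omega>}) \<longlonglongrightarrow> 0"
  shows "negl D (\<lambda>N \<omega> b. F N \<omega>)"
  unfolding negl_def
proof (intro allI impI)
  fix \<eta> :: real assume \<eta>: "\<eta> > 0"
  show "(\<lambda>N. outer_measure_of (data D) {\<omega> \<in> space (data D).
        outer_measure_of (PW D N \<omega>) {b \<in> space (PW D N \<omega>). F N \<omega>} > ennreal \<eta>}) \<longlonglongrightarrow> 0"
  proof (rule tendsto_sandwich[OF _ _ tendsto_const assms])
    have "{\<omega> \<in> space (data D). outer_measure_of (PW D N \<omega>) {b \<in> space (PW D N \<omega>). F N \<omega>} > ennreal \<eta>}
        \<subseteq> {\<omega> \<in> space (data D). F N \<omega>}" for N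
    proof safe
      fix w s assume "outer_measure_of (PW D N (w, s)) {b \<in> space (PW D N (w, s)). F N (w, s)} > ennreal \<eta>"
      then show "F N (w, s)" by (cases "F N (w, s)") auto
    qed
    then show "eventually (\<lambda>N. outer_measure_of (data D) {\<omega> \<in> space (data D).
        outer_measure_of (PW D N \<omega>) {b \<in> space (PW D N \<omega>). F N \<omega>} > ennreal \<eta>}
       \<le> outer_measure_of (data D) {\<omega> \<in> space (data D). F N \<omega>}) sequentially"
      by (intro always_eventually allI outer_measure_of_mono)
  qed auto
qed

lemma boot_oP_iff_negl: "boot_oP D \<Delta> \<longleftrightarrow> (\<forall>\<epsilon>>0. negl D (\<lambda>N \<omega> b. \<bar>\<Delta> N \<omega> b\<bar> > \<epsilon>))"
  unfolding boot_oP_def negl_def by simp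

lemma boot_OP_iff_negl:
  "boot_OP D \<Delta> \<longleftrightarrow> (\<forall>L. filterlim L at_top sequentially \<longrightarrow> negl D (\<lambda>N \<omega> b. \<bar>\<Delta> N \<omega> b\<bar> > L N))"
  unfolding boot_OP_def negl_def by blast

section \<open>The sampling design\<close>

locale boot_design =
  fixes D :: "('x, 'u, 'y, 'j::finite, 's) two_phase"
  assumes design: "two_phase_design D"
begin

abbreviation Z :: "('x \<times> 'u) measure" where "Z \<equiv> law0 D"

definition lab :: "'x \<times> 'u \<Rightarrow> 'j" where "lab z = stratum_of D (Vof D z)"

sublocale Z: prob_space Z
  using design by (simp add: two_phase_design_def)

sublocale R: prob_space "rand_space D"
  using design by (simp add: two_phase_design_def)

lemma measurable_Vof[measurable]: "Vof D \<in> measurable Z (V_space D)"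
proof -
  have "sets Z = sets (x_space D \<Otimes>\<^sub>M u_space D)"
    and [measurable]: "xtilde D \<in> measurable (x_space D) (xt_space D)"
    using design by (simp_all add: two_phase_design_def)
  moreover have "Vof D \<in> measurable (x_space D \<Otimes>\<^sub>M u_space D) (V_space D)"
    unfolding Vof_def[abs_def] V_space_def by measurable
  ultimately show ?thesis by (simp cong: measurable_cong_sets)
qed

lemma stratum_of_eq_iff:
  assumes "v \<in> space (V_space D)"
  shows "stratum_of D v = j \<longleftrightarrow> v \<in> stratum D j"
proof -
  have "disjoint_family (stratum D)" "(\<Union>j. stratum D j) = space (V_space D)"
    using design by (simp_all add: two_phase_design_def)
  with assms have ex: "\<exists>!j. v \<in> stratum D j"
    unfolding disjoint_family_on_def by (metis IntI UNIV_I UN_E empty_iff)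
  then show ?thesis
    unfolding stratum_of_def by (metis theI')
qed

lemma lab_eq_iff: "z \<in> space Z \<Longrightarrow> lab z = j \<longleftrightarrow> Vof D z \<in> stratum D j"
  unfolding lab_def by (rule stratum_of_eq_iff[OF measurable_space[OF measurable_Vof]])

lemma measurable_lab[measurable]: "lab \<in> measurable Z (count_space UNIV)"
proof -
  have "lab -` {j} \<inter> space Z = Vof D -` stratum D j \<inter> space Z" for j
    using lab_eq_iff by auto
  moreover have "stratum D j \<in> sets (V_space D)" for j
    using design by (simp add: two_phase_design_def)
  ultimately show ?thesis
    by (auto simp: measurable_count_space_eq2 intro: measurable_sets[OF measurable_Vof])
qed

sublocale L: labelled_sample Z lab "{..<N}" for N :: nat
  by standard auto

sublocale S: sequence_space Z ..

lemma iid_eq: "iid D = PiM UNIV (\<lambda>_. Z)" by (simp add: iid_def)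

sublocale I: prob_space "iid D" unfolding iid_eq by (rule S.P.prob_space_axioms)

sublocale IR: pair_prob_space "iid D" "rand_space D" ..

sublocale data: prob_space "data D"
  unfolding data_def by (rule IR.prob_space_axioms)

abbreviation PN :: "nat \<Rightarrow> (nat \<Rightarrow> 'x \<times> 'u) measure" where "PN N \<equiv> PiM {..<N} (\<lambda>_. Z)"

lemma space_iid: "space (iid D) = {w. \<forall>i. w i \<in> space Z}"
  by (auto simp: iid_eq space_PiM)

lemma restrict_measurable: "(\<lambda>w. restrict w {..<N}) \<in> measurable (iid D) (PN N)"
  unfolding iid_eq by (rule measurable_restrict_subset) auto

lemma distr_restrict_iid: "distr (iid D) (PN N) (\<lambda>w. restrict w {..<N}) = PN N"
proof -
  interpret pp: product_prob_space "\<lambda>_. Z" UNIV by standard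
  show ?thesis unfolding iid_eq by (rule pp.distr_PiM_restrict_finite) auto
qed

definition cnt :: "nat \<Rightarrow> (nat \<Rightarrow> 'j) \<Rightarrow> 'j \<Rightarrow> nat" where
  "cnt N l j = card {i. i < N \<and> l i = j}"

text \<open>The restriction to \<open>{..<N}\<close> gives the label vector a finite range, so that
  every function of it becomes measurable.\<close>

definition labels :: "nat \<Rightarrow> (nat \<Rightarrow> 'x \<times> 'u) \<Rightarrow> nat \<Rightarrow> 'j" where
  "labels N w = restrict (\<lambda>i. lab (w i)) {..<N}"

lemma labels_restrict: "labels N (restrict w {..<N}) = labels N w"
  by (auto simp: labels_def restrict_def)

lemma members_eq: "w \<in> space (iid D) \<Longrightarrow> members D N w j = {i. i < N \<and> labels N w i = j}"
  by (auto simp: members_def labels_def space_iid lab_eq_iff)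

lemma Ncount_eq: "w \<in> space (iid D) \<Longrightarrow> Ncount D N w = cnt N (labels N w)"
  by (auto simp: Ncount_def cnt_def members_eq)

text \<open>The subsets of units that stratified sampling can select when the label vector is
  \<open>l\<close>.\<close>

definition card_sat :: "nat \<Rightarrow> (nat \<Rightarrow> 'j) \<Rightarrow> nat set \<Rightarrow> bool" where
  "card_sat N l S \<longleftrightarrow> (\<forall>j. card (S \<inter> {i. i < N \<and> l i = j}) = nsel D (cnt N l) j)"

definition srs_prob :: "nat \<Rightarrow> (nat \<Rightarrow> 'j) \<Rightarrow> nat set \<Rightarrow> real" where
  "srs_prob N l S = (if card_sat N l S
     then (\<Prod>j\<in>UNIV. 1 / real (cnt N l j choose nsel D (cnt N l) j)) else 0)"

lemma srs_prob_nonneg: "0 \<le> srs_prob N l S"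
  by (auto simp: srs_prob_def intro!: prod_nonneg)

text \<open>An admissible subset amounts to an independent choice, in each stratum, of a subset of
  the prescribed size.\<close>

lemma card_card_sat:
  "card {S \<in> Pow {..<N}. card_sat N l S} = (\<Prod>j\<in>UNIV. cnt N l j choose nsel D (cnt N l) j)"
proof -
  let ?M = "\<lambda>j. {i. i < N \<and> l i = j}"
  let ?T = "\<lambda>j. {B. B \<subseteq> ?M j \<and> card B = nsel D (cnt N l) j}"
  have "bij_betw (\<lambda>S j. S \<inter> ?M j) {S \<in> Pow {..<N}. card_sat N l S} (PiE UNIV ?T)"
  proof (rule bij_betw_byWitness[where f'="\<lambda>g. \<Union>j. g j"])
    show "\<forall>S\<in>{S \<in> Pow {..<N}. card_sat N l S}. (\<Union>j. S \<inter> ?M j) = S" by auto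
    have gM: "(\<Union>j. g j) \<inter> ?M k = g k" if "g \<in> PiE UNIV ?T" for g k
    proof -
      have "g j \<subseteq> ?M j" for j using that by (auto simp: PiE_iff)
      then show ?thesis by blast
    qed
    then show "\<forall>g\<in>PiE UNIV ?T. (\<lambda>j. (\<Union>j. g j) \<inter> ?M j) = g" by (intro ballI ext)
    show "(\<lambda>S j. S \<inter> ?M j) ` {S \<in> Pow {..<N}. card_sat N l S} \<subseteq> PiE UNIV ?T"
      by (auto simp: card_sat_def)
    show "(\<lambda>g. \<Union>j. g j) ` PiE UNIV ?T \<subseteq> {S \<in> Pow {..<N}. card_sat N l S}"
    proof safe
      fix g i j assume g: "g \<in> PiE UNIV ?T" and "i \<in> g j"
      have "g j \<subseteq> ?M j" using g by (auto simp: PiE_iff)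
      with \<open>i \<in> g j\<close> show "i < N" by auto
    next
      fix g assume g: "g \<in> PiE UNIV ?T"
      show "card_sat N l (\<Union>j. g j)"
        unfolding card_sat_def gM[OF g] using g by (auto simp: PiE_iff)
    qed
  qed
  then have "card {S \<in> Pow {..<N}. card_sat N l S} = card (PiE UNIV ?T)" by (rule bij_betw_same_card)
  also have "\<dots> = (\<Prod>j\<in>UNIV. card (?T j))" by (simp add: card_PiE)
  also have "\<dots> = (\<Prod>j\<in>UNIV. cnt N l j choose nsel D (cnt N l) j)"
    by (intro prod.cong refl) (simp add: n_subsets cnt_def)
  finally show ?thesis .
qed

text \<open>Kept as a product of quotients because \<open>l\<close> is an arbitrary label vector: if
  the prescribed sample size exceeds a stratum, the binomial coefficient is 0, the quotient
  evaluates to 0, and the total is still at most 1.\<close>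

lemma sum_srs_prob_eq:
  "(\<Sum>S\<in>Pow {..<N}. srs_prob N l S) =
     (\<Prod>j\<in>UNIV. real (cnt N l j choose nsel D (cnt N l) j) / real (cnt N l j choose nsel D (cnt N l) j))"
proof -
  have "(\<Sum>S\<in>Pow {..<N}. srs_prob N l S) = (\<Sum>S\<in>{S \<in> Pow {..<N}. card_sat N l S}. srs_prob N l S)"
    by (rule sum.mono_neutral_right) (auto simp: srs_prob_def)
  also have "\<dots> = (\<Sum>S\<in>{S \<in> Pow {..<N}. card_sat N l S}.
      \<Prod>j\<in>UNIV. 1 / real (cnt N l j choose nsel D (cnt N l) j))"
    by (rule sum.cong) (auto simp: srs_prob_def)
  also have "\<dots> = real (\<Prod>j\<in>UNIV. cnt N l j choose nsel D (cnt N l) j) *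
      (\<Prod>j\<in>UNIV. 1 / real (cnt N l j choose nsel D (cnt N l) j))"
    by (simp only: sum_constant card_card_sat)
  finally show ?thesis by (simp add: prod.distrib[symmetric])
qed

lemma sum_srs_prob_le: "(\<Sum>S\<in>Pow {..<N}. srs_prob N l S) \<le> 1"
  unfolding sum_srs_prob_eq by (rule prod_le_1) (auto simp: divide_le_eq_1)

lemma sum_srs_prob:
  assumes "\<And>j. nsel D (cnt N l) j \<le> cnt N l j"
  shows "(\<Sum>S\<in>Pow {..<N}. srs_prob N l S) = 1"
  unfolding sum_srs_prob_eq using assms by (intro prod.neutral) (auto simp: binomial_eq_0_iff not_less)

lemma sets_xi: "{\<omega> \<in> space (data D). xi D N i \<omega>} \<in> sets (data D)"
proof -
  have "\<forall>N i. {\<omega> \<in> space (data D). xi D N i \<omega>} \<in> sets (data D)"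
    using design by (simp add: two_phase_design_def)
  then show ?thesis by simp
qed

lemma measurable_sampled: "sampled D N \<in> measurable (data D) (count_space (Pow {..<N}))"
proof -
  have "sampled D N -` {S} \<inter> space (data D) \<in> sets (data D)" if "S \<subseteq> {..<N}" for S
  proof -
    have "sampled D N -` {S} \<inter> space (data D) = {\<omega> \<in> space (data D). \<forall>i\<in>{..<N}. xi D N i \<omega> = (i \<in> S)}"
    proof -
      have "sampled D N \<omega> = S \<longleftrightarrow> (\<forall>i\<in>{..<N}. xi D N i \<omega> = (i \<in> S))" for \<omega>
        unfolding sampled_def set_eq_iff mem_Collect_eq using that by (meson lessThan_iff subsetD)
      then show ?thesis by (simp add: vimage_def Int_def conj_commute)
    qed
    also have "\<dots> \<in> sets (data D)"
    proof (rule sets.sets_Collect_finite_All)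
      fix i
      show "{\<omega> \<in> space (data D). xi D N i \<omega> = (i \<in> S)} \<in> sets (data D)"
        by (cases "i \<in> S") (simp_all add: sets_xi sets.sets_Collect_neg)
    qed simp
    finally show ?thesis .
  qed
  moreover have "sampled D N \<in> space (data D) \<rightarrow> Pow {..<N}" by (auto simp: sampled_def)
  ultimately show ?thesis by (simp add: measurable_count_space_eq2)
qed

lemma measurable_sampled_section:
  assumes w: "w \<in> space (iid D)"
  shows "(\<lambda>s. sampled D N (w, s)) \<in> measurable (rand_space D) (count_space (Pow {..<N}))"
  using measurable_compose[OF measurable_Pair1'[OF w] measurable_sampled[unfolded data_def]] .

lemma sampled_sets:
  assumes w: "w \<in> space (iid D)" and S: "S \<subseteq> {..<N}"
  shows "{s \<in> space (rand_space D). sampled D N (w, s) = S} \<in> sets (rand_space D)"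
proof -
  have "(\<lambda>s. sampled D N (w, s)) -` {S} \<inter> space (rand_space D) \<in> sets (rand_space D)"
    using measurable_sampled_section[OF w, of N] S by (auto simp: measurable_count_space_eq2)
  also have "(\<lambda>s. sampled D N (w, s)) -` {S} \<inter> space (rand_space D) =
     {s \<in> space (rand_space D). sampled D N (w, s) = S}" by auto
  finally show ?thesis .
qed

lemma nsel_le:
  assumes N: "N \<ge> 1" and w: "w \<in> space (iid D)"
  shows "nsel D (cnt N (labels N w)) j \<le> cnt N (labels N w) j"
proof -
  have "\<forall>N\<ge>1. \<forall>w\<in>space (iid D). \<forall>j. ncount D N w j \<le> Ncount D N w j"
    using design by (simp add: two_phase_design_def)
  then have "ncount D N w j \<le> Ncount D N w j" using N w by blast
  then show ?thesis unfolding ncount_def Ncount_eq[OF w] .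
qed

text \<open>The design prescribes probabilities only for admissible subsets. These already exhaust
  the total mass 1, so every other subset has probability 0 and the formula extends to all
  subsets.\<close>

lemma AE_srs:
  "AE w in iid D. \<forall>N\<ge>1. \<forall>S\<subseteq>{..<N}.
     R.prob {s \<in> space (rand_space D). sampled D N (w, s) = S} = srs_prob N (labels N w) S"
proof -
  have "AE w in iid D. \<forall>N\<ge>1. \<forall>A\<subseteq>{..<N}.
        (\<forall>j. card (A \<inter> members D N w j) = ncount D N w j) \<longrightarrow>
        measure (rand_space D) {s \<in> space (rand_space D). sampled D N (w, s) = A} =
          (\<Prod>j\<in>UNIV. 1 / real (Ncount D N w j choose ncount D N w j))"
    using design by (simp add: two_phase_design_def)
  then show ?thesis
    using AE_space
  proof eventually_elim
    case (elim w)
    note w = elim(2)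
    show ?case
    proof (intro allI impI)
      fix N :: nat and S assume N: "N \<ge> 1" and S: "S \<subseteq> {..<N}"
      let ?l = "labels N w"
      let ?p = "\<lambda>A. R.prob {s \<in> space (rand_space D). sampled D N (w, s) = A}"
      have ok: "?p A = srs_prob N ?l A" if "A \<subseteq> {..<N}" "card_sat N ?l A" for A
      proof -
        have "\<forall>j. card (A \<inter> members D N w j) = ncount D N w j"
          using that(2) unfolding card_sat_def ncount_def Ncount_eq[OF w] members_eq[OF w] .
        from elim(1)[THEN spec, THEN mp, OF N, THEN spec, THEN mp, OF that(1), THEN mp, OF this]
        show ?thesis using that(2) unfolding srs_prob_def ncount_def Ncount_eq[OF w] by simp
      qed
      show "?p S = srs_prob N ?l S"
      proof (cases "card_sat N ?l S")
        case True
        then show ?thesis using ok S by simp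
      next
        case False
        have "(\<Sum>A\<in>Pow {..<N}. ?p A) = R.prob (\<Union>A\<in>Pow {..<N}. {s \<in> space (rand_space D). sampled D N (w, s) = A})"
          using sampled_sets[OF w]
          by (intro R.finite_measure_finite_Union[symmetric]) (auto simp: disjoint_family_on_def)
        also have "\<dots> \<le> 1" by simp
        finally have le: "(\<Sum>A\<in>Pow {..<N}. ?p A) \<le> 1" .
        have "1 = (\<Sum>A\<in>Pow {..<N}. srs_prob N ?l A)"
          using nsel_le[OF N w] by (intro sum_srs_prob[symmetric]) auto
        also have "\<dots> = (\<Sum>A\<in>Pow {..<N} - {S}. srs_prob N ?l A)"
          using S False by (subst sum.remove[of _ S]) (auto simp: srs_prob_def)
        also have "\<dots> \<le> (\<Sum>A\<in>Pow {..<N} - {S}. ?p A)"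
        proof (rule sum_mono)
          fix A assume "A \<in> Pow {..<N} - {S}"
          then show "srs_prob N ?l A \<le> ?p A"
            by (cases "card_sat N ?l A") (auto simp: ok srs_prob_def)
        qed
        finally have "?p S \<le> 0" using le S by (subst (asm) sum.remove[of _ S]) auto
        then show ?thesis using False measure_nonneg[of "rand_space D"] by (simp add: srs_prob_def order_antisym)
      qed
    qed
  qed
qed

text \<open>All that the law of the weights sees of the data; the range is finite.\<close>

definition key :: "nat \<Rightarrow> (nat \<Rightarrow> 'x \<times> 'u) \<times> 's \<Rightarrow> (nat \<Rightarrow> 'j) \<times> nat set" where
  "key N \<omega> = (labels N (fst \<omega>), sampled D N \<omega>)"

definition keyset :: "nat \<Rightarrow> ((nat \<Rightarrow> 'j) \<times> nat set) set" where
  "keyset N = ({..<N} \<rightarrow>\<^sub>E UNIV) \<times> Pow {..<N}"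

lemma finite_keyset: "finite (keyset N)"
  by (simp add: keyset_def finite_PiE)

lemma measurable_labels: "labels N \<in> measurable (PN N) (count_space ({..<N} \<rightarrow>\<^sub>E UNIV))"
proof -
  have "labels N -` {l} \<inter> space (PN N) \<in> sets (PN N)" if l: "l \<in> {..<N} \<rightarrow>\<^sub>E UNIV" for l
  proof -
    have "labels N -` {l} \<inter> space (PN N) = {w \<in> space (PN N). \<forall>i\<in>{..<N}. lab (w i) = l i}"
      using l by (auto simp: labels_def PiE_iff extensional_def restrict_def fun_eq_iff)
    also have "\<dots> \<in> sets (PN N)" by measurable
    finally show ?thesis .
  qed
  then show ?thesis by (auto simp: measurable_count_space_eq2 finite_PiE labels_def)
qed

lemma measurable_labels_iid: "labels N \<in> measurable (iid D) (count_space ({..<N} \<rightarrow>\<^sub>E UNIV))"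
  using measurable_compose[OF restrict_measurable measurable_labels] by (simp add: labels_restrict)

lemma measurable_fst_data[measurable]: "fst \<in> measurable (data D) (iid D)"
  by (simp add: data_def)

lemma measurable_key: "key N \<in> measurable (data D) (count_space (keyset N))"
proof -
  have "key N -` {(l, S)} \<inter> space (data D) \<in> sets (data D)" if "(l, S) \<in> keyset N" for l S
  proof -
    have "key N -` {(l, S)} \<inter> space (data D) =
        ((\<lambda>\<omega>. labels N (fst \<omega>)) -` {l} \<inter> space (data D)) \<inter> (sampled D N -` {S} \<inter> space (data D))"
      by (auto simp: key_def)
    also have "\<dots> \<in> sets (data D)"
    proof (rule sets.Int)
      show "(\<lambda>\<omega>. labels N (fst \<omega>)) -` {l} \<inter> space (data D) \<in> sets (data D)"
        using that by (intro measurable_sets[OF measurable_compose[OF measurable_fst_data measurable_labels_iid]])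
          (auto simp: keyset_def)
      show "sampled D N -` {S} \<inter> space (data D) \<in> sets (data D)"
        using that by (intro measurable_sets[OF measurable_sampled]) (auto simp: keyset_def)
    qed
    finally show ?thesis .
  qed
  then show ?thesis
    by (auto simp: measurable_count_space_eq2 finite_keyset)
       (auto simp: key_def keyset_def labels_def sampled_def)
qed

definition good :: "nat \<Rightarrow> (nat \<Rightarrow> 'x \<times> 'u) \<times> 's \<Rightarrow> bool" where
  "good N \<omega> \<longleftrightarrow> card_sat N (fst (key N \<omega>)) (snd (key N \<omega>))"

lemma space_data: "space (data D) = space (iid D) \<times> space (rand_space D)"
  by (simp add: data_def space_pair_measure)

lemma AE_good:
  assumes N: "N \<ge> 1"
  shows "AE \<omega> in data D. good N \<omega>"
proof -
  have meas: "{\<omega> \<in> space (iid D \<Otimes>\<^sub>M rand_space D). good N \<omega>} \<in> sets (iid D \<Otimes>\<^sub>M rand_space D)"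
  proof -
    have "(\<lambda>\<omega>. good N \<omega>) \<in> measurable (data D) (count_space UNIV)"
      unfolding good_def by (rule measurable_compose[OF measurable_key]) simp
    then show ?thesis by (simp add: data_def pred_def)
  qed
  have "AE w in iid D. AE s in rand_space D. good N (w, s)"
    using AE_srs AE_space
  proof eventually_elim
    case (elim w)
    let ?B = "\<Union>S\<in>{S \<in> Pow {..<N}. \<not> card_sat N (labels N w) S}. {s \<in> space (rand_space D). sampled D N (w, s) = S}"
    show ?case
    proof (rule AE_I[where N="?B"])
      show "{s \<in> space (rand_space D). \<not> good N (w, s)} \<subseteq> ?B"
        by (auto simp: good_def key_def sampled_def)
      have "{s \<in> space (rand_space D). sampled D N (w, s) = S} \<in> null_sets (rand_space D)"
        if "S \<in> {S \<in> Pow {..<N}. \<not> card_sat N (labels N w) S}" for S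
        using elim that N sampled_sets[OF elim(2)]
        by (auto simp: null_sets_def R.emeasure_eq_measure srs_prob_def)
      then have "?B \<in> null_sets (rand_space D)"
        by (intro null_sets_UN' countable_finite) auto
      then show "emeasure (rand_space D) ?B = 0" "?B \<in> sets (rand_space D)" by auto
    qed
  qed
  then show ?thesis
    unfolding data_def by (rule IR.AE_pair_measure[OF meas])
qed

text \<open>Given the units, the sampled set has law \<open>srs_prob\<close>, which sees the units
  only through their labels. Integrating it out leaves a label-dependent factor times
  \<open>H\<close>.\<close>

lemma nn_integral_key:
  assumes N: "N \<ge> 1" and H[measurable]: "H \<in> borel_measurable (PN N)"
  shows "(\<integral>\<^sup>+\<omega>. \<phi> (key N \<omega>) * H (restrict (fst \<omega>) {..<N}) \<partial>data D)
    = (\<integral>\<^sup>+x. (\<Sum>S\<in>Pow {..<N}. \<phi> (labels N x, S) * ennreal (srs_prob N (labels N x) S)) * H x \<partial>PN N)"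
proof -
  note [measurable] = restrict_measurable
  have m1: "(\<lambda>\<omega>. \<phi> (key N \<omega>)) \<in> borel_measurable (data D)"
    by (rule measurable_compose[OF measurable_key]) simp
  have m2: "(\<lambda>\<omega>. \<phi> (key N \<omega>) * H (restrict (fst \<omega>) {..<N})) \<in> borel_measurable (iid D \<Otimes>\<^sub>M rand_space D)"
    using m1 unfolding data_def by measurable
  have m3: "(\<lambda>x. (\<Sum>S\<in>Pow {..<N}. \<phi> (labels N x, S) * ennreal (srs_prob N (labels N x) S)) * H x) \<in> borel_measurable (PN N)"
  proof (intro borel_measurable_times_ennreal H)
    show "(\<lambda>x. (\<Sum>S\<in>Pow {..<N}. \<phi> (labels N x, S) * ennreal (srs_prob N (labels N x) S))) \<in> borel_measurable (PN N)"
      by (rule measurable_compose[OF measurable_labels]) simp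
  qed
  have "(\<integral>\<^sup>+\<omega>. \<phi> (key N \<omega>) * H (restrict (fst \<omega>) {..<N}) \<partial>data D)
    = (\<integral>\<^sup>+w. \<integral>\<^sup>+s. \<phi> (key N (w, s)) * H (restrict w {..<N}) \<partial>rand_space D \<partial>iid D)"
    unfolding data_def by (subst R.nn_integral_fst[symmetric, OF m2]) simp
  also have "\<dots> = (\<integral>\<^sup>+w. (\<Sum>S\<in>Pow {..<N}. \<phi> (labels N (restrict w {..<N}), S) *
      ennreal (srs_prob N (labels N (restrict w {..<N})) S)) * H (restrict w {..<N}) \<partial>iid D)"
  proof (rule nn_integral_cong_AE)
    show "AE w in iid D. (\<integral>\<^sup>+s. \<phi> (key N (w, s)) * H (restrict w {..<N}) \<partial>rand_space D) =
      (\<Sum>S\<in>Pow {..<N}. \<phi> (labels N (restrict w {..<N}), S) *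
      ennreal (srs_prob N (labels N (restrict w {..<N})) S)) * H (restrict w {..<N})"
      using AE_srs AE_space
    proof eventually_elim
      case (elim w)
      note sm = sampled_sets[OF elim(2)]
      have "(\<integral>\<^sup>+s. \<phi> (key N (w, s)) * H (restrict w {..<N}) \<partial>rand_space D)
        = (\<integral>\<^sup>+s. (\<Sum>S\<in>Pow {..<N}. \<phi> (labels N w, S) * H (restrict w {..<N}) *
             indicator {s \<in> space (rand_space D). sampled D N (w, s) = S} s) \<partial>rand_space D)"
      proof (rule nn_integral_cong)
        fix s assume s: "s \<in> space (rand_space D)"
        have "sampled D N (w, s) \<in> Pow {..<N}" by (auto simp: sampled_def)
        then have "(\<Sum>S\<in>Pow {..<N}. \<phi> (labels N w, S) * H (restrict w {..<N}) *
             indicator {s \<in> space (rand_space D). sampled D N (w, s) = S} s)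
          = \<phi> (labels N w, sampled D N (w, s)) * H (restrict w {..<N})"
          using s by (subst sum.remove[of _ "sampled D N (w, s)"]) (auto intro!: sum.neutral)
        then show "\<phi> (key N (w, s)) * H (restrict w {..<N}) = (\<Sum>S\<in>Pow {..<N}. \<phi> (labels N w, S) * H (restrict w {..<N}) *
             indicator {s \<in> space (rand_space D). sampled D N (w, s) = S} s)"
          by (simp add: key_def)
      qed
      also have "\<dots> = (\<Sum>S\<in>Pow {..<N}. \<phi> (labels N w, S) * H (restrict w {..<N}) *
             emeasure (rand_space D) {s \<in> space (rand_space D). sampled D N (w, s) = S})"
        using sm by (subst nn_integral_sum) (auto intro!: sum.cong nn_integral_cmult_indicator)
      also have "\<dots> = (\<Sum>S\<in>Pow {..<N}. \<phi> (labels N w, S) * ennreal (srs_prob N (labels N w) S)) * H (restrict w {..<N})"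
        using elim(1) N unfolding sum_distrib_right
        by (intro sum.cong refl) (auto simp: R.emeasure_eq_measure mult_ac)
      finally show ?case by (simp add: labels_restrict)
    qed
  qed
  also have "\<dots> = (\<integral>\<^sup>+x. (\<Sum>S\<in>Pow {..<N}. \<phi> (labels N x, S) * ennreal (srs_prob N (labels N x) S)) * H x
      \<partial>distr (iid D) (PN N) (\<lambda>w. restrict w {..<N}))"
    using m3 by (subst nn_integral_distr) auto
  finally show ?thesis unfolding distr_restrict_iid .
qed

text \<open>\<open>\<phi>\<close> is a subprobability on sets of kept units, given labels and
  sampled set. Once the sampled set is integrated out, its weights depend on the labels alone, which
  is the case settled by \<open>nn_integral_resample_le\<close>; a random choice of the kept units
  therefore costs nothing.\<close>

lemma nn_integral_resample_average_le:
  assumes N: "N \<ge> 1" and U: "U \<in> borel_measurable (PN N)"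
    and \<phi>: "\<And>k. (\<Sum>A\<in>Pow {..<N}. \<phi> A k) \<le> 1"
  shows "(\<integral>\<^sup>+\<omega>. (\<Sum>A\<in>Pow {..<N}. \<phi> A (key N \<omega>) * L.resample N U A (restrict (fst \<omega>) {..<N})) \<partial>data D)
    \<le> (\<integral>\<^sup>+x. U x \<partial>PN N)"
proof -
  \<comment> \<open>The conditional expectation of \<open>\<phi> A\<close> given the labels.\<close>
  define g where "g A x = (\<Sum>S\<in>Pow {..<N}. \<phi> A (labels N x, S) * ennreal (srs_prob N (labels N x) S))" for A x
  have g: "g A \<in> borel_measurable (PN N)" for A
    unfolding g_def by (rule measurable_compose[OF measurable_labels]) simp
  have r: "L.resample N U A \<in> borel_measurable (PN N)" if "A \<in> Pow {..<N}" for A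
    using that U by (intro L.measurable_resample) auto
  have m: "(\<lambda>\<omega>. \<phi> A (key N \<omega>) * L.resample N U A (restrict (fst \<omega>) {..<N})) \<in> borel_measurable (data D)"
    if "A \<in> Pow {..<N}" for A
  proof (rule borel_measurable_times_ennreal)
    show "(\<lambda>\<omega>. \<phi> A (key N \<omega>)) \<in> borel_measurable (data D)"
      by (rule measurable_compose[OF measurable_key]) simp
    show "(\<lambda>\<omega>. L.resample N U A (restrict (fst \<omega>) {..<N})) \<in> borel_measurable (data D)"
      by (rule measurable_compose[OF measurable_compose[OF measurable_fst_data restrict_measurable] r[OF that]])
  qed
  have "(\<integral>\<^sup>+\<omega>. (\<Sum>A\<in>Pow {..<N}. \<phi> A (key N \<omega>) * L.resample N U A (restrict (fst \<omega>) {..<N})) \<partial>data D)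
    = (\<Sum>A\<in>Pow {..<N}. \<integral>\<^sup>+x. g A x * L.resample N U A x \<partial>PN N)"
    using m by (subst nn_integral_sum) (auto simp: g_def intro!: sum.cong nn_integral_key[OF N r])
  also have "\<dots> \<le> (\<Sum>A\<in>Pow {..<N}. \<integral>\<^sup>+x. g A x * U x \<partial>PN N)"
  proof (rule sum_mono)
    fix A assume A: "A \<in> Pow {..<N}"
    show "(\<integral>\<^sup>+x. g A x * L.resample N U A x \<partial>PN N) \<le> (\<integral>\<^sup>+x. g A x * U x \<partial>PN N)"
    proof (rule L.nn_integral_resample_le[OF _ U g])
      fix x x' assume "\<And>i. i \<in> {..<N} \<Longrightarrow> lab (x i) = lab (x' i)"
      then have "labels N x = labels N x'" by (auto simp: labels_def restrict_def)
      then show "g A x = g A x'" by (simp add: g_def)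
    qed (use A in auto)
  qed
  also have "\<dots> = (\<integral>\<^sup>+x. (\<Sum>A\<in>Pow {..<N}. g A x) * U x \<partial>PN N)"
    using g U by (subst nn_integral_sum[symmetric]) (auto simp: sum_distrib_right)
  also have "\<dots> \<le> (\<integral>\<^sup>+x. 1 * U x \<partial>PN N)"
  proof (intro nn_integral_mono mult_right_mono)
    fix x
    have "(\<Sum>A\<in>Pow {..<N}. g A x) = (\<Sum>S\<in>Pow {..<N}. (\<Sum>A\<in>Pow {..<N}. \<phi> A (labels N x, S)) * ennreal (srs_prob N (labels N x) S))"
      unfolding g_def by (subst sum.swap) (simp add: sum_distrib_right)
    also have "\<dots> \<le> (\<Sum>S\<in>Pow {..<N}. 1 * ennreal (srs_prob N (labels N x) S))"
      by (intro sum_mono mult_right_mono \<phi>) auto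
    also have "\<dots> = ennreal (\<Sum>S\<in>Pow {..<N}. srs_prob N (labels N x) S)"
      by (subst sum_ennreal[symmetric]) (auto simp: srs_prob_nonneg)
    also have "\<dots> \<le> ennreal 1" by (intro ennreal_leI sum_srs_prob_le)
    finally show "(\<Sum>A\<in>Pow {..<N}. g A x) \<le> 1" by simp
  qed auto
  finally show ?thesis by simp
qed

end

section \<open>Bootstrap weights\<close>

text \<open>Independent centred summands are orthogonal, so the second moment of the sum is at most
  \<open>card I * v\<close>; Cauchy-Schwarz passes to the first moment.\<close>

lemma nn_integral_abs_sum_centered_le:
  fixes g :: "'i \<Rightarrow> 'a \<Rightarrow> real"
  assumes I: "finite I" and M: "\<And>i. prob_space (M i)"
    and g: "\<And>i. i \<in> I \<Longrightarrow> integrable (M i) (g i)"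
    and g2: "\<And>i. i \<in> I \<Longrightarrow> integrable (M i) (\<lambda>x. (g i x)\<^sup>2)"
    and g0: "\<And>i. i \<in> I \<Longrightarrow> (\<integral>x. g i x \<partial>M i) = 0"
    and v: "\<And>i. i \<in> I \<Longrightarrow> (\<integral>x. (g i x)\<^sup>2 \<partial>M i) \<le> v"
  shows "(\<integral>\<^sup>+x. ennreal \<bar>\<Sum>i\<in>I. g i (x i)\<bar> \<partial>PiM I M) \<le> ennreal (sqrt (real (card I) * v))"
proof -
  interpret prob_space "M i" for i by (rule M)
  interpret PM: product_sigma_finite M ..
  interpret PI: prob_space "PiM I M" by (rule prob_space_PiM) (rule M)
  \<comment> \<open>Writing a product of two coordinates as a product over all of \<open>I\<close>
    covers both cases at once: equal indices give one squared factor, distinct indices two factors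
    of mean 0.\<close>
  define h where "h i k l x = (if l = i then g i x else 1) * (if l = k then g k x else 1)" for i k l x
  have hp: "g i (x i) * g k (x k) = (\<Prod>l\<in>I. h i k l (x l))" if "i \<in> I" "k \<in> I" for i k x
  proof -
    have "(\<Prod>l\<in>I. h i k l (x l)) = (\<Prod>l\<in>I. if l = i then g i (x l) else 1) * (\<Prod>l\<in>I. if l = k then g k (x l) else 1)"
      by (simp add: h_def prod.distrib)
    then show ?thesis using I that by (simp add: prod.delta)
  qed
  have hi: "integrable (M l) (h i k l)" if "i \<in> I" "k \<in> I" "l \<in> I" for i k l
    using g[of l] g2[of l] that
    by (cases "l = i"; cases "l = k") (auto simp: h_def[abs_def] power2_eq_square)
  have int: "integrable (PiM I M) (\<lambda>x. g i (x i) * g k (x k))" if "i \<in> I" "k \<in> I" for i k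
    unfolding hp[OF that] by (rule PM.product_integrable_prod[OF I hi[OF that]])
  have e: "(\<integral>x. g i (x i) * g k (x k) \<partial>PiM I M) \<le> (if i = k then v else 0)" if ik: "i \<in> I" "k \<in> I" for i k
  proof -
    have eq: "(\<integral>x. g i (x i) * g k (x k) \<partial>PiM I M) = (\<Prod>l\<in>I. \<integral>x. h i k l x \<partial>M l)"
      unfolding hp[OF ik] by (rule PM.product_integral_prod[OF I hi[OF ik]])
    show ?thesis
    proof (cases "i = k")
      case True
      have "(\<Prod>l\<in>I. \<integral>x. h i k l x \<partial>M l) = (\<Prod>l\<in>I. if l = i then (\<integral>x. (g i x)\<^sup>2 \<partial>M i) else 1)"
        using True by (intro prod.cong refl) (auto simp: h_def power2_eq_square prob_space)
      also have "\<dots> = (\<integral>x. (g i x)\<^sup>2 \<partial>M i)" using I ik by (simp add: prod.delta)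
      finally show ?thesis using eq True v[OF ik(1)] by simp
    next
      case False
      have "(\<integral>x. h i k i x \<partial>M i) = 0" using False g0[OF ik(1)] by (simp add: h_def)
      then have "(\<Prod>l\<in>I. \<integral>x. h i k l x \<partial>M l) = 0" using I ik by (intro prod_zero) auto
      then show ?thesis using eq False by simp
    qed
  qed
  let ?S = "\<lambda>x. \<Sum>i\<in>I. g i (x i)"
  have S2: "(?S x)\<^sup>2 = (\<Sum>i\<in>I. \<Sum>k\<in>I. g i (x i) * g k (x k))" for x
    by (simp add: power2_eq_square sum_product)
  have i2: "integrable (PiM I M) (\<lambda>x. (?S x)\<^sup>2)"
    unfolding S2 by (intro Bochner_Integration.integrable_sum int)
  have "(\<integral>x. (?S x)\<^sup>2 \<partial>PiM I M) = (\<Sum>i\<in>I. \<Sum>k\<in>I. \<integral>x. g i (x i) * g k (x k) \<partial>PiM I M)"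
    unfolding S2 using int by (simp add: Bochner_Integration.integral_sum Bochner_Integration.integrable_sum)
  also have "\<dots> \<le> (\<Sum>i\<in>I. \<Sum>k\<in>I. if i = k then v else 0)" by (intro sum_mono e)
  also have "\<dots> = real (card I) * v" using I by (simp add: sum.delta)
  finally have le: "(\<integral>x. (?S x)\<^sup>2 \<partial>PiM I M) \<le> real (card I) * v" .
  have gm: "(\<lambda>x. g i (x i)) \<in> borel_measurable (PiM I M)" if "i \<in> I" for i
    using g[OF that] that by (intro measurable_compose[OF measurable_component_singleton]) auto
  have Sm[measurable]: "?S \<in> borel_measurable (PiM I M)"
    by (intro borel_measurable_sum gm)
  have i1: "integrable (PiM I M) ?S"
    by (rule PI.square_integrable_imp_integrable[OF Sm i2])
  \<comment> \<open>Nonnegativity of this variance is Cauchy-Schwarz for the first absolute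
    moment.\<close>
  have "0 \<le> PI.variance (\<lambda>x. \<bar>?S x\<bar>)" by (rule PI.variance_positive)
  also have "\<dots> = PI.expectation (\<lambda>x. (?S x)\<^sup>2) - (PI.expectation (\<lambda>x. \<bar>?S x\<bar>))\<^sup>2"
    using i1 i2 by (subst PI.variance_eq) auto
  finally have "(PI.expectation (\<lambda>x. \<bar>?S x\<bar>))\<^sup>2 \<le> real (card I) * v" using le by simp
  then have "PI.expectation (\<lambda>x. \<bar>?S x\<bar>) \<le> sqrt (real (card I) * v)"
    by (rule real_le_rsqrt)
  then show ?thesis
    using i1 by (subst nn_integral_eq_integral) (auto intro!: ennreal_leI)
qed

locale boot_weights = boot_design D for D :: "('x, 'u, 'y, 'j::finite, 's) two_phase" +
  fixes Wmax :: real
  assumes weights: "phase1_weight_conditions D"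
    and Wmax: "\<And>j. AE x in w1_law D j. x \<le> Wmax"
begin

lemma w1_prob: "prob_space (w1_law D j)" and w1_sets: "sets (w1_law D j) = sets borel"
  and w1_pos: "AE x in w1_law D j. 0 < x" and w1_mean: "(\<integral>x. x \<partial>w1_law D j) = 1"
  using weights by (simp_all add: phase1_weight_conditions_def)

lemma Wmax_ge_1: "1 \<le> Wmax"
proof -
  interpret prob_space "w1_law D j" for j by (rule w1_prob)
  fix j0 :: 'j
  have i: "integrable (w1_law D j0) (\<lambda>x. x)"
    using weights by (simp add: phase1_weight_conditions_def)
  have "(\<integral>x. x \<partial>w1_law D j0) \<le> (\<integral>x. Wmax \<partial>w1_law D j0)"
    using Wmax i by (intro integral_mono_AE) auto
  then show ?thesis using w1_mean by (simp add: prob_space)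
qed

definition sig :: real where
  "sig = (SOME \<sigma>. \<sigma> > 0 \<and> (\<forall>N\<ge>1. \<forall>w\<in>space (iid D). \<forall>v\<in>space (V_space D).
        \<sigma> \<le> pi0 D N w v \<and> pi0 D N w v \<le> 1))"

lemma sig: "sig > 0"
  and pi0_bounds: "\<And>N w v. N \<ge> 1 \<Longrightarrow> w \<in> space (iid D) \<Longrightarrow> v \<in> space (V_space D) \<Longrightarrow>
    sig \<le> pi0 D N w v \<and> pi0 D N w v \<le> 1"
proof -
  have "\<exists>\<sigma>>0. \<forall>N\<ge>1. \<forall>w\<in>space (iid D). \<forall>v\<in>space (V_space D).
        \<sigma> \<le> pi0 D N w v \<and> pi0 D N w v \<le> 1"
    using design by (simp add: two_phase_design_def)
  then have "sig > 0 \<and> (\<forall>N\<ge>1. \<forall>w\<in>space (iid D). \<forall>v\<in>space (V_space D).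
        sig \<le> pi0 D N w v \<and> pi0 D N w v \<le> 1)"
    unfolding sig_def by (rule someI_ex)
  then show "sig > 0" "\<And>N w v. N \<ge> 1 \<Longrightarrow> w \<in> space (iid D) \<Longrightarrow> v \<in> space (V_space D) \<Longrightarrow>
    sig \<le> pi0 D N w v \<and> pi0 D N w v \<le> 1" by blast+
qed

definition ns :: "nat \<Rightarrow> (nat \<Rightarrow> 'j) \<Rightarrow> 'j \<Rightarrow> nat" where "ns N l j = nsel D (cnt N l) j"

lemma cnt_pos: "i < N \<Longrightarrow> cnt N l (l i) > 0"
  unfolding cnt_def card_gt_0_iff by auto

lemma pi0_eq:
  assumes w: "w \<in> space (iid D)" and z: "z \<in> space Z"
  shows "pi0 D N w (Vof D z) = (if cnt N (labels N w) (lab z) = 0 then 1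
    else real (ns N (labels N w) (lab z)) / real (cnt N (labels N w) (lab z)))"
  by (simp add: pi0_def Let_def lab_def[symmetric] Ncount_eq[OF w] ncount_def ns_def)

text \<open>The bounds on \<open>pi0\<close> are stated at points of the auxiliary space; a nonempty
  stratum contains a unit at which they can be read off.\<close>

lemma sampling_fraction:
  assumes N: "N \<ge> 1" and w: "w \<in> space (iid D)" and pos: "cnt N (labels N w) j > 0"
  shows "sig * cnt N (labels N w) j \<le> ns N (labels N w) j" "ns N (labels N w) j \<le> cnt N (labels N w) j"
    "0 < ns N (labels N w) j"
proof -
  obtain i where i: "i < N" "labels N w i = j" using pos by (auto simp: cnt_def card_gt_0_iff)
  have z: "w i \<in> space Z" "lab (w i) = j" using w i by (auto simp: space_iid labels_def)
  have "sig \<le> pi0 D N w (Vof D (w i))"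
    using pi0_bounds[OF N w measurable_space[OF measurable_Vof z(1)]] by simp
  then show 1: "sig * cnt N (labels N w) j \<le> ns N (labels N w) j"
    using pos by (simp add: pi0_eq[OF w z(1)] z(2) field_simps)
  show "ns N (labels N w) j \<le> cnt N (labels N w) j"
    unfolding ns_def by (rule nsel_le[OF N w])
  have "0 < sig * cnt N (labels N w) j" using sig pos by simp
  with 1 show "0 < ns N (labels N w) j" by simp
qed

text \<open>The inverse probability weight as a function of the key. It agrees with
  \<open>ipw\<close> on the first \<open>N\<close> units because the stratum of an observed unit is
  nonempty.\<close>

definition ipwk :: "nat \<Rightarrow> (nat \<Rightarrow> 'j) \<times> nat set \<Rightarrow> nat \<Rightarrow> real" where
  "ipwk N k i = of_bool (i \<in> snd k) * (real (cnt N (fst k) (fst k i)) / real (ns N (fst k) (fst k i)))"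

lemma ipw_eq:
  assumes w: "\<omega> \<in> space (data D)" and i: "i < N"
  shows "ipw D N \<omega> i = ipwk N (key N \<omega>) i"
proof -
  have fw: "fst \<omega> \<in> space (iid D)" using w by (auto simp: space_data)
  then have z: "fst \<omega> i \<in> space Z" by (auto simp: space_iid)
  have l: "labels N (fst \<omega>) i = lab (fst \<omega> i)" using i by (simp add: labels_def)
  have c: "cnt N (labels N (fst \<omega>)) (lab (fst \<omega> i)) > 0" using cnt_pos[OF i, of "labels N (fst \<omega>)"] by (simp add: l)
  show ?thesis
    using c i by (simp add: ipw_def pi0_eq[OF fw z] ipwk_def key_def l sampled_def)
qed

lemma ipwk_bounds:
  assumes N: "N \<ge> 1" and w: "\<omega> \<in> space (data D)" and i: "i < N"
  shows "0 \<le> ipwk N (key N \<omega>) i" "ipwk N (key N \<omega>) i \<le> 1 / sig"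
proof -
  have fw: "fst \<omega> \<in> space (iid D)" using w by (auto simp: space_data)
  let ?l = "labels N (fst \<omega>)"
  note s = sampling_fraction[OF N fw cnt_pos[OF i]]
  show "0 \<le> ipwk N (key N \<omega>) i" by (simp add: ipwk_def)
  have "real (cnt N ?l (?l i)) / real (ns N ?l (?l i)) \<le> 1 / sig"
    using s sig by (simp add: field_simps)
  then show "ipwk N (key N \<omega>) i \<le> 1 / sig"
    using sig by (cases "i \<in> sampled D N \<omega>") (simp_all add: ipwk_def key_def)
qed

text \<open>Conditional independence of weights and units, given memberships and indicators, takes
  this form; it allows the conditional law to be evaluated at any representative with the same
  key.\<close>

lemma PW_key:
  assumes "\<omega> \<in> space (data D)" "\<omega>' \<in> space (data D)" "key N \<omega> = key N \<omega>'"
  shows "PW D N \<omega> = PW D N \<omega>'"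
proof -
  have fw: "fst \<omega> \<in> space (iid D)" "fst \<omega>' \<in> space (iid D)" using assms by (auto simp: space_data)
  have l: "labels N (fst \<omega>) = labels N (fst \<omega>')" and s: "sampled D N \<omega> = sampled D N \<omega>'"
    using assms(3) by (simp_all add: key_def)
  have lab: "lab (fst \<omega> i) = lab (fst \<omega>' i)" if "i < N" for i
    using fun_cong[OF l, of i] that by (simp add: labels_def)
  have m: "members D N (fst \<omega>) j = members D N (fst \<omega>') j" for j
    by (simp add: members_eq fw l)
  have n: "Ncount D N (fst \<omega>) = Ncount D N (fst \<omega>')" by (simp add: Ncount_eq fw l)
  have "phase2_law D N \<omega> = phase2_law D N \<omega>'"
    unfolding phase2_law_def m n s
    by (intro map_pmf_cong refl ext) (auto simp: lab_def[symmetric] lab sampled_def)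
  moreover have "PiM {..<N} (\<lambda>i. w1_law D (lab (fst \<omega> i))) = PiM {..<N} (\<lambda>i. w1_law D (lab (fst \<omega>' i)))"
    by (rule PiM_cong) (auto simp: lab)
  ultimately show ?thesis by (simp add: PW_def lab_def)
qed

text \<open>With \<open>k \<ge> 1\<close> the groups hold at least \<open>card A\<close> balls, so
  the family of possible draws is nonempty and is the support of the uniform law.\<close>

lemma set_multi_hypergeometric:
  assumes A: "finite A" and k: "k \<ge> 1" and f: "f \<in> set_pmf (multi_hypergeometric A (\<lambda>_. k) (card A))"
  shows "f i \<le> k" "i \<notin> A \<Longrightarrow> f i = 0" "sum f A = card A"
proof -
  let ?X = "SIGMA i:A. {..<k}"
  let ?S = "{B. B \<subseteq> ?X \<and> card B = card A}"
  have fX: "finite ?X" using A by auto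
  have "card A \<le> card ?X" using A k by simp
  then obtain B0 where "B0 \<subseteq> ?X" "card B0 = card A" using obtain_subset_with_card_n by metis
  then have ne: "?S \<noteq> {}" by auto
  have fS: "finite ?S" using fX by simp
  obtain B where B: "B \<subseteq> ?X" "card B = card A" "f = (\<lambda>i. card {b \<in> B. fst b = i})"
    using f unfolding multi_hypergeometric_def by (auto simp: set_pmf_of_set[OF ne fS])
  have fB: "finite B" using B(1) fX finite_subset by blast
  have "{b \<in> B. fst b = i} \<subseteq> Pair i ` {..<k}" using B(1) by auto
  then have "card {b \<in> B. fst b = i} \<le> card (Pair i ` {..<k})" by (rule card_mono[rotated]) simp
  also have "\<dots> = k" by (simp add: card_image inj_on_def)
  finally show "f i \<le> k" by (simp add: B(3))
  show "f i = 0" if "i \<notin> A"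
  proof -
    have "{b \<in> B. fst b = i} = {}" using B(1) that by auto
    then show ?thesis unfolding B(3) by (simp only: card.empty)
  qed
  have "sum f A = card (\<Union>i\<in>A. {b \<in> B. fst b = i})"
    unfolding B(3) using A fB by (intro card_UN_disjoint[symmetric]) auto
  also have "(\<Union>i\<in>A. {b \<in> B. fst b = i}) = B" using B(1) by auto
  finally show "sum f A = card A" using B(2) by simp
qed

text \<open>The sampled units number at most \<open>Nj\<close>, so both group sizes of the mixture
  are at least 1, and the three facts hold in either branch whatever the mixing probability.\<close>

lemma set_stratum_weights:
  assumes A: "finite A" "A \<noteq> {}" "card A \<le> Nj" and f: "f \<in> set_pmf (stratum_weights Nj A)"
  shows "f i \<le> Nj div card A + 1" "i \<notin> A \<Longrightarrow> f i = 0" "sum f A = card A"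
proof -
  have "card A > 0" using A by (simp add: card_gt_0_iff)
  then have k: "Nj div card A \<ge> 1" using A(3) by (simp add: div_greater_zero_iff Suc_le_eq)
  have "f \<in> set_pmf (multi_hypergeometric A (\<lambda>_. Nj div card A) (card A)) \<or>
        f \<in> set_pmf (multi_hypergeometric A (\<lambda>_. Nj div card A + 1) (card A))"
    using f unfolding stratum_weights_def Let_def set_bind_pmf by (auto split: if_splits)
  then show "f i \<le> Nj div card A + 1" "i \<notin> A \<Longrightarrow> f i = 0" "sum f A = card A"
    using set_multi_hypergeometric[OF A(1) k, of f] set_multi_hypergeometric[OF A(1), of "Nj div card A + 1" f]
    by (auto intro: le_SucI)
qed

text \<open>A unit receives at most the integer part of stratum size over sample size, plus one; the
  quotient is at most \<open>1 / sig\<close>.\<close>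

definition W2max :: real where "W2max = 1 / sig + 1"

lemma W2max_pos: "W2max > 0" using sig by (simp add: W2max_def add_pos_pos)

lemma phase2_support:
  assumes N: "N \<ge> 1" and w: "\<omega> \<in> space (data D)" and g: "good N \<omega>"
    and f: "f \<in> set_pmf (phase2_law D N \<omega>)"
  shows "i \<notin> sampled D N \<omega> \<Longrightarrow> f i = 0" "real (f i) \<le> W2max"
    "(\<Sum>i\<in>{i. i < N \<and> labels N (fst \<omega>) i = j}. f i) = ns N (labels N (fst \<omega>)) j"
proof -
  have fw: "fst \<omega> \<in> space (iid D)" using w by (auto simp: space_data)
  let ?l = "labels N (fst \<omega>)" and ?S = "sampled D N \<omega>"
  let ?M = "\<lambda>j. {i. i < N \<and> ?l i = j}"
  have SN: "?S \<subseteq> {..<N}" by (auto simp: sampled_def)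
  have l: "?l i = stratum_of D (Vof D (fst \<omega> i))" if "i < N" for i using that by (simp add: labels_def lab_def)
  obtain h where h: "\<And>j. h j \<in> set_pmf (stratum_weights (cnt N ?l j) (?S \<inter> ?M j))"
    and fh: "f = (\<lambda>i. if i \<in> ?S then h (stratum_of D (Vof D (fst \<omega> i))) i else 0)"
    using f unfolding phase2_law_def
    by (auto simp: set_Pi_pmf PiE_dflt_def Ncount_eq[OF fw] members_eq[OF fw])
  have cS: "card (?S \<inter> ?M j) = ns N ?l j" for j
    using g by (simp add: good_def key_def card_sat_def ns_def)
  have ok: "h j i \<le> cnt N ?l j div ns N ?l j + 1" "i \<notin> ?S \<inter> ?M j \<Longrightarrow> h j i = 0"
     "sum (h j) (?S \<inter> ?M j) = ns N ?l j" if c: "cnt N ?l j > 0" for i j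
  proof -
    note s = sampling_fraction[OF N fw c]
    have "?S \<inter> ?M j \<noteq> {}" using s(3) cS[of j] by auto
    moreover have "finite (?S \<inter> ?M j)" using SN finite_subset by auto
    ultimately show "h j i \<le> cnt N ?l j div ns N ?l j + 1" "i \<notin> ?S \<inter> ?M j \<Longrightarrow> h j i = 0"
      "sum (h j) (?S \<inter> ?M j) = ns N ?l j"
      using set_stratum_weights(1,2)[OF _ _ _ h[of j], of i] set_stratum_weights(3)[OF _ _ _ h[of j]]
        s(2) cS[of j] by auto
  qed
  show "i \<notin> ?S \<Longrightarrow> f i = 0" by (simp add: fh)
  show "real (f i) \<le> W2max"
  proof (cases "i \<in> ?S")
    case True
    then have i: "i < N" using SN by auto
    note s = sampling_fraction[OF N fw cnt_pos[OF i]]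
    have "f i \<le> cnt N ?l (?l i) div ns N ?l (?l i) + 1"
      using ok(1)[OF cnt_pos[OF i], of i] True by (simp add: fh l[OF i])
    then have "real (f i) \<le> real (cnt N ?l (?l i) div ns N ?l (?l i)) + 1" by linarith
    also have "real (cnt N ?l (?l i) div ns N ?l (?l i)) \<le> real (cnt N ?l (?l i)) / real (ns N ?l (?l i))"
      by (rule of_nat_div_le_of_nat)
    also have "\<dots> \<le> 1 / sig" using s sig by (simp add: field_simps)
    finally show ?thesis by (simp add: W2max_def)
  qed (use W2max_pos in \<open>simp add: fh\<close>)
  have finM: "finite (?M j)" by simp
  have "(\<Sum>i\<in>?M j. f i) = (\<Sum>i\<in>?S \<inter> ?M j. f i)"
    by (rule sum.mono_neutral_right) (auto simp: fh)
  also have "\<dots> = (\<Sum>i\<in>?S \<inter> ?M j. h j i)"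
    by (intro sum.cong refl) (auto simp: fh l)
  also have "\<dots> = ns N ?l j"
  proof (cases "cnt N ?l j > 0")
    case True
    then show ?thesis by (rule ok(3))
  next
    case False
    then have "?M j = {}" by (auto simp: cnt_def)
    with cS[of j] show ?thesis by (metis Int_empty_right card.empty sum.empty)
  qed
  finally show "(\<Sum>i\<in>?M j. f i) = ns N ?l j" .
qed

end

section \<open>Integrals over the data of functions of the first units\<close>

context boot_design
begin

lemma distr_fst_data: "distr (data D) (iid D) fst = iid D"
  unfolding data_def by (rule R.distr_pair_fst)

lemma nn_integral_data_restrict:
  assumes H: "H \<in> borel_measurable (PN N)"
  shows "(\<integral>\<^sup>+\<omega>. H (restrict (fst \<omega>) {..<N}) \<partial>data D) = (\<integral>\<^sup>+x. H x \<partial>PN N)"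
proof -
  have m: "(\<lambda>w. H (restrict w {..<N})) \<in> borel_measurable (iid D)"
    by (rule measurable_compose[OF restrict_measurable H])
  have "(\<integral>\<^sup>+x. H x \<partial>PN N) = (\<integral>\<^sup>+x. H x \<partial>distr (iid D) (PN N) (\<lambda>w. restrict w {..<N}))"
    by (simp only: distr_restrict_iid)
  also have "\<dots> = (\<integral>\<^sup>+w. H (restrict w {..<N}) \<partial>iid D)"
    by (rule nn_integral_distr[OF restrict_measurable]) (use H in simp)
  also have "\<dots> = (\<integral>\<^sup>+w. H (restrict w {..<N}) \<partial>distr (data D) (iid D) fst)"
    by (simp only: distr_fst_data)
  also have "\<dots> = (\<integral>\<^sup>+\<omega>. H (restrict (fst \<omega>) {..<N}) \<partial>data D)"
    by (rule nn_integral_distr[OF measurable_fst_data]) (use m in simp)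
  finally show ?thesis by simp
qed

lemma measurable_data_restrict:
  assumes "H \<in> borel_measurable (PN N)"
  shows "(\<lambda>\<omega>. H (restrict (fst \<omega>) {..<N})) \<in> borel_measurable (data D)"
  by (rule measurable_compose[OF measurable_compose[OF measurable_fst_data restrict_measurable] assms])

lemma measurable_key_fun: "(\<lambda>\<omega>. \<phi> (key N \<omega>) :: ennreal) \<in> borel_measurable (data D)"
  by (rule measurable_compose[OF measurable_key]) simp

lemma restrict_space: "w \<in> space (iid D) \<Longrightarrow> restrict w {..<N} \<in> space (PN N)"
  using measurable_space[OF restrict_measurable] .

end

section \<open>The conditional law of the weights and multiplier schemes\<close>

context boot_weights
begin

lemma PiM_w1_prob: "prob_space (PiM {..<N} (\<lambda>i. w1_law D (l i)))"
  by (rule prob_space_PiM) (rule w1_prob)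

lemma PW_eq: "PW D N \<omega> = PiM {..<N} (\<lambda>i. w1_law D (lab (fst \<omega> i))) \<Otimes>\<^sub>M measure_pmf (phase2_law D N \<omega>)"
  by (simp add: PW_def lab_def)

lemma PW_prob: "prob_space (PW D N \<omega>)"
proof -
  interpret A: prob_space "PiM {..<N} (\<lambda>i. w1_law D (lab (fst \<omega> i)))" by (rule PiM_w1_prob)
  interpret pair_prob_space "PiM {..<N} (\<lambda>i. w1_law D (lab (fst \<omega> i)))" "measure_pmf (phase2_law D N \<omega>)" ..
  show ?thesis unfolding PW_eq by (rule prob_space_axioms)
qed

lemma AE_PW:
  "AE b in PW D N \<omega>. (\<forall>i<N. 0 < fst b i \<and> fst b i \<le> Wmax) \<and> snd b \<in> set_pmf (phase2_law D N \<omega>)"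
proof -
  let ?A = "PiM {..<N} (\<lambda>i. w1_law D (lab (fst \<omega> i)))" and ?B = "measure_pmf (phase2_law D N \<omega>)"
  interpret A: prob_space ?A by (rule PiM_w1_prob)
  interpret B: prob_space ?B by (rule prob_space_measure_pmf)
  interpret AB: pair_prob_space ?A ?B ..
  have a: "AE x in ?A. \<forall>i\<in>{..<N}. 0 < x i \<and> x i \<le> Wmax"
  proof (rule AE_finite_allI)
    fix i assume i: "i \<in> {..<N}"
    have "AE z in w1_law D (lab (fst \<omega> i)). 0 < z \<and> z \<le> Wmax"
      using w1_pos[of "lab (fst \<omega> i)"] Wmax[of "lab (fst \<omega> i)"] by eventually_elim simp
    then show "AE x in ?A. 0 < x i \<and> x i \<le> Wmax"
      using AE_PiM_component[of "{..<N}" "\<lambda>i. w1_law D (lab (fst \<omega> i))" i "\<lambda>z. 0 < z \<and> z \<le> Wmax"] w1_prob i by auto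
  qed simp
  have "AE x in distr (?A \<Otimes>\<^sub>M ?B) ?A fst. \<forall>i\<in>{..<N}. 0 < x i \<and> x i \<le> Wmax"
    unfolding prob_space.distr_pair_fst[OF prob_space_measure_pmf] by (rule a)
  then have 1: "AE b in ?A \<Otimes>\<^sub>M ?B. \<forall>i\<in>{..<N}. 0 < fst b i \<and> fst b i \<le> Wmax"
    by (rule AE_distrD[OF measurable_fst])
  have 2: "AE b in ?A \<Otimes>\<^sub>M ?B. snd b \<in> set_pmf (phase2_law D N \<omega>)"
  proof (rule AB.AE_pair_measure)
    have "{b \<in> space (?A \<Otimes>\<^sub>M ?B). snd b \<in> set_pmf (phase2_law D N \<omega>)}
        = snd -` set_pmf (phase2_law D N \<omega>) \<inter> space (?A \<Otimes>\<^sub>M ?B)" by auto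
    also have "\<dots> \<in> sets (?A \<Otimes>\<^sub>M ?B)" by (rule measurable_sets[OF measurable_snd]) simp
    finally show "{b \<in> space (?A \<Otimes>\<^sub>M ?B). snd b \<in> set_pmf (phase2_law D N \<omega>)} \<in> sets (?A \<Otimes>\<^sub>M ?B)" .
    show "AE x in ?A. AE y in ?B. snd (x, y) \<in> set_pmf (phase2_law D N \<omega>)"
      by (rule AE_I2) (simp add: AE_measure_pmf)
  qed
  show ?thesis unfolding PW_eq using 1 2 by eventually_elim auto
qed

lemma measurable_PW_fst: "i < N \<Longrightarrow> (\<lambda>b. fst b i) \<in> borel_measurable (PW D N \<omega>)"
proof -
  assume i: "i < N"
  have "(\<lambda>x. x i) \<in> measurable (PiM {..<N} (\<lambda>i. w1_law D (lab (fst \<omega> i)))) (w1_law D (lab (fst \<omega> i)))"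
    using i by simp
  then have "(\<lambda>x. x i) \<in> borel_measurable (PiM {..<N} (\<lambda>i. w1_law D (lab (fst \<omega> i))))"
    by (simp cong: measurable_cong_sets add: measurable_cong_sets[OF refl w1_sets])
  from measurable_compose[OF measurable_fst this] show ?thesis unfolding PW_eq .
qed

lemma measurable_PW_snd: "(\<lambda>b. real (snd b i)) \<in> borel_measurable (PW D N \<omega>)"
  unfolding PW_eq by (rule measurable_compose[OF measurable_snd]) simp

definition members_of :: "nat \<Rightarrow> (nat \<Rightarrow> 'j) \<Rightarrow> 'j \<Rightarrow> nat set" where
  "members_of N l j = {i. i < N \<and> l i = j}"

lemma card_members_of: "card (members_of N l j) = cnt N l j"
  by (simp add: members_of_def cnt_def)

lemma sum_by_label: "(\<Sum>j\<in>UNIV. \<Sum>i\<in>members_of N l j. h i) = (\<Sum>i<N. h i)"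
  for h :: "nat \<Rightarrow> real"
proof -
  have "(\<Sum>j\<in>UNIV. \<Sum>i\<in>{i \<in> {..<N}. l i = j}. h i) = (\<Sum>i<N. h i)"
    by (rule sum.group) auto
  then show ?thesis by (simp add: members_of_def)
qed

text \<open>Abstract multipliers: functions of the key and the bootstrap weights, bounded by
  \<open>B\<close>, whose stratum totals match the stratum sizes up to \<open>K * sqrt N\<close> in
  conditional mean. One inequality then serves the bootstrap measure, the phase II moments in the
  calibration equations, and the inverse-probability and unweighted means.\<close>

definition scheme ::
  "nat \<Rightarrow> ((nat \<Rightarrow> 'j) \<times> nat set \<Rightarrow> weights \<Rightarrow> nat \<Rightarrow> real) \<Rightarrow> real \<Rightarrow> real \<Rightarrow> bool" where
  "scheme N c B K \<longleftrightarrow> 0 < B \<and> 0 \<le> K \<and> (\<forall>\<omega>\<in>space (data D). good N \<omega> \<longrightarrow>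
     (\<forall>i<N. (\<lambda>b. c (key N \<omega>) b i) \<in> borel_measurable (PW D N \<omega>)) \<and>
     (AE b in PW D N \<omega>. \<forall>i<N. 0 \<le> c (key N \<omega>) b i \<and> c (key N \<omega>) b i \<le> B) \<and>
     (\<forall>j. (\<integral>\<^sup>+b. ennreal \<bar>(\<Sum>i\<in>members_of N (fst (key N \<omega>)) j. c (key N \<omega>) b i) -
         real (cnt N (fst (key N \<omega>)) j)\<bar> \<partial>PW D N \<omega>) \<le> ennreal (K * sqrt (real N))))"

lemma ns_pos:
  assumes N: "N \<ge> 1" and w: "\<omega> \<in> space (data D)" and i: "i \<in> members_of N (fst (key N \<omega>)) j"
  shows "ns N (fst (key N \<omega>)) j > 0"
proof -
  have "fst \<omega> \<in> space (iid D)" using w by (auto simp: space_data)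
  from sampling_fraction(3)[OF N this, of j] i show ?thesis
    by (auto simp: members_of_def key_def cnt_def card_gt_0_iff)
qed

text \<open>The draws in a stratum total its sample size exactly, and each counts stratum size over
  sample size, so the total is the stratum size without error. This gives \<open>K = 0\<close> for
  the phase II scheme.\<close>

lemma sum_phase2_ipwk:
  assumes N: "N \<ge> 1" and w: "\<omega> \<in> space (data D)" and g: "good N \<omega>"
    and f: "f \<in> set_pmf (phase2_law D N \<omega>)"
  shows "(\<Sum>i\<in>members_of N (fst (key N \<omega>)) j. real (f i) * ipwk N (key N \<omega>) i) = real (cnt N (fst (key N \<omega>)) j)"
proof (cases "members_of N (fst (key N \<omega>)) j = {}")
  case True
  then show ?thesis by (simp flip: card_members_of)
next
  case False
  let ?l = "fst (key N \<omega>)"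
  have n: "ns N ?l j > 0" using False ns_pos[OF N w] by blast
  have "(\<Sum>i\<in>members_of N ?l j. real (f i) * ipwk N (key N \<omega>) i)
     = (\<Sum>i\<in>members_of N ?l j. real (f i) * (real (cnt N ?l j) / real (ns N ?l j)))"
    using phase2_support(1)[OF N w g f]
    by (intro sum.cong refl) (auto simp: ipwk_def key_def members_of_def)
  also have "\<dots> = real (\<Sum>i\<in>members_of N ?l j. f i) * (real (cnt N ?l j) / real (ns N ?l j))"
    unfolding of_nat_sum sum_distrib_right ..
  also have "(\<Sum>i\<in>members_of N ?l j. f i) = ns N ?l j"
    using phase2_support(3)[OF N w g f, of j] by (simp add: members_of_def key_def)
  finally show ?thesis using n by simp
qed

lemma sum_ipwk:
  assumes N: "N \<ge> 1" and w: "\<omega> \<in> space (data D)" and g: "good N \<omega>"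
  shows "(\<Sum>i\<in>members_of N (fst (key N \<omega>)) j. ipwk N (key N \<omega>) i) = real (cnt N (fst (key N \<omega>)) j)"
proof (cases "members_of N (fst (key N \<omega>)) j = {}")
  case True
  then show ?thesis by (simp flip: card_members_of)
next
  case False
  let ?l = "fst (key N \<omega>)" and ?S = "snd (key N \<omega>)"
  have n: "ns N ?l j > 0" using False ns_pos[OF N w] by blast
  have "(\<Sum>i\<in>members_of N ?l j. ipwk N (key N \<omega>) i)
     = (\<Sum>i\<in>?S \<inter> members_of N ?l j. real (cnt N ?l j) / real (ns N ?l j))"
    by (rule sum.mono_neutral_cong_right) (auto simp: ipwk_def members_of_def)
  also have "\<dots> = real (card (?S \<inter> members_of N ?l j)) * (real (cnt N ?l j) / real (ns N ?l j))"
    by simp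
  also have "card (?S \<inter> members_of N ?l j) = ns N ?l j"
    using g by (simp add: good_def card_sat_def members_of_def ns_def)
  finally show ?thesis using n by simp
qed

lemma scheme_ipw: "N \<ge> 1 \<Longrightarrow> scheme N (\<lambda>k b i. ipwk N k i) (1 / sig) 0"
  unfolding scheme_def using sig ipwk_bounds[of N] by (auto simp: sum_ipwk)

lemma scheme_W2:
  assumes N: "N \<ge> 1"
  shows "scheme N (\<lambda>k b i. real (snd b i) * ipwk N k i) (W2max / sig) 0"
  unfolding scheme_def
proof (intro conjI ballI impI allI)
  show "0 < W2max / sig" using W2max_pos sig by simp
  fix \<omega> assume w: "\<omega> \<in> space (data D)" and g: "good N \<omega>"
  show "(\<lambda>b. real (snd b i) * ipwk N (key N \<omega>) i) \<in> borel_measurable (PW D N \<omega>)" for i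
    by (intro borel_measurable_times borel_measurable_const measurable_PW_snd)
  show "AE b in PW D N \<omega>. \<forall>i<N. 0 \<le> real (snd b i) * ipwk N (key N \<omega>) i \<and>
      real (snd b i) * ipwk N (key N \<omega>) i \<le> W2max / sig"
    using AE_PW[of N \<omega>]
  proof eventually_elim
    case (elim b)
    show ?case
    proof (intro allI impI)
      fix i assume i: "i < N"
      have "real (snd b i) * ipwk N (key N \<omega>) i \<le> W2max * (1 / sig)"
        using phase2_support(2)[OF N w g] elim ipwk_bounds[OF N w i] W2max_pos by (intro mult_mono) auto
      then show "0 \<le> real (snd b i) * ipwk N (key N \<omega>) i \<and>
        real (snd b i) * ipwk N (key N \<omega>) i \<le> W2max / sig" using ipwk_bounds[OF N w i] by simp
    qed
  qed
  fix j
  have "(\<integral>\<^sup>+b. ennreal \<bar>(\<Sum>i\<in>members_of N (fst (key N \<omega>)) j. real (snd b i) * ipwk N (key N \<omega>) i) -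
     real (cnt N (fst (key N \<omega>)) j)\<bar> \<partial>PW D N \<omega>) = (\<integral>\<^sup>+b. 0 \<partial>PW D N \<omega>)"
  proof (rule nn_integral_cong_AE)
    show "AE b in PW D N \<omega>. ennreal \<bar>(\<Sum>i\<in>members_of N (fst (key N \<omega>)) j. real (snd b i) * ipwk N (key N \<omega>) i) -
     real (cnt N (fst (key N \<omega>)) j)\<bar> = 0"
      using AE_PW[of N \<omega>] by eventually_elim (simp add: sum_phase2_ipwk[OF N w g])
  qed
  then show "(\<integral>\<^sup>+b. ennreal \<bar>(\<Sum>i\<in>members_of N (fst (key N \<omega>)) j. real (snd b i) * ipwk N (key N \<omega>) i) -
     real (cnt N (fst (key N \<omega>)) j)\<bar> \<partial>PW D N \<omega>) \<le> ennreal (0 * sqrt (real N))" by simp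
qed simp

text \<open>Given the phase II draws, the deviation of a stratum total is a sum of independent
  centred variables, the phase I weights minus 1, with bounded coefficients; its mean absolute value
  is of order \<open>sqrt N\<close>.\<close>

lemma scheme_W1W2:
  assumes N: "N \<ge> 1"
  shows "scheme N (\<lambda>k b i. fst b i * real (snd b i) * ipwk N k i) (Wmax * W2max / sig) ((Wmax + 1) * (W2max / sig))"
  unfolding scheme_def
proof (intro conjI ballI impI allI)
  show "0 < Wmax * W2max / sig" "0 \<le> (Wmax + 1) * (W2max / sig)" using W2max_pos sig Wmax_ge_1 by simp_all
  fix \<omega> assume w: "\<omega> \<in> space (data D)" and g: "good N \<omega>"
  let ?k = "key N \<omega>" and ?l = "fst (key N \<omega>)"
  have ckm: "(\<lambda>b. fst b i * real (snd b i) * ipwk N ?k i) \<in> borel_measurable (PW D N \<omega>)" if "i < N" for i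
    using that by (intro borel_measurable_times borel_measurable_const measurable_PW_snd measurable_PW_fst)
  then show "i < N \<Longrightarrow> (\<lambda>b. fst b i * real (snd b i) * ipwk N ?k i) \<in> borel_measurable (PW D N \<omega>)" for i .
  have f_bd: "0 \<le> real (f i) * ipwk N ?k i" "real (f i) * ipwk N ?k i \<le> W2max / sig"
    if "f \<in> set_pmf (phase2_law D N \<omega>)" "i < N" for f i
  proof -
    have "real (f i) * ipwk N ?k i \<le> W2max * (1 / sig)"
      using phase2_support(2)[OF N w g that(1)] ipwk_bounds[OF N w that(2)] W2max_pos by (intro mult_mono) auto
    then show "real (f i) * ipwk N ?k i \<le> W2max / sig" by simp
    show "0 \<le> real (f i) * ipwk N ?k i" using ipwk_bounds[OF N w that(2)] by simp
  qed
  show "AE b in PW D N \<omega>. \<forall>i<N. 0 \<le> fst b i * real (snd b i) * ipwk N ?k i \<and>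
      fst b i * real (snd b i) * ipwk N ?k i \<le> Wmax * W2max / sig"
    using AE_PW[of N \<omega>]
  proof eventually_elim
    case (elim b)
    show ?case
    proof (intro allI impI)
      fix i assume i: "i < N"
      have "fst b i * (real (snd b i) * ipwk N ?k i) \<le> Wmax * (W2max / sig)"
        using elim i f_bd[of "snd b" i] Wmax_ge_1 ipwk_bounds(1)[OF N w i] by (intro mult_mono) auto
      moreover have "0 \<le> fst b i * (real (snd b i) * ipwk N ?k i)"
        using elim i ipwk_bounds(1)[OF N w i] by (intro mult_nonneg_nonneg) (auto intro: less_imp_le)
      ultimately show "0 \<le> fst b i * real (snd b i) * ipwk N ?k i \<and>
        fst b i * real (snd b i) * ipwk N ?k i \<le> Wmax * W2max / sig" by (simp add: mult.assoc)
    qed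
  qed
  fix j
  let ?A = "PiM {..<N} (\<lambda>i. w1_law D (lab (fst \<omega> i)))" and ?B = "measure_pmf (phase2_law D N \<omega>)"
  interpret A: prob_space ?A by (rule PiM_w1_prob)
  interpret B: prob_space ?B by (rule prob_space_measure_pmf)
  interpret AB: pair_prob_space ?A ?B ..
  \<comment> \<open>Centring the phase I weights at 1 reproduces the deviation from the stratum
    size, because the phase II totals are exact.\<close>
  define T where "T b = ennreal \<bar>\<Sum>i<N. of_bool (?l i = j) * ((fst b i - 1) * (real (snd b i) * ipwk N ?k i))\<bar>" for b
  have T_eq: "(\<Sum>i\<in>members_of N ?l j. fst b i * real (snd b i) * ipwk N ?k i) - real (cnt N ?l j)
      = (\<Sum>i<N. of_bool (?l i = j) * ((fst b i - 1) * (real (snd b i) * ipwk N ?k i)))"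
    if "snd b \<in> set_pmf (phase2_law D N \<omega>)" for b
  proof -
    have "(\<Sum>i\<in>members_of N ?l j. fst b i * real (snd b i) * ipwk N ?k i) - real (cnt N ?l j)
       = (\<Sum>i\<in>members_of N ?l j. fst b i * real (snd b i) * ipwk N ?k i) -
         (\<Sum>i\<in>members_of N ?l j. real (snd b i) * ipwk N ?k i)"
      by (simp add: sum_phase2_ipwk[OF N w g that])
    also have "\<dots> = (\<Sum>i\<in>members_of N ?l j. (fst b i - 1) * (real (snd b i) * ipwk N ?k i))"
      by (simp add: sum_subtractf[symmetric] algebra_simps)
    also have "\<dots> = (\<Sum>i<N. of_bool (?l i = j) * ((fst b i - 1) * (real (snd b i) * ipwk N ?k i)))"
      by (rule sum.mono_neutral_cong_left) (auto simp: members_of_def)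
    finally show ?thesis .
  qed
  have Tm: "T \<in> borel_measurable (?A \<Otimes>\<^sub>M ?B)"
    unfolding T_def PW_eq[symmetric]
    by (intro measurable_compose[OF _ measurable_ennreal] borel_measurable_abs borel_measurable_sum
        borel_measurable_times borel_measurable_const borel_measurable_diff measurable_PW_fst measurable_PW_snd) auto
  have "(\<integral>\<^sup>+b. ennreal \<bar>(\<Sum>i\<in>members_of N ?l j. fst b i * real (snd b i) * ipwk N ?k i) -
     real (cnt N ?l j)\<bar> \<partial>PW D N \<omega>) = (\<integral>\<^sup>+b. T b \<partial>PW D N \<omega>)"
  proof (rule nn_integral_cong_AE)
    show "AE b in PW D N \<omega>. ennreal \<bar>(\<Sum>i\<in>members_of N ?l j. fst b i * real (snd b i) * ipwk N ?k i) -
     real (cnt N ?l j)\<bar> = T b"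
      using AE_PW[of N \<omega>] by eventually_elim (simp add: T_eq T_def)
  qed
  also have "\<dots> = (\<integral>\<^sup>+f. \<integral>\<^sup>+x. T (x, f) \<partial>?A \<partial>?B)"
    unfolding PW_eq by (rule AB.nn_integral_snd[OF Tm, symmetric])
  also have "\<dots> \<le> (\<integral>\<^sup>+f. ennreal ((Wmax + 1) * (W2max / sig) * sqrt (real N)) \<partial>?B)"
  proof (rule nn_integral_mono_AE)
    show "AE f in ?B. (\<integral>\<^sup>+x. T (x, f) \<partial>?A) \<le> ennreal ((Wmax + 1) * (W2max / sig) * sqrt (real N))"
    proof (rule AE_pmfI)
      fix f assume f: "f \<in> set_pmf (phase2_law D N \<omega>)"
      define a where "a i = of_bool (?l i = j) * (real (f i) * ipwk N ?k i)" for i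
      \<comment> \<open>The square of the uniform bound on one summand: \<open>x - 1\<close> is at
        most \<open>Wmax + 1\<close> in absolute value and the coefficients are at most
        \<open>W2max / sig\<close>.\<close>
      define v where "v = ((Wmax + 1) * (W2max / sig))\<^sup>2"
      have a: "0 \<le> a i" "a i \<le> W2max / sig" if "i < N" for i
        using f_bd[OF f that] W2max_pos sig by (auto simp: a_def)
      let ?M = "\<lambda>i. w1_law D (lab (fst \<omega> i))"
      have bd: "AE x in w1_law D j. \<bar>x - 1\<bar> \<le> Wmax + 1" for j
        using w1_pos[of j] Wmax[of j] by eventually_elim auto
      have sq: "AE x in w1_law D j'. (a i * (x - 1))\<^sup>2 \<le> v" if "i < N" for i j'
        using bd[of j']
      proof eventually_elim
        case (elim x)
        have "\<bar>a i * (x - 1)\<bar> \<le> (W2max / sig) * (Wmax + 1)"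
          unfolding abs_mult using elim a[OF that] W2max_pos sig by (intro mult_mono) auto
        then show ?case unfolding v_def by (subst abs_le_square_iff[symmetric]) (use W2max_pos sig Wmax_ge_1 in \<open>simp add: mult.commute\<close>)
      qed
      have id_meas: "(\<lambda>x. x) \<in> borel_measurable (w1_law D j)" for j
        by (simp cong: measurable_cong_sets add: measurable_cong_sets[OF w1_sets refl])
      have int1: "integrable (w1_law D j) (\<lambda>x. x - 1)" for j
      proof -
        interpret prob_space "w1_law D j" by (rule w1_prob)
        show ?thesis using bd[of j] id_meas[of j] by (intro integrable_const_bound[where B="Wmax + 1"]) auto
      qed
      have "(\<integral>\<^sup>+x. ennreal \<bar>\<Sum>i\<in>{..<N}. a i * (x i - 1)\<bar> \<partial>?A) \<le> ennreal (sqrt (real (card {..<N}) * v))"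
      proof (rule nn_integral_abs_sum_centered_le[where g="\<lambda>i x. a i * (x - 1)"])
        fix i assume i: "i \<in> {..<N}"
        interpret prob_space "?M i" by (rule w1_prob)
        show "integrable (?M i) (\<lambda>x. a i * (x - 1))" using int1 by auto
        show i2: "integrable (?M i) (\<lambda>x. (a i * (x - 1))\<^sup>2)"
          using sq[of i "lab (fst \<omega> i)"] i id_meas by (intro integrable_const_bound[where B=v]) auto
        have ix: "integrable (?M i) (\<lambda>x. x)"
          using weights by (simp add: phase1_weight_conditions_def)
        show "(\<integral>x. a i * (x - 1) \<partial>?M i) = 0"
          using ix by (simp add: w1_mean prob_space)
        have "(\<integral>x. (a i * (x - 1))\<^sup>2 \<partial>?M i) \<le> (\<integral>x. v \<partial>?M i)"
          using sq[of i "lab (fst \<omega> i)"] i i2 by (intro integral_mono_AE) auto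
        then show "(\<integral>x. (a i * (x - 1))\<^sup>2 \<partial>?M i) \<le> v" by (simp add: prob_space)
      qed (auto intro: w1_prob)
      also have "sqrt (real (card {..<N}) * v) = (Wmax + 1) * (W2max / sig) * sqrt (real N)"
        using W2max_pos sig Wmax_ge_1 by (simp add: v_def real_sqrt_mult)
      finally show "(\<integral>\<^sup>+x. T (x, f) \<partial>?A) \<le> ennreal ((Wmax + 1) * (W2max / sig) * sqrt (real N))"
        by (simp add: T_def a_def mult_ac)
    qed
  qed
  also have "\<dots> = ennreal ((Wmax + 1) * (W2max / sig) * sqrt (real N))"
    by (simp add: measure_pmf.emeasure_space_1)
  finally show "(\<integral>\<^sup>+b. ennreal \<bar>(\<Sum>i\<in>members_of N ?l j. fst b i * real (snd b i) * ipwk N ?k i) -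
     real (cnt N ?l j)\<bar> \<partial>PW D N \<omega>) \<le> ennreal ((Wmax + 1) * (W2max / sig) * sqrt (real N))" .
qed

end

section \<open>The multiplier bound\<close>

context boot_weights
begin

text \<open>The part \<open>2 * B\<close> comes from the two resampled majorants of the
  within-stratum sums. In the between-stratum part, 4 stems from the bound on mean absolute
  deviations, \<open>K\<close> from the stratum totals of the weights, and 1 from the fluctuation of
  the stratum counts.\<close>

definition mult_const :: "real \<Rightarrow> real \<Rightarrow> real" where
  "mult_const B K = 2 * B + (\<Sum>j\<in>UNIV. 4 * (K + 1) / L.nu j)"

lemma nn_integral_count_deviation:
  "(\<integral>\<^sup>+x. ennreal \<bar>\<Sum>i<N. of_bool (lab (x i) = j) - L.nu j\<bar> \<partial>PN N) \<le> ennreal (sqrt (real N))"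
proof -
  let ?g = "\<lambda>i::nat. \<lambda>z. of_bool (lab z = j) - L.nu j"
  have nu: "0 \<le> L.nu j" "L.nu j \<le> 1" by (simp_all add: L.nu_def)
  have ib: "integrable Z (\<lambda>z. of_bool (lab z = j) :: real)" by (rule Z.integrable_const_bound[where B=1]) auto
  have sq: "(?g i z)\<^sup>2 \<le> 1" for i z
    using nu by (cases "lab z = j") (auto simp: abs_square_le_1)
  have "(\<integral>\<^sup>+x. ennreal \<bar>\<Sum>i\<in>{..<N}. ?g i (x i)\<bar> \<partial>PN N) \<le> ennreal (sqrt (real (card {..<N}) * 1))"
  proof (rule nn_integral_abs_sum_centered_le)
    fix i :: nat
    show "integrable Z (?g i)" using ib by simp
    show i2: "integrable Z (\<lambda>z. (?g i z)\<^sup>2)"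
      using sq by (intro Z.integrable_const_bound[where B=1]) auto
    show "(\<integral>z. ?g i z \<partial>Z) = 0" using ib by (simp add: L.integral_of_bool_lab Z.prob_space)
    have "(\<integral>z. (?g i z)\<^sup>2 \<partial>Z) \<le> (\<integral>z. 1 \<partial>Z)" using sq i2 by (intro integral_mono) auto
    then show "(\<integral>z. (?g i z)\<^sup>2 \<partial>Z) \<le> 1" by (simp add: Z.prob_space)
  qed (auto intro: Z.prob_space_axioms)
  then show ?thesis by simp
qed

text \<open>The sum splits into a part centred at stratum means and a part carried by the stratum
  means. In the first, \<open>c / B\<close> is a mixture of vertices and each vertex sum is
  dominated by resampled majorants. In the second, stratum totals that deviate by order
  \<open>sqrt N\<close> meet stratum means that deviate by order \<open>t / sqrt N\<close>, which
  again gives order \<open>t\<close>. A single \<open>\<Psi>\<close> serves all of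
  \<open>F\<close>.\<close>

theorem multiplier_bound:
  assumes N: "N \<ge> 1" and sch: "scheme N c B K" and nu_pos: "\<And>j. L.nu j > 0"
    and U: "U \<in> borel_measurable (PN N)" and U_le: "(\<integral>\<^sup>+x. U x \<partial>PN N) \<le> ennreal t" and t: "0 \<le> t"
    and F: "\<And>f. f \<in> F \<Longrightarrow> integrable Z f"
    and UF: "\<And>f z. f \<in> F \<Longrightarrow> z \<in> space (PN N) \<Longrightarrow> ennreal \<bar>\<Sum>i<N. f (z i) - Z.expectation f\<bar> \<le> U z"
  obtains \<Psi> where "mean_le D N \<Psi> (ennreal (mult_const B K * t))"
    "AE \<omega> in data D. AE b in PW D N \<omega>. \<forall>f\<in>F.
       ennreal \<bar>\<Sum>i<N. c (key N \<omega>) b i * (f (fst \<omega> i) - Z.expectation f)\<bar> \<le> \<Psi> \<omega> b"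
proof -
  let ?P = "Pow {..<N}"
  define rs where "rs \<omega> = restrict (fst \<omega>) {..<N}" for \<omega> :: "(nat \<Rightarrow> 'x \<times> 'u) \<times> 's"
  \<comment> \<open>Clipping to the unit interval changes nothing almost surely, but makes
    \<open>V\<close> a probability vector for every \<open>b\<close>.\<close>
  define V where "V A k b = vertex_weight {..<N} (\<lambda>i. min 1 (max 0 (c k b i / B))) A" for A k b
  define Cj where "Cj k b j = (\<Sum>i\<in>members_of N (fst k) j. c k b i)" for k b j
  \<comment> \<open>The mean absolute deviation is at most \<open>4 * t / sqrt N\<close>; dividing
    by the stratum probability bounds the deviation of a stratum mean.\<close>
  define \<kappa> where "\<kappa> j = 4 * t / (sqrt (real N) * L.nu j)" for j
  have B: "B > 0" and K: "K \<ge> 0" using sch by (auto simp: scheme_def)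
  have c_meas: "(\<lambda>b. c (key N \<omega>) b i) \<in> borel_measurable (PW D N \<omega>)"
    if "\<omega> \<in> space (data D)" "good N \<omega>" "i < N" for \<omega> i
    using sch that by (auto simp: scheme_def)
  have c_bd: "AE b in PW D N \<omega>. \<forall>i<N. 0 \<le> c (key N \<omega>) b i \<and> c (key N \<omega>) b i \<le> B"
    if "\<omega> \<in> space (data D)" "good N \<omega>" for \<omega>
    using sch that by (auto simp: scheme_def)
  have c_sum: "(\<integral>\<^sup>+b. ennreal \<bar>Cj (key N \<omega>) b j - real (cnt N (fst (key N \<omega>)) j)\<bar> \<partial>PW D N \<omega>) \<le> ennreal (K * sqrt (real N))"
    if "\<omega> \<in> space (data D)" "good N \<omega>" for \<omega> j
    using sch that by (auto simp: scheme_def Cj_def)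
  have \<kappa>0: "0 \<le> \<kappa> j" for j using t nu_pos[of j] by (simp add: \<kappa>_def)
  have V0: "0 \<le> V A k b" if "A \<in> ?P" for A k b
    unfolding V_def using that by (intro vertex_weight_nonneg) auto
  have V1: "(\<Sum>A\<in>?P. V A k b) = 1" for k b unfolding V_def by (rule sum_vertex_weight) simp
  have V_meas: "(\<lambda>b. V A (key N \<omega>) b) \<in> borel_measurable (PW D N \<omega>)"
    if "\<omega> \<in> space (data D)" "good N \<omega>" "A \<in> ?P" for A \<omega>
    unfolding V_def vertex_weight_def using that(3) c_meas[OF that(1,2)]
    by (intro borel_measurable_times borel_measurable_prod borel_measurable_diff borel_measurable_const
        borel_measurable_min borel_measurable_max borel_measurable_divide) auto
  have res_meas: "L.resample N U A \<in> borel_measurable (PN N)" if "A \<in> ?P" for A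
    using that U by (intro L.measurable_resample) auto

  define \<Psi>1 where "\<Psi>1 \<omega> b = (\<Sum>A\<in>?P. ennreal (V A (key N \<omega>) b) * L.resample N U A (rs \<omega>))" for \<omega> b
  define \<Psi>2 :: "(nat \<Rightarrow> 'x \<times> 'u) \<times> 's \<Rightarrow> weights \<Rightarrow> ennreal" where "\<Psi>2 \<omega> b = L.resample N U {} (rs \<omega>)" for \<omega> b
  define \<Psi>3 where "\<Psi>3 \<omega> b = (\<Sum>j\<in>UNIV. ennreal (\<kappa> j) * ennreal \<bar>Cj (key N \<omega>) b j - real N * L.nu j\<bar>)" for \<omega> b

  have m1: "mean_le D N \<Psi>1 (ennreal t)"
  proof -
    define dom where "dom = key N ` {\<omega> \<in> space (data D). good N \<omega>}"
    \<comment> \<open>Through a representative for each key, the conditional mean of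
      \<open>V\<close> becomes a function of the key alone and hence measurable in the data.\<close>
    define rep where "rep k = (SOME \<omega>. \<omega> \<in> space (data D) \<and> good N \<omega> \<and> key N \<omega> = k)" for k
    have rep: "rep k \<in> space (data D)" "good N (rep k)" "key N (rep k) = k" if "k \<in> dom" for k
    proof -
      have "\<exists>\<omega>. \<omega> \<in> space (data D) \<and> good N \<omega> \<and> key N \<omega> = k" using that by (auto simp: dom_def)
      from someI_ex[OF this] show "rep k \<in> space (data D)" "good N (rep k)" "key N (rep k) = k"
        unfolding rep_def by auto
    qed
    define \<phi> where "\<phi> A k = (if k \<in> dom then \<integral>\<^sup>+b. ennreal (V A k b) \<partial>PW D N (rep k) else 0)" for A k
    have \<phi>_le: "(\<Sum>A\<in>?P. \<phi> A k) \<le> 1" for k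
    proof (cases "k \<in> dom")
      case True
      note r = rep[OF True]
      interpret PWr: prob_space "PW D N (rep k)" by (rule PW_prob)
      have "(\<Sum>A\<in>?P. \<phi> A k) = (\<integral>\<^sup>+b. (\<Sum>A\<in>?P. ennreal (V A k b)) \<partial>PW D N (rep k))"
        using V_meas[OF r(1,2)] True unfolding r(3)
        by (subst nn_integral_sum) (auto simp: \<phi>_def)
      also have "\<dots> = (\<integral>\<^sup>+b. 1 \<partial>PW D N (rep k))"
        by (intro nn_integral_cong, subst sum_ennreal) (auto simp: V0 V1)
      finally show ?thesis by (simp add: PWr.emeasure_space_1)
    qed (simp add: \<phi>_def)
    have \<phi>_key: "\<phi> A (key N \<omega>) = (\<integral>\<^sup>+b. ennreal (V A (key N \<omega>) b) \<partial>PW D N \<omega>)"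
      if "\<omega> \<in> space (data D)" "good N \<omega>" for A \<omega>
    proof -
      have k: "key N \<omega> \<in> dom" using that by (auto simp: dom_def)
      have "PW D N (rep (key N \<omega>)) = PW D N \<omega>"
        by (rule PW_key) (use rep[OF k] that in auto)
      then show ?thesis using k by (simp add: \<phi>_def)
    qed
    show ?thesis
    proof (rule mean_leI[of "\<lambda>\<omega>. \<Sum>A\<in>?P. \<phi> A (key N \<omega>) * L.resample N U A (rs \<omega>)"])
      show "(\<lambda>\<omega>. \<Sum>A\<in>?P. \<phi> A (key N \<omega>) * L.resample N U A (rs \<omega>)) \<in> borel_measurable (data D)"
        unfolding rs_def
        by (intro borel_measurable_sum borel_measurable_times_ennreal measurable_key_fun measurable_data_restrict res_meas)
      show "AE \<omega> in data D. \<Psi>1 \<omega> \<in> borel_measurable (PW D N \<omega>) \<and>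
         (\<integral>\<^sup>+b. \<Psi>1 \<omega> b \<partial>PW D N \<omega>) \<le> (\<Sum>A\<in>?P. \<phi> A (key N \<omega>) * L.resample N U A (rs \<omega>))"
        using AE_good[OF N] AE_space
      proof eventually_elim
        case (elim \<omega>)
        have mm: "(\<lambda>b. ennreal (V A (key N \<omega>) b)) \<in> borel_measurable (PW D N \<omega>)" if "A \<in> ?P" for A
          by (rule measurable_compose[OF V_meas[OF elim(2,1) that] measurable_ennreal])
        have "\<Psi>1 \<omega> \<in> borel_measurable (PW D N \<omega>)"
          unfolding \<Psi>1_def[abs_def]
          by (intro borel_measurable_sum borel_measurable_times_ennreal mm borel_measurable_const)
        moreover have "(\<integral>\<^sup>+b. \<Psi>1 \<omega> b \<partial>PW D N \<omega>) =
           (\<Sum>A\<in>?P. \<integral>\<^sup>+b. ennreal (V A (key N \<omega>) b) * L.resample N U A (rs \<omega>) \<partial>PW D N \<omega>)"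
          unfolding \<Psi>1_def by (rule nn_integral_sum) (intro borel_measurable_times_ennreal mm borel_measurable_const)
        moreover have "\<dots> = (\<Sum>A\<in>?P. \<phi> A (key N \<omega>) * L.resample N U A (rs \<omega>))"
          unfolding \<phi>_key[OF elim(2,1)] by (intro sum.cong refl nn_integral_multc mm)
        ultimately show ?case by simp
      qed
      show "(\<integral>\<^sup>+\<omega>. (\<Sum>A\<in>?P. \<phi> A (key N \<omega>) * L.resample N U A (rs \<omega>)) \<partial>data D) \<le> ennreal t"
        unfolding rs_def using nn_integral_resample_average_le[OF N U, of \<phi>] \<phi>_le U_le by (meson order_trans)
    qed
  qed

  have m2: "mean_le D N \<Psi>2 (ennreal t)"
  proof (rule mean_leI[of "\<lambda>\<omega>. L.resample N U {} (rs \<omega>)"])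
    show "(\<lambda>\<omega>. L.resample N U {} (rs \<omega>)) \<in> borel_measurable (data D)"
      unfolding rs_def by (intro measurable_data_restrict res_meas) simp
    show "AE \<omega> in data D. \<Psi>2 \<omega> \<in> borel_measurable (PW D N \<omega>) \<and> (\<integral>\<^sup>+b. \<Psi>2 \<omega> b \<partial>PW D N \<omega>) \<le> L.resample N U {} (rs \<omega>)"
    proof (rule AE_I2)
      fix \<omega>
      interpret PWr: prob_space "PW D N \<omega>" by (rule PW_prob)
      show "\<Psi>2 \<omega> \<in> borel_measurable (PW D N \<omega>) \<and> (\<integral>\<^sup>+b. \<Psi>2 \<omega> b \<partial>PW D N \<omega>) \<le> L.resample N U {} (rs \<omega>)"
        by (simp add: \<Psi>2_def[abs_def] PWr.emeasure_space_1)
    qed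
    have "(\<integral>\<^sup>+\<omega>. L.resample N U {} (rs \<omega>) \<partial>data D) = (\<integral>\<^sup>+x. 1 * L.resample N U {} x \<partial>PN N)"
      unfolding rs_def by (subst nn_integral_data_restrict[OF res_meas]) auto
    also have "\<dots> \<le> (\<integral>\<^sup>+x. 1 * U x \<partial>PN N)"
      by (rule L.nn_integral_resample_le[OF _ U]) auto
    finally show "(\<integral>\<^sup>+\<omega>. L.resample N U {} (rs \<omega>) \<partial>data D) \<le> ennreal t" using U_le by simp
  qed

  \<comment> \<open>Two errors enter a stratum total: the weights around the stratum count, and the
    count around \<open>N * nu j\<close>. Each is of order \<open>sqrt N\<close> in mean, and
    \<open>\<kappa>\<close> carries the compensating \<open>1 / sqrt N\<close>.\<close>
  have m3: "mean_le D N \<Psi>3 (ennreal ((\<Sum>j\<in>UNIV. 4 * (K + 1) / L.nu j) * t))"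
  proof -
    define H where "H j x = ennreal \<bar>\<Sum>i<N. of_bool (lab (x i) = j) - L.nu j\<bar>" for j x
    have H: "H j \<in> borel_measurable (PN N)" for j unfolding H_def by measurable
    show ?thesis
    proof (rule mean_leI[of "\<lambda>\<omega>. \<Sum>j\<in>UNIV. ennreal (\<kappa> j) * (ennreal (K * sqrt (real N)) + H j (rs \<omega>))"])
      show "(\<lambda>\<omega>. \<Sum>j\<in>UNIV. ennreal (\<kappa> j) * (ennreal (K * sqrt (real N)) + H j (rs \<omega>))) \<in> borel_measurable (data D)"
        unfolding rs_def
        by (intro borel_measurable_sum borel_measurable_times_ennreal borel_measurable_add borel_measurable_const measurable_data_restrict H)
      show "AE \<omega> in data D. \<Psi>3 \<omega> \<in> borel_measurable (PW D N \<omega>) \<and>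
         (\<integral>\<^sup>+b. \<Psi>3 \<omega> b \<partial>PW D N \<omega>) \<le> (\<Sum>j\<in>UNIV. ennreal (\<kappa> j) * (ennreal (K * sqrt (real N)) + H j (rs \<omega>)))"
        using AE_good[OF N] AE_space
      proof eventually_elim
        case (elim \<omega>)
        interpret PWr: prob_space "PW D N \<omega>" by (rule PW_prob)
        have cm: "(\<lambda>b. Cj (key N \<omega>) b j) \<in> borel_measurable (PW D N \<omega>)" for j
          unfolding Cj_def by (intro borel_measurable_sum c_meas elim) (auto simp: members_of_def)
        have mm: "(\<lambda>b. ennreal (\<kappa> j) * ennreal \<bar>Cj (key N \<omega>) b j - real N * L.nu j\<bar>) \<in> borel_measurable (PW D N \<omega>)" for j
          by (intro borel_measurable_times_ennreal borel_measurable_const measurable_compose[OF _ measurable_ennreal]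
              borel_measurable_abs borel_measurable_diff cm)
        have "real (cnt N (fst (key N \<omega>)) j) - real N * L.nu j = (\<Sum>i<N. of_bool (lab (rs \<omega> i) = j) - L.nu j)" for j
        proof -
          have "(\<Sum>i<N. of_bool (lab (rs \<omega> i) = j) :: real) = (\<Sum>i\<in>members_of N (fst (key N \<omega>)) j. 1)"
            by (rule sum.mono_neutral_cong_right) (auto simp: members_of_def key_def labels_def rs_def)
          then show ?thesis by (simp add: sum_subtractf card_members_of)
        qed
        then have Hr: "H j (rs \<omega>) = ennreal \<bar>real (cnt N (fst (key N \<omega>)) j) - real N * L.nu j\<bar>" for j
          by (simp add: H_def)
        have one: "(\<integral>\<^sup>+b. ennreal \<bar>Cj (key N \<omega>) b j - real N * L.nu j\<bar> \<partial>PW D N \<omega>)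
            \<le> ennreal (K * sqrt (real N)) + H j (rs \<omega>)" for j
        proof -
          let ?n = "real (cnt N (fst (key N \<omega>)) j)"
          have "(\<integral>\<^sup>+b. ennreal \<bar>Cj (key N \<omega>) b j - real N * L.nu j\<bar> \<partial>PW D N \<omega>)
            \<le> (\<integral>\<^sup>+b. ennreal \<bar>Cj (key N \<omega>) b j - ?n\<bar> + H j (rs \<omega>) \<partial>PW D N \<omega>)"
            unfolding Hr by (intro nn_integral_mono) (simp add: ennreal_plus[symmetric] ennreal_leI del: ennreal_plus)
          also have "\<dots> = (\<integral>\<^sup>+b. ennreal \<bar>Cj (key N \<omega>) b j - ?n\<bar> \<partial>PW D N \<omega>) + H j (rs \<omega>)"
            by (subst nn_integral_add)
               (auto simp: PWr.emeasure_space_1 intro!: measurable_compose[OF _ measurable_ennreal] borel_measurable_abs borel_measurable_diff cm)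
          also have "\<dots> \<le> ennreal (K * sqrt (real N)) + H j (rs \<omega>)"
            by (intro add_right_mono c_sum elim)
          finally show ?thesis .
        qed
        have "\<Psi>3 \<omega> \<in> borel_measurable (PW D N \<omega>)"
          unfolding \<Psi>3_def[abs_def] by (intro borel_measurable_sum mm)
        moreover have "(\<integral>\<^sup>+b. \<Psi>3 \<omega> b \<partial>PW D N \<omega>) = (\<Sum>j\<in>UNIV. \<integral>\<^sup>+b. ennreal (\<kappa> j) * ennreal \<bar>Cj (key N \<omega>) b j - real N * L.nu j\<bar> \<partial>PW D N \<omega>)"
          unfolding \<Psi>3_def by (rule nn_integral_sum) (rule mm)
        moreover have "\<dots> = (\<Sum>j\<in>UNIV. ennreal (\<kappa> j) * (\<integral>\<^sup>+b. ennreal \<bar>Cj (key N \<omega>) b j - real N * L.nu j\<bar> \<partial>PW D N \<omega>))"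
          by (intro sum.cong refl nn_integral_cmult measurable_compose[OF _ measurable_ennreal]
              borel_measurable_abs borel_measurable_diff cm borel_measurable_const)
        moreover have "\<dots> \<le> (\<Sum>j\<in>UNIV. ennreal (\<kappa> j) * (ennreal (K * sqrt (real N)) + H j (rs \<omega>)))"
          by (intro sum_mono mult_left_mono one) simp
        ultimately show ?case by simp
      qed
      have Hm: "(\<lambda>\<omega>. H j (rs \<omega>)) \<in> borel_measurable (data D)" for j
        unfolding rs_def by (intro measurable_data_restrict H)
      have "(\<integral>\<^sup>+\<omega>. (\<Sum>j\<in>UNIV. ennreal (\<kappa> j) * (ennreal (K * sqrt (real N)) + H j (rs \<omega>))) \<partial>data D)
         = (\<Sum>j\<in>UNIV. \<integral>\<^sup>+\<omega>. ennreal (\<kappa> j) * (ennreal (K * sqrt (real N)) + H j (rs \<omega>)) \<partial>data D)"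
        by (rule nn_integral_sum) (intro borel_measurable_times_ennreal borel_measurable_add borel_measurable_const Hm)
      also have "\<dots> = (\<Sum>j\<in>UNIV. ennreal (\<kappa> j) * (ennreal (K * sqrt (real N)) + (\<integral>\<^sup>+x. H j x \<partial>PN N)))"
      proof (intro sum.cong refl)
        fix j
        show "(\<integral>\<^sup>+\<omega>. ennreal (\<kappa> j) * (ennreal (K * sqrt (real N)) + H j (rs \<omega>)) \<partial>data D)
          = ennreal (\<kappa> j) * (ennreal (K * sqrt (real N)) + (\<integral>\<^sup>+x. H j x \<partial>PN N))"
          using Hm[of j] nn_integral_data_restrict[OF H[of j]]
          by (simp add: nn_integral_cmult nn_integral_add data.emeasure_space_1 rs_def)
      qed
      also have "\<dots> \<le> (\<Sum>j\<in>UNIV. ennreal (\<kappa> j) * (ennreal (K * sqrt (real N)) + ennreal (sqrt (real N))))"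
        unfolding H_def by (intro sum_mono mult_left_mono add_left_mono nn_integral_count_deviation) simp
      also have "\<dots> = (\<Sum>j\<in>UNIV. ennreal (4 * (K + 1) / L.nu j * t))"
      proof (intro sum.cong refl)
        fix j
        have s: "sqrt (real N) > 0" using N by simp
        have "ennreal (\<kappa> j) * (ennreal (K * sqrt (real N)) + ennreal (sqrt (real N))) = ennreal (\<kappa> j * (K * sqrt (real N) + sqrt (real N)))"
          using \<kappa>0 K by (simp add: ennreal_mult ennreal_plus)
        also have "\<kappa> j * (K * sqrt (real N) + sqrt (real N)) = 4 * (K + 1) / L.nu j * t"
          using s nu_pos[of j] by (simp add: \<kappa>_def field_simps)
        finally show "ennreal (\<kappa> j) * (ennreal (K * sqrt (real N)) + ennreal (sqrt (real N))) = ennreal (4 * (K + 1) / L.nu j * t)" .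
      qed
      also have "\<dots> = ennreal ((\<Sum>j\<in>UNIV. 4 * (K + 1) / L.nu j) * t)"
        unfolding sum_distrib_right using t K nu_pos by (intro sum_ennreal) (simp add: less_imp_le)
      finally show "(\<integral>\<^sup>+\<omega>. (\<Sum>j\<in>UNIV. ennreal (\<kappa> j) * (ennreal (K * sqrt (real N)) + H j (rs \<omega>))) \<partial>data D)
        \<le> ennreal ((\<Sum>j\<in>UNIV. 4 * (K + 1) / L.nu j) * t)" .
    qed
  qed

  define \<Psi> where "\<Psi> \<omega> b = ennreal B * (\<Psi>1 \<omega> b + \<Psi>2 \<omega> b) + \<Psi>3 \<omega> b" for \<omega> b
  show ?thesis
  proof (rule that[of \<Psi>])
    have "mean_le D N \<Psi> (ennreal B * (ennreal t + ennreal t) + ennreal ((\<Sum>j\<in>UNIV. 4 * (K + 1) / L.nu j) * t))"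
      unfolding \<Psi>_def by (intro mean_le_add mean_le_cmult m1 m2 m3)
    moreover have "ennreal B * (ennreal t + ennreal t) + ennreal ((\<Sum>j\<in>UNIV. 4 * (K + 1) / L.nu j) * t)
       = ennreal (mult_const B K * t)"
    proof -
      have s: "0 \<le> (\<Sum>j\<in>UNIV. 4 * (K + 1) / L.nu j)"
        using K nu_pos by (intro sum_nonneg) (simp add: less_imp_le)
      have "ennreal B * (ennreal t + ennreal t) = ennreal (2 * B * t)"
        using t B by (simp add: ennreal_plus[symmetric] ennreal_mult[symmetric] mult_ac del: ennreal_plus)
      then show ?thesis using t B s
        by (simp add: mult_const_def ennreal_plus[symmetric] distrib_right del: ennreal_plus)
    qed
    ultimately show "mean_le D N \<Psi> (ennreal (mult_const B K * t))" by simp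
    show "AE \<omega> in data D. AE b in PW D N \<omega>. \<forall>f\<in>F.
       ennreal \<bar>\<Sum>i<N. c (key N \<omega>) b i * (f (fst \<omega> i) - Z.expectation f)\<bar> \<le> \<Psi> \<omega> b"
      using AE_good[OF N] AE_space
    proof eventually_elim
      case (elim \<omega>)
      have w: "fst \<omega> \<in> space (iid D)" using elim by (auto simp: space_data)
      let ?k = "key N \<omega>" and ?x = "rs \<omega>"
      have x: "?x \<in> space (PN N)" unfolding rs_def by (rule restrict_space[OF w])
      have xi: "?x i = fst \<omega> i" if "i < N" for i using that by (simp add: rs_def)
      have li: "fst ?k i = lab (fst \<omega> i)" if "i < N" for i using that by (simp add: key_def labels_def)
      show ?case
        using c_bd[OF elim(2,1)]
      proof eventually_elim
        case (elim b)
        show ?case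
        proof
          fix f assume f: "f \<in> F"
          note fi = F[OF f]
          let ?E = "Z.expectation f" and ?sm = "L.smean f"
          define \<xi> where "\<xi> i = c ?k b i / B" for i
          have ci: "c ?k b i = B * \<xi> i" for i using B by (simp add: \<xi>_def)
          have \<xi>: "min 1 (max 0 (\<xi> i)) = \<xi> i" if "i < N" for i
            using elim that B by (auto simp: \<xi>_def min_def max_def divide_le_eq)
          let ?a = "\<lambda>i. f (fst \<omega> i) - ?sm (lab (fst \<omega> i))"
          have "(\<Sum>i<N. c ?k b i * ?a i) = B * (\<Sum>i<N. min 1 (max 0 (\<xi> i)) * ?a i)"
            by (simp add: sum_distrib_left ci \<xi> mult.assoc)
          also have "(\<Sum>i<N. min 1 (max 0 (\<xi> i)) * ?a i) = (\<Sum>A\<in>?P. V A ?k b * sum ?a A)"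
            unfolding V_def \<xi>_def by (rule sum_vertex_weight_sum[symmetric]) simp
          finally have e1: "(\<Sum>i<N. c ?k b i * ?a i) = B * (\<Sum>A\<in>?P. V A ?k b * sum ?a A)" .
          have b1: "ennreal \<bar>\<Sum>i<N. c ?k b i * ?a i\<bar> \<le> ennreal B * (\<Psi>1 \<omega> b + \<Psi>2 \<omega> b)"
          proof -
            have "\<bar>\<Sum>A\<in>?P. V A ?k b * sum ?a A\<bar> \<le> (\<Sum>A\<in>?P. V A ?k b * \<bar>sum ?a A\<bar>)"
              by (rule order_trans[OF sum_abs]) (simp add: abs_mult V0)
            then have "ennreal \<bar>\<Sum>i<N. c ?k b i * ?a i\<bar> \<le> ennreal (B * (\<Sum>A\<in>?P. V A ?k b * \<bar>sum ?a A\<bar>))"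
              unfolding e1 using B by (intro ennreal_leI) (simp add: abs_mult)
            also have "\<dots> = ennreal B * (\<Sum>A\<in>?P. ennreal (V A ?k b) * ennreal \<bar>sum ?a A\<bar>)"
            proof -
              have "ennreal (\<Sum>A\<in>?P. V A ?k b * \<bar>sum ?a A\<bar>) = (\<Sum>A\<in>?P. ennreal (V A ?k b * \<bar>sum ?a A\<bar>))"
                by (rule sum_ennreal[symmetric]) (simp add: V0)
              also have "\<dots> = (\<Sum>A\<in>?P. ennreal (V A ?k b) * ennreal \<bar>sum ?a A\<bar>)"
                by (intro sum.cong refl ennreal_mult V0) auto
              finally show ?thesis
                using B by (subst ennreal_mult) (auto intro!: sum_nonneg mult_nonneg_nonneg V0)
            qed
            also have "\<dots> \<le> ennreal B * (\<Sum>A\<in>?P. ennreal (V A ?k b) * (L.resample N U A ?x + L.resample N U {} ?x))"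
            proof (intro mult_left_mono sum_mono)
              fix A assume A: "A \<in> ?P"
              have "sum ?a A = (\<Sum>i\<in>A. f (?x i) - ?sm (lab (?x i)))"
                using A by (intro sum.cong refl) (auto simp: xi subset_eq)
              then show "ennreal \<bar>sum ?a A\<bar> \<le> L.resample N U A ?x + L.resample N U {} ?x"
                using L.resample_centered_ge[OF _ fi UF[OF f] x nu_pos, of A] A by simp
            qed auto
            also have "(\<Sum>A\<in>?P. ennreal (V A ?k b) * (L.resample N U A ?x + L.resample N U {} ?x))
               = \<Psi>1 \<omega> b + (\<Sum>A\<in>?P. ennreal (V A ?k b)) * L.resample N U {} ?x"
              by (simp add: \<Psi>1_def distrib_left sum.distrib sum_distrib_right)
            also have "(\<Sum>A\<in>?P. ennreal (V A ?k b)) = 1"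
              by (subst sum_ennreal) (simp_all add: V0 V1)
            finally show ?thesis by (simp add: \<Psi>2_def)
          qed
          have dev: "\<bar>?sm j - ?E\<bar> \<le> \<kappa> j" for j
          proof -
            have s: "sqrt (real N) > 0" using N by simp
            have "real N * Z.expectation (\<lambda>z. \<bar>f z - ?E\<bar>) \<le> 4 * sqrt (real N) * t"
              using Z.expectation_abs_deviation_le[OF _ fi U UF[OF f] U_le t] by simp
            moreover have "sqrt (real N) * (sqrt (real N) * Z.expectation (\<lambda>z. \<bar>f z - ?E\<bar>))
                = real N * Z.expectation (\<lambda>z. \<bar>f z - ?E\<bar>)"
              by (simp only: mult.assoc[symmetric] real_sqrt_mult_self abs_of_nat)
            moreover have "4 * sqrt (real N) * t = sqrt (real N) * (4 * t)" by simp
            ultimately have "sqrt (real N) * (sqrt (real N) * Z.expectation (\<lambda>z. \<bar>f z - ?E\<bar>)) \<le> sqrt (real N) * (4 * t)"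
              by linarith
            then have "sqrt (real N) * Z.expectation (\<lambda>z. \<bar>f z - ?E\<bar>) \<le> 4 * t" using s by simp
            then have "Z.expectation (\<lambda>z. \<bar>f z - ?E\<bar>) / L.nu j \<le> (4 * t / sqrt (real N)) / L.nu j"
              using s nu_pos[of j] by (intro divide_right_mono) (auto simp: field_simps less_imp_le)
            then show ?thesis using L.smean_deviation[OF fi nu_pos[of j]] by (simp add: \<kappa>_def)
          qed
          \<comment> \<open>The \<open>nu\<close>-average of the deviations
            \<open>smean j - E\<close> is 0, so \<open>N * nu j\<close> may be subtracted from each
            stratum total.\<close>
          have e2: "(\<Sum>i<N. c ?k b i * (?sm (lab (fst \<omega> i)) - ?E)) = (\<Sum>j\<in>UNIV. (Cj ?k b j - real N * L.nu j) * (?sm j - ?E))"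
          proof -
            have "(\<Sum>i<N. c ?k b i * (?sm (lab (fst \<omega> i)) - ?E))
              = (\<Sum>j\<in>UNIV. \<Sum>i\<in>members_of N (fst ?k) j. c ?k b i * (?sm (lab (fst \<omega> i)) - ?E))"
              by (rule sum_by_label[symmetric])
            also have "\<dots> = (\<Sum>j\<in>UNIV. Cj ?k b j * (?sm j - ?E))"
              unfolding Cj_def sum_distrib_right
              by (intro sum.cong refl) (auto simp: members_of_def li)
            also have "\<dots> = (\<Sum>j\<in>UNIV. (Cj ?k b j - real N * L.nu j) * (?sm j - ?E))
               + real N * (\<Sum>j\<in>UNIV. L.nu j * ?sm j - L.nu j * ?E)"
              by (simp add: sum_distrib_left sum.distrib[symmetric] algebra_simps)
            also have "(\<Sum>j\<in>UNIV. L.nu j * ?sm j - L.nu j * ?E) = 0"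
              using L.sum_nu_smean[OF fi nu_pos] L.sum_nu by (simp add: sum_subtractf flip: sum_distrib_right)
            finally show ?thesis by simp
          qed
          have b2: "ennreal \<bar>\<Sum>i<N. c ?k b i * (?sm (lab (fst \<omega> i)) - ?E)\<bar> \<le> \<Psi>3 \<omega> b"
          proof -
            have "\<bar>\<Sum>j\<in>UNIV. (Cj ?k b j - real N * L.nu j) * (?sm j - ?E)\<bar> \<le> (\<Sum>j\<in>UNIV. \<kappa> j * \<bar>Cj ?k b j - real N * L.nu j\<bar>)"
            proof (rule order_trans[OF sum_abs sum_mono])
              fix j
              have "\<bar>Cj ?k b j - real N * L.nu j\<bar> * \<bar>?sm j - ?E\<bar> \<le> \<bar>Cj ?k b j - real N * L.nu j\<bar> * \<kappa> j"
                by (intro mult_left_mono dev) simp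
              then show "\<bar>(Cj ?k b j - real N * L.nu j) * (?sm j - ?E)\<bar> \<le> \<kappa> j * \<bar>Cj ?k b j - real N * L.nu j\<bar>"
                by (simp add: abs_mult mult.commute)
            qed
            then have "ennreal \<bar>\<Sum>i<N. c ?k b i * (?sm (lab (fst \<omega> i)) - ?E)\<bar>
               \<le> ennreal (\<Sum>j\<in>UNIV. \<kappa> j * \<bar>Cj ?k b j - real N * L.nu j\<bar>)"
              unfolding e2 by (rule ennreal_leI)
            also have "\<dots> = \<Psi>3 \<omega> b"
            proof -
              have "ennreal (\<Sum>j\<in>UNIV. \<kappa> j * \<bar>Cj ?k b j - real N * L.nu j\<bar>)
                  = (\<Sum>j\<in>UNIV. ennreal (\<kappa> j * \<bar>Cj ?k b j - real N * L.nu j\<bar>))"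
                by (rule sum_ennreal[symmetric]) (simp add: \<kappa>0)
              also have "\<dots> = \<Psi>3 \<omega> b"
                unfolding \<Psi>3_def by (intro sum.cong refl ennreal_mult \<kappa>0) auto
              finally show ?thesis .
            qed
            finally show ?thesis .
          qed
          have "(\<Sum>i<N. c ?k b i * (f (fst \<omega> i) - ?E)) = (\<Sum>i<N. c ?k b i * ?a i) + (\<Sum>i<N. c ?k b i * (?sm (lab (fst \<omega> i)) - ?E))"
            by (simp add: sum.distrib[symmetric] algebra_simps)
          then have "ennreal \<bar>\<Sum>i<N. c ?k b i * (f (fst \<omega> i) - ?E)\<bar>
            \<le> ennreal \<bar>\<Sum>i<N. c ?k b i * ?a i\<bar> + ennreal \<bar>\<Sum>i<N. c ?k b i * (?sm (lab (fst \<omega> i)) - ?E)\<bar>"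
            by (simp add: ennreal_plus[symmetric] ennreal_leI del: ennreal_plus)
          also have "\<dots> \<le> \<Psi> \<omega> b" unfolding \<Psi>_def by (intro add_mono b1 b2)
          finally show "ennreal \<bar>\<Sum>i<N. c ?k b i * (f (fst \<omega> i) - ?E)\<bar> \<le> \<Psi> \<omega> b" .
        qed
      qed
    qed
  qed
qed

end

section \<open>Consequences for total weights and single functions\<close>

context boot_weights
begin

text \<open>In a null stratum almost every sequence has no unit at all, so the observed sampling
  fraction is \<open>0 / 0\<close>, which evaluates to 0 for every \<open>N\<close>. Its limit would
  be 0, whereas \<open>plim j\<close> is positive.\<close>

lemma nu_pos: "L.nu j > 0"
proof (rule ccontr)
  assume "\<not> L.nu j > 0"
  then have "Z.prob {z \<in> space Z. lab z = j} = 0"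
    using L.nu_nonneg[of j] unfolding L.nu_def by linarith
  then have "AE z in Z. lab z \<noteq> j"
    by (intro AE_I[of _ _ "{z \<in> space Z. lab z = j}"]) (auto simp: Z.emeasure_eq_measure)
  then have "AE w in iid D. lab (w i) \<noteq> j" for i :: nat
    unfolding iid_eq by (intro AE_PiM_component) (auto intro: Z.prob_space_axioms)
  then have "AE w in iid D. \<forall>i. lab (w i) \<noteq> j" by (simp add: AE_all_countable)
  moreover have "AE w in iid D. \<forall>j. (\<lambda>N. real (ncount D N w j) / real (Ncount D N w j)) \<longlonglongrightarrow> plim D j"
    using design by (simp add: two_phase_design_def)
  ultimately have "AE w in iid D. False"
    using AE_space
  proof eventually_elim
    case (elim w)
    have "members D N w j = {}" for N
      unfolding members_eq[OF elim(3)] using elim(1) by (auto simp: labels_def)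
    then have "(\<lambda>N. real (ncount D N w j) / real (Ncount D N w j)) = (\<lambda>N. 0)"
      by (simp add: Ncount_def)
    with elim(2)[THEN spec, of j] have "plim D j = 0" by (simp add: LIMSEQ_const_iff)
    moreover have "plim D j > 0" using design by (simp add: two_phase_design_def)
    ultimately show False by simp
  qed
  then show False by simp
qed

lemma cnt_sum: "(\<Sum>j\<in>UNIV. real (cnt N l j)) = real N"
  using sum_by_label[where N=N and l=l and h="\<lambda>_. 1"] by (simp add: card_members_of)

text \<open>A mean deviation of order \<open>sqrt N\<close> is negligible against
  \<open>\<epsilon> * N\<close>; the Markov bound is of order \<open>1 / sqrt N\<close>.\<close>

lemma negl_total_weight:
  assumes sch: "\<And>N. N \<ge> 1 \<Longrightarrow> scheme N (c N) B K" and \<epsilon>: "\<epsilon> > 0"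
  shows "negl D (\<lambda>N \<omega> b. \<bar>(\<Sum>i<N. c N (key N \<omega>) b i) - real N\<bar> > \<epsilon> * real N)"
proof -
  define T where "T N \<omega> b j = \<bar>(\<Sum>i\<in>members_of N (fst (key N \<omega>)) j. c N (key N \<omega>) b i) - real (cnt N (fst (key N \<omega>)) j)\<bar>" for N \<omega> b j
  define \<Xi> where "\<Xi> N \<omega> b = ennreal (1 / (\<epsilon> * real N)) * (\<Sum>j\<in>UNIV. ennreal (T N \<omega> b j))" for N \<omega> b
  define e where "e N = real CARD('j) * K * sqrt (real N) / (\<epsilon> * real N)" for N
  have K: "K \<ge> 0" using sch[of 1] by (simp add: scheme_def)
  have "negl D (\<lambda>N \<omega> b. 1 \<le> \<Xi> N \<omega> b)"
  proof (rule negl_markov)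
    show "eventually (\<lambda>N. mean_le D N (\<Xi> N) (ennreal (e N))) sequentially"
      using eventually_ge_at_top[of 1]
    proof eventually_elim
      case (elim N)
      show ?case
      proof (rule mean_leI[of "\<lambda>_. ennreal (e N)"])
        show "AE \<omega> in data D. \<Xi> N \<omega> \<in> borel_measurable (PW D N \<omega>) \<and> (\<integral>\<^sup>+b. \<Xi> N \<omega> b \<partial>PW D N \<omega>) \<le> ennreal (e N)"
          using AE_good[OF elim] AE_space
        proof eventually_elim
          case (elim \<omega>)
          have s: "\<And>i. i < N \<Longrightarrow> (\<lambda>b. c N (key N \<omega>) b i) \<in> borel_measurable (PW D N \<omega>)"
            "\<And>j. (\<integral>\<^sup>+b. ennreal (T N \<omega> b j) \<partial>PW D N \<omega>) \<le> ennreal (K * sqrt (real N))"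
            using sch[OF \<open>1 \<le> N\<close>] elim by (auto simp: scheme_def T_def)
          have m: "(\<lambda>b. ennreal (T N \<omega> b j)) \<in> borel_measurable (PW D N \<omega>)" for j
            unfolding T_def
            by (intro measurable_compose[OF _ measurable_ennreal] borel_measurable_abs borel_measurable_diff
                borel_measurable_sum borel_measurable_const s) (auto simp: members_of_def)
          have "(\<integral>\<^sup>+b. \<Xi> N \<omega> b \<partial>PW D N \<omega>) = ennreal (1 / (\<epsilon> * real N)) * (\<Sum>j\<in>UNIV. \<integral>\<^sup>+b. ennreal (T N \<omega> b j) \<partial>PW D N \<omega>)"
            unfolding \<Xi>_def using m
            by (subst nn_integral_cmult, intro borel_measurable_sum m) (subst nn_integral_sum, auto)
          also have "\<dots> \<le> ennreal (1 / (\<epsilon> * real N)) * (\<Sum>j\<in>(UNIV::'j set). ennreal (K * sqrt (real N)))"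
            by (intro mult_left_mono sum_mono s) simp
          also have "\<dots> = ennreal (1 / (\<epsilon> * real N)) * ennreal (real CARD('j) * (K * sqrt (real N)))"
            using K by (simp add: ennreal_mult' ennreal_of_nat_eq_real_of_nat)
          also have "\<dots> = ennreal (e N)"
            using \<epsilon> K by (subst ennreal_mult[symmetric]) (auto simp: e_def)
          finally show ?case
            unfolding \<Xi>_def[abs_def] by (intro conjI borel_measurable_times_ennreal borel_measurable_const borel_measurable_sum m) simp
        qed
      qed (auto simp: data.emeasure_space_1)
    qed
    have "(\<lambda>N. real CARD('j) * K / \<epsilon> * inverse (sqrt (real N))) \<longlonglongrightarrow> real CARD('j) * K / \<epsilon> * 0"
      by (intro tendsto_mult tendsto_const tendsto_inverse_0_at_top filterlim_compose[OF sqrt_at_top filterlim_real_sequentially])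
    moreover have "e = (\<lambda>N. real CARD('j) * K / \<epsilon> * inverse (sqrt (real N)))"
      unfolding e_def sqrt_divide_self_eq[OF of_nat_0_le_iff, symmetric] by simp
    ultimately show "e \<longlonglongrightarrow> 0" by simp
  qed
  then show ?thesis
  proof (rule negl_mono_pointwise, goal_cases)
    case 1
    show ?case
      using eventually_ge_at_top[of 1]
    proof eventually_elim
      case (elim N)
      show ?case
      proof (intro ballI impI)
        fix \<omega> b assume a: "\<bar>(\<Sum>i<N. c N (key N \<omega>) b i) - real N\<bar> > \<epsilon> * real N"
        have "(\<Sum>i<N. c N (key N \<omega>) b i) - real N
          = (\<Sum>j\<in>UNIV. (\<Sum>i\<in>members_of N (fst (key N \<omega>)) j. c N (key N \<omega>) b i) - real (cnt N (fst (key N \<omega>)) j))"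
          by (simp add: sum_subtractf sum_by_label cnt_sum)
        then have "\<bar>(\<Sum>i<N. c N (key N \<omega>) b i) - real N\<bar> \<le> (\<Sum>j\<in>UNIV. T N \<omega> b j)"
          unfolding T_def by simp
        with a have le: "\<epsilon> * real N \<le> (\<Sum>j\<in>UNIV. T N \<omega> b j)" by simp
        have "1 = ennreal (1 / (\<epsilon> * real N) * (\<epsilon> * real N))" using \<epsilon> elim by simp
        also have "\<dots> \<le> ennreal (1 / (\<epsilon> * real N) * (\<Sum>j\<in>UNIV. T N \<omega> b j))"
          using le \<epsilon> by (intro ennreal_leI mult_left_mono) auto
        also have "\<dots> = \<Xi> N \<omega> b"
          unfolding \<Xi>_def using \<epsilon> by (subst ennreal_mult, auto simp: T_def intro!: sum_nonneg)
        finally show "1 \<le> \<Xi> N \<omega> b" .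
      qed
    qed
  qed
qed

text \<open>The multiplier bound for the class \<open>{f}\<close>: for a bounded function the
  absolute centred sum is its own majorant, with mean at most \<open>s * sqrt N\<close>. All moments
  in the calibration equations are controlled through this root-N bound.\<close>

lemma negl_single_function:
  assumes sch: "\<And>N. N \<ge> 1 \<Longrightarrow> scheme N (c N) B K"
    and f: "f \<in> borel_measurable Z" and bd: "AE z in Z. \<bar>f z\<bar> \<le> b0"
    and L: "filterlim L at_top sequentially"
  shows "negl D (\<lambda>N \<omega> b. \<bar>\<Sum>i<N. c N (key N \<omega>) b i * (f (fst \<omega> i) - Z.expectation f)\<bar> > L N * sqrt (real N))"
proof -
  have fi: "integrable Z f" using f bd by (intro Z.integrable_const_bound[where B=b0]) auto
  define s where "s = \<bar>b0\<bar> + \<bar>Z.expectation f\<bar>"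
  have s0: "0 \<le> s" by (simp add: s_def)
  define U where "U N z = ennreal \<bar>\<Sum>i<N. f (z i) - Z.expectation f\<bar>" for N :: nat and z
  have U: "U N \<in> borel_measurable (PN N)" for N
    unfolding U_def using f by (intro measurable_compose[OF _ measurable_ennreal] borel_measurable_abs
      borel_measurable_sum borel_measurable_diff borel_measurable_const measurable_compose[OF measurable_component_singleton]) auto
  have sq: "AE z in Z. (f z - Z.expectation f)\<^sup>2 \<le> s\<^sup>2"
    using bd
  proof eventually_elim
    case (elim z)
    then have "\<bar>f z - Z.expectation f\<bar> \<le> \<bar>s\<bar>" by (simp add: s_def)
    then show ?case by (simp add: abs_le_square_iff)
  qed
  have U_le: "(\<integral>\<^sup>+x. U N x \<partial>PN N) \<le> ennreal (sqrt (real N) * s)" for N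
  proof -
    have "(\<integral>\<^sup>+x. U N x \<partial>PN N) \<le> ennreal (sqrt (real (card {..<N}) * s\<^sup>2))"
      unfolding U_def
    proof (rule nn_integral_abs_sum_centered_le[where g="\<lambda>i z. f z - Z.expectation f"])
      fix i :: nat
      show "integrable Z (\<lambda>z. f z - Z.expectation f)" using fi by simp
      show i2: "integrable Z (\<lambda>z. (f z - Z.expectation f)\<^sup>2)"
        using sq f by (intro Z.integrable_const_bound[where B="s\<^sup>2"]) auto
      show "(\<integral>z. f z - Z.expectation f \<partial>Z) = 0" using fi by (simp add: Z.prob_space)
      have "(\<integral>z. (f z - Z.expectation f)\<^sup>2 \<partial>Z) \<le> (\<integral>z. s\<^sup>2 \<partial>Z)" using sq i2 by (intro integral_mono_AE) auto
      then show "(\<integral>z. (f z - Z.expectation f)\<^sup>2 \<partial>Z) \<le> s\<^sup>2" by (simp add: Z.prob_space)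
    qed (auto intro: Z.prob_space_axioms)
    then show ?thesis using s0 by (simp add: real_sqrt_mult)
  qed
  have "\<exists>\<Psi>. mean_le D N \<Psi> (ennreal (mult_const B K * (sqrt (real N) * s))) \<and>
    (AE \<omega> in data D. AE b in PW D N \<omega>. ennreal \<bar>\<Sum>i<N. c N (key N \<omega>) b i * (f (fst \<omega> i) - Z.expectation f)\<bar> \<le> \<Psi> \<omega> b)"
    if N: "N \<ge> 1" for N
  proof -
    obtain \<Psi> where "mean_le D N \<Psi> (ennreal (mult_const B K * (sqrt (real N) * s)))"
      "AE \<omega> in data D. AE b in PW D N \<omega>. \<forall>g\<in>{f}. ennreal \<bar>\<Sum>i<N. c N (key N \<omega>) b i * (g (fst \<omega> i) - Z.expectation g)\<bar> \<le> \<Psi> \<omega> b"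
      by (rule multiplier_bound[OF N sch[OF N] nu_pos U U_le, of "{f}"]) (use s0 fi in \<open>auto simp: U_def\<close>)
    then show ?thesis by auto
  qed
  then have "\<forall>N. \<exists>\<Psi>. N \<ge> 1 \<longrightarrow> mean_le D N \<Psi> (ennreal (mult_const B K * (sqrt (real N) * s))) \<and>
    (AE \<omega> in data D. AE b in PW D N \<omega>. ennreal \<bar>\<Sum>i<N. c N (key N \<omega>) b i * (f (fst \<omega> i) - Z.expectation f)\<bar> \<le> \<Psi> \<omega> b)"
    by blast
  from choice[OF this] obtain \<Psi> where \<Psi>: "\<forall>N. N \<ge> 1 \<longrightarrow> mean_le D N (\<Psi> N) (ennreal (mult_const B K * (sqrt (real N) * s))) \<and>
    (AE \<omega> in data D. AE b in PW D N \<omega>. ennreal \<bar>\<Sum>i<N. c N (key N \<omega>) b i * (f (fst \<omega> i) - Z.expectation f)\<bar> \<le> \<Psi> N \<omega> b)" ..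
  have L1: "eventually (\<lambda>N. L N \<ge> 1 \<and> N \<ge> 1) sequentially"
    using L eventually_ge_at_top[of 1] by (auto simp: filterlim_at_top intro: eventually_conj)
  have "negl D (\<lambda>N \<omega> b. 1 \<le> ennreal (1 / (L N * sqrt (real N))) * \<Psi> N \<omega> b)"
  proof (rule negl_markov)
    show "eventually (\<lambda>N. mean_le D N (\<lambda>\<omega> b. ennreal (1 / (L N * sqrt (real N))) * \<Psi> N \<omega> b)
        (ennreal (mult_const B K * s * inverse (L N)))) sequentially"
      using L1
    proof eventually_elim
      case (elim N)
      have "mean_le D N (\<lambda>\<omega> b. ennreal (1 / (L N * sqrt (real N))) * \<Psi> N \<omega> b)
        (ennreal (1 / (L N * sqrt (real N))) * ennreal (mult_const B K * (sqrt (real N) * s)))"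
        using \<Psi> elim by (intro mean_le_cmult) auto
      moreover have "ennreal (1 / (L N * sqrt (real N))) * ennreal (mult_const B K * (sqrt (real N) * s))
        = ennreal (1 / (L N * sqrt (real N)) * (mult_const B K * (sqrt (real N) * s)))"
        using elim by (intro ennreal_mult'[symmetric]) auto
      moreover have "1 / (L N * sqrt (real N)) * (mult_const B K * (sqrt (real N) * s)) = mult_const B K * s * inverse (L N)"
        using elim by (simp add: field_simps)
      ultimately show ?case by simp
    qed
    have "(\<lambda>N. mult_const B K * s * inverse (L N)) \<longlonglongrightarrow> mult_const B K * s * 0"
      by (intro tendsto_mult tendsto_const tendsto_inverse_0_at_top L)
    then show "(\<lambda>N. mult_const B K * s * inverse (L N)) \<longlonglongrightarrow> 0" by simp
  qed
  then show ?thesis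
  proof (rule negl_mono, goal_cases)
    case 1
    show ?case
      using L1
    proof eventually_elim
      case (elim N)
      then have N: "N \<ge> 1" by simp
      have "AE \<omega> in data D. AE b in PW D N \<omega>. ennreal \<bar>\<Sum>i<N. c N (key N \<omega>) b i * (f (fst \<omega> i) - Z.expectation f)\<bar> \<le> \<Psi> N \<omega> b"
        using \<Psi> N by blast
      then show ?case
      proof eventually_elim
        case (elim \<omega>)
        then show ?case
        proof eventually_elim
        case (elim b)
        show ?case
        proof
          assume a: "\<bar>\<Sum>i<N. c N (key N \<omega>) b i * (f (fst \<omega> i) - Z.expectation f)\<bar> > L N * sqrt (real N)"
          have p: "L N * sqrt (real N) > 0" using \<open>1 \<le> L N \<and> 1 \<le> N\<close> by simp
          have "1 = ennreal (1 / (L N * sqrt (real N))) * ennreal (L N * sqrt (real N))"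
            using p \<open>1 \<le> L N \<and> 1 \<le> N\<close> by (subst ennreal_mult[symmetric]) (auto simp: less_imp_neq[THEN not_sym])
          also have "\<dots> \<le> ennreal (1 / (L N * sqrt (real N))) * \<Psi> N \<omega> b"
            using a by (intro mult_left_mono order_trans[OF ennreal_leI elim]) auto
          finally show "1 \<le> ennreal (1 / (L N * sqrt (real N))) * \<Psi> N \<omega> b" .
        qed
        qed
      qed
    qed
  qed
qed

text \<open>A strict inequality for the infimum yields an actual majorant. The factor
  \<open>sqrt N\<close> converts the empirical process into the sum of centred values.\<close>

lemma majorant_of_outer_expectation:
  assumes T: "outer_expectation (iid D) T < ennreal \<tau>"
    and Tf: "\<And>f w. f \<in> F \<Longrightarrow> w \<in> space (iid D) \<Longrightarrow>
      ennreal \<bar>sqrt (real N) * (empirical N w f - Z.expectation f)\<bar> \<le> T w"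
  obtains U where "U \<in> borel_measurable (PN N)" "(\<integral>\<^sup>+x. U x \<partial>PN N) \<le> ennreal (sqrt (real N) * \<tau>)"
    "\<And>f z. f \<in> F \<Longrightarrow> z \<in> space (PN N) \<Longrightarrow> ennreal \<bar>\<Sum>i<N. f (z i) - Z.expectation f\<bar> \<le> U z"
proof -
  obtain U0 where U0: "U0 \<in> borel_measurable (iid D)" "\<And>w. w \<in> space (iid D) \<Longrightarrow> T w \<le> U0 w"
    "(\<integral>\<^sup>+w. U0 w \<partial>iid D) < ennreal \<tau>"
    using T unfolding outer_expectation_def INF_less_iff by auto
  obtain U' where U': "U' \<in> borel_measurable (PN N)"
    "(\<integral>\<^sup>+x. U' x \<partial>PN N) = (\<integral>\<^sup>+w. U0 w \<partial>iid D)"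
    "\<And>z t. z \<in> space (PN N) \<Longrightarrow> (\<And>w. w \<in> space (iid D) \<Longrightarrow> (\<And>i. i < N \<Longrightarrow> w i = z i) \<Longrightarrow> t \<le> U0 w) \<Longrightarrow> t \<le> U' z"
    using Z.finite_dim_majorant[of U0 N thesis] U0(1) unfolding iid_eq by blast
  show ?thesis
  proof (rule that[of "\<lambda>z. ennreal (sqrt (real N)) * U' z"])
    show "(\<lambda>z. ennreal (sqrt (real N)) * U' z) \<in> borel_measurable (PN N)" using U'(1) by simp
    show "(\<integral>\<^sup>+x. ennreal (sqrt (real N)) * U' x \<partial>PN N) \<le> ennreal (sqrt (real N) * \<tau>)"
    proof (subst nn_integral_cmult[OF U'(1)])
      have "ennreal (sqrt (real N)) * (\<integral>\<^sup>+x. U' x \<partial>PN N) \<le> ennreal (sqrt (real N)) * ennreal \<tau>"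
        using U0(3) unfolding U'(2) by (intro mult_left_mono) auto
      then show "ennreal (sqrt (real N)) * (\<integral>\<^sup>+x. U' x \<partial>PN N) \<le> ennreal (sqrt (real N) * \<tau>)"
        by (simp add: ennreal_mult')
    qed
    fix f z assume f: "f \<in> F" and z: "z \<in> space (PN N)"
    have "ennreal \<bar>sqrt (real N) * (empirical N z f - Z.expectation f)\<bar> \<le> U' z"
    proof (rule U'(3)[OF z])
      fix w assume w: "w \<in> space (iid D)" and "\<And>i. i < N \<Longrightarrow> w i = z i"
      then have "empirical N z f = empirical N w f" by (simp add: empirical_def)
      then show "ennreal \<bar>sqrt (real N) * (empirical N z f - Z.expectation f)\<bar> \<le> U0 w"
        using Tf[OF f w] U0(2)[OF w] by (auto intro: order_trans)
    qed
    then have "ennreal (sqrt (real N)) * ennreal \<bar>sqrt (real N) * (empirical N z f - Z.expectation f)\<bar>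
        \<le> ennreal (sqrt (real N)) * U' z" by (rule mult_left_mono) simp
    moreover have "(\<Sum>i<N. f (z i) - Z.expectation f) = sqrt (real N) * (sqrt (real N) * (empirical N z f - Z.expectation f))"
      unfolding mult.assoc[symmetric] by (cases "N = 0") (simp_all add: empirical_def sum_subtractf right_diff_distrib)
    ultimately show "ennreal \<bar>\<Sum>i<N. f (z i) - Z.expectation f\<bar> \<le> ennreal (sqrt (real N)) * U' z"
      by (simp add: abs_mult ennreal_mult)
  qed
qed

end

section \<open>Peeling\<close>

lemma dyadic_shell:
  fixes y :: real
  assumes "1 \<le> y"
  obtains n :: nat where "2 ^ n \<le> y" "y < 2 ^ Suc n"
proof -
  obtain m where m: "y < 2 ^ m" using real_arch_pow[of 2 y] by auto
  define k where "k = (LEAST m. y < 2 ^ m)"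
  have k: "y < 2 ^ k" unfolding k_def by (rule LeastI[of "\<lambda>m. y < 2 ^ m", OF m])
  have "k \<noteq> 0" using k assms by (cases k) auto
  then obtain n where n: "k = Suc n" by (cases k) auto
  have "\<not> y < 2 ^ n" using not_less_Least[of n "\<lambda>m. y < 2 ^ m"] n k_def by auto
  with k n show ?thesis by (intro that[of n]) auto
qed

lemma ennreal_mult_add_mult:
  assumes "0 \<le> x" "0 \<le> y" "0 \<le> z" "0 \<le> w"
  shows "ennreal x * (ennreal y + ennreal z * ennreal w) = ennreal (x * (y + z * w))"
  using assms by (simp add: ennreal_mult ennreal_plus)

lemma filterlim_powr_at_top:
  fixes p :: real
  assumes "p > 0"
  shows "filterlim (\<lambda>x. x powr p) at_top at_top"
proof -
  have "filterlim (\<lambda>x. exp (p * ln x)) at_top at_top"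
    using assms by (intro filterlim_compose[OF exp_at_top]
      filterlim_tendsto_pos_mult_at_top[OF tendsto_const] ln_at_top) auto
  moreover have "eventually (\<lambda>x. x powr p = exp (p * ln x)) at_top"
    using eventually_gt_at_top[of 0] by eventually_elim (simp add: powr_def)
  ultimately show ?thesis by (subst filterlim_cong[OF refl refl])
qed

context boot_weights
begin

text \<open>On the shell where \<open>r N * d\<close> lies between \<open>2 ^ n * T N\<close> and
  twice that, the margin pulls the criterion down by order \<open>N * d^2\<close>, so the centred
  sums must reach \<open>thr N n\<close>. The modulus bounds their mean, the ratios form a geometric
  series in \<open>n\<close>, and its sum vanishes as \<open>T N\<close> grows. The factors
  \<open>g\<close> stand for 1 or for the calibration factors; their distance from 1 enters through
  sums of absolute deviations.\<close>

theorem peeling: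
  fixes \<theta>hh :: "nat \<Rightarrow> (nat \<Rightarrow> 'x \<times> 'u) \<times> 's \<Rightarrow> weights \<Rightarrow> 't"
    and g :: "nat \<Rightarrow> (nat \<Rightarrow> 'x \<times> 'u) \<times> 's \<Rightarrow> weights \<Rightarrow> nat \<Rightarrow> real"
    and f :: "'t \<Rightarrow> 'x \<times> 'u \<Rightarrow> real"
  assumes f_int: "\<And>\<theta>. \<theta> \<in> \<Theta> \<Longrightarrow> integrable Z (f \<theta>)"
    and d0: "\<And>\<theta>. \<theta> \<in> \<Theta> \<Longrightarrow> 0 \<le> d \<theta> \<theta>0"
    and kappa: "\<kappa> > 0" "\<eta> > 0"
    and margin: "\<And>\<theta>. \<theta> \<in> \<Theta> \<Longrightarrow> d \<theta> \<theta>0 < \<eta> \<Longrightarrow> Z.expectation (f \<theta>) \<le> - \<kappa> * (d \<theta> \<theta>0)\<^sup>2"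
    and rate: "rate_function \<phi>"
    and K: "K > 0" "\<delta>0 > 0"
    and maj: "\<And>N \<delta> \<tau>. N \<ge> 1 \<Longrightarrow> 0 < \<delta> \<Longrightarrow> \<delta> < \<delta>0 \<Longrightarrow> 0 < \<tau> \<Longrightarrow> K * \<phi> N \<delta> < \<tau> \<Longrightarrow>
      \<exists>U\<in>borel_measurable (PN N). (\<integral>\<^sup>+x. U x \<partial>PN N) \<le> ennreal (sqrt (real N) * \<tau>) \<and>
        (\<forall>\<theta>\<in>\<Theta>. d \<theta> \<theta>0 < \<delta> \<longrightarrow> (\<forall>z\<in>space (PN N).
          ennreal \<bar>\<Sum>i<N. f \<theta> (z i) - Z.expectation (f \<theta>)\<bar> \<le> U z))"
    and r: "\<And>N. N \<ge> 1 \<Longrightarrow> 0 < r N \<and> (r N)\<^sup>2 * \<phi> N (1 / r N) \<le> sqrt (real N)"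
    and \<theta>hh: "\<And>N \<omega> b. \<theta>hh N \<omega> b \<in> \<Theta>"
    and R: "boot_OP D R"
    and near_max: "\<And>N \<omega> b. N \<ge> 1 \<Longrightarrow> \<omega> \<in> space (data D) \<Longrightarrow> b \<in> space (PW D N \<omega>) \<Longrightarrow>
      (\<Sum>i<N. fst b i * real (snd b i) * ipwk N (key N \<omega>) i * (g N \<omega> b i * f (\<theta>hh N \<omega> b) (fst \<omega> i)))
        \<ge> - (real N * (1 / (r N)\<^sup>2 * R N \<omega> b))"
    and g: "\<And>L. filterlim L at_top sequentially \<Longrightarrow>
      negl D (\<lambda>N \<omega> b. \<not> (\<forall>i<N. \<bar>g N \<omega> b i - 1\<bar> \<le> L N / sqrt (real N)))"
    and cons: "boot_oP D (\<lambda>N \<omega> b. d (\<theta>hh N \<omega> b) \<theta>0)"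
  shows "boot_OP D (\<lambda>N \<omega> b. r N * d (\<theta>hh N \<omega> b) \<theta>0)"
  unfolding boot_OP_iff_negl
proof (intro allI impI)
  fix T :: "nat \<Rightarrow> real" assume T: "filterlim T at_top sequentially"
  obtain a where a: "a < 2" and anti: "\<And>N. N \<ge> 1 \<Longrightarrow> antimono_on {0<..} (\<lambda>\<delta>. \<phi> N \<delta> / \<delta> powr a)"
    using rate by (auto simp: rate_function_def)
  define B where "B = Wmax * W2max / sig"
  define Kc where "Kc = (Wmax + 1) * (W2max / sig)"
  have sch: "scheme N (\<lambda>k b i. fst b i * real (snd b i) * ipwk N k i) B Kc" if "N \<ge> 1" for N
    unfolding B_def Kc_def by (rule scheme_W1W2[OF that])
  have B: "B > 0" using sch[of 1] by (simp add: scheme_def)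
  have Kc: "Kc \<ge> 0" using sch[of 1] by (simp add: scheme_def)
  define C where "C = mult_const B Kc"
  have C: "C \<ge> 0" unfolding C_def mult_const_def using B Kc nu_pos
    by (intro add_nonneg_nonneg sum_nonneg) (auto simp: less_imp_le)
  \<comment> \<open>Consistency confines \<open>d\<close> to at most \<open>\<epsilon>0\<close>; the
    outer radius of the shell is at most \<open>2 * d\<close> and so stays below
    \<open>\<delta>0\<close>, where the modulus is known.\<close>
  define \<epsilon>0 where "\<epsilon>0 = min \<eta> \<delta>0 / 3"
  have \<epsilon>0: "\<epsilon>0 > 0" "\<epsilon>0 < \<eta>" "2 * \<epsilon>0 < \<delta>0" using kappa K by (auto simp: \<epsilon>0_def)
  \<comment> \<open>Unbounded, as the hypothesis on \<open>g\<close> demands, yet slow enough that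
    \<open>l N * T N powr (a - 2) = T N powr ((a - 2) / 2)\<close> still tends to 0.\<close>
  define l where "l N = T N powr ((2 - a) / 2)" for N
  have l0: "0 \<le> l N" for N by (simp add: l_def)
  have l_top: "filterlim l at_top sequentially"
    unfolding l_def using a T by (intro filterlim_compose[OF filterlim_powr_at_top T]) auto
  let ?c = "\<lambda>N \<omega> b i. fst b i * real (snd b i) * ipwk N (key N \<omega>) i :: real"
  \<comment> \<open>A quarter of \<open>N * \<kappa> * d^2\<close> at the inner radius
    \<open>d = 2 ^ n * T N / r N\<close>: a half is given up because the total weight is only known
    to be at least \<open>N / 2\<close>, and a quarter goes to the near-maximality error.\<close>
  define thr where "thr N n = real N * \<kappa> * 4 ^ n * (T N)\<^sup>2 / (4 * (r N)\<^sup>2)" for N n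
  define \<delta> where "\<delta> N n = 2 ^ Suc n * T N / r N" for N n
  \<comment> \<open>Monotonicity of \<open>\<phi> N \<delta> / \<delta> powr a\<close> between
    \<open>1 / r N\<close> and the shell radius, together with the rate condition at
    \<open>1 / r N\<close>, bounds \<open>K * \<phi>\<close> by half of \<open>tau\<close>; the
    factor 2 makes the inequality strict.\<close>
  define tau where "tau N n = 2 * K * (2 ^ Suc n * T N) powr a * sqrt (real N) / (r N)\<^sup>2" for N n
  define q where "q = 2 powr (a - 2)"
  have q: "0 < q" "q < 1" using a powr_less_mono[of "a - 2" 0 2] by (auto simp: q_def)
  \<comment> \<open>This is \<open>(C + 4 * B * l N) * sqrt N * tau / thr\<close>. The exponent
    \<open>a\<close> of the modulus against the exponent 2 of the margin leaves the ratio
    \<open>q\<close> from one shell to the next.\<close>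
  define e where "e N n = (8 * K / \<kappa>) * (C + 4 * B * l N) * 2 powr a * T N powr (a - 2) * q ^ n" for N n
  define dominates where "dominates N n \<Psi> \<omega> b \<longleftrightarrow> (\<forall>\<theta>\<in>\<Theta>. d \<theta> \<theta>0 < \<delta> N n \<longrightarrow> \<delta> N n < \<delta>0 \<longrightarrow>
        ennreal (1 / thr N n) * (ennreal \<bar>\<Sum>i<N. ?c N \<omega> b i * (f \<theta> (fst \<omega> i) - Z.expectation (f \<theta>))\<bar>
          + ennreal (B * l N / sqrt (real N)) * ennreal (\<Sum>i<N. \<bar>f \<theta> (fst \<omega> i) - Z.expectation (f \<theta>)\<bar>))
        \<le> \<Psi> \<omega> b)" for N n \<Psi> \<omega> b
  define E where "E N n \<Psi> \<longleftrightarrow> mean_le D N \<Psi> (ennreal (e N n)) \<and>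
     (AE \<omega> in data D. AE b in PW D N \<omega>. dominates N n \<Psi> \<omega> b)" for N n \<Psi>
  have ex: "\<exists>\<Psi>. E N n \<Psi>" if N: "N \<ge> 1" and TN: "T N \<ge> 1" for N n
  proof (cases "\<delta> N n < \<delta>0")
    \<comment> \<open>A shell that reaches beyond \<open>\<delta>0\<close> imposes nothing, so the
      zero majorant serves.\<close>
    case False
    then show ?thesis by (intro exI[of _ "\<lambda>\<omega> b. 0"]) (simp add: E_def dominates_def mean_le_zero)
  next
    case True
    have rN: "r N > 0" using r[OF N] by simp
    have dpos: "\<delta> N n > 0" using rN TN by (simp add: \<delta>_def)
    have tpos: "tau N n > 0" using K N TN rN by (simp add: tau_def)
    have thrpos: "thr N n > 0" using N TN rN kappa by (simp add: thr_def)
    have ge1: "2 ^ Suc n * T N \<ge> 1"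
    proof -
      have "(1::real) * 1 \<le> 2 ^ Suc n * T N" using TN by (intro mult_mono) (auto intro: one_le_power simp del: power_Suc)
      then show ?thesis by simp
    qed
    have "1 / r N \<le> \<delta> N n" using ge1 rN by (simp add: \<delta>_def divide_right_mono del: power_Suc)
    then have "\<phi> N (\<delta> N n) / \<delta> N n powr a \<le> \<phi> N (1 / r N) / (1 / r N) powr a"
      using anti[OF N] rN dpos by (auto simp: monotone_on_def)
    then have "\<phi> N (\<delta> N n) \<le> \<phi> N (1 / r N) / (1 / r N) powr a * \<delta> N n powr a"
      using dpos by (simp add: divide_le_eq)
    also have "\<dots> = (2 ^ Suc n * T N) powr a * \<phi> N (1 / r N)"
    proof -
      have "(1 / r N) powr a = 1 / r N powr a" using rN by (simp add: powr_divide)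
      moreover have "\<delta> N n powr a = (2 ^ Suc n * T N) powr a / r N powr a"
        using rN ge1 by (simp add: \<delta>_def powr_divide del: power_Suc)
      moreover have "r N powr a \<noteq> 0" using rN by simp
      ultimately show ?thesis by simp
    qed
    also have "\<dots> \<le> (2 ^ Suc n * T N) powr a * (sqrt (real N) / (r N)\<^sup>2)"
      using r[OF N] by (intro mult_left_mono) (auto simp: field_simps)
    finally have "\<phi> N (\<delta> N n) \<le> (2 ^ Suc n * T N) powr a * (sqrt (real N) / (r N)\<^sup>2)" .
    then have "K * \<phi> N (\<delta> N n) \<le> K * ((2 ^ Suc n * T N) powr a * (sqrt (real N) / (r N)\<^sup>2))"
      using K by (intro mult_left_mono) auto
    also have "\<dots> = tau N n / 2" by (simp add: tau_def)
    finally have "K * \<phi> N (\<delta> N n) \<le> tau N n / 2" .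
    then have lt: "K * \<phi> N (\<delta> N n) < tau N n" using tpos by linarith
    obtain U where U: "U \<in> borel_measurable (PN N)" "(\<integral>\<^sup>+x. U x \<partial>PN N) \<le> ennreal (sqrt (real N) * tau N n)"
      "\<And>\<theta> z. \<theta> \<in> \<Theta> \<Longrightarrow> d \<theta> \<theta>0 < \<delta> N n \<Longrightarrow> z \<in> space (PN N) \<Longrightarrow>
          ennreal \<bar>\<Sum>i<N. f \<theta> (z i) - Z.expectation (f \<theta>)\<bar> \<le> U z"
      using maj[OF N dpos True tpos lt] by blast
    define F where "F = {f \<theta> | \<theta>. \<theta> \<in> \<Theta> \<and> d \<theta> \<theta>0 < \<delta> N n}"
    have F: "h \<in> F \<Longrightarrow> integrable Z h" for h by (auto simp: F_def f_int)
    have UF: "h \<in> F \<Longrightarrow> z \<in> space (PN N) \<Longrightarrow> ennreal \<bar>\<Sum>i<N. h (z i) - Z.expectation h\<bar> \<le> U z" for h z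
      by (auto simp: F_def U(3))
    define t where "t = sqrt (real N) * tau N n"
    have t0: "t \<ge> 0" using tpos by (simp add: t_def)
    obtain \<Psi>1 where \<Psi>1: "mean_le D N \<Psi>1 (ennreal (mult_const B Kc * t))"
      "AE \<omega> in data D. AE b in PW D N \<omega>. \<forall>h\<in>F. ennreal \<bar>\<Sum>i<N. ?c N \<omega> b i * (h (fst \<omega> i) - Z.expectation h)\<bar> \<le> \<Psi>1 \<omega> b"
      by (rule multiplier_bound[OF N sch[OF N] nu_pos U(1) U(2)[folded t_def] t0 F UF]) auto
    define A where "A = Z.abs_majorant {..<N} U"
    have A: "A \<in> borel_measurable (PN N)" unfolding A_def by (rule Z.measurable_abs_majorant[OF finite_lessThan U(1)])
    define \<Psi>2 :: "(nat \<Rightarrow> 'x \<times> 'u) \<times> 's \<Rightarrow> weights \<Rightarrow> ennreal" where "\<Psi>2 \<omega> b = A (restrict (fst \<omega>) {..<N})" for \<omega> b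
    have \<Psi>2: "mean_le D N \<Psi>2 (ennreal (4 * sqrt (real N) * t))"
    proof (rule mean_leI[of "\<lambda>\<omega>. A (restrict (fst \<omega>) {..<N})"])
      show "(\<lambda>\<omega>. A (restrict (fst \<omega>) {..<N})) \<in> borel_measurable (data D)"
        by (rule measurable_data_restrict[OF A])
      show "AE \<omega> in data D. \<Psi>2 \<omega> \<in> borel_measurable (PW D N \<omega>) \<and>
          (\<integral>\<^sup>+b. \<Psi>2 \<omega> b \<partial>PW D N \<omega>) \<le> A (restrict (fst \<omega>) {..<N})"
      proof (rule AE_I2)
        fix \<omega>
        interpret PWr: prob_space "PW D N \<omega>" by (rule PW_prob)
        show "\<Psi>2 \<omega> \<in> borel_measurable (PW D N \<omega>) \<and> (\<integral>\<^sup>+b. \<Psi>2 \<omega> b \<partial>PW D N \<omega>) \<le> A (restrict (fst \<omega>) {..<N})"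
          by (simp add: \<Psi>2_def[abs_def] PWr.emeasure_space_1)
      qed
      have "(\<integral>\<^sup>+\<omega>. A (restrict (fst \<omega>) {..<N}) \<partial>data D) \<le> ennreal (4 * sqrt (real N)) * (\<integral>\<^sup>+x. U x \<partial>PN N)"
        unfolding nn_integral_data_restrict[OF A] unfolding A_def
        using Z.nn_integral_abs_majorant_le[OF finite_lessThan U(1)] by simp
      also have "\<dots> \<le> ennreal (4 * sqrt (real N)) * ennreal t"
        using U(2) unfolding t_def by (rule mult_left_mono) simp
      also have "\<dots> = ennreal (4 * sqrt (real N) * t)" using t0 by (simp add: ennreal_mult)
      finally show "(\<integral>\<^sup>+\<omega>. A (restrict (fst \<omega>) {..<N}) \<partial>data D) \<le> ennreal (4 * sqrt (real N) * t)" .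
    qed
    define \<Psi> where "\<Psi> \<omega> b = ennreal (1 / thr N n) * (\<Psi>1 \<omega> b + ennreal (B * l N / sqrt (real N)) * \<Psi>2 \<omega> b)" for \<omega> b
    have "mean_le D N \<Psi> (ennreal (1 / thr N n) * (ennreal (mult_const B Kc * t) +
        ennreal (B * l N / sqrt (real N)) * ennreal (4 * sqrt (real N) * t)))"
      unfolding \<Psi>_def by (intro mean_le_cmult mean_le_add \<Psi>1 \<Psi>2)
    moreover have "ennreal (1 / thr N n) * (ennreal (mult_const B Kc * t) +
        ennreal (B * l N / sqrt (real N)) * ennreal (4 * sqrt (real N) * t)) = ennreal (e N n)"
    proof -
      have p: "0 \<le> 1 / thr N n" "0 \<le> C * t" "0 \<le> B * l N / sqrt (real N)" "0 \<le> 4 * sqrt (real N) * t"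
        using thrpos C t0 B l0[of N] by auto
      have "ennreal (1 / thr N n) * (ennreal (C * t) +
        ennreal (B * l N / sqrt (real N)) * ennreal (4 * sqrt (real N) * t))
        = ennreal (1 / thr N n * (C * t + B * l N / sqrt (real N) * (4 * sqrt (real N) * t)))"
        by (rule ennreal_mult_add_mult[OF p])
      moreover have "1 / thr N n * (C * t + B * l N / sqrt (real N) * (4 * sqrt (real N) * t)) = e N n"
      proof -
        have sN: "sqrt (real N) > 0" using N by simp
        have "B * l N / sqrt (real N) * (4 * sqrt (real N) * t) = 4 * B * l N * t" using sN by simp
        then have "1 / thr N n * (C * t + B * l N / sqrt (real N) * (4 * sqrt (real N) * t)) = (C + 4 * B * l N) * (t / thr N n)"
          by (simp add: distrib_right)
        also have "t / thr N n = (8 * K / \<kappa>) * ((2 ^ Suc n * T N) powr a / (4 ^ n * (T N)\<^sup>2))"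
        proof -
          have "t = real N * (2 * K * (2 ^ Suc n * T N) powr a / (r N)\<^sup>2)"
            using N by (simp add: t_def tau_def)
          then show ?thesis using N rN TN kappa unfolding thr_def by (simp add: field_simps)
        qed
        also have "(2 ^ Suc n * T N) powr a / (4 ^ n * (T N)\<^sup>2) = 2 powr a * T N powr (a - 2) * q ^ n"
        proof -
          have p2: "(2::real) ^ n = 2 powr real n" by (simp add: powr_realpow)
          have "(2 ^ Suc n * T N) powr a = 2 powr a * (2 powr real n) powr a * T N powr a"
            using TN by (simp add: powr_mult p2)
          moreover have "(4::real) ^ n = (2 powr real n) powr 2"
          proof -
            have "(4::real) ^ n = (2 ^ n)\<^sup>2" by (simp add: power_mult[symmetric] mult.commute[of n] power_mult)
            then show ?thesis by (simp add: p2 powr_numeral)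
          qed
          moreover have "(T N)\<^sup>2 = T N powr 2" using TN by (simp add: powr_numeral)
          moreover have "q ^ n = (2 powr real n) powr a / (2 powr real n) powr 2"
            unfolding q_def by (simp add: powr_realpow[symmetric] powr_powr powr_diff[symmetric] algebra_simps)
          moreover have "T N powr (a - 2) = T N powr a / T N powr 2" by (rule powr_diff)
          ultimately show ?thesis by (simp add: mult_ac)
        qed
        finally show ?thesis by (simp add: e_def mult_ac)
      qed
      ultimately show ?thesis by (simp add: C_def)
    qed
    ultimately have m: "mean_le D N \<Psi> (ennreal (e N n))" by simp
    have "AE \<omega> in data D. AE b in PW D N \<omega>. dominates N n \<Psi> \<omega> b"
      using \<Psi>1(2) AE_space
    proof eventually_elim
      case (elim \<omega>)
      have x: "restrict (fst \<omega>) {..<N} \<in> space (PN N)"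
        using elim(2) by (intro restrict_space) (auto simp: space_data)
      show ?case
        using elim(1)
      proof eventually_elim
        case (elim b)
        show ?case
          unfolding dominates_def
        proof (intro ballI impI)
          fix \<theta> assume th: "\<theta> \<in> \<Theta>" "d \<theta> \<theta>0 < \<delta> N n"
          then have hF: "f \<theta> \<in> F" by (auto simp: F_def)
          have "ennreal (\<Sum>i\<in>{..<N}. \<bar>f \<theta> (restrict (fst \<omega>) {..<N} i) - Z.expectation (f \<theta>)\<bar>) \<le> \<Psi>2 \<omega> b"
            unfolding \<Psi>2_def A_def
            by (rule Z.abs_majorant_ge[OF finite_lessThan f_int[OF th(1)] UF[OF hF] x])
          then have "ennreal (\<Sum>i<N. \<bar>f \<theta> (fst \<omega> i) - Z.expectation (f \<theta>)\<bar>) \<le> \<Psi>2 \<omega> b" by simp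
          then show "ennreal (1 / thr N n) * (ennreal \<bar>\<Sum>i<N. ?c N \<omega> b i * (f \<theta> (fst \<omega> i) - Z.expectation (f \<theta>))\<bar>
          + ennreal (B * l N / sqrt (real N)) * ennreal (\<Sum>i<N. \<bar>f \<theta> (fst \<omega> i) - Z.expectation (f \<theta>)\<bar>))
            \<le> \<Psi> \<omega> b"
            unfolding \<Psi>_def using elim hF by (intro mult_left_mono add_mono) auto
        qed
      qed
    qed
    with m show ?thesis by (auto simp: E_def)
  qed
  define \<Psi> where "\<Psi> N n = (SOME \<Psi>. E N n \<Psi>)" for N n
  have \<Psi>: "E N n (\<Psi> N n)" if "N \<ge> 1" "T N \<ge> 1" for N n
    unfolding \<Psi>_def by (rule someI_ex[OF ex[OF that]])
  have T1: "eventually (\<lambda>N. N \<ge> 1 \<and> T N \<ge> 1) sequentially"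
    using T eventually_ge_at_top[of 1] by (auto simp: filterlim_at_top intro: eventually_conj)
  define A where "A N = (8 * K / \<kappa>) * (C + 4 * B * l N) * 2 powr a * T N powr (a - 2)" for N
  have E6: "negl D (\<lambda>N \<omega> b. 1 \<le> (\<Sum>n. \<Psi> N n \<omega> b))"
  proof (rule negl_markov)
    show "eventually (\<lambda>N. mean_le D N (\<lambda>\<omega> b. \<Sum>n. \<Psi> N n \<omega> b) (ennreal (A N * (1 / (1 - q))))) sequentially"
      using T1
    proof eventually_elim
      case (elim N)
      have "mean_le D N (\<lambda>\<omega> b. \<Sum>n. \<Psi> N n \<omega> b) (\<Sum>n. ennreal (e N n))"
        using \<Psi>[of N] elim by (intro mean_le_suminf) (auto simp: E_def)
      moreover have "(\<Sum>n. ennreal (e N n)) = ennreal (A N * (1 / (1 - q)))"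
      proof -
        have A0: "0 \<le> A N" using K kappa C B l0[of N] by (simp add: A_def)
        have s: "(\<lambda>n. e N n) sums (A N * (1 / (1 - q)))"
          unfolding e_def A_def using q by (intro sums_mult geometric_sums) auto
        have "e N n = A N * q ^ n" for n by (simp add: e_def A_def)
        then have "0 \<le> e N n" for n using A0 q by simp
        then have "(\<Sum>n. ennreal (e N n)) = ennreal (\<Sum>n. e N n)"
          by (intro suminf_ennreal2) (use s in \<open>auto simp: sums_iff\<close>)
        then show ?thesis using s by (simp add: sums_iff)
      qed
      ultimately show ?case by simp
    qed
    have lim1: "((\<lambda>x. x powr (a - 2)) \<longlongrightarrow> 0) at_top" using a by (intro tendsto_neg_powr filterlim_ident) auto
    have lim2: "((\<lambda>x. x powr ((a - 2) / 2)) \<longlongrightarrow> 0) at_top" using a by (intro tendsto_neg_powr filterlim_ident) auto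
    have "(\<lambda>N. (8 * K / \<kappa>) * 2 powr a * (C * T N powr (a - 2) + 4 * B * T N powr ((a - 2) / 2)) * (1 / (1 - q)))
       \<longlonglongrightarrow> (8 * K / \<kappa>) * 2 powr a * (C * 0 + 4 * B * 0) * (1 / (1 - q))"
      by (intro tendsto_mult tendsto_add tendsto_const filterlim_compose[OF lim1 T] filterlim_compose[OF lim2 T])
    moreover have "(8 * K / \<kappa>) * 2 powr a * (C * T N powr (a - 2) + 4 * B * T N powr ((a - 2) / 2)) * (1 / (1 - q))
        = A N * (1 / (1 - q))" for N
    proof -
      have "l N * T N powr (a - 2) = T N powr ((2 - a) / 2 + (a - 2))" unfolding l_def by (rule powr_add[symmetric])
      also have "(2 - a) / 2 + (a - 2) = (a - 2) / 2" by (simp add: field_simps)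
      finally have "T N powr ((a - 2) / 2) = l N * T N powr (a - 2)" by simp
      then show ?thesis by (simp add: A_def algebra_simps)
    qed
    ultimately show "(\<lambda>N. A N * (1 / (1 - q))) \<longlonglongrightarrow> 0" by simp
  qed
  have T2: "filterlim (\<lambda>N. \<kappa> * (T N)\<^sup>2 / 4) at_top sequentially"
  proof -
    have "filterlim (\<lambda>N. (\<kappa> / 4) * (T N)\<^sup>2) at_top sequentially"
      using kappa by (intro filterlim_tendsto_pos_mult_at_top[OF tendsto_const] filterlim_pow_at_top T) auto
    then show ?thesis by simp
  qed
  have L4: "filterlim (\<lambda>N. sqrt (real N) / (4 * B)) at_top sequentially"
  proof -
    have "filterlim (\<lambda>N. (1 / (4 * B)) * sqrt (real N)) at_top sequentially"
      using B by (intro filterlim_tendsto_pos_mult_at_top[OF tendsto_const]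
        filterlim_compose[OF sqrt_at_top filterlim_real_sequentially]) auto
    then show ?thesis by simp
  qed
  have E1: "negl D (\<lambda>N \<omega> b. \<bar>d (\<theta>hh N \<omega> b) \<theta>0\<bar> > \<epsilon>0)"
    using cons \<epsilon>0 by (simp add: boot_oP_iff_negl)
  have E2: "negl D (\<lambda>N \<omega> b. \<bar>R N \<omega> b\<bar> > \<kappa> * (T N)\<^sup>2 / 4)"
    using R T2 unfolding boot_OP_iff_negl by blast
  note E3 = g[OF l_top]
  \<comment> \<open>\<open>T N\<close> may grow arbitrarily fast, so \<open>l N / sqrt N\<close>
    need not be small. This second instance bounds the distance of \<open>g\<close> from 1 by
    \<open>1 / (4 * B)\<close>, which protects the total weight.\<close>
  note E3' = g[OF L4]
  have E4: "negl D (\<lambda>N \<omega> b. \<bar>(\<Sum>i<N. ?c N \<omega> b i) - real N\<bar> > (1/4) * real N)"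
    using negl_total_weight[of "\<lambda>N k b i. fst b i * real (snd b i) * ipwk N k i" B Kc "1/4"] sch by simp
  define nice where "nice N \<omega> b \<longleftrightarrow> (\<forall>i<N. 0 \<le> ?c N \<omega> b i \<and> ?c N \<omega> b i \<le> B) \<and>
     (\<forall>n. dominates N n (\<Psi> N n) \<omega> b)" for N \<omega> b
  have E5: "negl D (\<lambda>N \<omega> b. \<not> nice N \<omega> b)"
  proof (rule negl_AE)
    show "eventually (\<lambda>N. AE \<omega> in data D. AE b in PW D N \<omega>. \<not> \<not> nice N \<omega> b) sequentially"
      using T1
    proof eventually_elim
      case (elim N)
      then have N: "N \<ge> 1" by simp
      have "AE \<omega> in data D. \<forall>n. AE b in PW D N \<omega>. dominates N n (\<Psi> N n) \<omega> b"
        unfolding AE_all_countable using \<Psi>[of N] elim by (auto simp: E_def)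
      then show ?case
        using AE_good[OF N] AE_space
      proof eventually_elim
        case (elim \<omega>)
        have 1: "AE b in PW D N \<omega>. \<forall>i<N. 0 \<le> ?c N \<omega> b i \<and> ?c N \<omega> b i \<le> B"
          using sch[OF N] elim(2,3) by (auto simp: scheme_def)
        have 2: "AE b in PW D N \<omega>. \<forall>n. dominates N n (\<Psi> N n) \<omega> b"
          unfolding AE_all_countable using elim(1) by blast
        show ?case using 1 2 unfolding nice_def by eventually_elim blast
      qed
    qed
  qed
  note neg = negl_disj[OF E1 negl_disj[OF E2 negl_disj[OF E3 negl_disj[OF E3' negl_disj[OF E4 negl_disj[OF E5 E6]]]]]]
  show "negl D (\<lambda>N \<omega> b. \<bar>r N * d (\<theta>hh N \<omega> b) \<theta>0\<bar> > T N)"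
  proof (rule negl_mono_pointwise[OF neg], goal_cases)
    case 1
    show ?case
      using T1
    proof eventually_elim
      case (elim N)
      then have N: "N \<ge> 1" and TN: "T N \<ge> 1" by auto
      have rN: "r N > 0" using r[OF N] by simp
      show ?case
      proof (intro ballI impI, rule ccontr, goal_cases)
        case (1 \<omega> b)
        note w = 1(1) and b = 1(2) and big = 1(3)
        let ?\<theta> = "\<theta>hh N \<omega> b"
        let ?d = "d ?\<theta> \<theta>0"
        from 1(4) have n1': "\<bar>?d\<bar> \<le> \<epsilon>0" and n2: "\<bar>R N \<omega> b\<bar> \<le> \<kappa> * (T N)\<^sup>2 / 4"
          and n3: "\<And>i. i < N \<Longrightarrow> \<bar>g N \<omega> b i - 1\<bar> \<le> l N / sqrt (real N)"
          and n3': "\<And>i. i < N \<Longrightarrow> \<bar>g N \<omega> b i - 1\<bar> \<le> sqrt (real N) / (4 * B) / sqrt (real N)"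
          and n4: "\<bar>(\<Sum>i<N. ?c N \<omega> b i) - real N\<bar> \<le> (1/4) * real N"
          and n5: "nice N \<omega> b" and n6: "\<not> 1 \<le> (\<Sum>n. \<Psi> N n \<omega> b)"
          unfolding de_Morgan_disj not_not not_less by blast+
        have n1: "?d \<le> \<epsilon>0" using n1' by simp
        have thT: "?\<theta> \<in> \<Theta>" by (rule \<theta>hh)
        have dge: "0 \<le> ?d" by (rule d0[OF thT])
        have cN: "0 \<le> ?c N \<omega> b i" "?c N \<omega> b i \<le> B" if "i < N" for i
          using n5 that by (auto simp: nice_def)
        have sN: "sqrt (real N) > 0" using N by simp
        have big': "T N < r N * ?d" using big dge rN by (simp add: abs_mult)
        have "1 \<le> r N * ?d / T N" using big' TN by simp
        then obtain n where n: "2 ^ n \<le> r N * ?d / T N" "r N * ?d / T N < 2 ^ Suc n"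
          by (rule dyadic_shell)
        have lo: "2 ^ n * T N \<le> r N * ?d" using n(1) TN by (simp add: pos_le_divide_eq)
        have hi: "r N * ?d < 2 ^ Suc n * T N" using n(2) TN by (simp add: pos_divide_less_eq del: power_Suc)
        have d_lt: "?d < \<delta> N n" using hi rN by (simp add: \<delta>_def pos_less_divide_eq mult.commute del: power_Suc)
        have "\<delta> N n \<le> 2 * ?d" using lo rN by (simp add: \<delta>_def pos_divide_le_eq mult_ac)
        also have "\<dots> \<le> 2 * \<epsilon>0" using n1 by simp
        finally have \<delta>lt: "\<delta> N n < \<delta>0" using \<epsilon>0 by simp
        let ?f = "\<lambda>i. f ?\<theta> (fst \<omega> i)" and ?E = "Z.expectation (f ?\<theta>)"
        define S where "S = (\<Sum>i<N. ?c N \<omega> b i * (?f i - ?E))"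
        define Q where "Q = (\<Sum>i<N. \<bar>?f i - ?E\<bar>)"
        have Q0: "0 \<le> Q" by (simp add: Q_def sum_nonneg)
        have Ele: "?E \<le> - \<kappa> * ?d\<^sup>2" using margin[OF thT] n1 \<epsilon>0 by simp
        have E0: "?E \<le> 0" using Ele kappa by (smt (verit) mult_nonneg_nonneg zero_le_power2 mult_minus_left)
        \<comment> \<open>The uncalibrated total is within \<open>N / 4\<close> of \<open>N\<close>,
          and the factors change it by at most \<open>N * B / (4 * B)\<close>.\<close>
        have G: "(\<Sum>i<N. ?c N \<omega> b i * g N \<omega> b i) \<ge> real N / 2"
        proof -
          have "(\<Sum>i<N. ?c N \<omega> b i * g N \<omega> b i) = (\<Sum>i<N. ?c N \<omega> b i) + (\<Sum>i<N. ?c N \<omega> b i * (g N \<omega> b i - 1))"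
            by (simp add: sum.distrib[symmetric] algebra_simps)
          moreover have "\<bar>\<Sum>i<N. ?c N \<omega> b i * (g N \<omega> b i - 1)\<bar> \<le> real N * (1 / 4)"
          proof -
            have "\<bar>?c N \<omega> b i * (g N \<omega> b i - 1)\<bar> \<le> 1 / 4" if "i < N" for i
            proof -
              have "\<bar>g N \<omega> b i - 1\<bar> \<le> 1 / (4 * B)" using n3'[OF that] sN by simp
              then have "?c N \<omega> b i * \<bar>g N \<omega> b i - 1\<bar> \<le> B * (1 / (4 * B))"
                using cN[OF that] B by (intro mult_mono) auto
              then show ?thesis
                unfolding abs_mult[of "?c N \<omega> b i"] abs_of_nonneg[OF cN(1)[OF that]] using B by simp
            qed
            then have "(\<Sum>i<N. \<bar>?c N \<omega> b i * (g N \<omega> b i - 1)\<bar>) \<le> (\<Sum>i<N. 1 / 4)" by (intro sum_mono) auto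
            then have "\<bar>\<Sum>i<N. ?c N \<omega> b i * (g N \<omega> b i - 1)\<bar> \<le> (\<Sum>i<N. 1 / 4)"
              by (rule order_trans[OF sum_abs])
            then show ?thesis by (simp only: sum_constant card_lessThan)
          qed
          ultimately show ?thesis using n4 by linarith
        qed
        \<comment> \<open>The three terms are the multiplier sum, the effect of \<open>g - 1\<close>
          on the centred values, and the drift, which carries the margin.\<close>
        have dec: "(\<Sum>i<N. ?c N \<omega> b i * (g N \<omega> b i * ?f i))
           = S + (\<Sum>i<N. ?c N \<omega> b i * (g N \<omega> b i - 1) * (?f i - ?E)) + ?E * (\<Sum>i<N. ?c N \<omega> b i * g N \<omega> b i)"
          unfolding S_def sum_distrib_left sum.distrib[symmetric]
          by (intro sum.cong refl) (simp add: algebra_simps)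
        have t2: "\<bar>\<Sum>i<N. ?c N \<omega> b i * (g N \<omega> b i - 1) * (?f i - ?E)\<bar> \<le> B * l N / sqrt (real N) * Q"
        proof -
          have "\<bar>?c N \<omega> b i * (g N \<omega> b i - 1) * (?f i - ?E)\<bar> \<le> B * l N / sqrt (real N) * \<bar>?f i - ?E\<bar>" if "i < N" for i
          proof -
            have "?c N \<omega> b i * \<bar>g N \<omega> b i - 1\<bar> \<le> B * (l N / sqrt (real N))"
              using cN[OF that] n3[OF that] B by (intro mult_mono) auto
            then have "\<bar>?c N \<omega> b i * (g N \<omega> b i - 1)\<bar> \<le> B * l N / sqrt (real N)"
              unfolding abs_mult[of "?c N \<omega> b i"] abs_of_nonneg[OF cN(1)[OF that]] by simp
            then show ?thesis unfolding abs_mult[of "?c N \<omega> b i * (g N \<omega> b i - 1)"] by (rule mult_right_mono) simp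
          qed
          then have "(\<Sum>i<N. \<bar>?c N \<omega> b i * (g N \<omega> b i - 1) * (?f i - ?E)\<bar>) \<le> (\<Sum>i<N. B * l N / sqrt (real N) * \<bar>?f i - ?E\<bar>)"
            by (intro sum_mono) auto
          then show ?thesis unfolding Q_def sum_distrib_left by (rule order_trans[OF sum_abs])
        qed
        have t3: "?E * (\<Sum>i<N. ?c N \<omega> b i * g N \<omega> b i) \<le> - \<kappa> * ?d\<^sup>2 * (real N / 2)"
        proof -
          have "?E * (\<Sum>i<N. ?c N \<omega> b i * g N \<omega> b i) \<le> ?E * (real N / 2)"
            by (rule mult_left_mono_neg[OF G E0])
          also have "\<dots> \<le> - \<kappa> * ?d\<^sup>2 * (real N / 2)" by (rule mult_right_mono[OF Ele]) simp
          finally show ?thesis .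
        qed
        have sq: "(2 ^ n * T N)\<^sup>2 \<le> (r N)\<^sup>2 * ?d\<^sup>2"
          unfolding power_mult_distrib[of "r N", symmetric] using lo TN by (intro power_mono) auto
        have four: "(2 ^ n * T N)\<^sup>2 = 4 ^ n * (T N)\<^sup>2"
          by (simp add: power_mult_distrib power_mult[symmetric] mult.commute[of n] power_mult)
        \<comment> \<open>On the shell \<open>r N * d\<close> is at least \<open>T N\<close>, so the
          threshold \<open>\<kappa> * (T N)^2 / 4\<close> for the error is at most a quarter of
          \<open>\<kappa> * (r N * d)^2\<close>.\<close>
        have Rb: "real N * (1 / (r N)\<^sup>2 * R N \<omega> b) \<le> real N * (\<kappa> * ?d\<^sup>2 / 4)"
        proof (rule mult_left_mono)
          have "(T N)\<^sup>2 \<le> 4 ^ n * (T N)\<^sup>2" using one_le_power[of "4::real" n] by (simp add: mult_le_cancel_right1)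
          then have "(T N)\<^sup>2 \<le> (r N)\<^sup>2 * ?d\<^sup>2" using sq four by linarith
          then have "\<kappa> * (T N)\<^sup>2 / 4 \<le> \<kappa> * ((r N)\<^sup>2 * ?d\<^sup>2) / 4" using kappa by simp
          then have "R N \<omega> b \<le> \<kappa> * ((r N)\<^sup>2 * ?d\<^sup>2) / 4" using n2 by linarith
          then have "1 / (r N)\<^sup>2 * R N \<omega> b \<le> 1 / (r N)\<^sup>2 * (\<kappa> * ((r N)\<^sup>2 * ?d\<^sup>2) / 4)"
            by (rule mult_left_mono) simp
          also have "\<dots> = \<kappa> * ?d\<^sup>2 / 4" using rN by simp
          finally show "1 / (r N)\<^sup>2 * R N \<omega> b \<le> \<kappa> * ?d\<^sup>2 / 4" .
        qed simp
        have "- (real N * (\<kappa> * ?d\<^sup>2 / 4)) \<le> \<bar>S\<bar> + B * l N / sqrt (real N) * Q - \<kappa> * ?d\<^sup>2 * (real N / 2)"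
          using near_max[OF N w b] dec t2 t3 Rb by linarith
        then have key: "real N * (\<kappa> * ?d\<^sup>2 / 4) \<le> \<bar>S\<bar> + B * l N / sqrt (real N) * Q"
          by (simp add: field_simps)
        have thr_le: "thr N n \<le> real N * (\<kappa> * ?d\<^sup>2 / 4)"
        proof -
          have "4 ^ n * (T N)\<^sup>2 / (r N)\<^sup>2 \<le> ?d\<^sup>2"
            using sq four rN by (simp add: pos_divide_le_eq mult.commute)
          then have "real N * \<kappa> / 4 * (4 ^ n * (T N)\<^sup>2 / (r N)\<^sup>2) \<le> real N * \<kappa> / 4 * ?d\<^sup>2"
            using kappa by (intro mult_left_mono) auto
          then show ?thesis by (simp add: thr_def mult_ac)
        qed
        have thrpos: "thr N n > 0" using N TN rN kappa by (simp add: thr_def)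
        \<comment> \<open>The shell that contains the estimator thus forces its majorant, and with
          it the whole series, to be at least 1, contrary to the choice of the exceptional
          events.\<close>
        have "1 = ennreal (1 / thr N n * thr N n)" using thrpos by simp
        also have "\<dots> \<le> ennreal (1 / thr N n * (\<bar>S\<bar> + B * l N / sqrt (real N) * Q))"
          using thrpos by (intro ennreal_leI mult_left_mono order_trans[OF thr_le key]) auto
        also have "\<dots> = ennreal (1 / thr N n) * (ennreal \<bar>S\<bar> + ennreal (B * l N / sqrt (real N)) * ennreal Q)"
          using thrpos Q0 B l0[of N] by (intro ennreal_mult_add_mult[symmetric]) auto
        also have "\<dots> \<le> \<Psi> N n \<omega> b"
          using n5 thT d_lt \<delta>lt unfolding nice_def dominates_def S_def Q_def by blast
        also have "\<dots> \<le> (\<Sum>n. \<Psi> N n \<omega> b)"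
          using sum_le_suminf[of "\<lambda>n. \<Psi> N n \<omega> b" "{n}"] by simp
        finally show False using n6 by simp
      qed
    qed
  qed
qed

end

section \<open>Calibration\<close>

lemma negl_Ex_finite:
  fixes E :: "'l::finite \<Rightarrow> nat \<Rightarrow> (nat \<Rightarrow> 'x \<times> 'u) \<times> 's \<Rightarrow> weights \<Rightarrow> bool"
    and D :: "('x, 'u, 'y, 'j::finite, 's) two_phase"
  assumes "\<And>l. negl D (E l)"
  shows "negl D (\<lambda>N \<omega> b. \<exists>l. E l N \<omega> b)"
proof -
  have "negl D (\<lambda>N \<omega> b. \<exists>l\<in>X. E l N \<omega> b)" for X :: "'l set"
  proof (induction X rule: finite_induct[OF finite])
    case 1
    then show ?case using negl_False by simp
  next
    case (2 x X)
    then show ?case using negl_disj[OF assms[of x], of "\<lambda>N \<omega> b. \<exists>l\<in>X. E l N \<omega> b"] by simp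
  qed
  from this[of UNIV] show ?thesis by simp
qed

text \<open>The residual equation is tested against \<open>\<alpha>\<close>: monotonicity of
  \<open>G\<close> makes every summand nonnegative, and near 0 the sum dominates a quadratic form.
  The vector is first pulled back along its ray into the ball where the quadratic bound holds; a
  proper pull-back would have the full radius as its norm and contradict the smallness of
  \<open>\<Delta>\<close>. A root of the calibration equation is therefore small without a
  preliminary localisation.\<close>

lemma calibration_step:
  fixes v :: "nat \<Rightarrow> 'v::euclidean_space" and \<alpha> :: 'v
  assumes G: "strict_mono G" "G 0 = 1"
    and c0: "c0 > 0" "t0 > 0" "\<And>t. \<bar>t\<bar> \<le> t0 \<Longrightarrow> c0 * t\<^sup>2 \<le> (G t - 1) * t"
    and e: "\<And>i. i < N \<Longrightarrow> 0 \<le> e i" and q: "\<And>i. i < N \<Longrightarrow> 0 \<le> q i \<and> q i \<le> Q"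
    and v: "\<And>i. i < N \<Longrightarrow> norm (v i) \<le> vb" and Qb: "Q > 0" "vb > 0" and N: "N \<ge> 1"
    and pd: "\<And>u. real N * lam * (norm u)\<^sup>2 \<le> (\<Sum>i<N. e i * q i * (v i \<bullet> u)\<^sup>2)"
    and le: "(\<Sum>i<N. e i * (G (q i * (v i \<bullet> \<alpha>)) - 1) * (v i \<bullet> \<alpha>)) \<le> real N * norm \<alpha> * \<Delta>"
    and small: "\<Delta> < c0 * lam * (t0 / (Q * vb))" and lam: "lam > 0"
  shows "c0 * lam * norm \<alpha> \<le> \<Delta> \<or> \<alpha> = 0"
proof (cases "\<alpha> = 0")
  case False
  \<comment> \<open>For \<open>norm u \<le> \<rho>\<close> every argument
    \<open>q i * (v i \<bullet> u)\<close> stays within \<open>t0\<close>.\<close>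
  define \<rho> where "\<rho> = t0 / (Q * vb)"
  have \<rho>: "\<rho> > 0" using c0 Qb by (simp add: \<rho>_def)
  have na: "norm \<alpha> > 0" using False by simp
  define s where "s = min 1 (\<rho> / norm \<alpha>)"
  have s: "0 < s" "s \<le> 1" using \<rho> na by (auto simp: s_def)
  define u where "u = s *\<^sub>R \<alpha>"
  have nu: "norm u = s * norm \<alpha>" using s by (simp add: u_def)
  have nu_le: "norm u \<le> \<rho>"
  proof -
    have "s * norm \<alpha> \<le> \<rho> / norm \<alpha> * norm \<alpha>" by (intro mult_right_mono) (auto simp: s_def)
    then show ?thesis using na nu by simp
  qed
  have vu: "v i \<bullet> u = s * (v i \<bullet> \<alpha>)" for i by (simp add: u_def)
  have summand: "c0 * (e i * q i * (v i \<bullet> u)\<^sup>2) \<le> s * (e i * (G (q i * (v i \<bullet> \<alpha>)) - 1) * (v i \<bullet> \<alpha>))"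
    if i: "i < N" for i
  proof -
    define t where "t = v i \<bullet> u"
    have t_le: "\<bar>q i * t\<bar> \<le> t0"
    proof -
      have "\<bar>t\<bar> \<le> vb * \<rho>"
        unfolding t_def using v[OF i] nu_le Qb
        by (intro order_trans[OF Cauchy_Schwarz_ineq2] mult_mono) auto
      then have "\<bar>q i * t\<bar> \<le> Q * (vb * \<rho>)"
        unfolding abs_mult using q[OF i] Qb by (intro mult_mono) auto
      then show ?thesis using Qb by (simp add: \<rho>_def)
    qed
    have ta: "v i \<bullet> \<alpha> = t / s" using s by (simp add: t_def vu)
    have 1: "c0 * (q i * t\<^sup>2) \<le> (G (q i * t) - 1) * t"
    proof (cases "q i = 0")
      case True
      then show ?thesis using G by simp
    next
      case False
      then have qp: "q i > 0" using q[OF i] by simp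
      have "q i * (c0 * (q i * t\<^sup>2)) \<le> q i * ((G (q i * t) - 1) * t)"
        using c0(3)[OF t_le] by (simp add: power2_eq_square mult_ac)
      then show ?thesis using qp by simp
    qed
    \<comment> \<open>Lengthening the vector from \<open>u\<close> to \<open>\<alpha>\<close>
      multiplies the argument by \<open>1 / s \<ge> 1\<close>, which moves \<open>G\<close> further
      in the direction given by the sign of \<open>t\<close>.\<close>
    have 2: "(G (q i * t) - 1) * t \<le> (G (q i * (t / s)) - 1) * t"
    proof -
      have inv: "1 \<le> 1 / s" using s by simp
      show ?thesis
      proof (cases "t \<ge> 0")
        case True
        then have "q i * t * 1 \<le> q i * t * (1 / s)" using q[OF i] inv by (intro mult_left_mono) auto
        then have "G (q i * t) \<le> G (q i * (t / s))"
          unfolding strict_mono_less_eq[OF G(1)] by simp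
        then show ?thesis using True by (intro mult_right_mono) auto
      next
        case False
        then have "0 \<le> q i * (-t)" using q[OF i] by (intro mult_nonneg_nonneg) auto
        then have "q i * (-t) * 1 \<le> q i * (-t) * (1 / s)" using inv by (intro mult_left_mono) auto
        then have "G (q i * (t / s)) \<le> G (q i * t)"
          unfolding strict_mono_less_eq[OF G(1)] by simp
        then show ?thesis using False by (intro mult_right_mono_neg) auto
      qed
    qed
    have "c0 * (e i * q i * t\<^sup>2) = e i * (c0 * (q i * t\<^sup>2))" by simp
    also have "\<dots> \<le> e i * ((G (q i * (t / s)) - 1) * t)"
      using 1 2 e[OF i] by (intro mult_left_mono) auto
    also have "\<dots> = s * (e i * (G (q i * (t / s)) - 1) * (t / s))" using s by simp
    finally show ?thesis unfolding ta by (simp only: t_def[symmetric])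
  qed
  have "c0 * (real N * lam * (norm u)\<^sup>2) \<le> c0 * (\<Sum>i<N. e i * q i * (v i \<bullet> u)\<^sup>2)"
    using c0 by (intro mult_left_mono pd) auto
  also have "\<dots> \<le> s * (\<Sum>i<N. e i * (G (q i * (v i \<bullet> \<alpha>)) - 1) * (v i \<bullet> \<alpha>))"
    unfolding sum_distrib_left by (intro sum_mono) (use summand in auto)
  also have "\<dots> \<le> s * (real N * norm \<alpha> * \<Delta>)" using s by (intro mult_left_mono le) auto
  also have "\<dots> = (real N * norm u) * \<Delta>" by (simp add: nu mult_ac)
  finally have "(real N * norm u) * (c0 * lam * norm u) \<le> (real N * norm u) * \<Delta>"
    by (simp add: power2_eq_square mult_ac)
  moreover have "real N * norm u > 0" using N nu s na by simp
  ultimately have *: "c0 * lam * norm u \<le> \<Delta>" by (simp only: mult_le_cancel_left_pos)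
  have "s = 1"
  proof (rule ccontr)
    assume "s \<noteq> 1"
    then have "s = \<rho> / norm \<alpha>" by (auto simp: s_def min_def split: if_splits)
    then have "norm u = \<rho>" using nu na by simp
    with * small show False by (simp add: \<rho>_def)
  qed
  then show ?thesis using * nu by simp
qed simp

text \<open>Half of the derivative absorbs the error of the difference quotient near 0, and
  multiplying by \<open>t^2\<close> removes the case distinction on the sign of
  \<open>t\<close>.\<close>

lemma derivative_lower:
  fixes G :: "real \<Rightarrow> real"
  assumes G: "(G has_real_derivative \<gamma>) (at 0)" "\<gamma> > 0" "G 0 = 1"
  obtains t0 where "t0 > 0" "\<And>t. \<bar>t\<bar> \<le> t0 \<Longrightarrow> \<gamma> / 2 * t\<^sup>2 \<le> (G t - 1) * t"
proof -
  have "((\<lambda>h. (G h - 1) / h) \<longlongrightarrow> \<gamma>) (at 0)"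
    using G(1) unfolding has_field_derivative_iff by (simp add: G(3))
  then have "eventually (\<lambda>h. (G h - 1) / h > \<gamma> / 2) (at 0)"
    using G(2) by (intro order_tendstoD) auto
  then obtain s where s: "s > 0" "\<And>h. h \<noteq> 0 \<Longrightarrow> \<bar>h\<bar> < s \<Longrightarrow> (G h - 1) / h > \<gamma> / 2"
    unfolding eventually_at by (auto simp: dist_real_def)
  show ?thesis
  proof (rule that[of "s / 2"])
    show "s / 2 > 0" using s by simp
    fix t :: real assume t: "\<bar>t\<bar> \<le> s / 2"
    show "\<gamma> / 2 * t\<^sup>2 \<le> (G t - 1) * t"
    proof (cases "t = 0")
      case False
      have "\<gamma> / 2 * t\<^sup>2 \<le> (G t - 1) / t * t\<^sup>2"
        using s(2)[OF False] t s(1) by (intro mult_right_mono) auto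
      then show ?thesis using False by (simp add: power2_eq_square)
    qed simp
  qed
qed

text \<open>The form attains a positive minimum on the compact unit sphere, and homogeneity extends
  the bound to all vectors.\<close>

lemma positive_definite_lower:
  fixes A :: "real ^ 'k ^ 'k"
  assumes "positive_definite A"
  obtains lam where "lam > 0" "\<And>u. lam * (norm u)\<^sup>2 \<le> u \<bullet> (A *v u)"
proof -
  have cont: "continuous_on (sphere 0 1) (\<lambda>u. u \<bullet> (A *v u))"
    by (intro continuous_intros matrix_vector_mult_linear_continuous_on)
  have "axis undefined 1 \<in> sphere (0 :: real ^ 'k) 1" by simp
  then have ne: "sphere (0 :: real ^ 'k) 1 \<noteq> {}" by blast
  obtain u0 where u0: "u0 \<in> sphere 0 1" "\<And>u. u \<in> sphere 0 1 \<Longrightarrow> u0 \<bullet> (A *v u0) \<le> u \<bullet> (A *v u)"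
    using continuous_attains_inf[OF compact_sphere ne cont] by blast
  show ?thesis
  proof (rule that[of "u0 \<bullet> (A *v u0)"])
    have "u0 \<noteq> 0" using u0(1) by auto
    then show "0 < u0 \<bullet> (A *v u0)" using assms by (simp add: positive_definite_def)
    fix u :: "real ^ 'k"
    show "u0 \<bullet> (A *v u0) * (norm u)\<^sup>2 \<le> u \<bullet> (A *v u)"
    proof (cases "u = 0")
      case False
      define w where "w = (1 / norm u) *\<^sub>R u"
      have "w \<in> sphere 0 1" using False by (simp add: w_def)
      then have "u0 \<bullet> (A *v u0) \<le> w \<bullet> (A *v w)" by (rule u0(2))
      then have "u0 \<bullet> (A *v u0) * (norm u)\<^sup>2 \<le> w \<bullet> (A *v w) * (norm u)\<^sup>2" by (rule mult_right_mono) simp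
      also have "\<dots> = (norm u *\<^sub>R w) \<bullet> (A *v (norm u *\<^sub>R w))"
        by (simp add: matrix_vector_mult_scaleR power2_eq_square mult_ac)
      also have "norm u *\<^sub>R w = u" using False by (simp add: w_def)
      finally show ?thesis .
    qed simp
  qed
qed

text \<open>Since each coordinate of \<open>u\<close> is at most \<open>norm u\<close>, entrywise
  errors of relative size \<open>\<epsilon>\<close> cost at most \<open>\<epsilon>\<close> times the
  squared dimension.\<close>

lemma quadratic_form_lower:
  fixes A :: "real ^ 'k ^ 'k" and x :: "nat \<Rightarrow> real ^ 'k"
  assumes A: "\<And>u. lam * (norm u)\<^sup>2 \<le> u \<bullet> (A *v u)"
    and dev: "\<And>l m. \<bar>(\<Sum>i<N. w i * (x i $ l * x i $ m)) - real N * A $ l $ m\<bar> \<le> real N * \<epsilon>"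
  shows "real N * (lam - \<epsilon> * (real CARD('k))\<^sup>2) * (norm u)\<^sup>2 \<le> (\<Sum>i<N. w i * (x i \<bullet> u)\<^sup>2)"
proof -
  let ?H = "\<lambda>l m. \<Sum>i<N. w i * (x i $ l * x i $ m)"
  have e1: "(\<Sum>i<N. w i * (x i \<bullet> u)\<^sup>2) = (\<Sum>l\<in>UNIV. \<Sum>m\<in>UNIV. u $ l * u $ m * ?H l m)"
  proof -
    have "(\<Sum>i<N. w i * (x i \<bullet> u)\<^sup>2) = (\<Sum>i<N. \<Sum>l\<in>UNIV. \<Sum>m\<in>UNIV. u $ l * u $ m * (w i * (x i $ l * x i $ m)))"
      by (simp add: inner_vec_def power2_eq_square sum_product sum_distrib_left mult_ac)
    also have "\<dots> = (\<Sum>l\<in>UNIV. \<Sum>m\<in>UNIV. \<Sum>i<N. u $ l * u $ m * (w i * (x i $ l * x i $ m)))"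
      by (subst sum.swap) (intro sum.cong refl sum.swap)
    finally show ?thesis by (simp add: sum_distrib_left)
  qed
  have e2: "u \<bullet> (A *v u) = (\<Sum>l\<in>UNIV. \<Sum>m\<in>UNIV. u $ l * u $ m * A $ l $ m)"
    by (simp add: inner_vec_def matrix_vector_mult_def sum_distrib_left mult_ac)
  have "\<bar>(\<Sum>i<N. w i * (x i \<bullet> u)\<^sup>2) - real N * (u \<bullet> (A *v u))\<bar>
     = \<bar>\<Sum>l\<in>UNIV. \<Sum>m\<in>UNIV. u $ l * u $ m * (?H l m - real N * A $ l $ m)\<bar>"
    unfolding e1 e2 by (simp add: sum_distrib_left sum_subtractf right_diff_distrib mult_ac)
  also have "\<dots> \<le> (\<Sum>l\<in>(UNIV::'k set). \<Sum>m\<in>(UNIV::'k set). (norm u)\<^sup>2 * (real N * \<epsilon>))"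
  proof (rule order_trans[OF sum_abs], rule sum_mono, rule order_trans[OF sum_abs], rule sum_mono)
    fix l m :: 'k
    have "\<bar>u $ l\<bar> * \<bar>u $ m\<bar> \<le> norm u * norm u" by (intro mult_mono component_le_norm_cart) auto
    then show "\<bar>u $ l * u $ m * (?H l m - real N * A $ l $ m)\<bar> \<le> (norm u)\<^sup>2 * (real N * \<epsilon>)"
      unfolding abs_mult power2_eq_square using dev[of l m] by (rule mult_mono) auto
  qed
  also have "\<dots> = real N * (\<epsilon> * (real CARD('k))\<^sup>2) * (norm u)\<^sup>2"
    by (simp add: power2_eq_square mult_ac)
  finally have "real N * (u \<bullet> (A *v u)) - real N * (\<epsilon> * (real CARD('k))\<^sup>2) * (norm u)\<^sup>2 \<le> (\<Sum>i<N. w i * (x i \<bullet> u)\<^sup>2)"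
    by linarith
  moreover have "real N * (lam * (norm u)\<^sup>2) \<le> real N * (u \<bullet> (A *v u))" by (intro mult_left_mono A) simp
  ultimately show ?thesis by (simp add: algebra_simps)
qed

section \<open>Sampling fractions and weighted second moments\<close>

context boot_weights
begin

lemma scheme_one: "N \<ge> 1 \<Longrightarrow> scheme N (\<lambda>k b i. 1) 1 0"
  by (simp add: scheme_def card_members_of)

lemma AE_data_fst:
  assumes "AE w in iid D. P w"
  shows "AE \<omega> in data D. P (fst \<omega>)"
proof -
  have "AE w in distr (data D) (iid D) fst. P w" using assms by (simp only: distr_fst_data)
  then show ?thesis by (rule AE_distrD[OF measurable_fst_data])
qed

lemma AE_iid_all:
  assumes "AE z in Z. P z"
  shows "AE w in iid D. \<forall>i. P (w i)"
  unfolding iid_eq AE_all_countable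
  by (intro allI AE_PiM_component) (auto intro: Z.prob_space_axioms assms)

text \<open>The design gives almost sure convergence; dominated convergence for the indicator of the
  bad event turns it into convergence in probability. The event is measurable because it depends on
  the key.\<close>

lemma sampling_fraction_limit:
  assumes \<epsilon>: "\<epsilon> > 0"
  shows "negl D (\<lambda>N \<omega> b. \<not> (\<forall>j. \<bar>real (cnt N (fst (key N \<omega>)) j) / real (ns N (fst (key N \<omega>)) j) - 1 / plim D j\<bar> \<le> \<epsilon>))"
proof -
  define bad where "bad N k \<longleftrightarrow> \<not> (\<forall>j. \<bar>real (cnt N (fst k) j) / real (ns N (fst k) j) - 1 / plim D j\<bar> \<le> \<epsilon>)"
    for N and k :: "(nat \<Rightarrow> 'j) \<times> nat set"
  define h where "h N \<omega> = (if bad N (key N \<omega>) then 1 else 0 :: ennreal)" for N \<omega>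
  have h[measurable]: "h N \<in> borel_measurable (data D)" for N
    unfolding h_def by (rule measurable_compose[OF measurable_key]) simp
  have "AE \<omega> in data D. \<forall>j. (\<lambda>N. real (ncount D N (fst \<omega>) j) / real (Ncount D N (fst \<omega>) j)) \<longlonglongrightarrow> plim D j"
    using design by (intro AE_data_fst) (simp add: two_phase_design_def)
  then have lim: "AE \<omega> in data D. (\<lambda>N. h N \<omega>) \<longlonglongrightarrow> 0"
    using AE_space
  proof eventually_elim
    case (elim \<omega>)
    have w: "fst \<omega> \<in> space (iid D)" using elim(2) by (auto simp: space_data)
    have "(\<lambda>N. real (cnt N (fst (key N \<omega>)) j) / real (ns N (fst (key N \<omega>)) j)) \<longlonglongrightarrow> 1 / plim D j" for j
    proof -
      have p: "plim D j \<noteq> 0" using design by (auto simp: two_phase_design_def dest: spec[of _ j])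
      have "(\<lambda>N. 1 / (real (ncount D N (fst \<omega>) j) / real (Ncount D N (fst \<omega>) j))) \<longlonglongrightarrow> 1 / plim D j"
        using elim(1) p by (intro tendsto_divide tendsto_const) auto
      then show ?thesis by (simp add: ncount_def ns_def Ncount_eq[OF w] key_def)
    qed
    then have "eventually (\<lambda>N. \<bar>real (cnt N (fst (key N \<omega>)) j) / real (ns N (fst (key N \<omega>)) j) - 1 / plim D j\<bar> < \<epsilon>) sequentially" for j
      using \<epsilon> by (auto simp: tendsto_iff dist_real_def)
    then have "eventually (\<lambda>N. \<forall>j. \<bar>real (cnt N (fst (key N \<omega>)) j) / real (ns N (fst (key N \<omega>)) j) - 1 / plim D j\<bar> < \<epsilon>) sequentially"
      by (simp add: eventually_all_finite)
    then have "eventually (\<lambda>N. h N \<omega> = 0) sequentially"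
      by eventually_elim (auto simp: h_def bad_def intro: less_imp_le)
    then show ?case by (rule tendsto_eventually)
  qed
  have "(\<lambda>N. \<integral>\<^sup>+\<omega>. h N \<omega> \<partial>data D) \<longlonglongrightarrow> (\<integral>\<^sup>+\<omega>. 0 \<partial>data D)"
  proof (rule nn_integral_dominated_convergence[where w="\<lambda>_. 1"])
    show "AE \<omega> in data D. (\<lambda>N. h N \<omega>) \<longlonglongrightarrow> 0" by (rule lim)
    show "(\<integral>\<^sup>+\<omega>. 1 \<partial>data D) < \<infinity>" by (simp add: data.emeasure_space_1)
  qed (use h in \<open>auto simp: h_def[abs_def]\<close>)
  then have i: "(\<lambda>N. \<integral>\<^sup>+\<omega>. h N \<omega> \<partial>data D) \<longlonglongrightarrow> 0" by simp
  have "outer_measure_of (data D) {\<omega> \<in> space (data D). bad N (key N \<omega>)} = (\<integral>\<^sup>+\<omega>. h N \<omega> \<partial>data D)" for N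
  proof -
    have m: "{\<omega> \<in> space (data D). bad N (key N \<omega>)} \<in> sets (data D)"
    proof -
      have "(\<lambda>\<omega>. bad N (key N \<omega>)) \<in> measurable (data D) (count_space UNIV)"
        by (rule measurable_compose[OF measurable_key]) simp
      then show ?thesis by (simp add: pred_def)
    qed
    have "(\<integral>\<^sup>+\<omega>. h N \<omega> \<partial>data D) = (\<integral>\<^sup>+\<omega>. indicator {\<omega> \<in> space (data D). bad N (key N \<omega>)} \<omega> \<partial>data D)"
      by (intro nn_integral_cong) (auto simp: h_def)
    then show ?thesis using m by simp
  qed
  then have "(\<lambda>N. outer_measure_of (data D) {\<omega> \<in> space (data D). bad N (key N \<omega>)}) \<longlonglongrightarrow> 0"
    using i by simp
  then show ?thesis unfolding bad_def by (rule negl_data)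
qed

lemma pi_inf_eq: "z \<in> space Z \<Longrightarrow> pi_inf D (Vof D z) = plim D (lab z)"
proof -
  assume z: "z \<in> space Z"
  have "pi_inf D (Vof D z) = (\<Sum>j\<in>UNIV. if j = lab z then plim D j else 0)"
    unfolding pi_inf_def using lab_eq_iff[OF z, symmetric]
    by (intro sum.cong refl) (auto simp: indicator_def)
  then show ?thesis by simp
qed

end

lemma sqrt_sqrt_mult: "x * sqrt (real N) * sqrt (real N) = real N * x"
proof -
  have "x * sqrt (real N) * sqrt (real N) = x * (sqrt (real N) * sqrt (real N))" by (rule mult.assoc)
  also have "\<dots> = x * real N" by simp
  also have "\<dots> = real N * x" by (rule mult.commute)
  finally show ?thesis .
qed

context boot_weights
begin

text \<open>The multipliers of the bootstrap calibration equations, in which only the phase II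
  weights occur.\<close>

definition W2w :: "nat \<Rightarrow> (nat \<Rightarrow> 'x \<times> 'u) \<times> 's \<Rightarrow> weights \<Rightarrow> nat \<Rightarrow> real" where
  "W2w N \<omega> b i = real (snd b i) * ipwk N (key N \<omega>) i"

lemma AE_W2w:
  assumes N: "N \<ge> 1"
  shows "AE \<omega> in data D. AE b in PW D N \<omega>. (\<forall>i<N. 0 \<le> W2w N \<omega> b i) \<and> (\<Sum>i<N. W2w N \<omega> b i) = real N \<and>
    (\<Sum>i<N. ipwk N (key N \<omega>) i) = real N"
  using AE_good[OF N] AE_space
proof eventually_elim
  case (elim \<omega>)
  show ?case
    using AE_PW[of N \<omega>]
  proof eventually_elim
    case (elim b)
    have w: "\<omega> \<in> space (data D)" and g: "good N \<omega>" by fact+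
    have s: "snd b \<in> set_pmf (phase2_law D N \<omega>)" using elim by simp
    have "(\<Sum>i<N. W2w N \<omega> b i) = real N"
      unfolding W2w_def sum_by_label[of _ N "fst (key N \<omega>)", symmetric] sum_phase2_ipwk[OF N w g s] by (rule cnt_sum)
    moreover have "(\<Sum>i<N. ipwk N (key N \<omega>) i) = real N"
      unfolding sum_by_label[of _ N "fst (key N \<omega>)", symmetric] sum_ipwk[OF N w g] by (rule cnt_sum)
    ultimately show ?case using ipwk_bounds(1)[OF N w] by (simp add: W2w_def)
  qed
qed

lemma integral_vec_nth:
  fixes y :: "'x \<times> 'u \<Rightarrow> real ^ 'k"
  assumes "integrable Z y"
  shows "Z.expectation (\<lambda>z. y z $ l) = Z.expectation y $ l"
  by (rule integral_bounded_linear[OF bounded_linear_vec_nth assms])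

lemma measurable_nth:
  fixes y :: "'x \<times> 'u \<Rightarrow> real ^ 'k"
  assumes "y \<in> borel_measurable Z"
  shows "(\<lambda>z. y z $ l) \<in> borel_measurable Z"
  by (rule measurable_compose[OF assms borel_measurable_continuous_onI[OF linear_continuous_on[OF bounded_linear_vec_nth]]])

text \<open>Each coordinate receives an equal share of \<open>L\<close>, and the norm is at most the
  sum of the absolute coordinates.\<close>

lemma negl_vector_mean:
  fixes y :: "'x \<times> 'u \<Rightarrow> real ^ 'k"
  assumes sch: "\<And>N. N \<ge> 1 \<Longrightarrow> scheme N (c N) B K"
    and y: "y \<in> borel_measurable Z" and bd: "AE z in Z. norm (y z) \<le> vb"
    and L: "filterlim L at_top sequentially"
  shows "negl D (\<lambda>N \<omega> b. norm (\<Sum>i<N. c N (key N \<omega>) b i *\<^sub>R (y (fst \<omega> i) - Z.expectation y)) > L N * sqrt (real N))"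
proof -
  have yi: "integrable Z y" by (rule Z.integrable_const_bound[OF bd y])
  let ?k = "real CARD('k)"
  have Lk: "filterlim (\<lambda>N. L N / ?k) at_top sequentially"
  proof -
    have "filterlim (\<lambda>N. (1 / ?k) * L N) at_top sequentially"
      by (intro filterlim_tendsto_pos_mult_at_top[OF tendsto_const] L) auto
    then show ?thesis by simp
  qed
  have "negl D (\<lambda>N \<omega> b. \<bar>\<Sum>i<N. c N (key N \<omega>) b i * (y (fst \<omega> i) $ l - Z.expectation (\<lambda>z. y z $ l))\<bar> > L N / ?k * sqrt (real N))" for l
  proof (rule negl_single_function[OF sch _ _ Lk])
    show "(\<lambda>z. y z $ l) \<in> borel_measurable Z" by (rule measurable_nth[OF y])
    show "AE z in Z. \<bar>y z $ l\<bar> \<le> vb"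
      using bd by eventually_elim (rule order_trans[OF component_le_norm_cart])
  qed
  then have n: "negl D (\<lambda>N \<omega> b. \<exists>l. \<bar>\<Sum>i<N. c N (key N \<omega>) b i * (y (fst \<omega> i) $ l - Z.expectation (\<lambda>z. y z $ l))\<bar> > L N / ?k * sqrt (real N))"
    by (rule negl_Ex_finite)
  show ?thesis
  proof (rule negl_mono_pointwise[OF n], intro always_eventually allI ballI impI, rule ccontr)
    fix N \<omega> b
    let ?x = "\<Sum>i<N. c N (key N \<omega>) b i *\<^sub>R (y (fst \<omega> i) - Z.expectation y)"
    assume big: "norm ?x > L N * sqrt (real N)"
      and "\<not> (\<exists>l. \<bar>\<Sum>i<N. c N (key N \<omega>) b i * (y (fst \<omega> i) $ l - Z.expectation (\<lambda>z. y z $ l))\<bar> > L N / ?k * sqrt (real N))"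
    then have le: "\<bar>?x $ l\<bar> \<le> L N / ?k * sqrt (real N)" for l
      by (auto simp: not_less integral_vec_nth[OF yi])
    have "norm ?x \<le> (\<Sum>l\<in>UNIV. \<bar>?x $ l\<bar>)" by (rule norm_le_l1_cart)
    also have "\<dots> \<le> (\<Sum>l\<in>(UNIV::'k set). L N / ?k * sqrt (real N))" by (intro sum_mono le)
    also have "\<dots> = L N * sqrt (real N)" by simp
    finally show False using big by simp
  qed
qed

text \<open>With this choice of the diverging sequence a root-N bound reads as a law of large
  numbers, with deviations of size \<open>\<epsilon> * N\<close>.\<close>

lemma filterlim_const_sqrt: "\<epsilon> > 0 \<Longrightarrow> filterlim (\<lambda>N. \<epsilon> * sqrt (real N)) at_top sequentially"
  by (intro filterlim_tendsto_pos_mult_at_top[OF tendsto_const]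
      filterlim_compose[OF sqrt_at_top filterlim_real_sequentially])

text \<open>Each entry of the weighted second-moment matrix obeys a law of large numbers. Finitely
  many entries suffice to bound the form for all \<open>u\<close> simultaneously, at the cost of
  half its limiting lower bound.\<close>

lemma quadratic_form_limit:
  fixes y :: "'x \<times> 'u \<Rightarrow> real ^ 'k" and h :: "'x \<times> 'u \<Rightarrow> real"
  assumes y: "y \<in> borel_measurable Z" and bd: "AE z in Z. norm (y z) \<le> vb"
    and h: "h \<in> borel_measurable Z" and hb: "AE z in Z. \<bar>h z\<bar> \<le> hB"
    and int: "integrable Z (\<lambda>z. h z *\<^sub>R outer_square (y z))"
    and pd: "positive_definite (\<integral>z. h z *\<^sub>R outer_square (y z) \<partial>Z)"
  obtains lam where "lam > 0"
    "negl D (\<lambda>N \<omega> b. \<not> (\<forall>u. real N * lam * (norm u)\<^sup>2 \<le> (\<Sum>i<N. W2w N \<omega> b i * h (fst \<omega> i) * (y (fst \<omega> i) \<bullet> u)\<^sup>2)))"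
proof -
  let ?A = "\<integral>z. h z *\<^sub>R outer_square (y z) \<partial>Z"
  obtain lam0 where lam0: "lam0 > 0" "\<And>u. lam0 * (norm u)\<^sup>2 \<le> u \<bullet> (?A *v u)"
    by (rule positive_definite_lower[OF pd]) blast
  \<comment> \<open>Chosen so that the entrywise error times the squared dimension is half of
    \<open>lam0\<close>.\<close>
  define \<epsilon> where "\<epsilon> = lam0 / 2 / (real CARD('k))\<^sup>2"
  have \<epsilon>: "\<epsilon> > 0" using lam0 by (simp add: \<epsilon>_def)
  define F where "F l m z = h z * (y z $ l * y z $ m)" for l m z
  have F_meas: "F l m \<in> borel_measurable Z" for l m
    unfolding F_def using y h by (intro borel_measurable_times measurable_nth)
  have F_bd: "AE z in Z. \<bar>F l m z\<bar> \<le> hB * (vb * vb)" for l m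
    using bd hb
  proof eventually_elim
    case (elim z)
    have "\<bar>y z $ l\<bar> \<le> vb" "\<bar>y z $ m\<bar> \<le> vb" using elim component_le_norm_cart order_trans by blast+
    then show ?case unfolding F_def abs_mult using elim by (intro mult_mono) auto
  qed
  have F_int: "Z.expectation (F l m) = ?A $ l $ m" for l m
  proof -
    have bl: "bounded_linear (\<lambda>A :: real ^ 'k ^ 'k. A $ l $ m)"
      by (rule bounded_linear_compose[OF bounded_linear_vec_nth bounded_linear_vec_nth])
    show ?thesis using integral_bounded_linear[OF bl int] by (simp add: F_def[abs_def] outer_square_def)
  qed
  have "negl D (\<lambda>N \<omega> b. \<bar>\<Sum>i<N. real (snd b i) * ipwk N (key N \<omega>) i * (F l m (fst \<omega> i) - Z.expectation (F l m))\<bar>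
      > \<epsilon> * sqrt (real N) * sqrt (real N))" for l m
    by (rule negl_single_function[OF scheme_W2 F_meas F_bd filterlim_const_sqrt[OF \<epsilon>]])
  then have "negl D (\<lambda>N \<omega> b. \<exists>l. \<bar>\<Sum>i<N. real (snd b i) * ipwk N (key N \<omega>) i * (F l m (fst \<omega> i) - Z.expectation (F l m))\<bar>
      > \<epsilon> * sqrt (real N) * sqrt (real N))" for m
    by (rule negl_Ex_finite)
  then have n: "negl D (\<lambda>N \<omega> b. \<exists>m l. \<bar>\<Sum>i<N. real (snd b i) * ipwk N (key N \<omega>) i * (F l m (fst \<omega> i) - Z.expectation (F l m))\<bar>
      > \<epsilon> * sqrt (real N) * sqrt (real N))"
    by (rule negl_Ex_finite)
  show ?thesis
  proof (rule that[of "lam0 / 2"])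
    show "lam0 / 2 > 0" using lam0 by simp
    show "negl D (\<lambda>N \<omega> b. \<not> (\<forall>u. real N * (lam0 / 2) * (norm u)\<^sup>2 \<le> (\<Sum>i<N. W2w N \<omega> b i * h (fst \<omega> i) * (y (fst \<omega> i) \<bullet> u)\<^sup>2)))"
    proof (rule negl_mono[OF n], goal_cases)
      case 1
      show ?case
        using eventually_ge_at_top[of 1]
      proof eventually_elim
        case (elim N)
        show ?case
          using AE_W2w[OF elim]
        proof eventually_elim
          case (elim \<omega>)
          then show ?case
          proof eventually_elim
            case (elim b)
            have eN: "(\<Sum>i<N. W2w N \<omega> b i) = real N" using elim by simp
            show ?case
            proof (intro impI, rule ccontr, goal_cases)
              case 1
              then have le: "\<bar>\<Sum>i<N. W2w N \<omega> b i * (F l m (fst \<omega> i) - Z.expectation (F l m))\<bar> \<le> \<epsilon> * sqrt (real N) * sqrt (real N)" for l m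
                unfolding W2w_def by (auto simp: not_less)
              have dev: "\<bar>(\<Sum>i<N. (W2w N \<omega> b i * h (fst \<omega> i)) * (y (fst \<omega> i) $ l * y (fst \<omega> i) $ m)) - real N * ?A $ l $ m\<bar> \<le> real N * \<epsilon>" for l m
              proof -
                have "(\<Sum>i<N. W2w N \<omega> b i * (F l m (fst \<omega> i) - Z.expectation (F l m)))
                  = (\<Sum>i<N. W2w N \<omega> b i * F l m (fst \<omega> i)) - (\<Sum>i<N. W2w N \<omega> b i) * Z.expectation (F l m)"
                  by (simp add: right_diff_distrib sum_subtractf sum_distrib_right)
                also have "\<dots> = (\<Sum>i<N. (W2w N \<omega> b i * h (fst \<omega> i)) * (y (fst \<omega> i) $ l * y (fst \<omega> i) $ m)) - real N * ?A $ l $ m"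
                  unfolding eN F_int by (simp add: F_def mult.assoc)
                finally show ?thesis using le[of l m] unfolding sqrt_sqrt_mult by simp
              qed
              have lam_eq: "lam0 - \<epsilon> * (real CARD('k))\<^sup>2 = lam0 / 2" by (simp add: \<epsilon>_def)
              have "real N * (lam0 / 2) * (norm u)\<^sup>2 \<le> (\<Sum>i<N. W2w N \<omega> b i * h (fst \<omega> i) * (y (fst \<omega> i) \<bullet> u)\<^sup>2)" for u
                using quadratic_form_lower[OF lam0(2) dev, of u] unfolding lam_eq .
              with 1(1) show False by blast
            qed
          qed
        qed
      qed
    qed
  qed
qed

end

section \<open>The calibration conditions and their quadratic forms\<close>

locale boot_calibration = boot_weights D Wmax
  for D :: "('x, 'u, 'y, 'j::finite, 's) two_phase" and Wmax :: real +
  fixes Vv :: "'y \<times> 'u \<Rightarrow> real ^ 'k" and G :: "real \<Rightarrow> real" and \<A> :: "(real ^ 'k) set" and \<alpha>0 :: "real ^ 'k"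
    and \<alpha>h :: "sharp \<Rightarrow> nat \<Rightarrow> (nat \<Rightarrow> 'x \<times> 'u) \<times> 's \<Rightarrow> real ^ 'k"
    and \<alpha>hh :: "star \<Rightarrow> sharp \<Rightarrow> nat \<Rightarrow> (nat \<Rightarrow> 'x \<times> 'u) \<times> 's \<Rightarrow> weights \<Rightarrow> real ^ 'k"
  assumes cal: "calibration_conditions D Vv G \<A> \<alpha>0 \<alpha>h \<alpha>hh"
begin

definition y :: "'x \<times> 'u \<Rightarrow> real ^ 'k" where "y z = Vv (Vof D z)"

lemma y_meas: "y \<in> borel_measurable Z"
proof -
  have "Vv \<in> borel_measurable (V_space D)" using cal by (simp add: calibration_conditions_def)
  from measurable_compose[OF measurable_Vof this] show ?thesis by (simp add: y_def[abs_def])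
qed

definition vb :: real where "vb = max 1 (SOME B. AE z in Z. norm (y z) \<le> B)"

lemma vb: "vb > 0" "AE z in Z. norm (y z) \<le> vb"
proof -
  have "\<exists>B. AE z in Z. norm (y z) \<le> B" using cal by (simp add: calibration_conditions_def y_def)
  from someI_ex[OF this] have "AE z in Z. norm (y z) \<le> (SOME B. AE z in Z. norm (y z) \<le> B)" .
  then show "AE z in Z. norm (y z) \<le> vb" by eventually_elim (simp add: vb_def)
  show "vb > 0" by (simp add: vb_def)
qed

definition mu :: "real ^ 'k" where "mu = Z.expectation y"

lemma y_int: "integrable Z y" by (rule Z.integrable_const_bound[OF vb(2) y_meas])

lemma norm_mu: "norm mu \<le> vb"
proof -
  have "norm mu \<le> Z.expectation (\<lambda>z. norm (y z))" unfolding mu_def by (rule integral_norm_bound)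
  also have "\<dots> \<le> Z.expectation (\<lambda>z. vb)" using y_int vb(2) by (intro integral_mono_AE) auto
  finally show ?thesis by (simp add: Z.prob_space)
qed

lemma G_mono: "strict_mono G" and G0: "G 0 = 1"
  using cal by (simp_all add: calibration_conditions_def)

lemma G_bound: obtains BG where "\<And>x. \<bar>G x\<bar> \<le> BG"
proof -
  have "bounded (range G)" using cal by (simp add: calibration_conditions_def)
  then show ?thesis using that by (auto simp: bounded_iff)
qed

lemma G_lipschitz: obtains Gd where "Gd > 0" "\<And>x. \<bar>G x - 1\<bar> \<le> Gd * \<bar>x\<bar>"
proof -
  obtain G' where G': "\<And>x. (G has_real_derivative G' x) (at x)" "bounded (range G')"
    using cal unfolding calibration_conditions_def by blast
  then obtain B where B: "\<And>x. \<bar>G' x\<bar> \<le> B" by (auto simp: bounded_iff)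
  have "\<bar>G x - 1\<bar> \<le> (\<bar>B\<bar> + 1) * \<bar>x\<bar>" for x
  proof -
    have "norm (G x - G 0) \<le> B * norm (x - 0)"
      by (rule field_differentiable_bound[of UNIV G G']) (use G' B in auto)
    also have "\<dots> \<le> (\<bar>B\<bar> + 1) * \<bar>x\<bar>" by (simp add: mult_right_mono)
    finally show ?thesis by (simp add: G0)
  qed
  then show ?thesis by (intro that[of "\<bar>B\<bar> + 1"]) auto
qed

lemma G_lower: obtains c0 t0 where "c0 > 0" "t0 > 0" "\<And>t. \<bar>t\<bar> \<le> t0 \<Longrightarrow> c0 * t\<^sup>2 \<le> (G t - 1) * t"
proof -
  obtain G' where G': "\<And>x. (G has_real_derivative G' x) (at x)" "G' 0 > 0"
    using cal unfolding calibration_conditions_def by blast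
  obtain t0 where "t0 > 0" "\<And>t. \<bar>t\<bar> \<le> t0 \<Longrightarrow> G' 0 / 2 * t\<^sup>2 \<le> (G t - 1) * t"
    by (rule derivative_lower[OF G'(1) G'(2) G0]) blast
  then show ?thesis using that[of "G' 0 / 2" t0] G'(2) by simp
qed

definition ybar :: "nat \<Rightarrow> (nat \<Rightarrow> 'x \<times> 'u) \<Rightarrow> real ^ 'k" where "ybar N w = empirical N w y"

text \<open>Both calibration functions have the form \<open>G (q * (v \<bullet> \<alpha>))\<close>
  with a bounded nonnegative scalar and a bounded vector; \<open>qc\<close> and \<open>vc\<close>
  supply these, so that one argument treats both kinds of calibration.\<close>

definition qc :: "sharp \<Rightarrow> nat \<Rightarrow> (nat \<Rightarrow> 'x \<times> 'u) \<times> 's \<Rightarrow> nat \<Rightarrow> real" where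
  "qc sh N \<omega> i = (case sh of Cal_c \<Rightarrow> 1 |
     Cal_cc \<Rightarrow> real (cnt N (fst (key N \<omega>)) (fst (key N \<omega>) i)) / real (ns N (fst (key N \<omega>)) (fst (key N \<omega>) i)) - 1)"

definition vc :: "sharp \<Rightarrow> nat \<Rightarrow> (nat \<Rightarrow> 'x \<times> 'u) \<times> 's \<Rightarrow> nat \<Rightarrow> real ^ 'k" where
  "vc sh N \<omega> i = (case sh of Cal_c \<Rightarrow> y (fst \<omega> i) | Cal_cc \<Rightarrow> y (fst \<omega> i) - ybar N (fst \<omega>))"

lemma Gcal_eq:
  assumes w: "\<omega> \<in> space (data D)" and i: "i < N"
  shows "Gcal D Vv G sh N (fst \<omega>) (Vof D (fst \<omega> i)) \<alpha> = G (qc sh N \<omega> i * (vc sh N \<omega> i \<bullet> \<alpha>))"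
proof (cases sh)
  case Cal_c
  then show ?thesis by (simp add: qc_def vc_def y_def)
next
  case Cal_cc
  have fw: "fst \<omega> \<in> space (iid D)" using w by (auto simp: space_data)
  then have z: "fst \<omega> i \<in> space Z" by (auto simp: space_iid)
  have l: "labels N (fst \<omega>) i = lab (fst \<omega> i)" using i by (simp add: labels_def)
  have "cnt N (labels N (fst \<omega>)) (lab (fst \<omega> i)) > 0" using cnt_pos[OF i, of "labels N (fst \<omega>)"] by (simp add: l)
  then have "1 / pi0 D N (fst \<omega>) (Vof D (fst \<omega> i)) - 1 = qc Cal_cc N \<omega> i"
    by (simp add: qc_def pi0_eq[OF fw z] key_def l)
  moreover have "empirical N (fst \<omega>) (\<lambda>z. Vv (Vof D z)) = ybar N (fst \<omega>)" by (simp add: ybar_def y_def[abs_def])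
  ultimately show ?thesis using Cal_cc by (simp add: vc_def y_def)
qed

definition Qc :: real where "Qc = 1 + 1 / sig"

lemma Qc_pos: "Qc > 0" using sig by (simp add: Qc_def add_pos_pos)

lemma qc_bounds:
  assumes N: "N \<ge> 1" and w: "\<omega> \<in> space (data D)" and i: "i < N"
  shows "0 \<le> qc sh N \<omega> i \<and> qc sh N \<omega> i \<le> Qc"
proof -
  have fw: "fst \<omega> \<in> space (iid D)" using w by (auto simp: space_data)
  let ?l = "labels N (fst \<omega>)"
  note s = sampling_fraction[OF N fw cnt_pos[OF i]]
  have "real (cnt N ?l (?l i)) / real (ns N ?l (?l i)) \<le> 1 / sig" using s sig by (simp add: field_simps)
  moreover have "1 \<le> real (cnt N ?l (?l i)) / real (ns N ?l (?l i))" using s by simp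
  ultimately show ?thesis using sig by (cases sh) (auto simp: qc_def Qc_def key_def)
qed

lemma AE_y_bound: "AE \<omega> in data D. \<forall>i. norm (y (fst \<omega> i)) \<le> vb"
  by (rule AE_data_fst[OF AE_iid_all[OF vb(2)]])

lemma norm_ybar: "N \<ge> 1 \<Longrightarrow> (\<And>i. norm (y (w i)) \<le> vb) \<Longrightarrow> norm (ybar N w) \<le> vb"
proof -
  assume N: "N \<ge> 1" and b: "\<And>i. norm (y (w i)) \<le> vb"
  have "norm (\<Sum>i<N. y (w i)) \<le> real N * vb"
    using sum_norm_le[of "{..<N}" "\<lambda>i. y (w i)" "\<lambda>_. vb"] b by simp
  then show ?thesis using N by (simp add: ybar_def empirical_def field_simps)
qed

lemma norm_vc:
  assumes "N \<ge> 1" "\<And>i. norm (y (fst \<omega> i)) \<le> vb"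
  shows "norm (vc sh N \<omega> i) \<le> 2 * vb"
proof (cases sh)
  case Cal_c
  then show ?thesis using assms(2)[of i] vb by (simp add: vc_def)
next
  case Cal_cc
  have "norm (y (fst \<omega> i) - ybar N (fst \<omega>)) \<le> vb + vb"
    using norm_ybar[OF assms] assms(2)[of i] by (intro order_trans[OF norm_triangle_ineq4] add_mono)
  with Cal_cc show ?thesis by (simp add: vc_def)
qed

lemma quadratic_c:
  obtains lam where "lam > 0"
    "negl D (\<lambda>N \<omega> b. \<not> (\<forall>u. real N * lam * (norm u)\<^sup>2 \<le> (\<Sum>i<N. W2w N \<omega> b i * qc Cal_c N \<omega> i * (vc Cal_c N \<omega> i \<bullet> u)\<^sup>2)))"
proof -
  have "integrable Z (\<lambda>z. (1::real) *\<^sub>R outer_square (y z))"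
    "positive_definite (\<integral>z. (1::real) *\<^sub>R outer_square (y z) \<partial>Z)"
    using cal by (simp_all add: calibration_conditions_def y_def)
  then obtain lam where "lam > 0"
    "negl D (\<lambda>N \<omega> b. \<not> (\<forall>u. real N * lam * (norm u)\<^sup>2 \<le> (\<Sum>i<N. W2w N \<omega> b i * 1 * (y (fst \<omega> i) \<bullet> u)\<^sup>2)))"
    by (rule quadratic_form_limit[OF y_meas vb(2), of "\<lambda>_. 1" 1, rotated 2]) auto
  then show ?thesis by (intro that[of lam]) (simp_all add: qc_def vc_def)
qed

text \<open>The limiting form, with limiting sampling fractions and centring at \<open>mu\<close>,
  is covered by \<open>quadratic_form_limit\<close>. Passing to the observed fractions and to the
  empirical mean costs a quarter of \<open>lam\<close> each.\<close>

lemma quadratic_cc: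
  obtains lam where "lam > 0"
    "negl D (\<lambda>N \<omega> b. \<not> (\<forall>u. real N * lam * (norm u)\<^sup>2 \<le> (\<Sum>i<N. W2w N \<omega> b i * qc Cal_cc N \<omega> i * (vc Cal_cc N \<omega> i \<bullet> u)\<^sup>2)))"
proof -
  define h where "h z = 1 / plim D (lab z) - 1" for z
  have h_meas: "h \<in> borel_measurable Z"
    unfolding h_def[abs_def] by (rule measurable_compose[OF measurable_lab]) simp
  have h_bd: "\<bar>h z\<bar> \<le> (\<Sum>j\<in>UNIV. \<bar>1 / plim D j - 1\<bar>)" for z
    unfolding h_def by (rule member_le_sum[of "lab z" UNIV "\<lambda>j. \<bar>1 / plim D j - 1\<bar>"]) auto
  let ?x = "\<lambda>z. y z - mu"
  have x_meas: "?x \<in> borel_measurable Z" using y_meas by simp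
  have x_bd: "AE z in Z. norm (?x z) \<le> 2 * vb"
    using vb(2)
  proof eventually_elim
    case (elim z)
    have "norm (y z - mu) \<le> vb + vb" using elim norm_mu by (intro order_trans[OF norm_triangle_ineq4] add_mono)
    then show ?case by simp
  qed
  have S: "integrable Z (\<lambda>z. (1 / pi_inf D (Vof D z) - 1) *\<^sub>R outer_square (y z - mu))"
    "positive_definite (\<integral>z. (1 / pi_inf D (Vof D z) - 1) *\<^sub>R outer_square (y z - mu) \<partial>Z)"
    using cal by (simp_all add: calibration_conditions_def Let_def y_def[abs_def] mu_def)
  have eq: "z \<in> space Z \<Longrightarrow> (1 / pi_inf D (Vof D z) - 1) *\<^sub>R outer_square (y z - mu) = h z *\<^sub>R outer_square (?x z)" for z
    by (simp add: h_def pi_inf_eq)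
  have int: "integrable Z (\<lambda>z. h z *\<^sub>R outer_square (?x z))"
    using S(1) by (subst Bochner_Integration.integrable_cong[OF refl eq[symmetric]]) auto
  have pd: "positive_definite (\<integral>z. h z *\<^sub>R outer_square (?x z) \<partial>Z)"
    using S(2) by (subst Bochner_Integration.integral_cong[OF refl eq[symmetric]]) auto
  obtain lam where lam: "lam > 0"
    "negl D (\<lambda>N \<omega> b. \<not> (\<forall>u. real N * lam * (norm u)\<^sup>2 \<le> (\<Sum>i<N. W2w N \<omega> b i * h (fst \<omega> i) * (?x (fst \<omega> i) \<bullet> u)\<^sup>2)))"
    by (rule quadratic_form_limit[OF x_meas x_bd h_meas AE_I2[OF h_bd] int pd]) blast
  \<comment> \<open>Since centred values have norm at most \<open>2 * vb\<close>, this is the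
    solution of \<open>\<epsilon> * (2 * vb)^2 = lam / 4\<close>; likewise \<open>\<zeta>\<close>
    solves \<open>4 * Qc * vb * \<zeta> = lam / 4\<close>.\<close>
  define \<epsilon> where "\<epsilon> = lam / (16 * vb\<^sup>2)"
  define \<zeta> where "\<zeta> = lam / (16 * Qc * vb)"
  have \<epsilon>: "\<epsilon> > 0" and \<zeta>: "\<zeta> > 0" using lam vb Qc_pos by (simp_all add: \<epsilon>_def \<zeta>_def)
  note n1 = sampling_fraction_limit[OF \<epsilon>]
  have n2: "negl D (\<lambda>N \<omega> b. norm (\<Sum>i<N. 1 *\<^sub>R (y (fst \<omega> i) - Z.expectation y)) > \<zeta> * sqrt (real N) * sqrt (real N))"
    by (rule negl_vector_mean[OF scheme_one y_meas vb(2) filterlim_const_sqrt[OF \<zeta>]])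
  show ?thesis
  proof (rule that[of "lam / 2"])
    show "lam / 2 > 0" using lam by simp
    show "negl D (\<lambda>N \<omega> b. \<not> (\<forall>u. real N * (lam / 2) * (norm u)\<^sup>2 \<le> (\<Sum>i<N. W2w N \<omega> b i * qc Cal_cc N \<omega> i * (vc Cal_cc N \<omega> i \<bullet> u)\<^sup>2)))"
    proof (rule negl_mono[OF negl_disj[OF lam(2) negl_disj[OF n1 n2]]], goal_cases)
      case 1
      show ?case
        using eventually_ge_at_top[of 1]
      proof eventually_elim
        case (elim N)
        note N = elim
        show ?case
          using AE_W2w[OF N] AE_y_bound AE_space
        proof eventually_elim
          case (elim \<omega>)
          note yb = elim(2) and w = elim(3)
          show ?case
            using elim(1)
          proof eventually_elim
            case (elim b)
            note e = elim
            show ?case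
            proof (intro impI, rule ccontr, goal_cases)
              case 1
              from 1(2) have q1: "\<And>u. real N * lam * (norm u)\<^sup>2 \<le> (\<Sum>i<N. W2w N \<omega> b i * h (fst \<omega> i) * (?x (fst \<omega> i) \<bullet> u)\<^sup>2)"
                and q2: "\<And>j. \<bar>real (cnt N (fst (key N \<omega>)) j) / real (ns N (fst (key N \<omega>)) j) - 1 / plim D j\<bar> \<le> \<epsilon>"
                and q3: "norm (\<Sum>i<N. 1 *\<^sub>R (y (fst \<omega> i) - Z.expectation y)) \<le> \<zeta> * sqrt (real N) * sqrt (real N)"
                unfolding de_Morgan_disj not_not not_less by blast+
              have yd: "norm (mu - ybar N (fst \<omega>)) \<le> \<zeta>"
              proof -
                have "(\<Sum>i<N. 1 *\<^sub>R (y (fst \<omega> i) - Z.expectation y)) = real N *\<^sub>R (ybar N (fst \<omega>) - mu)"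
                  using N by (simp add: ybar_def empirical_def sum_subtractf mu_def scaleR_diff_right sum_constant_scaleR del: sum_constant)
                then have "real N * norm (ybar N (fst \<omega>) - mu) \<le> real N * \<zeta>"
                  using q3 unfolding sqrt_sqrt_mult by simp
                then show ?thesis using N by (simp add: norm_minus_commute)
              qed
              have "real N * (lam / 2) * (norm u)\<^sup>2 \<le> (\<Sum>i<N. W2w N \<omega> b i * qc Cal_cc N \<omega> i * (vc Cal_cc N \<omega> i \<bullet> u)\<^sup>2)" for u
              proof -
                \<comment> \<open>The factor \<open>q\<close> is at least
                  \<open>h - \<epsilon>\<close>, the cross term of \<open>(p + s)^2\<close> is
                  small, and \<open>s^2\<close> is dropped as nonnegative. Both losses are charged
                  to the weight \<open>W2w\<close>, whose total is \<open>N\<close>.\<close>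
                have each: "W2w N \<omega> b i * h (fst \<omega> i) * (?x (fst \<omega> i) \<bullet> u)\<^sup>2 - W2w N \<omega> b i * (lam / 2 * (norm u)\<^sup>2)
                   \<le> W2w N \<omega> b i * qc Cal_cc N \<omega> i * (vc Cal_cc N \<omega> i \<bullet> u)\<^sup>2" if i: "i < N" for i
                proof -
                  define p where "p = ?x (fst \<omega> i) \<bullet> u"
                  define s where "s = (mu - ybar N (fst \<omega>)) \<bullet> u"
                  define q where "q = qc Cal_cc N \<omega> i"
                  have v: "vc Cal_cc N \<omega> i \<bullet> u = p + s" by (simp add: vc_def p_def s_def inner_diff_left)
                  have p: "\<bar>p\<bar> \<le> 2 * vb * norm u"
                  proof -
                    have "norm (?x (fst \<omega> i)) \<le> vb + vb"
                      using yb norm_mu by (intro order_trans[OF norm_triangle_ineq4] add_mono) auto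
                    then show ?thesis unfolding p_def
                      by (intro order_trans[OF Cauchy_Schwarz_ineq2] mult_right_mono) auto
                  qed
                  have s: "\<bar>s\<bar> \<le> \<zeta> * norm u"
                    unfolding s_def using yd by (intro order_trans[OF Cauchy_Schwarz_ineq2] mult_right_mono) auto
                  have q: "0 \<le> q" "q \<le> Qc" using qc_bounds[OF N w i, of Cal_cc] by (auto simp: q_def)
                  have li: "fst (key N \<omega>) i = lab (fst \<omega> i)" using i by (simp add: key_def labels_def)
                  have qh: "h (fst \<omega> i) - \<epsilon> \<le> q"
                    using q2[of "lab (fst \<omega> i)"] by (simp add: q_def qc_def h_def li)
                  have ps: "\<bar>p * s\<bar> \<le> (2 * vb * norm u) * (\<zeta> * norm u)"
                    unfolding abs_mult using p s vb by (intro mult_mono) auto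
                  have "p\<^sup>2 - 4 * vb * \<zeta> * (norm u)\<^sup>2 \<le> p\<^sup>2 + 2 * (p * s)"
                    using ps by (simp add: abs_le_iff power2_eq_square algebra_simps)
                  also have "\<dots> \<le> (p + s)\<^sup>2" by (simp add: power2_eq_square algebra_simps)
                  finally have "q * (p\<^sup>2 - 4 * vb * \<zeta> * (norm u)\<^sup>2) \<le> q * (p + s)\<^sup>2" using q by (intro mult_left_mono)
                  moreover have "q * (4 * vb * \<zeta> * (norm u)\<^sup>2) \<le> lam / 4 * (norm u)\<^sup>2"
                  proof -
                    have "q * (4 * vb * \<zeta> * (norm u)\<^sup>2) \<le> Qc * (4 * vb * \<zeta> * (norm u)\<^sup>2)"
                      using q vb \<zeta> by (intro mult_right_mono) auto
                    also have "\<dots> = lam / 4 * (norm u)\<^sup>2" using vb Qc_pos by (simp add: \<zeta>_def)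
                    finally show ?thesis .
                  qed
                  moreover have "h (fst \<omega> i) * p\<^sup>2 - lam / 4 * (norm u)\<^sup>2 \<le> q * p\<^sup>2"
                  proof -
                    have "(h (fst \<omega> i) - \<epsilon>) * p\<^sup>2 \<le> q * p\<^sup>2" using qh by (rule mult_right_mono) simp
                    moreover have "\<epsilon> * p\<^sup>2 \<le> \<epsilon> * (2 * vb * norm u)\<^sup>2"
                      using p \<epsilon> vb by (intro mult_left_mono) (auto simp: abs_le_square_iff[symmetric] abs_mult)
                    moreover have "\<epsilon> * (2 * vb * norm u)\<^sup>2 = lam / 4 * (norm u)\<^sup>2"
                      using vb by (simp add: \<epsilon>_def power_mult_distrib)
                    ultimately show ?thesis by (simp add: left_diff_distrib)
                  qed
                  ultimately have "h (fst \<omega> i) * p\<^sup>2 - lam / 2 * (norm u)\<^sup>2 \<le> q * (p + s)\<^sup>2"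
                    by (simp add: right_diff_distrib)
                  then have "W2w N \<omega> b i * (h (fst \<omega> i) * p\<^sup>2 - lam / 2 * (norm u)\<^sup>2) \<le> W2w N \<omega> b i * (q * (p + s)\<^sup>2)"
                    using e i by (intro mult_left_mono) auto
                  then show ?thesis unfolding v q_def[symmetric] p_def[symmetric] by (simp add: right_diff_distrib mult.assoc)
                qed
                have "real N * (lam / 2) * (norm u)\<^sup>2 = real N * lam * (norm u)\<^sup>2 - (\<Sum>i<N. W2w N \<omega> b i) * (lam / 2 * (norm u)\<^sup>2)"
                  using e by simp
                also have "\<dots> \<le> (\<Sum>i<N. W2w N \<omega> b i * h (fst \<omega> i) * (?x (fst \<omega> i) \<bullet> u)\<^sup>2 - W2w N \<omega> b i * (lam / 2 * (norm u)\<^sup>2))"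
                  unfolding sum_subtractf sum_distrib_right[symmetric] using q1[of u] by (rule diff_right_mono)
                also have "\<dots> \<le> (\<Sum>i<N. W2w N \<omega> b i * qc Cal_cc N \<omega> i * (vc Cal_cc N \<omega> i \<bullet> u)\<^sup>2)"
                  by (intro sum_mono each) simp
                finally show ?thesis .
              qed
              with 1(1) show False by blast
            qed
          qed
        qed
      qed
    qed
  qed
qed

lemma quadratic:
  obtains lam where "lam > 0"
    "negl D (\<lambda>N \<omega> b. \<not> (\<forall>u. real N * lam * (norm u)\<^sup>2 \<le> (\<Sum>i<N. W2w N \<omega> b i * qc sh N \<omega> i * (vc sh N \<omega> i \<bullet> u)\<^sup>2)))"
proof (cases sh)
  case Cal_c
  show ?thesis by (rule quadratic_c) (use that Cal_c in blast)
next
  case Cal_cc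
  show ?thesis by (rule quadratic_cc) (use that Cal_cc in blast)
qed

end

section \<open>Root-N rate of the calibration parameter\<close>

context boot_calibration
begin

lemma emp_pi_W2_eq:
  assumes "\<omega> \<in> space (data D)"
  shows "emp_pi_W2 D N \<omega> b f = (1 / real N) *\<^sub>R (\<Sum>i<N. W2w N \<omega> b i *\<^sub>R f (fst \<omega> i))"
  using assms by (simp add: emp_pi_W2_def W2w_def ipw_eq)

lemma emp_pi_eq:
  assumes "\<omega> \<in> space (data D)"
  shows "emp_pi D N \<omega> f = (1 / real N) *\<^sub>R (\<Sum>i<N. ipwk N (key N \<omega>) i *\<^sub>R f (fst \<omega> i))"
  using assms by (simp add: emp_pi_def ipw_eq)

text \<open>All four bootstrap calibration equations say that the reweighted sum
  \<open>\<Sum> W\<^sub>i\<^sup>(\<^sup>2\<^sup>) (G - 1) v\<close> is a combination of differences of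
  root-\<open>N\<close> consistent weighted means of \<open>V\<close>.\<close>

lemma calibration_residual:
  fixes b :: weights and \<omega> :: "(nat \<Rightarrow> 'x \<times> 'u) \<times> 's"
  assumes N: "N \<ge> 1" and w: "\<omega> \<in> space (data D)"
    and e0: "\<And>i. i < N \<Longrightarrow> 0 \<le> W2w N \<omega> b i"
    and e1: "(\<Sum>i<N. W2w N \<omega> b i) = real N" and i1: "(\<Sum>i<N. ipwk N (key N \<omega>) i) = real N"
    and BG: "\<And>x. \<bar>G x\<bar> \<le> BG"
    and eq: "boot_calibration_eq D Vv G st sh N \<omega> b \<alpha>"
    and d1: "norm (\<Sum>i<N. 1 *\<^sub>R (y (fst \<omega> i) - mu)) \<le> t"
    and d2: "norm (\<Sum>i<N. W2w N \<omega> b i *\<^sub>R (y (fst \<omega> i) - mu)) \<le> t"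
    and d3: "norm (\<Sum>i<N. ipwk N (key N \<omega>) i *\<^sub>R (y (fst \<omega> i) - mu)) \<le> t"
  shows "norm (\<Sum>i<N. (W2w N \<omega> b i * (G (qc sh N \<omega> i * (vc sh N \<omega> i \<bullet> \<alpha>)) - 1)) *\<^sub>R vc sh N \<omega> i) \<le> 3 * (BG + 1) * t"
proof -
  define e where "e i = W2w N \<omega> b i" for i
  define g where "g i = G (qc sh N \<omega> i * (vc sh N \<omega> i \<bullet> \<alpha>))" for i
  define x where "x i = y (fst \<omega> i)" for i
  define Y1 where "Y1 = (\<Sum>i<N. x i)"
  define Ye where "Ye = (\<Sum>i<N. e i *\<^sub>R x i)"
  define Yp where "Yp = (\<Sum>i<N. ipwk N (key N \<omega>) i *\<^sub>R x i)"
  have t0: "0 \<le> t" using d1 norm_ge_zero order_trans by blast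
  have BG1: "1 \<le> BG" using BG[of 0] G0 by simp
  have c1: "norm (Y1 - real N *\<^sub>R mu) \<le> t"
    using d1 by (simp add: Y1_def x_def sum_subtractf sum_constant_scaleR del: sum_constant)
  have c2: "norm (Ye - real N *\<^sub>R mu) \<le> t"
    using d2 e1 by (simp add: Ye_def x_def e_def scaleR_diff_right sum_subtractf scaleR_sum_left[symmetric])
  have c3: "norm (Yp - real N *\<^sub>R mu) \<le> t"
    using d3 i1 by (simp add: Yp_def x_def scaleR_diff_right sum_subtractf scaleR_sum_left[symmetric])
  \<comment> \<open>Applied to the unweighted, the phase II weighted and the inverse-probability
    weighted totals of the auxiliary vector, all of which lie within \<open>t\<close> of
    \<open>N * mu\<close>.\<close>
  have tri: "norm (a - c) \<le> 2 * t" if "norm (a - real N *\<^sub>R mu) \<le> t" "norm (c - real N *\<^sub>R mu) \<le> t" for a c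
  proof -
    have "a - c = (a - real N *\<^sub>R mu) - (c - real N *\<^sub>R mu)" by simp
    then have "norm (a - c) \<le> norm (a - real N *\<^sub>R mu) + norm (c - real N *\<^sub>R mu)" by (metis norm_triangle_ineq4)
    then show ?thesis using that by simp
  qed
  have t2: "2 * t \<le> 3 * (BG + 1) * t" using BG1 t0 by (intro mult_right_mono) auto
  have ybarY: "ybar N (fst \<omega>) = (1 / real N) *\<^sub>R Y1" by (simp add: ybar_def empirical_def Y1_def x_def)
  have emp: "empirical N (fst \<omega>) (\<lambda>z. Vv (Vof D z)) = (1 / real N) *\<^sub>R Y1"
    by (simp add: empirical_def Y1_def x_def y_def)
  have empp: "emp_pi D N \<omega> (\<lambda>z. Vv (Vof D z)) = (1 / real N) *\<^sub>R Yp"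
    by (simp add: emp_pi_eq[OF w] Yp_def x_def y_def)
  have W2G: "emp_pi_W2 D N \<omega> b (\<lambda>z. Gcal D Vv G sh N (fst \<omega>) (Vof D z) \<alpha> *\<^sub>R (Vv (Vof D z) - a))
     = (1 / real N) *\<^sub>R (\<Sum>i<N. (e i * g i) *\<^sub>R (x i - a))" for a
    unfolding emp_pi_W2_eq[OF w]
    by (intro arg_cong[of _ _ "\<lambda>s. (1 / real N) *\<^sub>R s"] sum.cong refl)
       (simp add: Gcal_eq[OF w] e_def g_def x_def y_def)
  have Nn: "real N \<noteq> 0" using N by simp
  have X: "(\<Sum>i<N. (W2w N \<omega> b i * (G (qc sh N \<omega> i * (vc sh N \<omega> i \<bullet> \<alpha>)) - 1)) *\<^sub>R vc sh N \<omega> i)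
     = (\<Sum>i<N. (e i * g i) *\<^sub>R vc sh N \<omega> i) - (\<Sum>i<N. e i *\<^sub>R vc sh N \<omega> i)"
    by (simp add: e_def g_def right_diff_distrib scaleR_diff_left sum_subtractf)
  show ?thesis
  proof (cases sh)
    case Cal_c
    have vx: "vc sh N \<omega> i = x i" for i by (simp add: Cal_c vc_def x_def)
    have XX: "(\<Sum>i<N. (e i * g i) *\<^sub>R vc sh N \<omega> i) - (\<Sum>i<N. e i *\<^sub>R vc sh N \<omega> i) = (\<Sum>i<N. (e i * g i) *\<^sub>R x i) - Ye"
      by (simp add: vx Ye_def)
    show ?thesis
    proof (cases st)
      case Boot_b
      have "(1 / real N) *\<^sub>R (\<Sum>i<N. (e i * g i) *\<^sub>R x i) = (1 / real N) *\<^sub>R Y1"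
        using eq W2G[of 0] unfolding Cal_c Boot_b by (auto simp: emp)
      then have "(\<Sum>i<N. (e i * g i) *\<^sub>R x i) = Y1" using Nn by simp
      then show ?thesis unfolding X XX using tri[OF c1 c2] t2 by simp
    next
      case Boot_bs
      have "(1 / real N) *\<^sub>R (\<Sum>i<N. (e i * g i) *\<^sub>R x i) = (1 / real N) *\<^sub>R Yp"
        using eq W2G[of 0] unfolding Cal_c Boot_bs by (auto simp: empp)
      then have "(\<Sum>i<N. (e i * g i) *\<^sub>R x i) = Yp" using Nn by simp
      then show ?thesis unfolding X XX using tri[OF c3 c2] t2 by simp
    qed
  next
    case Cal_cc
    let ?y = "(1 / real N) *\<^sub>R Y1"
    have vx: "vc sh N \<omega> i = x i - ?y" for i by (simp add: Cal_cc vc_def x_def ybarY)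
    have s2: "(\<Sum>i<N. e i *\<^sub>R vc sh N \<omega> i) = Ye - Y1"
    proof -
      have "(\<Sum>i<N. e i *\<^sub>R ?y) = (\<Sum>i<N. e i) *\<^sub>R ?y" by (rule scaleR_sum_left[symmetric])
      also have "\<dots> = Y1" unfolding e_def e1 using Nn by simp
      finally show ?thesis unfolding vx scaleR_diff_right sum_subtractf Ye_def by simp
    qed
    show ?thesis
    proof (cases st)
      case Boot_b
      have "(1 / real N) *\<^sub>R (\<Sum>i<N. (e i * g i) *\<^sub>R (x i - ?y)) = 0"
        using eq W2G[of ?y] unfolding Cal_cc Boot_b by (auto simp: emp)
      then have "(\<Sum>i<N. (e i * g i) *\<^sub>R vc sh N \<omega> i) = 0" using Nn by (simp add: vx)
      then show ?thesis unfolding X s2 using tri[OF c1 c2] t2 by simp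
    next
      \<comment> \<open>The equation is centred at the inverse-probability weighted mean,
        \<open>vc\<close> at the unweighted one. The shift between them is multiplied by the
        weighted mean of \<open>G\<close>, which is where \<open>BG\<close> enters the
        bound.\<close>
      case Boot_bs
      let ?yp = "(1 / real N) *\<^sub>R Yp"
      have "(1 / real N) *\<^sub>R (\<Sum>i<N. (e i * g i) *\<^sub>R (x i - ?yp)) = 0"
        using eq W2G[of ?yp] unfolding Cal_cc Boot_bs by (auto simp: empp)
      then have z: "(\<Sum>i<N. (e i * g i) *\<^sub>R (x i - ?yp)) = 0" using Nn by simp
      have "(\<Sum>i<N. (e i * g i) *\<^sub>R vc sh N \<omega> i) = (\<Sum>i<N. (e i * g i) *\<^sub>R (x i - ?yp)) + (\<Sum>i<N. (e i * g i) *\<^sub>R (?yp - ?y))"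
        unfolding sum.distrib[symmetric] scaleR_add_right[symmetric] by (simp add: vx)
      also have "\<dots> = ((\<Sum>i<N. e i * g i) / real N) *\<^sub>R (Yp - Y1)"
        unfolding z scaleR_diff_right[symmetric] scaleR_sum_left[symmetric] by simp
      finally have s1: "(\<Sum>i<N. (e i * g i) *\<^sub>R vc sh N \<omega> i) = ((\<Sum>i<N. e i * g i) / real N) *\<^sub>R (Yp - Y1)" .
      have "\<bar>\<Sum>i<N. e i * g i\<bar> \<le> (\<Sum>i<N. e i * BG)"
      proof (rule order_trans[OF sum_abs sum_mono])
        fix i assume "i \<in> {..<N}"
        then have "0 \<le> e i" using e0 by (simp add: e_def)
        then show "\<bar>e i * g i\<bar> \<le> e i * BG" using BG by (simp add: abs_mult g_def mult_left_mono)
      qed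
      also have "\<dots> = real N * BG" using e1 by (simp add: e_def sum_distrib_right[symmetric])
      finally have "\<bar>(\<Sum>i<N. e i * g i) / real N\<bar> \<le> BG" using N by (simp add: divide_le_eq mult.commute)
      then have b1: "norm (((\<Sum>i<N. e i * g i) / real N) *\<^sub>R (Yp - Y1)) \<le> BG * (2 * t)"
        unfolding norm_scaleR using tri[OF c3 c1] BG1 by (intro mult_mono) auto
      have "norm ((\<Sum>i<N. (e i * g i) *\<^sub>R vc sh N \<omega> i) - (Ye - Y1)) \<le> BG * (2 * t) + 2 * t"
        unfolding s1 by (rule order_trans[OF norm_triangle_ineq4 add_mono[OF b1 tri[OF c2 c1]]])
      also have "\<dots> = 2 * (BG + 1) * t" by (simp add: algebra_simps)
      also have "\<dots> \<le> 3 * (BG + 1) * t" using BG1 t0 by (intro mult_right_mono) auto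
      finally show ?thesis unfolding X s2 .
    qed
  qed
qed

text \<open>The weighted totals of the auxiliary vector are accurate up to multiples of
  \<open>l N * sqrt N\<close>, so \<open>calibration_residual\<close> bounds the residual by
  \<open>N * \<Delta>\<close> with \<open>\<Delta>\<close> proportional to
  \<open>l N / sqrt N\<close>, and \<open>calibration_step\<close> transfers this rate to the
  root.\<close>

theorem negl_calibration_parameter:
  assumes L: "filterlim L at_top sequentially"
  shows "negl D (\<lambda>N \<omega> b. \<not> norm (\<alpha>hh st sh N \<omega> b) \<le> L N / sqrt (real N))"
proof -
  obtain BG where BG: "\<And>x. \<bar>G x\<bar> \<le> BG" by (rule G_bound) blast
  have BG1: "1 \<le> BG" using BG[of 0] G0 by simp
  obtain c0 t0 where c0: "c0 > 0" "t0 > 0" "\<And>t. \<bar>t\<bar> \<le> t0 \<Longrightarrow> c0 * t\<^sup>2 \<le> (G t - 1) * t"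
    by (rule G_lower) blast
  obtain lam where lam: "lam > 0"
    "negl D (\<lambda>N \<omega> b. \<not> (\<forall>u. real N * lam * (norm u)\<^sup>2 \<le> (\<Sum>i<N. W2w N \<omega> b i * qc sh N \<omega> i * (vc sh N \<omega> i \<bullet> u)\<^sup>2)))"
    by (rule quadratic) blast
  \<comment> \<open>The cap at the fourth root of \<open>N\<close> forces
    \<open>l N / sqrt N\<close> to 0, as the smallness condition on \<open>\<Delta>\<close>
    requires, even if \<open>L\<close> grows fast.\<close>
  define l where "l N = min (L N) (sqrt (sqrt (real N)))" for N
  have l_top: "filterlim l at_top sequentially"
    unfolding filterlim_at_top
  proof
    fix Z :: real
    have "filterlim (\<lambda>N. sqrt (sqrt (real N))) at_top sequentially"
      by (intro filterlim_compose[OF sqrt_at_top] filterlim_real_sequentially)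
    then have "eventually (\<lambda>N. Z \<le> sqrt (sqrt (real N))) sequentially" by (simp add: filterlim_at_top)
    moreover have "eventually (\<lambda>N. Z \<le> L N) sequentially" using L by (simp add: filterlim_at_top)
    ultimately show "eventually (\<lambda>N. Z \<le> l N) sequentially"
      by eventually_elim (simp add: l_def)
  qed
  \<comment> \<open>Solves \<open>3 * (BG + 1) * \<beta> = c0 * lam\<close>, so that the constants
    of the residual bound and of the curvature cancel.\<close>
  define \<beta> where "\<beta> = c0 * lam / (3 * (BG + 1))"
  have \<beta>: "\<beta> > 0" using c0 lam BG1 by (simp add: \<beta>_def)
  have bl: "filterlim (\<lambda>N. \<beta> * l N) at_top sequentially"
    by (intro filterlim_tendsto_pos_mult_at_top[OF tendsto_const] l_top \<beta>)
  have n1: "negl D (\<lambda>N \<omega> b. norm (\<Sum>i<N. 1 *\<^sub>R (y (fst \<omega> i) - Z.expectation y)) > \<beta> * l N * sqrt (real N))"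
    by (rule negl_vector_mean[OF scheme_one y_meas vb(2) bl])
  have n2: "negl D (\<lambda>N \<omega> b. norm (\<Sum>i<N. (real (snd b i) * ipwk N (key N \<omega>) i) *\<^sub>R (y (fst \<omega> i) - Z.expectation y)) > \<beta> * l N * sqrt (real N))"
    by (rule negl_vector_mean[OF scheme_W2 y_meas vb(2) bl])
  have n3: "negl D (\<lambda>N \<omega> b. norm (\<Sum>i<N. ipwk N (key N \<omega>) i *\<^sub>R (y (fst \<omega> i) - Z.expectation y)) > \<beta> * l N * sqrt (real N))"
    by (rule negl_vector_mean[OF scheme_ipw y_meas vb(2) bl])
  have n4: "negl D (\<lambda>N \<omega> b. \<not> (\<alpha>hh st sh N \<omega> b \<in> \<A> \<and> boot_calibration_eq D Vv G st sh N \<omega> b (\<alpha>hh st sh N \<omega> b)))"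
    using cal unfolding calibration_conditions_def negl_def by blast
  define \<rho> where "\<rho> = t0 / (Qc * (2 * vb))"
  have \<rho>: "\<rho> > 0" using c0 vb Qc_pos by (simp add: \<rho>_def)
  have ev: "eventually (\<lambda>N. N \<ge> 1 \<and> l N \<ge> 1 \<and> l N / sqrt (real N) < \<rho>) sequentially"
  proof -
    have "((\<lambda>N. inverse (sqrt (sqrt (real N)))) \<longlongrightarrow> 0) sequentially"
      by (intro tendsto_inverse_0_at_top filterlim_compose[OF sqrt_at_top] filterlim_real_sequentially)
    then have "eventually (\<lambda>N. inverse (sqrt (sqrt (real N))) < \<rho>) sequentially"
      using \<rho> by (rule order_tendstoD)
    moreover have "eventually (\<lambda>N. l N \<ge> 1) sequentially" using l_top by (simp add: filterlim_at_top)
    ultimately show ?thesis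
      using eventually_ge_at_top[of 1]
    proof eventually_elim
      case (elim N)
      have "l N / sqrt (real N) \<le> sqrt (sqrt (real N)) / sqrt (real N)"
        by (intro divide_right_mono) (auto simp: l_def)
      also have "\<dots> = inverse (sqrt (sqrt (real N)))" by (rule sqrt_divide_self_eq) simp
      finally show ?case using elim by simp
    qed
  qed
  note nn = negl_disj[OF lam(2) negl_disj[OF n1 negl_disj[OF n2 negl_disj[OF n3 n4]]]]
  show ?thesis
  proof (rule negl_mono[OF nn], goal_cases)
    case 1
    show ?case
      using ev
    proof eventually_elim
      case (elim N)
      then have N: "N \<ge> 1" and l1: "l N \<ge> 1" and lr: "l N / sqrt (real N) < \<rho>" by auto
      show ?case
        using AE_W2w[OF N] AE_y_bound AE_space
      proof eventually_elim
        case (elim \<omega>)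
        note yb = elim(2) and w = elim(3)
        show ?case
          using elim(1)
        proof eventually_elim
          case (elim b)
          let ?\<alpha> = "\<alpha>hh st sh N \<omega> b"
          have e: "\<And>i. i < N \<Longrightarrow> 0 \<le> W2w N \<omega> b i" "(\<Sum>i<N. W2w N \<omega> b i) = real N"
            "(\<Sum>i<N. ipwk N (key N \<omega>) i) = real N" using elim by auto
          show ?case
          proof (intro impI, rule ccontr, goal_cases)
            case 1
            note big = 1(1)
            from 1(2) have q1: "\<And>u. real N * lam * (norm u)\<^sup>2 \<le> (\<Sum>i<N. W2w N \<omega> b i * qc sh N \<omega> i * (vc sh N \<omega> i \<bullet> u)\<^sup>2)"
              and q2: "norm (\<Sum>i<N. 1 *\<^sub>R (y (fst \<omega> i) - mu)) \<le> \<beta> * l N * sqrt (real N)"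
              and q3: "norm (\<Sum>i<N. W2w N \<omega> b i *\<^sub>R (y (fst \<omega> i) - mu)) \<le> \<beta> * l N * sqrt (real N)"
              and q4: "norm (\<Sum>i<N. ipwk N (key N \<omega>) i *\<^sub>R (y (fst \<omega> i) - mu)) \<le> \<beta> * l N * sqrt (real N)"
              and q5: "boot_calibration_eq D Vv G st sh N \<omega> b ?\<alpha>"
              unfolding de_Morgan_disj not_not not_less mu_def W2w_def by blast+
            define \<Delta> where "\<Delta> = c0 * lam * (l N / sqrt (real N))"
            have sN: "sqrt (real N) > 0" using N by simp
            have res: "norm (\<Sum>i<N. (W2w N \<omega> b i * (G (qc sh N \<omega> i * (vc sh N \<omega> i \<bullet> ?\<alpha>)) - 1)) *\<^sub>R vc sh N \<omega> i) \<le> real N * \<Delta>"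
            proof -
              have "3 * (BG + 1) * (\<beta> * l N * sqrt (real N)) = c0 * lam * l N * sqrt (real N)"
                using BG1 by (simp add: \<beta>_def)
              also have "\<dots> = real N * \<Delta>"
                unfolding \<Delta>_def using sN by (simp add: field_simps)
              finally show ?thesis
                using calibration_residual[OF N w e BG q5 q2 q3 q4] by simp
            qed
            have le: "(\<Sum>i<N. W2w N \<omega> b i * (G (qc sh N \<omega> i * (vc sh N \<omega> i \<bullet> ?\<alpha>)) - 1) * (vc sh N \<omega> i \<bullet> ?\<alpha>)) \<le> real N * norm ?\<alpha> * \<Delta>"
            proof -
              have "(\<Sum>i<N. W2w N \<omega> b i * (G (qc sh N \<omega> i * (vc sh N \<omega> i \<bullet> ?\<alpha>)) - 1) * (vc sh N \<omega> i \<bullet> ?\<alpha>))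
                = (\<Sum>i<N. (W2w N \<omega> b i * (G (qc sh N \<omega> i * (vc sh N \<omega> i \<bullet> ?\<alpha>)) - 1)) *\<^sub>R vc sh N \<omega> i) \<bullet> ?\<alpha>"
                by (simp add: inner_sum_left)
              also have "\<dots> \<le> norm (\<Sum>i<N. (W2w N \<omega> b i * (G (qc sh N \<omega> i * (vc sh N \<omega> i \<bullet> ?\<alpha>)) - 1)) *\<^sub>R vc sh N \<omega> i) * norm ?\<alpha>"
                by (rule norm_cauchy_schwarz)
              also have "\<dots> \<le> real N * \<Delta> * norm ?\<alpha>" by (intro mult_right_mono res) simp
              finally show ?thesis by (simp add: mult_ac)
            qed
            have "c0 * lam * norm ?\<alpha> \<le> \<Delta> \<or> ?\<alpha> = 0"
            proof (rule calibration_step[OF G_mono G0 c0 e(1) qc_bounds[OF N w] norm_vc[OF N] Qc_pos _ N q1 le _ lam(1)])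
              show "norm (y (fst \<omega> i)) \<le> vb" for i using yb by simp
              show "0 < 2 * vb" using vb by simp
              show "\<Delta> < c0 * lam * (t0 / (Qc * (2 * vb)))"
                unfolding \<Delta>_def \<rho>_def[symmetric] using lr c0 lam by (intro mult_strict_left_mono) auto
            qed
            then have "norm ?\<alpha> \<le> l N / sqrt (real N)"
            proof
              assume "c0 * lam * norm ?\<alpha> \<le> \<Delta>"
              then have "(c0 * lam) * norm ?\<alpha> \<le> (c0 * lam) * (l N / sqrt (real N))" by (simp add: \<Delta>_def)
              moreover have "c0 * lam > 0" using c0 lam by simp
              ultimately show ?thesis by (simp only: mult_le_cancel_left_pos)
            next
              assume "?\<alpha> = 0"
              then show ?thesis using l1 by simp
            qed
            also have "\<dots> \<le> L N / sqrt (real N)" by (intro divide_right_mono) (auto simp: l_def)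
            finally show False using big by simp
          qed
        qed
      qed
    qed
  qed
qed

text \<open>\<open>G\<close> is Lipschitz with \<open>G 0 = 1\<close>, and scalars and vectors in
  its argument are bounded, so the factor differs from 1 by at most a constant times the norm of the
  parameter, uniformly over the units.\<close>

theorem negl_calibration_factor:
  assumes L: "filterlim L at_top sequentially"
  shows "negl D (\<lambda>N \<omega> b. \<not> (\<forall>i<N. \<bar>Gcal D Vv G sh N (fst \<omega>) (Vof D (fst \<omega> i)) (\<alpha>hh st sh N \<omega> b) - 1\<bar> \<le> L N / sqrt (real N)))"
proof -
  obtain Gd where Gd: "Gd > 0" "\<And>x. \<bar>G x - 1\<bar> \<le> Gd * \<bar>x\<bar>" by (rule G_lipschitz) blast
  define C where "C = Gd * (Qc * (2 * vb))"
  have C: "C > 0" using Gd Qc_pos vb by (simp add: C_def)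
  have LC: "filterlim (\<lambda>N. L N / C) at_top sequentially"
  proof -
    have "filterlim (\<lambda>N. (1 / C) * L N) at_top sequentially"
      using C by (intro filterlim_tendsto_pos_mult_at_top[OF tendsto_const] L) auto
    then show ?thesis by simp
  qed
  show ?thesis
  proof (rule negl_mono[OF negl_calibration_parameter[OF LC, of st sh]], goal_cases)
    case 1
    show ?case
      using eventually_ge_at_top[of 1]
    proof eventually_elim
      case (elim N)
      note N = elim
      show ?case
        using AE_y_bound AE_space
      proof eventually_elim
        case (elim \<omega>)
        note yb = elim(1) and w = elim(2)
        show ?case
        proof (intro AE_I2 impI notI)
          fix b
          let ?\<alpha> = "\<alpha>hh st sh N \<omega> b"
          assume le: "norm ?\<alpha> \<le> L N / C / sqrt (real N)"
          have "\<bar>Gcal D Vv G sh N (fst \<omega>) (Vof D (fst \<omega> i)) ?\<alpha> - 1\<bar> \<le> L N / sqrt (real N)" if i: "i < N" for i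
          proof -
            have "\<bar>Gcal D Vv G sh N (fst \<omega>) (Vof D (fst \<omega> i)) ?\<alpha> - 1\<bar> \<le> Gd * \<bar>qc sh N \<omega> i * (vc sh N \<omega> i \<bullet> ?\<alpha>)\<bar>"
              unfolding Gcal_eq[OF w i] by (rule Gd(2))
            also have "\<bar>qc sh N \<omega> i * (vc sh N \<omega> i \<bullet> ?\<alpha>)\<bar> \<le> Qc * (2 * vb * norm ?\<alpha>)"
            proof -
              have "\<bar>vc sh N \<omega> i \<bullet> ?\<alpha>\<bar> \<le> 2 * vb * norm ?\<alpha>"
                using norm_vc[OF N, of \<omega> sh i] yb
                by (intro order_trans[OF Cauchy_Schwarz_ineq2] mult_right_mono) auto
              then show ?thesis
                unfolding abs_mult using qc_bounds[OF N w i, of sh] Qc_pos by (intro mult_mono) auto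
            qed
            also have "Gd * (Qc * (2 * vb * norm ?\<alpha>)) = C * norm ?\<alpha>" by (simp add: C_def)
            also have "\<dots> \<le> C * (L N / C / sqrt (real N))" using C le by (intro mult_left_mono) auto
            also have "\<dots> = L N / sqrt (real N)" using C by simp
            finally show ?thesis using Gd(1) by simp
          qed
          moreover assume "\<not> (\<forall>i<N. \<bar>Gcal D Vv G sh N (fst \<omega>) (Vof D (fst \<omega> i)) ?\<alpha> - 1\<bar> \<le> L N / sqrt (real N))"
          ultimately show False by blast
        qed
      qed
    qed
  qed
qed

end

section \<open>The rate theorem\<close>

lemma Gcal_zero: "Gcal D Vv G sh N w v 0 = G 0"
  by (cases sh) simp_all

context boot_weights
begin

lemma measurable_fst_Z: "fst \<in> measurable Z (x_space D)"
proof -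
  have "sets Z = sets (x_space D \<Otimes>\<^sub>M u_space D)"
    using design by (simp add: two_phase_design_def)
  then show ?thesis by (simp cong: measurable_cong_sets)
qed

lemma integrable_P0: "integrable (P0 D) h \<Longrightarrow> integrable Z (\<lambda>z. h (fst z))" for h :: "'x \<Rightarrow> real"
  unfolding P0_def by (rule integrable_distr[OF measurable_fst_Z])

lemma integral_P0:
  fixes h :: "'x \<Rightarrow> real"
  assumes "integrable (P0 D) h"
  shows "(\<integral>x. h x \<partial>P0 D) = (\<integral>z. h (fst z) \<partial>Z)"
  using borel_measurable_integrable[OF assms] unfolding P0_def
  by (intro integral_distr[OF measurable_fst_Z]) simp

lemma boot_emp_eq:
  fixes h :: "'x \<times> 'u \<Rightarrow> real"
  assumes "\<omega> \<in> space (data D)"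
  shows "boot_emp D N \<omega> b h = 1 / real N * (\<Sum>i<N. fst b i * real (snd b i) * ipwk N (key N \<omega>) i * h (fst \<omega> i))"
  using assms by (simp add: boot_emp_def ipw_eq)

text \<open>Linearity turns near-maximality into a lower bound on the weighted sum of criterion
  differences, the form in which \<open>peeling\<close> takes it.\<close>

lemma near_maximum:
  assumes N: "N \<ge> 1" and w: "\<omega> \<in> space (data D)"
    and le: "boot_emp D N \<omega> b (\<lambda>z. g z * k z) - x \<le> boot_emp D N \<omega> b (\<lambda>z. g z * h z)"
  shows "- (real N * x) \<le> (\<Sum>i<N. fst b i * real (snd b i) * ipwk N (key N \<omega>) i *
      (g (fst \<omega> i) * (h (fst \<omega> i) - k (fst \<omega> i))))"
proof -
  have "(\<Sum>i<N. fst b i * real (snd b i) * ipwk N (key N \<omega>) i * (g (fst \<omega> i) * (h (fst \<omega> i) - k (fst \<omega> i))))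
     = real N * (boot_emp D N \<omega> b (\<lambda>z. g z * h z) - boot_emp D N \<omega> b (\<lambda>z. g z * k z))"
    using N by (simp add: boot_emp_eq[OF w] right_diff_distrib sum_subtractf)
  moreover have "real N * (- x) \<le> real N * (boot_emp D N \<omega> b (\<lambda>z. g z * h z) - boot_emp D N \<omega> b (\<lambda>z. g z * k z))"
    using le by (intro mult_left_mono) auto
  ultimately show ?thesis by simp
qed

end

theorem lemma5p1:
  fixes D :: "('x, 'u, 'y, 'j::finite, 's) two_phase"
    and \<Theta> :: "'t set" and d :: "'t \<Rightarrow> 't \<Rightarrow> real" and \<theta>0 :: 't
    and m :: "'t \<Rightarrow> 'x \<Rightarrow> real"
    and Vv :: "'y \<times> 'u \<Rightarrow> real ^ 'k" and G :: "real \<Rightarrow> real"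
    and \<A> :: "(real ^ 'k) set" and \<alpha>0 :: "real ^ 'k"
    and \<alpha>h :: "sharp \<Rightarrow> nat \<Rightarrow> (nat \<Rightarrow> 'x \<times> 'u) \<times> 's \<Rightarrow> real ^ 'k"
    and \<alpha>hh :: "star \<Rightarrow> sharp \<Rightarrow> nat \<Rightarrow> (nat \<Rightarrow> 'x \<times> 'u) \<times> 's \<Rightarrow> weights \<Rightarrow> real ^ 'k"
  assumes design: "two_phase_design D"
    and weights: "phase1_weight_conditions D"
    and bounded_weights: "\<exists>M::real. \<forall>j. AE x in w1_law D j. x \<le> M"
    and semimetric: "semimetric_on \<Theta> d" and theta0: "\<theta>0 \<in> \<Theta>"
    and m_integrable: "\<And>\<theta>. \<theta> \<in> \<Theta> \<Longrightarrow> integrable (P0 D) (m \<theta>)"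
  shows
    "(\<forall>(\<phi> :: nat \<Rightarrow> real \<Rightarrow> real) (r :: nat \<Rightarrow> real)
        (\<theta>hh :: nat \<Rightarrow> (nat \<Rightarrow> 'x \<times> 'u) \<times> 's \<Rightarrow> weights \<Rightarrow> 't).
        (\<exists>K>0. \<exists>\<eta>>0. \<forall>\<theta>\<in>\<Theta>. d \<theta> \<theta>0 < \<eta> \<longrightarrow>
            (\<integral>x. m \<theta> x - m \<theta>0 x \<partial>P0 D) \<le> K * (- (d \<theta> \<theta>0)\<^sup>2)) \<longrightarrow>
        rate_function \<phi> \<longrightarrow>
        (\<exists>K>0. \<exists>\<delta>0>0. \<forall>N\<ge>1. \<forall>\<delta>. 0 < \<delta> \<and> \<delta> < \<delta>0 \<longrightarrow>
            outer_expectation (iid D)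
              (\<lambda>w. sup_over (empirical_process (P0 D) N (\<lambda>i. fst (w i))) (M_local \<Theta> d m \<theta>0 \<delta>))
              \<le> ennreal (K * \<phi> N \<delta>)) \<longrightarrow>
        (\<forall>N\<ge>1. 0 < r N \<and> (r N)\<^sup>2 * \<phi> N (1 / r N) \<le> sqrt (real N)) \<longrightarrow>
        (\<forall>N \<omega> b. \<theta>hh N \<omega> b \<in> \<Theta>) \<longrightarrow>
        (\<exists>R. boot_OP D R \<and>
           (\<forall>N\<ge>1. \<forall>\<omega>\<in>space (data D). \<forall>b\<in>space (PW D N \<omega>).
              boot_emp D N \<omega> b (\<lambda>z. m (\<theta>hh N \<omega> b) (fst z)) \<ge>
              boot_emp D N \<omega> b (\<lambda>z. m \<theta>0 (fst z)) - 1 / (r N)\<^sup>2 * R N \<omega> b)) \<longrightarrow>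
        boot_oP D (\<lambda>N \<omega> b. d (\<theta>hh N \<omega> b) \<theta>0) \<longrightarrow>
        boot_OP D (\<lambda>N \<omega> b. r N * d (\<theta>hh N \<omega> b) \<theta>0))
     \<and>
     (calibration_conditions D Vv G \<A> \<alpha>0 \<alpha>h \<alpha>hh \<longrightarrow>
      (\<forall>(st :: star) (sh :: sharp) (\<A>N :: nat \<Rightarrow> (real ^ 'k) set)
        (\<phi> :: nat \<Rightarrow> real \<Rightarrow> real) (r :: nat \<Rightarrow> real)
        (\<theta>hh :: nat \<Rightarrow> (nat \<Rightarrow> 'x \<times> 'u) \<times> 's \<Rightarrow> weights \<Rightarrow> 't).
        (\<exists>K>0. \<exists>\<eta>>0. AE w in iid D. \<forall>N\<ge>1. \<forall>\<theta>\<in>\<Theta>. \<forall>\<alpha>\<in>\<A>.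
            d \<theta> \<theta>0 < \<eta> \<and> norm (\<alpha> - \<alpha>0) < \<eta> \<longrightarrow>
            (\<integral>z. Gcal D Vv G sh N w (Vof D z) \<alpha> * (m \<theta> (fst z) - m \<theta>0 (fst z)) \<partial>law0 D)
              \<le> K * (- (d \<theta> \<theta>0)\<^sup>2 + (norm (\<alpha> - \<alpha>0))\<^sup>2)) \<longrightarrow>
        (\<forall>N\<ge>1. \<A>N N \<subseteq> \<A> \<and> \<alpha>0 \<in> \<A>N N) \<longrightarrow>
        rate_function \<phi> \<longrightarrow>
        (\<exists>K>0. \<exists>\<delta>0>0. \<forall>N\<ge>1. \<forall>\<delta>. 0 < \<delta> \<and> \<delta> < \<delta>0 \<longrightarrow>
            outer_expectation (iid D)
              (\<lambda>w. sup_over (empirical_process (law0 D) N w)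
                     (GM_local D Vv G sh N w (\<A>N N) (M_local \<Theta> d m \<theta>0 \<delta>) \<delta>))
              \<le> ennreal (K * \<phi> N \<delta>)) \<longrightarrow>
        (\<forall>N\<ge>1. 0 < r N \<and> (r N)\<^sup>2 * \<phi> N (1 / r N) \<le> sqrt (real N)) \<longrightarrow>
        (\<forall>N \<omega> b. \<theta>hh N \<omega> b \<in> \<Theta>) \<longrightarrow>
        (\<exists>R. boot_OP D R \<and>
           (\<forall>N\<ge>1. \<forall>\<omega>\<in>space (data D). \<forall>b\<in>space (PW D N \<omega>).
              boot_emp_cal D Vv G sh N \<omega> b (\<alpha>hh st sh N \<omega> b) (\<lambda>z. m (\<theta>hh N \<omega> b) (fst z)) \<ge>
              boot_emp_cal D Vv G sh N \<omega> b (\<alpha>hh st sh N \<omega> b) (\<lambda>z. m \<theta>0 (fst z))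
                - 1 / (r N)\<^sup>2 * R N \<omega> b)) \<longrightarrow>
        boot_oP D (\<lambda>N \<omega> b. d (\<theta>hh N \<omega> b) \<theta>0) \<longrightarrow>
        boot_OP D (\<lambda>N \<omega> b. r N * d (\<theta>hh N \<omega> b) \<theta>0)))"
proof -
  obtain Wmax where Wmax: "\<And>j. AE x in w1_law D j. x \<le> Wmax" using bounded_weights by blast
  interpret W: boot_weights D Wmax
    by standard (use design weights Wmax in auto)
  \<comment> \<open>Criterion differences are lifted from the first component to the whole unit, so
    that both parts work over \<open>law0 D\<close>.\<close>
  define f where "f \<theta> z = m \<theta> (fst z) - m \<theta>0 (fst z)" for \<theta> and z :: "'x \<times> 'u"
  have diff_int: "integrable (P0 D) (\<lambda>x. m \<theta> x - m \<theta>0 x)" if "\<theta> \<in> \<Theta>" for \<theta>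
    using m_integrable[OF that] m_integrable[OF theta0] by simp
  have f_int: "integrable (law0 D) (f \<theta>)" if "\<theta> \<in> \<Theta>" for \<theta>
    using W.integrable_P0[OF diff_int[OF that]] by (simp add: f_def[abs_def])
  have f_exp: "(\<integral>x. m \<theta> x - m \<theta>0 x \<partial>P0 D) = W.Z.expectation (f \<theta>)" if "\<theta> \<in> \<Theta>" for \<theta>
    using W.integral_P0[OF diff_int[OF that]] by (simp add: f_def[abs_def])
  have d0: "0 \<le> d \<theta> \<theta>0" if "\<theta> \<in> \<Theta>" for \<theta>
    using semimetric theta0 that by (auto simp: semimetric_on_def)
  have emp_eq: "empirical_process (P0 D) N (\<lambda>i. fst (w i)) (\<lambda>x. m \<theta> x - m \<theta>0 x)
      = sqrt (real N) * (empirical N w (f \<theta>) - W.Z.expectation (f \<theta>))" if "\<theta> \<in> \<Theta>" for \<theta> N w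
    by (simp add: empirical_process_def empirical_def f_exp[OF that] f_def)
  \<comment> \<open>The modulus condition is a weak inequality for an infimum; the room between
    \<open>x\<close> and \<open>\<tau>\<close> is what allows a majorant to be extracted.\<close>
  have maj: "\<exists>U\<in>borel_measurable (W.PN N). (\<integral>\<^sup>+x. U x \<partial>W.PN N) \<le> ennreal (sqrt (real N) * \<tau>) \<and>
        (\<forall>\<theta>\<in>\<Theta>. d \<theta> \<theta>0 < \<delta> \<longrightarrow> (\<forall>z\<in>space (W.PN N).
          ennreal \<bar>\<Sum>i<N. f \<theta> (z i) - W.Z.expectation (f \<theta>)\<bar> \<le> U z))"
    if T: "outer_expectation (iid D) T \<le> ennreal x" and x: "x < \<tau>" "0 < \<tau>"
      and T_ge: "\<And>\<theta> w. \<theta> \<in> \<Theta> \<Longrightarrow> d \<theta> \<theta>0 < \<delta> \<Longrightarrow>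
        ennreal \<bar>sqrt (real N) * (empirical N w (f \<theta>) - W.Z.expectation (f \<theta>))\<bar> \<le> T w"
    for N T x \<tau> \<delta>
  proof -
    have "outer_expectation (iid D) T < ennreal \<tau>"
      using T x by (auto intro: le_less_trans ennreal_lessI)
    then obtain U where "U \<in> borel_measurable (W.PN N)" "(\<integral>\<^sup>+x. U x \<partial>W.PN N) \<le> ennreal (sqrt (real N) * \<tau>)"
      "\<And>h z. h \<in> f ` {\<theta> \<in> \<Theta>. d \<theta> \<theta>0 < \<delta>} \<Longrightarrow> z \<in> space (W.PN N) \<Longrightarrow>
         ennreal \<bar>\<Sum>i<N. h (z i) - W.Z.expectation h\<bar> \<le> U z"
      by (rule W.majorant_of_outer_expectation[where F="f ` {\<theta> \<in> \<Theta>. d \<theta> \<theta>0 < \<delta>}"]) (use T_ge in auto)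
    then show ?thesis by (intro bexI[of _ U]) auto
  qed
  show ?thesis
  proof (intro conjI impI allI)
    fix \<phi> r \<theta>hh
    assume margin: "\<exists>K>0. \<exists>\<eta>>0. \<forall>\<theta>\<in>\<Theta>. d \<theta> \<theta>0 < \<eta> \<longrightarrow>
            (\<integral>x. m \<theta> x - m \<theta>0 x \<partial>P0 D) \<le> K * (- (d \<theta> \<theta>0)\<^sup>2)"
      and rate: "rate_function \<phi>"
      and modulus: "\<exists>K>0. \<exists>\<delta>0>0. \<forall>N\<ge>1. \<forall>\<delta>. 0 < \<delta> \<and> \<delta> < \<delta>0 \<longrightarrow>
            outer_expectation (iid D)
              (\<lambda>w. sup_over (empirical_process (P0 D) N (\<lambda>i. fst (w i))) (M_local \<Theta> d m \<theta>0 \<delta>))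
              \<le> ennreal (K * \<phi> N \<delta>)"
      and r: "\<forall>N\<ge>1. 0 < r N \<and> (r N)\<^sup>2 * \<phi> N (1 / r N) \<le> sqrt (real N)"
      and \<theta>hh: "\<forall>N \<omega> b. \<theta>hh N \<omega> b \<in> \<Theta>"
      and near: "\<exists>R. boot_OP D R \<and>
           (\<forall>N\<ge>1. \<forall>\<omega>\<in>space (data D). \<forall>b\<in>space (PW D N \<omega>).
              boot_emp D N \<omega> b (\<lambda>z. m (\<theta>hh N \<omega> b) (fst z)) \<ge>
              boot_emp D N \<omega> b (\<lambda>z. m \<theta>0 (fst z)) - 1 / (r N)\<^sup>2 * R N \<omega> b)"
      and cons: "boot_oP D (\<lambda>N \<omega> b. d (\<theta>hh N \<omega> b) \<theta>0)"
    obtain \<kappa> \<eta> where \<kappa>: "\<kappa> > 0" "\<eta> > 0"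
      and marg: "\<And>\<theta>. \<theta> \<in> \<Theta> \<Longrightarrow> d \<theta> \<theta>0 < \<eta> \<Longrightarrow> (\<integral>x. m \<theta> x - m \<theta>0 x \<partial>P0 D) \<le> \<kappa> * (- (d \<theta> \<theta>0)\<^sup>2)"
      using margin by blast
    obtain K \<delta>0 where K: "K > 0" "\<delta>0 > 0"
      and mod: "\<And>N \<delta>. N \<ge> 1 \<Longrightarrow> 0 < \<delta> \<Longrightarrow> \<delta> < \<delta>0 \<Longrightarrow> outer_expectation (iid D)
              (\<lambda>w. sup_over (empirical_process (P0 D) N (\<lambda>i. fst (w i))) (M_local \<Theta> d m \<theta>0 \<delta>))
              \<le> ennreal (K * \<phi> N \<delta>)"
      using modulus by blast
    obtain R where R: "boot_OP D R"
      and nm: "\<And>N \<omega> b. N \<ge> 1 \<Longrightarrow> \<omega> \<in> space (data D) \<Longrightarrow> b \<in> space (PW D N \<omega>) \<Longrightarrow>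
        boot_emp D N \<omega> b (\<lambda>z. m \<theta>0 (fst z)) - 1 / (r N)\<^sup>2 * R N \<omega> b \<le> boot_emp D N \<omega> b (\<lambda>z. m (\<theta>hh N \<omega> b) (fst z))"
      using near by blast
    show "boot_OP D (\<lambda>N \<omega> b. r N * d (\<theta>hh N \<omega> b) \<theta>0)"
    proof (rule W.peeling[where g="\<lambda>N \<omega> b i. 1" and R=R and f=f and \<Theta>=\<Theta> and d=d
          and ?\<theta>0.0=\<theta>0 and \<phi>=\<phi> and r=r and \<theta>hh=\<theta>hh, OF f_int d0 \<kappa> _ rate K _ _ _ R _ _ cons])
      show "W.Z.expectation (f \<theta>) \<le> - \<kappa> * (d \<theta> \<theta>0)\<^sup>2" if "\<theta> \<in> \<Theta>" "d \<theta> \<theta>0 < \<eta>" for \<theta>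
        using marg[OF that] f_exp[OF that(1)] by simp
      show "\<exists>U\<in>borel_measurable (W.PN N). (\<integral>\<^sup>+x. U x \<partial>W.PN N) \<le> ennreal (sqrt (real N) * \<tau>) \<and>
        (\<forall>\<theta>\<in>\<Theta>. d \<theta> \<theta>0 < \<delta> \<longrightarrow> (\<forall>z\<in>space (W.PN N).
          ennreal \<bar>\<Sum>i<N. f \<theta> (z i) - W.Z.expectation (f \<theta>)\<bar> \<le> U z))"
        if N: "1 \<le> N" "0 < \<delta>" "\<delta> < \<delta>0" "0 < \<tau>" "K * \<phi> N \<delta> < \<tau>" for N \<delta> \<tau>
      proof (rule maj[OF mod[OF N(1-3)] N(5,4)])
        fix \<theta> w assume th: "\<theta> \<in> \<Theta>" "d \<theta> \<theta>0 < \<delta>"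
        then have "(\<lambda>x. m \<theta> x - m \<theta>0 x) \<in> M_local \<Theta> d m \<theta>0 \<delta>" by (auto simp: M_local_def)
        then show "ennreal \<bar>sqrt (real N) * (empirical N w (f \<theta>) - W.Z.expectation (f \<theta>))\<bar>
          \<le> sup_over (empirical_process (P0 D) N (\<lambda>i. fst (w i))) (M_local \<Theta> d m \<theta>0 \<delta>)"
          unfolding sup_over_def emp_eq[OF th(1), symmetric] by (rule SUP_upper)
      qed
      show "0 < r N \<and> (r N)\<^sup>2 * \<phi> N (1 / r N) \<le> sqrt (real N)" if "1 \<le> N" for N using r that by blast
      show "\<theta>hh N \<omega> b \<in> \<Theta>" for N \<omega> b using \<theta>hh by blast
      show "- (real N * (1 / (r N)\<^sup>2 * R N \<omega> b)) \<le> (\<Sum>i<N. fst b i * real (snd b i) * W.ipwk N (W.key N \<omega>) i *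
          (1 * f (\<theta>hh N \<omega> b) (fst \<omega> i)))"
        if "1 \<le> N" "\<omega> \<in> space (data D)" "b \<in> space (PW D N \<omega>)" for N \<omega> b
        unfolding f_def by (rule W.near_maximum[OF that(1,2), where g="\<lambda>_. 1"]) (use nm[OF that] in simp)
      \<comment> \<open>With the constant factor 1 the deviation is 0, and \<open>L N\<close> is
        eventually nonnegative.\<close>
      show "negl D (\<lambda>N \<omega> b. \<not> (\<forall>i<N. \<bar>1 - 1\<bar> \<le> L N / sqrt (real N)))"
        if L: "filterlim L at_top sequentially" for L
      proof (rule negl_mono_pointwise[OF negl_False])
        have "eventually (\<lambda>N. 0 \<le> L N) sequentially" using L by (simp add: filterlim_at_top)
        then show "eventually (\<lambda>N. \<forall>\<omega>\<in>space (data D). \<forall>b\<in>space (PW D N \<omega>).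
          \<not> (\<forall>i<N. \<bar>1 - 1\<bar> \<le> L N / sqrt (real N)) \<longrightarrow> False) sequentially"
          by eventually_elim simp
      qed
    qed
  next
    fix st sh \<A>N \<phi> r \<theta>hh
    assume cal: "calibration_conditions D Vv G \<A> \<alpha>0 \<alpha>h \<alpha>hh"
      and margin: "\<exists>K>0. \<exists>\<eta>>0. AE w in iid D. \<forall>N\<ge>1. \<forall>\<theta>\<in>\<Theta>. \<forall>\<alpha>\<in>\<A>.
            d \<theta> \<theta>0 < \<eta> \<and> norm (\<alpha> - \<alpha>0) < \<eta> \<longrightarrow>
            (\<integral>z. Gcal D Vv G sh N w (Vof D z) \<alpha> * (m \<theta> (fst z) - m \<theta>0 (fst z)) \<partial>law0 D)
              \<le> K * (- (d \<theta> \<theta>0)\<^sup>2 + (norm (\<alpha> - \<alpha>0))\<^sup>2)"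
      and AN: "\<forall>N\<ge>1. \<A>N N \<subseteq> \<A> \<and> \<alpha>0 \<in> \<A>N N"
      and rate: "rate_function \<phi>"
      and modulus: "\<exists>K>0. \<exists>\<delta>0>0. \<forall>N\<ge>1. \<forall>\<delta>. 0 < \<delta> \<and> \<delta> < \<delta>0 \<longrightarrow>
            outer_expectation (iid D)
              (\<lambda>w. sup_over (empirical_process (law0 D) N w)
                     (GM_local D Vv G sh N w (\<A>N N) (M_local \<Theta> d m \<theta>0 \<delta>) \<delta>))
              \<le> ennreal (K * \<phi> N \<delta>)"
      and r: "\<forall>N\<ge>1. 0 < r N \<and> (r N)\<^sup>2 * \<phi> N (1 / r N) \<le> sqrt (real N)"
      and \<theta>hh: "\<forall>N \<omega> b. \<theta>hh N \<omega> b \<in> \<Theta>"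
      and near: "\<exists>R. boot_OP D R \<and>
           (\<forall>N\<ge>1. \<forall>\<omega>\<in>space (data D). \<forall>b\<in>space (PW D N \<omega>).
              boot_emp_cal D Vv G sh N \<omega> b (\<alpha>hh st sh N \<omega> b) (\<lambda>z. m (\<theta>hh N \<omega> b) (fst z)) \<ge>
              boot_emp_cal D Vv G sh N \<omega> b (\<alpha>hh st sh N \<omega> b) (\<lambda>z. m \<theta>0 (fst z))
                - 1 / (r N)\<^sup>2 * R N \<omega> b)"
      and cons: "boot_oP D (\<lambda>N \<omega> b. d (\<theta>hh N \<omega> b) \<theta>0)"
    interpret C: boot_calibration D Wmax Vv G \<A> \<alpha>0 \<alpha>h \<alpha>hh by standard (rule cal)
    have \<alpha>0: "\<alpha>0 = 0" "\<alpha>0 \<in> \<A>" using cal unfolding calibration_conditions_def by blast+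
    obtain \<kappa> \<eta> where \<kappa>: "\<kappa> > 0" "\<eta> > 0"
      and margAE: "AE w in iid D. \<forall>N\<ge>1. \<forall>\<theta>\<in>\<Theta>. \<forall>\<alpha>\<in>\<A>.
            d \<theta> \<theta>0 < \<eta> \<and> norm (\<alpha> - \<alpha>0) < \<eta> \<longrightarrow>
            (\<integral>z. Gcal D Vv G sh N w (Vof D z) \<alpha> * (m \<theta> (fst z) - m \<theta>0 (fst z)) \<partial>law0 D)
              \<le> \<kappa> * (- (d \<theta> \<theta>0)\<^sup>2 + (norm (\<alpha> - \<alpha>0))\<^sup>2)"
      using margin by blast
    \<comment> \<open>At the zero parameter the factor is \<open>G 0 = 1\<close>, so the inequality
      no longer involves \<open>w\<close> and holds outright once it holds almost surely.\<close>
    have marg: "W.Z.expectation (f \<theta>) \<le> - \<kappa> * (d \<theta> \<theta>0)\<^sup>2" if th: "\<theta> \<in> \<Theta>" "d \<theta> \<theta>0 < \<eta>" for \<theta>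
    proof -
      have "AE w in iid D. W.Z.expectation (f \<theta>) \<le> - \<kappa> * (d \<theta> \<theta>0)\<^sup>2"
        using margAE
      proof eventually_elim
        case (elim w)
        from elim[rule_format, of 1 \<theta> \<alpha>0] th \<alpha>0 \<kappa> show ?case
          by (simp add: Gcal_zero C.G0 f_def[abs_def])
      qed
      then show ?thesis by simp
    qed
    obtain K \<delta>0 where K: "K > 0" "\<delta>0 > 0"
      and mod: "\<And>N \<delta>. N \<ge> 1 \<Longrightarrow> 0 < \<delta> \<Longrightarrow> \<delta> < \<delta>0 \<Longrightarrow> outer_expectation (iid D)
              (\<lambda>w. sup_over (empirical_process (law0 D) N w)
                     (GM_local D Vv G sh N w (\<A>N N) (M_local \<Theta> d m \<theta>0 \<delta>) \<delta>))
              \<le> ennreal (K * \<phi> N \<delta>)"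
      using modulus by blast
    obtain R where R: "boot_OP D R"
      and nm: "\<And>N \<omega> b. N \<ge> 1 \<Longrightarrow> \<omega> \<in> space (data D) \<Longrightarrow> b \<in> space (PW D N \<omega>) \<Longrightarrow>
        boot_emp_cal D Vv G sh N \<omega> b (\<alpha>hh st sh N \<omega> b) (\<lambda>z. m \<theta>0 (fst z)) - 1 / (r N)\<^sup>2 * R N \<omega> b
        \<le> boot_emp_cal D Vv G sh N \<omega> b (\<alpha>hh st sh N \<omega> b) (\<lambda>z. m (\<theta>hh N \<omega> b) (fst z))"
      using near by blast
    show "boot_OP D (\<lambda>N \<omega> b. r N * d (\<theta>hh N \<omega> b) \<theta>0)"
    proof (rule W.peeling[where g="\<lambda>N \<omega> b i. Gcal D Vv G sh N (fst \<omega>) (Vof D (fst \<omega> i)) (\<alpha>hh st sh N \<omega> b)" and R=R and f=f and \<Theta>=\<Theta>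
          and d=d and ?\<theta>0.0=\<theta>0 and \<phi>=\<phi> and r=r and \<theta>hh=\<theta>hh, OF f_int d0 \<kappa> marg rate K _ _ _ R _ C.negl_calibration_factor cons])
      show "\<exists>U\<in>borel_measurable (W.PN N). (\<integral>\<^sup>+x. U x \<partial>W.PN N) \<le> ennreal (sqrt (real N) * \<tau>) \<and>
        (\<forall>\<theta>\<in>\<Theta>. d \<theta> \<theta>0 < \<delta> \<longrightarrow> (\<forall>z\<in>space (W.PN N).
          ennreal \<bar>\<Sum>i<N. f \<theta> (z i) - W.Z.expectation (f \<theta>)\<bar> \<le> U z))"
        if N: "1 \<le> N" "0 < \<delta>" "\<delta> < \<delta>0" "0 < \<tau>" "K * \<phi> N \<delta> < \<tau>" for N \<delta> \<tau>
      proof (rule maj[OF mod[OF N(1-3)] N(5,4)])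
        fix \<theta> w assume th: "\<theta> \<in> \<Theta>" "d \<theta> \<theta>0 < \<delta>"
        then have "(\<lambda>x. m \<theta> x - m \<theta>0 x) \<in> M_local \<Theta> d m \<theta>0 \<delta>" by (auto simp: M_local_def)
        moreover have "\<alpha>0 \<in> \<A>N N" using AN N(1) by blast
        \<comment> \<open>The zero parameter satisfies \<open>norm \<alpha> \<le> \<delta>\<close>
          for every radius, which places \<open>f \<theta>\<close> itself in the calibrated
          class.\<close>
        ultimately have "(\<lambda>z. Gcal D Vv G sh N w (Vof D z) \<alpha>0 * (m \<theta> (fst z) - m \<theta>0 (fst z)))
            \<in> GM_local D Vv G sh N w (\<A>N N) (M_local \<Theta> d m \<theta>0 \<delta>) \<delta>"
          using N(2) \<alpha>0(1) unfolding GM_local_def by fastforce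
        moreover have "(\<lambda>z. Gcal D Vv G sh N w (Vof D z) \<alpha>0 * (m \<theta> (fst z) - m \<theta>0 (fst z))) = f \<theta>"
          by (simp add: \<alpha>0(1) Gcal_zero C.G0 f_def[abs_def])
        ultimately have "f \<theta> \<in> GM_local D Vv G sh N w (\<A>N N) (M_local \<Theta> d m \<theta>0 \<delta>) \<delta>" by simp
        then show "ennreal \<bar>sqrt (real N) * (empirical N w (f \<theta>) - W.Z.expectation (f \<theta>))\<bar>
          \<le> sup_over (empirical_process (law0 D) N w) (GM_local D Vv G sh N w (\<A>N N) (M_local \<Theta> d m \<theta>0 \<delta>) \<delta>)"
          unfolding sup_over_def empirical_process_def by (rule SUP_upper)
      qed
      show "0 < r N \<and> (r N)\<^sup>2 * \<phi> N (1 / r N) \<le> sqrt (real N)" if "1 \<le> N" for N using r that by blast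
      show "\<theta>hh N \<omega> b \<in> \<Theta>" for N \<omega> b using \<theta>hh by blast
      show "- (real N * (1 / (r N)\<^sup>2 * R N \<omega> b)) \<le> (\<Sum>i<N. fst b i * real (snd b i) * W.ipwk N (W.key N \<omega>) i *
          (Gcal D Vv G sh N (fst \<omega>) (Vof D (fst \<omega> i)) (\<alpha>hh st sh N \<omega> b) * f (\<theta>hh N \<omega> b) (fst \<omega> i)))"
        if "1 \<le> N" "\<omega> \<in> space (data D)" "b \<in> space (PW D N \<omega>)" for N \<omega> b
        unfolding f_def by (rule W.near_maximum[OF that(1,2)]) (use nm[OF that] in \<open>simp add: boot_emp_cal_def\<close>)
    qed
  qed
qed

end
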